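(* Let $N\ge2$, let $\Omega\subset\mathbb{R}^N$ be a ball with unit outward normal $\nu$ on $\partial\Omega$, and let $\beta>0$. Then there exists $p_0>1$ such that for every subcritical $p$ with $1<p<p_0$ the problem $$-\Delta u=u^p\ \text{in }\Omega,\qquad u>0\ \text{in }\Omega,\qquad \frac{\partial u}{\partial\nu}+\beta u=0\ \text{on }\partial\Omega$$ has exactly one positive solution, and this solution is radial (with respect to the center of the ball).
   Context: The exponent $p$ is called subcritical if $1<p<\infty$ when $N=2$, and $1<p<\frac{N+2}{N-2}$ when $N\ge3$. A (positive) solution is a function $u\in H^1(\Omega)$, $u>0$ in $\Omega$, with $\int_\Omega\nabla u\cdot\nabla v\,dx+\beta\int_{\partial\Omega}uv\,dS=\int_\Omega u^pv\,dx$ for all $v\in H^1(\Omega)$; by elliptic regularity it is a classical solution. *)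

theory Defs
  imports "HOL-Analysis.Analysis"
begin

definition grad :: "('a::euclidean_space \<Rightarrow> real) \<Rightarrow> 'a \<Rightarrow> 'a" where
  "grad f x = (THE D. GDERIV f x :> D)"

primrec C_k :: "nat \<Rightarrow> ('a::euclidean_space \<Rightarrow> real) \<Rightarrow> bool" where
  "C_k 0 f \<longleftrightarrow> continuous_on UNIV f"
| "C_k (Suc k) f \<longleftrightarrow> (\<forall>x. f differentiable (at x)) \<and> (\<forall>b\<in>Basis. C_k k (\<lambda>x. grad f x \<bullet> b))"

definition smooth :: "('a::euclidean_space \<Rightarrow> real) \<Rightarrow> bool" where
  "smooth f \<longleftrightarrow> (\<forall>k. C_k k f)"

definition test_function :: "'a::euclidean_space set \<Rightarrow> ('a \<Rightarrow> real) \<Rightarrow> bool" where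
  "test_function \<Omega> \<phi> \<longleftrightarrow>
     smooth \<phi> \<and> compact (closure {x. \<phi> x \<noteq> 0}) \<and> closure {x. \<phi> x \<noteq> 0} \<subseteq> \<Omega>"

definition L2 :: "'a measure \<Rightarrow> ('a \<Rightarrow> 'b::euclidean_space) \<Rightarrow> bool" where
  "L2 M f \<longleftrightarrow> f \<in> borel_measurable M \<and> integrable M (\<lambda>x. (norm (f x))\<^sup>2)"

text \<open>Members of \<^term>\<open>L2\<close> and of the Sobolev space below are actual functions, not equivalence
  classes; only their values almost everywhere on the domain matter.\<close>

definition is_weak_grad :: "'a::euclidean_space set \<Rightarrow> ('a \<Rightarrow> real) \<Rightarrow> ('a \<Rightarrow> 'a) \<Rightarrow> bool" where
  "is_weak_grad \<Omega> u G \<longleftrightarrow> L2 (lebesgue_on \<Omega>) G \<and>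
     (\<forall>\<phi>. test_function \<Omega> \<phi> \<longrightarrow>
        (\<integral>x. u x *\<^sub>R grad \<phi> x \<partial>lebesgue_on \<Omega>) = - (\<integral>x. \<phi> x *\<^sub>R G x \<partial>lebesgue_on \<Omega>))"

definition H1 :: "'a::euclidean_space set \<Rightarrow> ('a \<Rightarrow> real) set" where
  "H1 \<Omega> = {u. L2 (lebesgue_on \<Omega>) u \<and> (\<exists>G. is_weak_grad \<Omega> u G)}"

text \<open>On \<^term>\<open>H1 \<Omega>\<close>, for open \<open>\<Omega>\<close>, the weak gradient is determined up to a null set, so the
  choice below does not affect any integral.\<close>

definition weak_grad :: "'a::euclidean_space set \<Rightarrow> ('a \<Rightarrow> real) \<Rightarrow> 'a \<Rightarrow> 'a" where
  "weak_grad \<Omega> u = (SOME G. is_weak_grad \<Omega> u G)"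

text \<open>Surface measure on the sphere of centre \<open>c\<close> and radius \<open>r > 0\<close>, as in polar coordinates:
  a part \<open>E\<close> of the sphere has area \<open>N / r\<close> times the volume of the cone
  \<open>{c + t (y - c) | y \<in> E, 0 < t < 1}\<close> over it, \<open>N\<close> being the dimension. It is
  realised as a Borel measure on the whole space that is concentrated on the sphere. (The centre,
  where the radial projection is undefined, is a null set.)\<close>

definition sphere_measure :: "'a::euclidean_space \<Rightarrow> real \<Rightarrow> 'a measure" where
  "sphere_measure c r = scale_measure (ennreal (real DIM('a) / r))
     (distr (lebesgue_on (ball c r)) borel (\<lambda>x. c + (r / dist c x) *\<^sub>R (x - c)))"

text \<open>The trace operator on a ball is the continuous extension to \<open>H1\<close>, with values in
  \<open>L2\<close> of the sphere, of the restriction of smooth functions to the sphere; the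
  trace of \<open>u\<close> is again unique up to a null set.\<close>

definition is_trace :: "'a::euclidean_space \<Rightarrow> real \<Rightarrow> ('a \<Rightarrow> real) \<Rightarrow> ('a \<Rightarrow> real) \<Rightarrow> bool" where
  "is_trace c r u g \<longleftrightarrow> L2 (sphere_measure c r) g \<and>
     (\<exists>\<phi>. (\<forall>n. smooth (\<phi> n)) \<and>
        (\<lambda>n. \<integral>x. (\<phi> n x - u x)\<^sup>2 + (norm (grad (\<phi> n) x - weak_grad (ball c r) u x))\<^sup>2
               \<partial>lebesgue_on (ball c r)) \<longlonglongrightarrow> 0 \<and>
        (\<lambda>n. \<integral>x. (\<phi> n x - g x)\<^sup>2 \<partial>sphere_measure c r) \<longlonglongrightarrow> 0)"

definition boundary_trace :: "'a::euclidean_space \<Rightarrow> real \<Rightarrow> ('a \<Rightarrow> real) \<Rightarrow> 'a \<Rightarrow> real" where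
  "boundary_trace c r u = (SOME g. is_trace c r u g)"

definition subcritical :: "nat \<Rightarrow> real \<Rightarrow> bool" where
  "subcritical N p \<longleftrightarrow>
     1 < p \<and> (N = 2 \<or> (3 \<le> N \<and> p < (real N + 2) / (real N - 2)))"

text \<open>Positive (weak) solutions on the ball of centre \<open>c\<close> and radius \<open>r\<close>. The
  integrability clause only makes the right-hand side meaningful (a Bochner integral that does not
  exist is \<open>0\<close>); for subcritical \<open>p\<close> it holds for all \<open>u\<close> and \<open>v\<close> in
  \<open>H1\<close> by the Sobolev embedding.\<close>

definition positive_solution ::
    "'a::euclidean_space \<Rightarrow> real \<Rightarrow> real \<Rightarrow> real \<Rightarrow> ('a \<Rightarrow> real) \<Rightarrow> bool" where
  "positive_solution c r \<beta> p u \<longleftrightarrow>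
     u \<in> H1 (ball c r) \<and> (AE x in lebesgue_on (ball c r). u x > 0) \<and>
     (\<forall>v\<in>H1 (ball c r).
        integrable (lebesgue_on (ball c r)) (\<lambda>x. u x powr p * v x) \<and>
        (\<integral>x. weak_grad (ball c r) u x \<bullet> weak_grad (ball c r) v x \<partial>lebesgue_on (ball c r))
          + \<beta> * (\<integral>x. boundary_trace c r u x * boundary_trace c r v x \<partial>sphere_measure c r)
        = (\<integral>x. u x powr p * v x \<partial>lebesgue_on (ball c r)))"

definition radial_in_ball :: "'a::euclidean_space \<Rightarrow> real \<Rightarrow> ('a \<Rightarrow> real) \<Rightarrow> bool" where
  "radial_in_ball c r u \<longleftrightarrow> (\<exists>f. AE x in lebesgue_on (ball c r). u x = f (dist c x))"

end

theory Submission
  imports Defs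
begin

text \<open>A radial positive solution \<open>u\<close> comes from the radial equation with initial value \<open>1\<close>: its solution
  \<open>U\<close>, obtained by a contraction argument, is followed up to the first zero of \<open>s U' + \<beta> r U\<close> and then
  rescaled to the ball. Up to normalisation, \<open>u\<close> is bounded above and below uniformly in \<open>p\<close> near \<open>1\<close>.

  If \<open>v\<close> is any positive solution, then \<open>w = v / u\<close> formally solves
  \<open>- div (u\<^sup>2 \<nabla>w) = u\<^bsup>p + 1\<^esup> (w\<^bsup>p\<^esup> - w)\<close> with a homogeneous Neumann condition, since the boundary
  terms of \<open>u\<close> and \<open>v\<close> cancel. Testing with \<open>1\<close> and \<open>w\<close> expresses the Dirichlet energy of \<open>w\<close> by the integral
  of \<open>u\<^bsup>p + 1\<^esup> (w\<^bsup>p\<^esup> - w) w\<close>, which carries a factor \<open>p - 1\<close>; a Poincare--Sobolev inequality with an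
  exponent slightly above \<open>2\<close> absorbs it for \<open>p\<close> close to \<open>1\<close>. So \<open>w\<close> is constant, and the constant is \<open>1\<close>.
  No regularity of \<open>v\<close> is needed: the ground-state identity behind the energy formula is proved for
  smooth functions, which approximate \<open>v\<close> in \<open>H1\<close> together with its trace.\<close>

section \<open>Smooth functions\<close>

text \<open>The threshold is chosen before \<open>p\<close>, so every constant has to be free of
  \<open>p\<close>. The size of \<open>u\<close> is not controlled as \<open>p\<close> tends to 1:
  scaling makes its maximum \<open>\<sigma>\<close> a power with exponent
  \<open>2 / (p - 1)\<close>. What stays bounded on both sides is \<open>u / \<sigma>\<close> and
  the potential \<open>u powr (p - 1)\<close>, and only these enter the estimates. Nothing is known
  in advance about the competitor, so its energy may be large. An inequality that is sublinear in
  the energy bounds it for all small \<open>p - 1\<close>; only with that bound does the factor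
  \<open>p - 1\<close> make the quadratic estimate absorbing. Both estimates need an integrability
  exponent strictly above 2 for the quotient, since \<open>w powr (p + 1)\<close> outgrows a square;
  the exponent \<open>2 + 1 / N\<close> comes from an elementary averaging over segments. The weight
  \<open>u powr (p + 1)\<close>, normalised to mass 1, is dictated by symmetry of the bilinear form:
  testing each equation with the other solution says that \<open>w\<close> and
  \<open>w powr p\<close> have the same mean. This cancels the first-order terms and finally fixes
  the constant.\<close>

lemma GDERIV_unique:
  fixes f :: "'a::euclidean_space \<Rightarrow> real"
  assumes "GDERIV f x :> D" "GDERIV f x :> E"
  shows "D = E"
proof -
  have "(\<lambda>h. h \<bullet> D) = (\<lambda>h. h \<bullet> E)"
    using assms unfolding gderiv_def by (rule has_derivative_unique)
  then have "b \<bullet> D = b \<bullet> E" for b by metis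
  then show ?thesis by (metis inner_commute vector_eq_rdot)
qed

lemma grad_eqI: "GDERIV f x :> D \<Longrightarrow> grad f x = D"
  unfolding grad_def by (rule the_equality) (auto intro: GDERIV_unique)

lemma differentiable_GDERIV:
  fixes f :: "'a::euclidean_space \<Rightarrow> real"
  assumes "f differentiable (at x)"
  shows "GDERIV f x :> grad f x"
proof -
  from assms obtain L where L: "(f has_derivative L) (at x)"
    unfolding differentiable_def by blast
  then have lin: "linear L" using has_derivative_linear by blast
  have "L h = h \<bullet> (\<Sum>b\<in>Basis. L b *\<^sub>R b)" for h
  proof -
    have "L h = L (\<Sum>b\<in>Basis. (h \<bullet> b) *\<^sub>R b)" by (simp add: euclidean_representation)
    also have "\<dots> = (\<Sum>b\<in>Basis. (h \<bullet> b) * L b)"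
      using lin by (simp add: linear_sum linear_cmul)
    finally show ?thesis by (simp add: inner_sum_right mult.commute)
  qed
  then have "L = (\<lambda>h. h \<bullet> (\<Sum>b\<in>Basis. L b *\<^sub>R b))" by blast
  with L have "GDERIV f x :> (\<Sum>b\<in>Basis. L b *\<^sub>R b)"
    unfolding gderiv_def by simp
  then show ?thesis using grad_eqI by metis
qed

lemma GDERIV_differentiable: "GDERIV f x :> D \<Longrightarrow> f differentiable (at x)"
  unfolding gderiv_def differentiable_def by blast

text \<open>The induction on the order of differentiation is done once, here. Each later smoothness
  proof only exhibits a class of differentiable functions that is closed under partial
  derivatives.\<close>

lemma smooth_coinduct:
  assumes "f \<in> S"
    and "\<And>f x. f \<in> S \<Longrightarrow> f differentiable (at x)"
    and "\<And>f b. f \<in> S \<Longrightarrow> b \<in> Basis \<Longrightarrow> (\<lambda>x. grad f x \<bullet> b) \<in> S"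
  shows "smooth f"
proof -
  have "f \<in> S \<longrightarrow> C_k k f" for k f
  proof (induction k arbitrary: f)
    case 0
    then show ?case
      using assms(2) by (auto simp: continuous_on_eq_continuous_at intro: differentiable_imp_continuous_within)
  next
    case (Suc k)
    then show ?case using assms(2,3) by auto
  qed
  with assms(1) show ?thesis unfolding smooth_def by blast
qed

lemma smooth_differentiable: "smooth f \<Longrightarrow> f differentiable (at x)"
  unfolding smooth_def by (metis C_k.simps(2))

lemma smooth_GDERIV: "smooth f \<Longrightarrow> GDERIV f x :> grad f x"
  by (rule differentiable_GDERIV, rule smooth_differentiable)

lemma smooth_partial: "smooth f \<Longrightarrow> b \<in> Basis \<Longrightarrow> smooth (\<lambda>x. grad f x \<bullet> b)"
  unfolding smooth_def by (metis C_k.simps(2))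

lemma smooth_continuous: "smooth f \<Longrightarrow> continuous_on UNIV f"
  unfolding smooth_def by (metis C_k.simps(1))

lemma smooth_continuous_grad: "smooth f \<Longrightarrow> continuous_on UNIV (grad f)"
proof -
  assume "smooth f"
  then have "continuous_on UNIV (\<lambda>x. \<Sum>b\<in>Basis. (grad f x \<bullet> b) *\<^sub>R b)"
    by (intro continuous_intros smooth_continuous smooth_partial)
  then show ?thesis by (simp add: euclidean_representation)
qed

lemma GDERIV_affine:
  fixes f :: "'a::euclidean_space \<Rightarrow> real"
  assumes "GDERIV f (z + k *\<^sub>R x) :> D"
  shows "GDERIV (\<lambda>x. s * f (z + k *\<^sub>R x)) x :> (s * k) *\<^sub>R D"
proof -
  have "((\<lambda>x. z + k *\<^sub>R x) has_derivative (\<lambda>h. k *\<^sub>R h)) (at x)"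
    by (auto intro!: derivative_eq_intros)
  from has_derivative_compose[OF this assms[unfolded gderiv_def]]
  have "((\<lambda>x. f (z + k *\<^sub>R x)) has_derivative (\<lambda>h. (k *\<^sub>R h) \<bullet> D)) (at x)" .
  from has_derivative_mult_right[OF this, of s]
  show ?thesis unfolding gderiv_def by (simp add: mult.assoc)
qed

lemma grad_affine:
  "smooth f \<Longrightarrow> grad (\<lambda>x. s * f (z + k *\<^sub>R x)) x = (s * k) *\<^sub>R grad f (z + k *\<^sub>R x)"
  by (intro grad_eqI GDERIV_affine smooth_GDERIV)

lemma smooth_affine:
  fixes f :: "'a::euclidean_space \<Rightarrow> real"
  assumes "smooth f"
  shows "smooth (\<lambda>x. s * f (z + k *\<^sub>R x))"
proof -
  \<comment> \<open>The scalar belongs to the class because every differentiation multiplies it by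
    \<open>k\<close>.\<close>
  define S where "S = {g. \<exists>s f. smooth (f :: 'a \<Rightarrow> real) \<and> g = (\<lambda>x. s * f (z + k *\<^sub>R x))}"
  have S: "g \<in> S" if "smooth f" "g = (\<lambda>x. s * f (z + k *\<^sub>R x))" for g f s
    using that unfolding S_def by blast
  show ?thesis
  proof (rule smooth_coinduct[of _ S])
    show "(\<lambda>x. s * f (z + k *\<^sub>R x)) \<in> S" using assms S by blast
  next
    fix g x assume "g \<in> S"
    then show "g differentiable (at x)"
      by (auto simp: S_def intro: GDERIV_differentiable GDERIV_affine smooth_GDERIV)
  next
    fix g and b :: 'a assume "g \<in> S" and b: "b \<in> Basis"
    then obtain s f where g: "g = (\<lambda>x. s * f (z + k *\<^sub>R x))" "smooth f" unfolding S_def by blast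
    show "(\<lambda>x. grad g x \<bullet> b) \<in> S"
      by (rule S[OF smooth_partial[OF g(2) b], of _ "s * k"]) (simp add: g grad_affine)
  qed
qed

section \<open>A smooth bump function with compact support\<close>

text \<open>The powers of \<open>t\<close> in the denominator are there because differentiating
  \<open>exp (- 1 / t)\<close> produces them: the span of this family is closed under
  differentiation.\<close>

definition flat_exp :: "nat \<Rightarrow> real \<Rightarrow> real" where
  "flat_exp k t = (if t > 0 then exp (- 1 / t) / t ^ k else 0)"

text \<open>A single term of the exponential series, \<open>(1 / t) ^ Suc k / fact (Suc k)\<close>,
  lies below \<open>exp (1 / t)\<close>. With \<open>k + 1\<close> in place of \<open>k\<close> the
  estimate shows that the difference quotient of \<open>flat_exp k\<close> at 0 tends to 0.\<close>

lemma flat_exp_le: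
  assumes "t > 0"
  shows "flat_exp k t \<le> fact (Suc k) * t"
proof -
  have "(1 / t) ^ Suc k / fact (Suc k) \<le> exp (1 / t)"
  proof -
    have "sum (\<lambda>n. inverse (fact n) * (1 / t) ^ n) {Suc k} \<le> (\<Sum>n. inverse (fact n) * (1 / t) ^ n)"
      by (rule sum_le_suminf) (use summable_exp[of "1 / t"] assms in auto)
    then show ?thesis by (simp add: exp_def scaleR_conv_of_real divide_inverse mult.commute)
  qed
  then have "1 \<le> fact (Suc k) * t ^ Suc k * exp (1 / t)"
    using assms mult_left_mono[of "(1 / t) ^ Suc k / fact (Suc k)" "exp (1 / t)" "fact (Suc k) * t ^ Suc k"]
    by (simp add: power_one_over del: fact_Suc power_Suc)
  then have "1 * exp (- (1 / t)) \<le> fact (Suc k) * t ^ Suc k * exp (1 / t) * exp (- (1 / t))"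
    by (rule mult_right_mono) simp
  also have "\<dots> = fact (Suc k) * t ^ Suc k" by (simp add: mult.assoc flip: exp_add del: fact_Suc power_Suc)
  finally have "exp (- (1 / t)) \<le> fact (Suc k) * t ^ Suc k" by simp
  then have "exp (- 1 / t) \<le> fact (Suc k) * t * t ^ k" by (simp add: mult.assoc del: fact_Suc)
  then show ?thesis
    using assms by (simp add: flat_exp_def pos_divide_le_eq del: fact_Suc)
qed

lemma flat_exp_DERIV:
  "(flat_exp k has_real_derivative (flat_exp (k + 2) t - real k * flat_exp (k + 1) t)) (at t)"
proof -
  consider "t > 0" | "t < 0" | "t = 0" by linarith
  then show ?thesis
  proof cases
    case 1
    have "((\<lambda>t. exp (- 1 / t) / t ^ k) has_real_derivative
        (flat_exp (k + 2) t - real k * flat_exp (k + 1) t)) (at t)"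
      using 1 by (auto intro!: derivative_eq_intros simp: flat_exp_def field_simps power2_eq_square;
          cases k; simp add: field_simps)
    then show ?thesis
      by (rule DERIV_cong_ev[THEN iffD1, rotated -1])
         (use 1 in \<open>auto simp: flat_exp_def eventually_nhds intro!: exI[of _ "{0<..}"]\<close>)
  next
    case 2
    have "((\<lambda>t. 0) has_real_derivative (flat_exp (k + 2) t - real k * flat_exp (k + 1) t)) (at t)"
      using 2 by (auto simp: flat_exp_def)
    then show ?thesis
      by (rule DERIV_cong_ev[THEN iffD1, rotated -1])
         (use 2 in \<open>auto simp: flat_exp_def eventually_nhds intro!: exI[of _ "{..<0}"]\<close>)
  next
    case 3
    have "((\<lambda>h. (flat_exp k (0 + h) - flat_exp k 0) / h) \<longlongrightarrow> 0) (at 0)"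
    proof (rule Lim_null_comparison)
      show "\<forall>\<^sub>F h in at 0. norm ((flat_exp k (0 + h) - flat_exp k 0) / h) \<le> fact (Suc (k + 1)) * \<bar>h\<bar>"
      proof (rule always_eventually, rule allI)
        fix h :: real
        show "norm ((flat_exp k (0 + h) - flat_exp k 0) / h) \<le> fact (Suc (k + 1)) * \<bar>h\<bar>"
        proof (cases "h > 0")
          case True
          then have "(flat_exp k (0 + h) - flat_exp k 0) / h = flat_exp (k + 1) h"
            by (simp add: flat_exp_def)
          then show ?thesis using flat_exp_le[OF True, of "k + 1"] True
            by (simp add: flat_exp_def mult.commute)
        next
          case False
          then have "norm ((flat_exp k (0 + h) - flat_exp k 0) / h) = 0" by (simp add: flat_exp_def)
          then show ?thesis by (simp only:) simp
        qed
      qed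
      show "((\<lambda>h. fact (Suc (k + 1)) * \<bar>h\<bar>) \<longlongrightarrow> 0) (at (0::real))"
        by (auto intro!: tendsto_eq_intros)
    qed
    then show ?thesis using 3 by (simp add: DERIV_def flat_exp_def)
  qed
qed

text \<open>The algebra generated by the linear functionals and the functions built from
  \<open>flat_exp\<close>. Sums and products are included because the product and chain rules create
  them, so the class is closed under partial derivatives.\<close>

inductive bump_class :: "('a::euclidean_space \<Rightarrow> real) \<Rightarrow> bool" where
  const: "bump_class (\<lambda>_. a)"
| inner: "bump_class (\<lambda>x. x \<bullet> v)"
| add: "bump_class f \<Longrightarrow> bump_class g \<Longrightarrow> bump_class (\<lambda>x. f x + g x)"
| mult: "bump_class f \<Longrightarrow> bump_class g \<Longrightarrow> bump_class (\<lambda>x. f x * g x)"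
| flat: "bump_class (\<lambda>x. flat_exp k (1 - x \<bullet> x))"

lemma bump_class_GDERIV:
  fixes f :: "'a::euclidean_space \<Rightarrow> real"
  assumes "bump_class f"
  shows "\<exists>f'. (\<forall>x. GDERIV f x :> f' x) \<and> (\<forall>b. bump_class (\<lambda>x. f' x \<bullet> b))"
  using assms
proof induction
  case (const a)
  show ?case
    by (rule exI[of _ "\<lambda>_. 0"]) (auto intro: GDERIV_const bump_class.const)
next
  case (inner v)
  show ?case
    by (rule exI[of _ "\<lambda>_. v"])
       (auto simp: gderiv_def intro!: derivative_eq_intros bump_class.const)
next
  case (add f g)
  then obtain f' g' where "\<forall>x. GDERIV f x :> f' x" "\<forall>x. GDERIV g x :> g' x"
    "\<forall>b. bump_class (\<lambda>x. f' x \<bullet> b)" "\<forall>b. bump_class (\<lambda>x. g' x \<bullet> b)" by blast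
  then show ?case
    by (intro exI[of _ "\<lambda>x. f' x + g' x"])
       (auto intro!: GDERIV_add simp: inner_add_left intro: bump_class.add)
next
  case (mult f g)
  then obtain f' g' where "\<forall>x. GDERIV f x :> f' x" "\<forall>x. GDERIV g x :> g' x"
    "\<forall>b. bump_class (\<lambda>x. f' x \<bullet> b)" "\<forall>b. bump_class (\<lambda>x. g' x \<bullet> b)" by blast
  then show ?case using mult
    by (intro exI[of _ "\<lambda>x. f x *\<^sub>R g' x + g x *\<^sub>R f' x"])
       (auto intro!: GDERIV_mult simp: inner_add_left intro!: bump_class.add bump_class.mult)
next
  case (flat k)
  define d where "d = (\<lambda>x::'a. flat_exp (k + 2) (1 - x \<bullet> x) - real k * flat_exp (k + 1) (1 - x \<bullet> x))"
  have "GDERIV (\<lambda>x. flat_exp k (1 - x \<bullet> x)) x :> d x *\<^sub>R (- (2 *\<^sub>R x))" for x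
  proof -
    have "GDERIV (\<lambda>x. 1 - x \<bullet> x) x :> - (2 *\<^sub>R x)"
      by (auto simp: gderiv_def intro!: derivative_eq_intros simp: inner_commute)
    from GDERIV_DERIV_compose[OF this flat_exp_DERIV]
    show ?thesis by (simp add: d_def)
  qed
  moreover have "bump_class (\<lambda>x. (d x *\<^sub>R (- (2 *\<^sub>R x))) \<bullet> b)" for b
  proof -
    have "bump_class (\<lambda>x. (flat_exp (k + 2) (1 - x \<bullet> x) + (- real k) * flat_exp (k + 1) (1 - x \<bullet> x))
            * ((-2) * (x \<bullet> b)))"
      by (intro bump_class.mult bump_class.add bump_class.const bump_class.flat bump_class.inner)
    then show ?thesis by (simp add: d_def mult_ac)
  qed
  ultimately show ?case by (intro exI[of _ "\<lambda>x. d x *\<^sub>R (- (2 *\<^sub>R x))"]) blast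
qed

lemma bump_class_smooth:
  fixes f :: "'a::euclidean_space \<Rightarrow> real"
  assumes "bump_class f"
  shows "smooth f"
proof (rule smooth_coinduct[where S = "{f. bump_class f}"])
  fix g x assume "g \<in> {f :: 'a \<Rightarrow> real. bump_class f}"
  then show "g differentiable (at x)"
    using bump_class_GDERIV GDERIV_differentiable by blast
next
  fix g :: "'a \<Rightarrow> real" and b :: 'a assume "g \<in> {f. bump_class f}"
  then obtain g' where g': "\<forall>x. GDERIV g x :> g' x" "\<forall>b. bump_class (\<lambda>x. g' x \<bullet> b)"
    using bump_class_GDERIV by blast
  then have "grad g = g'" using grad_eqI by blast
  then show "(\<lambda>x. grad g x \<bullet> b) \<in> {f. bump_class f}" using g' by simp
qed (use assms in auto)

lemma integrable_continuous_bounded_support: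
  fixes f :: "'a::euclidean_space \<Rightarrow> 'b::euclidean_space"
  assumes "continuous_on UNIV f" "\<And>x. norm x > R \<Longrightarrow> f x = 0"
  shows "integrable lborel f"
proof -
  have "integrable lborel (\<lambda>x. indicator (cball 0 R) x *\<^sub>R f x)"
    using borel_integrable_compact[of "cball 0 R" f] assms(1)
    by (auto simp: set_integrable_def intro: continuous_on_subset)
  moreover have "(\<lambda>x. indicator (cball 0 R) x *\<^sub>R f x) = f"
    using assms(2) by (auto simp: indicator_def fun_eq_iff not_le)
  ultimately show ?thesis by simp
qed

text \<open>The function \<open>exp (- 1 / (1 - x \<bullet> x))\<close> on the unit ball,
  normalised. Its integral cannot be 0, because it would then vanish almost everywhere on a ball of
  positive volume.\<close>

lemma bump_exists:
  obtains \<eta> :: "'a::euclidean_space \<Rightarrow> real" where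
    "smooth \<eta>" "\<And>x. 0 \<le> \<eta> x" "\<And>x. 1 \<le> norm x \<Longrightarrow> \<eta> x = 0"
    "integrable lborel \<eta>" "(\<integral>x. \<eta> x \<partial>lborel) = 1"
proof -
  define f where "f = (\<lambda>x::'a. flat_exp 0 (1 - x \<bullet> x))"
  have sm: "smooth f" unfolding f_def by (rule bump_class_smooth[OF bump_class.flat])
  have nn: "0 \<le> f x" for x by (simp add: f_def flat_exp_def)
  have z: "f x = 0" if "1 \<le> norm x" for x
  proof -
    have "1 \<le> (norm x)\<^sup>2" using that by simp
    then show ?thesis by (simp add: f_def flat_exp_def power2_norm_eq_inner)
  qed
  have int: "integrable lborel f"
    by (rule integrable_continuous_bounded_support[of _ 1]) (use sm smooth_continuous z in auto)
  have "(\<integral>x. f x \<partial>lborel) \<noteq> 0"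
  proof
    assume "(\<integral>x. f x \<partial>lborel) = 0"
    then have "AE x in lborel. f x = 0"
      using integral_nonneg_eq_0_iff_AE[OF int] nn by auto
    then have "AE x in lborel. x \<notin> ball (0::'a) 1"
    proof eventually_elim
      fix x :: 'a assume "f x = 0"
      then have "1 \<le> (norm x)\<^sup>2" by (auto simp: f_def flat_exp_def power2_norm_eq_inner split: if_splits)
      then show "x \<notin> ball 0 1" using abs_square_le_1[of "norm x"] power_less_one_iff[of "norm x" 2] by force
    qed
    then have "emeasure lborel (ball (0::'a) 1) = 0"
      by (subst (asm) AE_iff_measurable[of "ball 0 1"]) auto
    then have "measure lborel (ball (0::'a) 1) = 0" by (simp add: measure_def)
    then show False using content_ball_gt_0_iff[of "0::'a" 1] by (simp add: measure_def)
  qed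
  moreover have "(\<integral>x. f x \<partial>lborel) \<ge> 0" using nn by simp
  ultimately have pos: "(\<integral>x. f x \<partial>lborel) > 0" by linarith
  define s where "s = inverse (\<integral>x. f x \<partial>lborel)"
  show ?thesis
  proof
    show "smooth (\<lambda>x. s * f (0 + 1 *\<^sub>R x))" by (rule smooth_affine[OF sm])
    show "integrable lborel (\<lambda>x. s * f (0 + 1 *\<^sub>R x))" using int by simp
    show "(\<integral>x. s * f (0 + 1 *\<^sub>R x) \<partial>lborel) = 1" using pos by (simp add: s_def)
    show "0 \<le> s * f (0 + 1 *\<^sub>R x)" for x using nn pos by (simp add: s_def)
    show "1 \<le> norm x \<Longrightarrow> s * f (0 + 1 *\<^sub>R x) = 0" for x using z by simp
  qed
qed

section \<open>The L2 norm\<close>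

text \<open>A seminorm on \<open>L2\<close> only: where the square is not integrable the Bochner
  integral, and hence this expression, is 0. This is why the estimates carry \<open>L2\<close>
  hypotheses.\<close>

definition l2 :: "'a measure \<Rightarrow> ('a \<Rightarrow> 'b::euclidean_space) \<Rightarrow> real" where
  "l2 M f = sqrt (\<integral>x. (norm (f x))\<^sup>2 \<partial>M)"

lemma L2_measurable: "L2 M f \<Longrightarrow> f \<in> borel_measurable M"
  and L2_integrable_sq: "L2 M f \<Longrightarrow> integrable M (\<lambda>x. (norm (f x))\<^sup>2)"
  unfolding L2_def by auto

lemma l2_nonneg [simp]: "0 \<le> l2 M f"
  unfolding l2_def by simp

lemma l2_power2: "(l2 M f)\<^sup>2 = (\<integral>x. (norm (f x))\<^sup>2 \<partial>M)"
  unfolding l2_def by simp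

lemma L2_norm_mult_integrable:
  assumes "L2 M f" "L2 M g"
  shows "integrable M (\<lambda>x. norm (f x) * norm (g x))"
proof (rule Bochner_Integration.integrable_bound)
  show "integrable M (\<lambda>x. (norm (f x))\<^sup>2 + (norm (g x))\<^sup>2)"
    using assms by (auto simp: L2_def)
  show "(\<lambda>x. norm (f x) * norm (g x)) \<in> borel_measurable M"
    using assms[THEN L2_measurable] by measurable
  have "norm (f x) * norm (g x) \<le> (norm (f x))\<^sup>2 + (norm (g x))\<^sup>2" for x
    using sum_squares_bound[of "norm (f x)" "norm (g x)"] mult_nonneg_nonneg[of "norm (f x)" "norm (g x)"]
    by (simp del: mult_nonneg_nonneg)
  then show "AE x in M. norm (norm (f x) * norm (g x)) \<le> norm ((norm (f x))\<^sup>2 + (norm (g x))\<^sup>2)"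
    by auto
qed

lemma L2_inner_integrable:
  assumes "L2 M f" "L2 M g"
  shows "integrable M (\<lambda>x. f x \<bullet> g x)"
  by (rule Bochner_Integration.integrable_bound[OF L2_norm_mult_integrable[OF assms]])
     (use assms[THEN L2_measurable] Cauchy_Schwarz_ineq2 in \<open>auto simp: abs_mult\<close>)

lemma L2_mult_integrable:
  fixes f g :: "'a \<Rightarrow> real"
  assumes "L2 M f" "L2 M g"
  shows "integrable M (\<lambda>x. f x * g x)"
  using L2_inner_integrable[OF assms] by simp

lemma L2_scaleR_integrable:
  assumes "L2 M f" "L2 M g"
  shows "integrable M (\<lambda>x. f x *\<^sub>R g x)"
  by (rule Bochner_Integration.integrable_bound[OF L2_norm_mult_integrable[OF assms]])
     (use assms[THEN L2_measurable] in \<open>auto simp: abs_mult\<close>)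

lemma L2_bounded_mult:
  fixes h :: "'a \<Rightarrow> real" and f :: "'a \<Rightarrow> 'b::euclidean_space"
  assumes f: "L2 M f" and h: "h \<in> borel_measurable M" "\<And>x. x \<in> space M \<Longrightarrow> \<bar>h x\<bar> \<le> K"
  shows "L2 M (\<lambda>x. h x *\<^sub>R f x)"
proof -
  have meas: "(\<lambda>x. h x *\<^sub>R f x) \<in> borel_measurable M"
    using f[THEN L2_measurable] h by measurable
  have "integrable M (\<lambda>x. (norm (h x *\<^sub>R f x))\<^sup>2)"
  proof (rule Bochner_Integration.integrable_bound)
    show "integrable M (\<lambda>x. K\<^sup>2 * (norm (f x))\<^sup>2)" using f by (auto simp: L2_def)
    show "(\<lambda>x. (norm (h x *\<^sub>R f x))\<^sup>2) \<in> borel_measurable M" using meas by measurable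
    show "AE x in M. norm ((norm (h x *\<^sub>R f x))\<^sup>2) \<le> norm (K\<^sup>2 * (norm (f x))\<^sup>2)"
    proof (rule AE_I2)
      fix x assume "x \<in> space M"
      then have "\<bar>h x\<bar> * norm (f x) \<le> \<bar>K\<bar> * norm (f x)"
        using h(2) by (intro mult_right_mono) force+
      then have "(\<bar>h x\<bar> * norm (f x))\<^sup>2 \<le> (\<bar>K\<bar> * norm (f x))\<^sup>2"
        by (intro power_mono) auto
      then show "norm ((norm (h x *\<^sub>R f x))\<^sup>2) \<le> norm (K\<^sup>2 * (norm (f x))\<^sup>2)"
        by (simp add: power_mult_distrib)
    qed
  qed
  with meas show ?thesis unfolding L2_def by auto
qed

lemma L2_cmult: "L2 M f \<Longrightarrow> L2 M (\<lambda>x. a *\<^sub>R f x)"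
  by (rule L2_bounded_mult[where K = "\<bar>a\<bar>"]) auto

lemma L2_add:
  assumes "L2 M f" "L2 M g"
  shows "L2 M (\<lambda>x. f x + g x)"
proof -
  have eq: "(\<lambda>x. (norm (f x + g x))\<^sup>2) = (\<lambda>x. (norm (f x))\<^sup>2 + 2 * (f x \<bullet> g x) + (norm (g x))\<^sup>2)"
    by (simp add: fun_eq_iff power2_norm_eq_inner inner_add_left inner_add_right inner_commute)
  have "integrable M (\<lambda>x. (norm (f x + g x))\<^sup>2)"
    unfolding eq using assms L2_inner_integrable[OF assms] by (auto simp: L2_def)
  then show ?thesis using assms unfolding L2_def by auto
qed

lemma L2_diff: "L2 M f \<Longrightarrow> L2 M g \<Longrightarrow> L2 M (\<lambda>x. f x - g x)"
  using L2_add[of M f "\<lambda>x. (-1) *\<^sub>R g x"] L2_cmult[of M g "-1"] by simp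

lemma L2_norm: "L2 M f \<Longrightarrow> L2 M (\<lambda>x. norm (f x))"
  unfolding L2_def by auto

text \<open>Nonnegativity of the quadratic form
  \<open>(s, t) \<mapsto> s^2 A - 2 s t C + t^2 B\<close>. At \<open>s = C\<close>,
  \<open>t = A\<close> it reads \<open>A (A B - C^2) \<ge> 0\<close>, which is useless for
  \<open>A = 0\<close>; that case is treated apart.\<close>

lemma l2_Cauchy_Schwarz:
  assumes "L2 M f" "L2 M g"
  shows "(\<integral>x. norm (f x) * norm (g x) \<partial>M) \<le> l2 M f * l2 M g"
proof -
  define A B C where "A = (\<integral>x. (norm (f x))\<^sup>2 \<partial>M)" and "B = (\<integral>x. (norm (g x))\<^sup>2 \<partial>M)"
    and "C = (\<integral>x. norm (f x) * norm (g x) \<partial>M)"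
  have AB: "0 \<le> A" "0 \<le> B" "0 \<le> C" unfolding A_def B_def C_def by auto
  have quad: "0 \<le> s\<^sup>2 * A - 2 * s * t * C + t\<^sup>2 * B" for s t :: real
  proof -
    have "0 \<le> (\<integral>x. (s * norm (f x) - t * norm (g x))\<^sup>2 \<partial>M)" by simp
    also have "(\<integral>x. (s * norm (f x) - t * norm (g x))\<^sup>2 \<partial>M) =
        (\<integral>x. s\<^sup>2 * (norm (f x))\<^sup>2 - 2 * s * t * (norm (f x) * norm (g x)) + t\<^sup>2 * (norm (g x))\<^sup>2 \<partial>M)"
      by (rule Bochner_Integration.integral_cong) (auto simp: power2_eq_square algebra_simps)
    also have "\<dots> = s\<^sup>2 * A - 2 * s * t * C + t\<^sup>2 * B"
      using assms L2_norm_mult_integrable[OF assms] by (simp add: L2_def A_def B_def C_def)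
    finally show ?thesis .
  qed
  have "C\<^sup>2 \<le> A * B"
  proof (cases "A = 0")
    case True
    have "C = 0"
    proof (rule ccontr)
      assume "C \<noteq> 0"
      \<comment> \<open>For \<open>A = 0\<close> the form is linear in \<open>s\<close>, and this
        choice of \<open>s\<close> with \<open>t = 1\<close> makes it equal to
        \<open>- B - 2\<close>.\<close>
      have "2 * ((B + 1) / C) * 1 * C = 2 * (B + 1)" using \<open>C \<noteq> 0\<close> by simp
      then show False
        using quad[of "(B + 1) / C" 1] True AB by simp
    qed
    then show ?thesis using True by simp
  next
    case False
    then have "A > 0" using AB by simp
    then show ?thesis
      using quad[of C A] by (simp add: power2_eq_square algebra_simps)
  qed
  then have "C \<le> sqrt (A * B)" by (rule real_le_rsqrt)
  then show ?thesis by (simp add: l2_def A_def B_def C_def real_sqrt_mult)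
qed

lemma l2_inner:
  assumes "L2 M f" "L2 M g"
  shows "\<bar>\<integral>x. f x \<bullet> g x \<partial>M\<bar> \<le> l2 M f * l2 M g"
proof -
  have "\<bar>\<integral>x. f x \<bullet> g x \<partial>M\<bar> \<le> (\<integral>x. norm (f x) * norm (g x) \<partial>M)"
    by (rule order_trans[OF integral_abs_bound])
       (intro integral_mono integrable_abs L2_inner_integrable L2_norm_mult_integrable assms Cauchy_Schwarz_ineq2)
  then show ?thesis using l2_Cauchy_Schwarz[OF assms] by linarith
qed

lemma l2_triangle:
  assumes "L2 M f" "L2 M g"
  shows "l2 M (\<lambda>x. f x + g x) \<le> l2 M f + l2 M g"
proof -
  have "(l2 M (\<lambda>x. f x + g x))\<^sup>2 = (\<integral>x. (norm (f x))\<^sup>2 + 2 * (f x \<bullet> g x) + (norm (g x))\<^sup>2 \<partial>M)"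
    unfolding l2_power2
    by (rule Bochner_Integration.integral_cong)
       (auto simp: power2_norm_eq_inner inner_add_left inner_add_right inner_commute)
  also have "\<dots> = (l2 M f)\<^sup>2 + 2 * (\<integral>x. f x \<bullet> g x \<partial>M) + (l2 M g)\<^sup>2"
    using assms L2_inner_integrable[OF assms] by (simp add: L2_def l2_power2)
  also have "\<dots> \<le> (l2 M f + l2 M g)\<^sup>2"
    using l2_inner[OF assms] by (simp add: power2_sum)
  finally show ?thesis by (rule power2_le_imp_le) simp
qed

lemma l2_cmult: "l2 M (\<lambda>x. a *\<^sub>R f x) = \<bar>a\<bar> * l2 M f"
  unfolding l2_def by (simp add: power_mult_distrib real_sqrt_mult)

lemma l2_minus_commute: "l2 M (\<lambda>x. f x - g x) = l2 M (\<lambda>x. g x - f x)"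
  unfolding l2_def by (simp add: norm_minus_commute)

lemma l2_triangle_diff:
  assumes "L2 M f" "L2 M g" "L2 M h"
  shows "l2 M (\<lambda>x. f x - h x) \<le> l2 M (\<lambda>x. f x - g x) + l2 M (\<lambda>x. g x - h x)"
  using l2_triangle[OF L2_diff[OF assms(1,2)] L2_diff[OF assms(2,3)]] by simp

lemma l2_mono:
  assumes "L2 M g" "f \<in> borel_measurable M" "\<And>x. x \<in> space M \<Longrightarrow> norm (f x) \<le> norm (g x)"
  shows "l2 M f \<le> l2 M g" and "L2 M f"
proof -
  have le: "(norm (f x))\<^sup>2 \<le> (norm (g x))\<^sup>2" if "x \<in> space M" for x
    using assms(3)[OF that] by (intro power_mono) auto
  show 1: "L2 M f" unfolding L2_def
  proof
    show "integrable M (\<lambda>x. (norm (f x))\<^sup>2)"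
      by (rule Bochner_Integration.integrable_bound[OF L2_integrable_sq[OF assms(1)]])
         (use assms(2) le in auto)
  qed fact
  show "l2 M f \<le> l2 M g"
    unfolding l2_def using assms(1) 1 le
    by (intro real_sqrt_le_mono integral_mono) (auto simp: L2_def)
qed

lemma l2_tendsto_0_iff:
  "(\<lambda>n. l2 M (f n)) \<longlonglongrightarrow> 0 \<longleftrightarrow> (\<lambda>n. \<integral>x. (norm (f n x))\<^sup>2 \<partial>M) \<longlonglongrightarrow> 0"
proof
  assume "(\<lambda>n. l2 M (f n)) \<longlonglongrightarrow> 0"
  then have "(\<lambda>n. (l2 M (f n))\<^sup>2) \<longlonglongrightarrow> 0\<^sup>2" by (rule tendsto_power)
  then show "(\<lambda>n. \<integral>x. (norm (f n x))\<^sup>2 \<partial>M) \<longlonglongrightarrow> 0" by (simp add: l2_power2)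
next
  assume "(\<lambda>n. \<integral>x. (norm (f n x))\<^sup>2 \<partial>M) \<longlonglongrightarrow> 0"
  then show "(\<lambda>n. l2 M (f n)) \<longlonglongrightarrow> 0"
    unfolding l2_def using tendsto_real_sqrt by fastforce
qed

lemma l2_eq_0_AE:
  assumes "L2 M f" "l2 M f = 0"
  shows "AE x in M. f x = 0"
proof -
  have "(\<integral>x. (norm (f x))\<^sup>2 \<partial>M) = 0" using assms(2) by (simp add: l2_def)
  then have "AE x in M. (norm (f x))\<^sup>2 = 0"
    using integral_nonneg_eq_0_iff_AE[OF L2_integrable_sq[OF assms(1)]] by simp
  then show ?thesis by simp
qed

text \<open>The difference of the two integrals is expanded bilinearly into three terms, each of
  which Cauchy-Schwarz bounds by a product with a factor tending to 0. This is the tool that carries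
  identities for smooth functions over to \<open>H1\<close> and to traces.\<close>

lemma l2_tendsto_inner:
  assumes L2: "\<And>n. L2 M (f n)" "L2 M F" "\<And>n. L2 M (g n)" "L2 M G"
    and f: "(\<lambda>n. l2 M (\<lambda>x. f n x - F x)) \<longlonglongrightarrow> 0" and g: "(\<lambda>n. l2 M (\<lambda>x. g n x - G x)) \<longlonglongrightarrow> 0"
  shows "(\<lambda>n. \<integral>x. f n x \<bullet> g n x \<partial>M) \<longlonglongrightarrow> (\<integral>x. F x \<bullet> G x \<partial>M)"
proof -
  have eq: "(\<integral>x. f n x \<bullet> g n x \<partial>M) - (\<integral>x. F x \<bullet> G x \<partial>M) =
      (\<integral>x. (f n x - F x) \<bullet> (g n x - G x) \<partial>M) + (\<integral>x. (f n x - F x) \<bullet> G x \<partial>M)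
      + (\<integral>x. F x \<bullet> (g n x - G x) \<partial>M)" for n
  proof -
    have "(\<integral>x. f n x \<bullet> g n x \<partial>M) = (\<integral>x. (f n x - F x) \<bullet> (g n x - G x) + (f n x - F x) \<bullet> G x
        + F x \<bullet> (g n x - G x) + F x \<bullet> G x \<partial>M)"
      by (rule Bochner_Integration.integral_cong) (auto simp: inner_diff_left inner_diff_right)
    also have "\<dots> = (\<integral>x. (f n x - F x) \<bullet> (g n x - G x) \<partial>M) + (\<integral>x. (f n x - F x) \<bullet> G x \<partial>M)
      + (\<integral>x. F x \<bullet> (g n x - G x) \<partial>M) + (\<integral>x. F x \<bullet> G x \<partial>M)"
      using L2 by (simp add: L2_inner_integrable L2_diff)
    finally show ?thesis by simp
  qed
  have "(\<lambda>n. (\<integral>x. f n x \<bullet> g n x \<partial>M) - (\<integral>x. F x \<bullet> G x \<partial>M)) \<longlonglongrightarrow> 0"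
  proof (rule Lim_null_comparison)
    show "\<forall>\<^sub>F n in sequentially. norm ((\<integral>x. f n x \<bullet> g n x \<partial>M) - (\<integral>x. F x \<bullet> G x \<partial>M)) \<le>
       l2 M (\<lambda>x. f n x - F x) * l2 M (\<lambda>x. g n x - G x) + l2 M (\<lambda>x. f n x - F x) * l2 M G
       + l2 M F * l2 M (\<lambda>x. g n x - G x)"
      unfolding eq
    proof (intro always_eventually allI)
      fix n
      show "norm ((\<integral>x. (f n x - F x) \<bullet> (g n x - G x) \<partial>M) + (\<integral>x. (f n x - F x) \<bullet> G x \<partial>M)
          + (\<integral>x. F x \<bullet> (g n x - G x) \<partial>M)) \<le>
       l2 M (\<lambda>x. f n x - F x) * l2 M (\<lambda>x. g n x - G x) + l2 M (\<lambda>x. f n x - F x) * l2 M G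
       + l2 M F * l2 M (\<lambda>x. g n x - G x)"
        using l2_inner[OF L2_diff[OF L2(1)[of n] L2(2)] L2_diff[OF L2(3)[of n] L2(4)]]
          l2_inner[OF L2_diff[OF L2(1)[of n] L2(2)] L2(4)]
          l2_inner[OF L2(2) L2_diff[OF L2(3)[of n] L2(4)]] by simp
    qed
    show "(\<lambda>n. l2 M (\<lambda>x. f n x - F x) * l2 M (\<lambda>x. g n x - G x) + l2 M (\<lambda>x. f n x - F x) * l2 M G
       + l2 M F * l2 M (\<lambda>x. g n x - G x)) \<longlonglongrightarrow> 0"
      using f g by (auto intro!: tendsto_eq_intros)
  qed
  then show ?thesis by (simp add: LIM_zero_iff)
qed

lemma l2_tendsto_power2:
  assumes "\<And>n. L2 M (f n)" "L2 M F" "(\<lambda>n. l2 M (\<lambda>x. f n x - F x)) \<longlonglongrightarrow> 0"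
  shows "(\<lambda>n. \<integral>x. (norm (f n x))\<^sup>2 \<partial>M) \<longlonglongrightarrow> (\<integral>x. (norm (F x))\<^sup>2 \<partial>M)"
  using l2_tendsto_inner[OF assms(1,2,1,2,3,3)] by (simp add: power2_norm_eq_inner)

lemma l2_bounded_mult_tendsto:
  fixes h :: "'a \<Rightarrow> real" and f :: "nat \<Rightarrow> 'a \<Rightarrow> 'b::euclidean_space"
  assumes f: "\<And>n. L2 M (f n)" "(\<lambda>n. l2 M (f n)) \<longlonglongrightarrow> 0"
    and h: "h \<in> borel_measurable M" "\<And>x. x \<in> space M \<Longrightarrow> \<bar>h x\<bar> \<le> K"
  shows "(\<lambda>n. l2 M (\<lambda>x. h x *\<^sub>R f n x)) \<longlonglongrightarrow> 0"
proof (rule Lim_null_comparison)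
  show "\<forall>\<^sub>F n in sequentially. norm (l2 M (\<lambda>x. h x *\<^sub>R f n x)) \<le> \<bar>K\<bar> * l2 M (f n)"
  proof (intro always_eventually allI)
    fix n
    have "l2 M (\<lambda>x. h x *\<^sub>R f n x) \<le> l2 M (\<lambda>x. K *\<^sub>R f n x)"
    proof (rule l2_mono)
      show "L2 M (\<lambda>x. K *\<^sub>R f n x)" using f by (auto intro: L2_cmult)
      show "(\<lambda>x. h x *\<^sub>R f n x) \<in> borel_measurable M" using L2_measurable[OF f(1)] h by measurable
      fix x assume "x \<in> space M"
      then show "norm (h x *\<^sub>R f n x) \<le> norm (K *\<^sub>R f n x)"
        using h(2)[of x] by (auto intro!: mult_right_mono)
    qed
    then show "norm (l2 M (\<lambda>x. h x *\<^sub>R f n x)) \<le> \<bar>K\<bar> * l2 M (f n)" by (simp add: l2_cmult)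
  qed
  show "(\<lambda>n. \<bar>K\<bar> * l2 M (f n)) \<longlonglongrightarrow> 0" using f(2) by (auto intro!: tendsto_eq_intros)
qed

lemma l2_AE_subseq:
  assumes "\<And>n. L2 M (f n)" "(\<lambda>n. l2 M (f n)) \<longlonglongrightarrow> 0"
  obtains s :: "nat \<Rightarrow> nat" where "strict_mono s" "AE x in M. (\<lambda>n. f (s n) x) \<longlonglongrightarrow> 0"
proof -
  have "(\<lambda>n. \<integral>x. norm ((norm (f n x))\<^sup>2) \<partial>M) \<longlonglongrightarrow> 0"
    using assms(2) unfolding l2_tendsto_0_iff by simp
  from tendsto_L1_AE_subseq[OF L2_integrable_sq[OF assms(1)] this]
  obtain s where s: "strict_mono s" "AE x in M. (\<lambda>n. (norm (f (s n) x))\<^sup>2) \<longlonglongrightarrow> 0" by auto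
  have "AE x in M. (\<lambda>n. f (s n) x) \<longlonglongrightarrow> 0"
    using s(2)
  proof eventually_elim
    fix x assume "(\<lambda>n. (norm (f (s n) x))\<^sup>2) \<longlonglongrightarrow> 0"
    then have "(\<lambda>n. sqrt ((norm (f (s n) x))\<^sup>2)) \<longlonglongrightarrow> sqrt 0" by (rule tendsto_real_sqrt)
    then show "(\<lambda>n. f (s n) x) \<longlonglongrightarrow> 0" by (simp add: tendsto_norm_zero_iff)
  qed
  with s(1) show ?thesis by (rule that)
qed

lemma (in finite_measure) L2_bounded:
  assumes "f \<in> borel_measurable M" "\<And>x. x \<in> space M \<Longrightarrow> norm (f x) \<le> K"
  shows "L2 M f"
  unfolding L2_def
proof
  show "integrable M (\<lambda>x. (norm (f x))\<^sup>2)"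
  proof (rule integrable_const_bound[where B = "K\<^sup>2"])
    show "AE x in M. norm ((norm (f x))\<^sup>2) \<le> K\<^sup>2"
      using assms(2) by (auto intro!: power_mono)
  qed (use assms(1) in measurable)
qed fact

lemma (in finite_measure) L2_integrable:
  assumes "L2 M f"
  shows "integrable M f"
  using L2_scaleR_integrable[OF L2_bounded[of "\<lambda>_. 1::real" 1] assms] by simp

section \<open>Mollification\<close>

lemma borel_measurable_lebesgue_on:
  "f \<in> borel_measurable borel \<Longrightarrow> f \<in> borel_measurable (lebesgue_on S)"
  by (intro measurable_restrict_space1 measurable_completion) simp

lemma continuous_borel_measurable_lebesgue_on:
  fixes f :: "'a::euclidean_space \<Rightarrow> 'b::euclidean_space"
  shows "continuous_on UNIV f \<Longrightarrow> f \<in> borel_measurable (lebesgue_on S)"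
  by (intro borel_measurable_lebesgue_on borel_measurable_continuous_onI)

lemma finite_measure_lebesgue_ball: "finite_measure (lebesgue_on (ball c r))"
  by (rule finite_measure_lebesgue_on) auto

lemma nn_integral_lborel_affine:
  fixes f :: "'a::euclidean_space \<Rightarrow> ennreal"
  assumes [measurable]: "f \<in> borel_measurable borel" and k: "k \<noteq> 0"
  shows "(\<integral>\<^sup>+x. f (t + k *\<^sub>R x) \<partial>lborel) = ennreal (1 / \<bar>k\<bar> ^ DIM('a)) * (\<integral>\<^sup>+x. f x \<partial>lborel)"
proof -
  have "(\<integral>\<^sup>+x. f x \<partial>lborel) = ennreal (\<bar>k\<bar> ^ DIM('a)) * (\<integral>\<^sup>+x. f (t + k *\<^sub>R x) \<partial>lborel)"
    by (subst lborel_affine[OF k, of t])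
       (simp add: nn_integral_density nn_integral_distr nn_integral_cmult ennreal_power)
  then show ?thesis
    using k by (simp add: mult.assoc[symmetric] flip: ennreal_mult)
qed

text \<open>More than differentiability requires, but both uses supply a quadratic remainder:
  convolutions with a kernel of bounded second order, and the radial profile at its centre.\<close>

lemma quadratic_GDERIV:
  fixes f :: "'a::euclidean_space \<Rightarrow> real"
  assumes "\<And>h. \<bar>f (x + h) - f x - h \<bullet> D\<bar> \<le> K * (norm h)\<^sup>2"
  shows "GDERIV f x :> D"
  unfolding gderiv_def has_derivative_at
proof (intro conjI)
  show "bounded_linear (\<lambda>h. h \<bullet> D)" by (rule bounded_linear_inner_left)
  show "(\<lambda>h. norm (f (x + h) - f x - h \<bullet> D) / norm h) \<midarrow>0\<rightarrow> 0"
  proof (rule Lim_null_comparison)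
    show "\<forall>\<^sub>F h in at 0. norm (norm (f (x + h) - f x - h \<bullet> D) / norm h) \<le> K * norm h"
    proof (intro always_eventually allI)
      fix h
      show "norm (norm (f (x + h) - f x - h \<bullet> D) / norm h) \<le> K * norm h"
        using assms[of h] by (cases "h = 0") (auto simp: power2_eq_square divide_simps mult.assoc)
    qed
    show "((\<lambda>h. K * norm h) \<longlongrightarrow> 0) (at 0)" by (auto intro!: tendsto_eq_intros)
  qed
qed

section \<open>Smoothness of convolutions with compactly supported kernels\<close>

lemma bounded_support_bounded:
  fixes f :: "'a::euclidean_space \<Rightarrow> 'b::euclidean_space"
  assumes "continuous_on UNIV f" "\<And>x. norm x > R \<Longrightarrow> f x = 0"
  obtains K where "K \<ge> 0" "\<And>x. norm (f x) \<le> K"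
proof -
  have "bounded (f ` cball 0 R)"
    by (intro compact_imp_bounded compact_continuous_image continuous_on_subset[OF assms(1)]) auto
  then obtain K where "\<forall>y\<in>f ` cball 0 R. norm y \<le> K"
    unfolding bounded_iff by blast
  then have K: "\<And>x. x \<in> cball 0 R \<Longrightarrow> norm (f x) \<le> K" by blast
  show ?thesis
  proof
    show "norm (f x) \<le> \<bar>K\<bar>" for x
      using K[of x] assms(2)[of x] by (cases "norm x > R") auto
  qed auto
qed

lemma grad_bounded_support:
  fixes f :: "'a::euclidean_space \<Rightarrow> real"
  assumes "\<And>x. norm x > R \<Longrightarrow> f x = 0" "norm x > R"
  shows "grad f x = 0"
proof (rule grad_eqI)
  have "GDERIV (\<lambda>_. 0) x :> 0" by (rule GDERIV_const)
  moreover have "open {x :: 'a. norm x > R}"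
    by (intro open_Collect_less continuous_intros)
  ultimately show "GDERIV f x :> 0"
    unfolding gderiv_def
    by (rule has_derivative_transform_within_open) (use assms in auto)
qed

lemma GDERIV_bounded_Lipschitz:
  fixes f :: "'a::euclidean_space \<Rightarrow> real"
  assumes "convex S" "\<And>x. x \<in> S \<Longrightarrow> GDERIV f x :> f' x" "\<And>x. x \<in> S \<Longrightarrow> norm (f' x) \<le> K"
    and "x \<in> S" "y \<in> S"
  shows "\<bar>f x - f y\<bar> \<le> K * norm (x - y)"
proof -
  have "norm (f x - f y) \<le> K * norm (x - y)"
  proof (rule differentiable_bound[OF assms(1)])
    fix x assume x: "x \<in> S"
    show "(f has_derivative (\<lambda>h. h \<bullet> f' x)) (at x within S)"
      using assms(2)[OF x] unfolding gderiv_def by (rule has_derivative_at_withinI)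
    show "onorm (\<lambda>h. h \<bullet> f' x) \<le> K"
    proof (rule onorm_le)
      fix h
      have "norm (h \<bullet> f' x) \<le> norm h * norm (f' x)" by (simp add: Cauchy_Schwarz_ineq2)
      also have "\<dots> \<le> norm h * K" using assms(3)[OF x] by (rule mult_left_mono) simp
      finally show "norm (h \<bullet> f' x) \<le> K * norm h" by (simp add: mult.commute)
    qed
  qed (use assms in auto)
  then show ?thesis by simp
qed

text \<open>Bounded support makes the second derivatives bounded, so the gradient is globally
  Lipschitz. The mean value inequality on the ball of radius \<open>norm h\<close> about
  \<open>z\<close>, applied to \<open>f\<close> minus its linear part at \<open>z\<close>, then
  gives a remainder that is uniform in \<open>z\<close>.\<close>

lemma smooth_second_order:
  fixes f :: "'a::euclidean_space \<Rightarrow> real"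
  assumes f: "smooth f" and supp: "\<And>x. norm x > R \<Longrightarrow> f x = 0"
  obtains K where "\<And>z h. \<bar>f (z + h) - f z - h \<bullet> grad f z\<bar> \<le> K * (norm h)\<^sup>2"
proof -
  have "\<exists>K. \<forall>x y. \<bar>grad f x \<bullet> b - grad f y \<bullet> b\<bar> \<le> K * norm (x - y)" if b: "b \<in> Basis" for b
  proof -
    let ?g = "\<lambda>x. grad f x \<bullet> b"
    have sm: "smooth ?g" by (rule smooth_partial[OF f b])
    have "grad ?g x = 0" if "norm x > R" for x
      by (rule grad_bounded_support[OF _ that]) (simp add: grad_bounded_support[OF supp])
    then obtain K where "\<And>x. norm (grad ?g x) \<le> K"
      using bounded_support_bounded[OF smooth_continuous_grad[OF sm]] by blast
    then have "\<bar>?g x - ?g y\<bar> \<le> K * norm (x - y)" for x y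
      by (intro GDERIV_bounded_Lipschitz[of UNIV ?g]) (auto intro: smooth_GDERIV[OF sm])
    then show ?thesis by blast
  qed
  then obtain k where k: "\<And>b x y. b \<in> Basis \<Longrightarrow> \<bar>grad f x \<bullet> b - grad f y \<bullet> b\<bar> \<le> k b * norm (x - y)"
    by metis
  define K where "K = (\<Sum>b\<in>Basis. \<bar>k b\<bar>)"
  have K: "norm (grad f x - grad f y) \<le> K * norm (x - y)" for x y
  proof -
    have "norm (grad f x - grad f y) \<le> (\<Sum>b\<in>Basis. \<bar>(grad f x - grad f y) \<bullet> b\<bar>)" by (rule norm_le_l1)
    also have "\<dots> \<le> (\<Sum>b\<in>Basis. \<bar>k b\<bar> * norm (x - y))"
    proof (rule sum_mono)
      fix b :: 'a assume "b \<in> Basis"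
      have "k b * norm (x - y) \<le> \<bar>k b\<bar> * norm (x - y)" by (intro mult_right_mono) auto
      with k[OF \<open>b \<in> Basis\<close>, of x y] show "\<bar>(grad f x - grad f y) \<bullet> b\<bar> \<le> \<bar>k b\<bar> * norm (x - y)"
        by (auto simp: inner_diff_left)
    qed
    finally show ?thesis by (simp add: K_def sum_distrib_right)
  qed
  have "K \<ge> 0" by (auto simp: K_def)
  show ?thesis
  proof
    fix z h
    let ?F = "\<lambda>w. f w - w \<bullet> grad f z"
    have "\<bar>?F (z + h) - ?F z\<bar> \<le> (K * norm h) * norm ((z + h) - z)"
    proof (rule GDERIV_bounded_Lipschitz[of "cball z (norm h)" ?F "\<lambda>w. grad f w - grad f z"])
      fix w
      have "GDERIV (\<lambda>w. w \<bullet> grad f z) w :> grad f z" by (auto simp: gderiv_def intro!: derivative_eq_intros)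
      then show "GDERIV ?F w :> grad f w - grad f z" by (intro GDERIV_diff smooth_GDERIV f)
      assume "w \<in> cball z (norm h)"
      then have "K * norm (w - z) \<le> K * norm h"
        using \<open>K \<ge> 0\<close> by (intro mult_left_mono) (auto simp: dist_norm norm_minus_commute)
      then show "norm (grad f w - grad f z) \<le> K * norm h" using K[of w z] by linarith
    qed (auto simp: dist_norm)
    then show "\<bar>f (z + h) - f z - h \<bullet> grad f z\<bar> \<le> K * (norm h)\<^sup>2"
      by (simp add: inner_add_left power2_eq_square algebra_simps)
  qed
qed

lemma convolution_integrable:
  fixes u :: "'a::euclidean_space \<Rightarrow> 'b::euclidean_space" and \<zeta> :: "'a \<Rightarrow> real"
  assumes "(\<lambda>y. y) \<in> M \<rightarrow>\<^sub>M borel" "integrable M u" "continuous_on UNIV \<zeta>" "\<And>x. norm x > R \<Longrightarrow> \<zeta> x = 0"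
  shows "integrable M (\<lambda>y. \<zeta> (z - y) *\<^sub>R u y)"
proof -
  from bounded_support_bounded[OF assms(3,4)] obtain K where K: "\<And>x. norm (\<zeta> x) \<le> K" by metis
  have [measurable]: "\<zeta> \<in> borel_measurable borel" by (rule borel_measurable_continuous_onI[OF assms(3)])
  note [measurable] = assms(1) borel_measurable_integrable[OF assms(2)]
  show ?thesis
  proof (rule Bochner_Integration.integrable_bound)
    show "integrable M (\<lambda>y. K * norm (u y))" using assms(2) by simp
    show "(\<lambda>y. \<zeta> (z - y) *\<^sub>R u y) \<in> borel_measurable M" by measurable
    show "AE y in M. norm (\<zeta> (z - y) *\<^sub>R u y) \<le> norm (K * norm (u y))"
      using K by (auto intro!: AE_I2 simp: abs_mult intro!: mult_right_mono order_trans[OF K[simplified]])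
  qed
qed

lemma convolution_integrable_grad:
  fixes u :: "'a::euclidean_space \<Rightarrow> real"
  assumes M: "(\<lambda>y. y) \<in> M \<rightarrow>\<^sub>M borel" and u: "integrable M u"
    and \<zeta>: "smooth \<zeta>" "\<And>x. norm x > R \<Longrightarrow> \<zeta> x = 0"
  shows "integrable M (\<lambda>y. u y *\<^sub>R grad \<zeta> (z - y))"
proof -
  have "grad \<zeta> x = 0" if "norm x > R" for x by (rule grad_bounded_support[OF \<zeta>(2) that])
  from bounded_support_bounded[OF smooth_continuous_grad[OF \<zeta>(1)] this]
  obtain K where K: "\<And>x. norm (grad \<zeta> x) \<le> K" by metis
  have [measurable]: "grad \<zeta> \<in> borel_measurable borel"
    by (rule borel_measurable_continuous_onI[OF smooth_continuous_grad[OF \<zeta>(1)]])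
  note [measurable] = M borel_measurable_integrable[OF u]
  show ?thesis
  proof (rule Bochner_Integration.integrable_bound)
    show "integrable M (\<lambda>y. K * u y)" using u by simp
    show "(\<lambda>y. u y *\<^sub>R grad \<zeta> (z - y)) \<in> borel_measurable M" by measurable
    show "AE y in M. norm (u y *\<^sub>R grad \<zeta> (z - y)) \<le> norm (K * u y)"
    proof (rule AE_I2)
      fix y
      have "norm (grad \<zeta> (z - y)) * \<bar>u y\<bar> \<le> \<bar>K\<bar> * \<bar>u y\<bar>"
        by (intro mult_right_mono order_trans[OF K abs_ge_self]) auto
      then show "norm (u y *\<^sub>R grad \<zeta> (z - y)) \<le> norm (K * u y)"
        by (simp add: abs_mult mult.commute)
    qed
  qed
qed

text \<open>The Taylor remainder of the kernel is uniform in \<open>y\<close>, so it survives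
  integration against \<open>u\<close>, of which only integrability is used. The affine argument
  makes room for the contraction of the ball towards its centre.\<close>

lemma convolution_GDERIV:
  fixes u :: "'a::euclidean_space \<Rightarrow> real"
  assumes M: "(\<lambda>y. y) \<in> M \<rightarrow>\<^sub>M borel" and u: "integrable M u"
    and \<zeta>: "smooth \<zeta>" "\<And>x. norm x > R \<Longrightarrow> \<zeta> x = 0"
  shows "GDERIV (\<lambda>x. \<integral>y. \<zeta> (a + s *\<^sub>R x - y) * u y \<partial>M) x :>
           s *\<^sub>R (\<integral>y. u y *\<^sub>R grad \<zeta> (a + s *\<^sub>R x - y) \<partial>M)"
proof -
  from smooth_second_order[OF \<zeta>] obtain K
    where K: "\<And>z h. \<bar>\<zeta> (z + h) - \<zeta> z - h \<bullet> grad \<zeta> z\<bar> \<le> K * (norm h)\<^sup>2" by metis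
  have int: "integrable M (\<lambda>y. \<zeta> (z - y) * u y)" for z
    using convolution_integrable[OF M u smooth_continuous[OF \<zeta>(1)] \<zeta>(2)] by simp
  have intg: "integrable M (\<lambda>y. u y *\<^sub>R grad \<zeta> (z - y))" for z
    by (rule convolution_integrable_grad[OF M u \<zeta>])
  show ?thesis
  proof (rule quadratic_GDERIV)
    fix h
    let ?z = "a + s *\<^sub>R x"
    have inth: "integrable M (\<lambda>y. (s *\<^sub>R h) \<bullet> (u y *\<^sub>R grad \<zeta> (?z - y)))"
      using intg by (intro integrable_inner_right)
    have "h \<bullet> (s *\<^sub>R (\<integral>y. u y *\<^sub>R grad \<zeta> (?z - y) \<partial>M)) = (\<integral>y. (s *\<^sub>R h) \<bullet> (u y *\<^sub>R grad \<zeta> (?z - y)) \<partial>M)"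
      using intg by (subst integral_inner_right) auto
    then have "(\<integral>y. \<zeta> (a + s *\<^sub>R (x + h) - y) * u y \<partial>M) - (\<integral>y. \<zeta> (?z - y) * u y \<partial>M)
        - h \<bullet> (s *\<^sub>R (\<integral>y. u y *\<^sub>R grad \<zeta> (?z - y) \<partial>M))
      = (\<integral>y. \<zeta> (a + s *\<^sub>R (x + h) - y) * u y - \<zeta> (?z - y) * u y - (s *\<^sub>R h) \<bullet> (u y *\<^sub>R grad \<zeta> (?z - y)) \<partial>M)"
      using int inth by (simp del: inner_scaleR_left inner_scaleR_right)
    moreover have "\<bar>\<dots>\<bar> \<le> (\<integral>y. (K * (norm (s *\<^sub>R h))\<^sup>2) * \<bar>u y\<bar> \<partial>M)"
    proof -
      have "norm (\<integral>y. \<zeta> (a + s *\<^sub>R (x + h) - y) * u y - \<zeta> (?z - y) * u y - (s *\<^sub>R h) \<bullet> (u y *\<^sub>R grad \<zeta> (?z - y)) \<partial>M)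
        \<le> (\<integral>y. (K * (norm (s *\<^sub>R h))\<^sup>2) * \<bar>u y\<bar> \<partial>M)"
      proof (rule Bochner_Integration.integral_norm_bound_integral)
        show "integrable M (\<lambda>y. \<zeta> (a + s *\<^sub>R (x + h) - y) * u y - \<zeta> (?z - y) * u y - (s *\<^sub>R h) \<bullet> (u y *\<^sub>R grad \<zeta> (?z - y)))"
          by (intro Bochner_Integration.integrable_diff int inth)
        show "integrable M (\<lambda>y. (K * (norm (s *\<^sub>R h))\<^sup>2) * \<bar>u y\<bar>)" using u by auto
        fix y
        have eq: "a + s *\<^sub>R (x + h) - y = (?z - y) + s *\<^sub>R h" by (simp add: algebra_simps)
        have "\<zeta> (a + s *\<^sub>R (x + h) - y) * u y - \<zeta> (?z - y) * u y - (s *\<^sub>R h) \<bullet> (u y *\<^sub>R grad \<zeta> (?z - y))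
          = (\<zeta> ((?z - y) + s *\<^sub>R h) - \<zeta> (?z - y) - (s *\<^sub>R h) \<bullet> grad \<zeta> (?z - y)) * u y"
          unfolding eq by (simp add: algebra_simps)
        also have "norm \<dots> = \<bar>\<zeta> ((?z - y) + s *\<^sub>R h) - \<zeta> (?z - y) - (s *\<^sub>R h) \<bullet> grad \<zeta> (?z - y)\<bar> * \<bar>u y\<bar>"
          by (simp add: abs_mult)
        also have "\<dots> \<le> (K * (norm (s *\<^sub>R h))\<^sup>2) * \<bar>u y\<bar>"
          by (rule mult_right_mono[OF K]) simp
        finally show "norm (\<zeta> (a + s *\<^sub>R (x + h) - y) * u y - \<zeta> (?z - y) * u y - (s *\<^sub>R h) \<bullet> (u y *\<^sub>R grad \<zeta> (?z - y)))
          \<le> (K * (norm (s *\<^sub>R h))\<^sup>2) * \<bar>u y\<bar>" .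
      qed
      then show ?thesis by simp
    qed
    moreover have "(\<integral>y. (K * (norm (s *\<^sub>R h))\<^sup>2) * \<bar>u y\<bar> \<partial>M) = (K * s\<^sup>2 * (\<integral>y. \<bar>u y\<bar> \<partial>M)) * (norm h)\<^sup>2"
      by (simp add: power_mult_distrib)
    ultimately show "\<bar>(\<integral>y. \<zeta> (a + s *\<^sub>R (x + h) - y) * u y \<partial>M) - (\<integral>y. \<zeta> (?z - y) * u y \<partial>M)
        - h \<bullet> (s *\<^sub>R (\<integral>y. u y *\<^sub>R grad \<zeta> (?z - y) \<partial>M))\<bar> \<le> (K * s\<^sup>2 * (\<integral>y. \<bar>u y\<bar> \<partial>M)) * (norm h)\<^sup>2"
      by linarith
  qed
qed

lemma convolution_smooth:
  fixes u :: "'a::euclidean_space \<Rightarrow> real"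
  assumes M: "(\<lambda>y. y) \<in> M \<rightarrow>\<^sub>M borel" and u: "integrable M u"
    and \<zeta>: "smooth \<zeta>" "\<And>x. norm x > R \<Longrightarrow> \<zeta> x = 0"
  shows "smooth (\<lambda>x. \<integral>y. \<zeta> (a + s *\<^sub>R x - y) * u y \<partial>M)"
proof -
  define S where "S = {f. \<exists>\<zeta>. smooth \<zeta> \<and> (\<forall>x. norm x > R \<longrightarrow> \<zeta> x = 0) \<and>
    f = (\<lambda>x::'a. \<integral>y. \<zeta> (a + s *\<^sub>R x - y) * u y \<partial>M)}"
  show ?thesis
  proof (rule smooth_coinduct[of _ S])
    show "(\<lambda>x. \<integral>y. \<zeta> (a + s *\<^sub>R x - y) * u y \<partial>M) \<in> S"
      unfolding S_def using \<zeta> by blast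
  next
    fix f x assume "f \<in> S"
    then show "f differentiable (at x)"
      unfolding S_def using convolution_GDERIV[OF M u] GDERIV_differentiable by blast
  next
    fix f and b :: 'a assume "f \<in> S" and b: "b \<in> Basis"
    then obtain \<zeta> where \<zeta>: "smooth \<zeta>" "\<And>x. norm x > R \<Longrightarrow> \<zeta> x = 0"
      and f: "f = (\<lambda>x. \<integral>y. \<zeta> (a + s *\<^sub>R x - y) * u y \<partial>M)" unfolding S_def by blast
    \<comment> \<open>The factor \<open>s\<close> of the chain rule is absorbed into the new kernel,
      so that the class stays closed. The form \<open>0 + 1 *\<^sub>R x\<close> is the one that
      \<open>smooth_affine\<close> matches.\<close>
    let ?\<xi> = "\<lambda>x. s * (\<lambda>w. grad \<zeta> w \<bullet> b) (0 + 1 *\<^sub>R x)"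
    have "smooth ?\<xi>" by (rule smooth_affine[OF smooth_partial[OF \<zeta>(1) b]])
    moreover have "grad \<zeta> x = 0" if "norm x > R" for x by (rule grad_bounded_support[OF \<zeta>(2) that])
    then have "\<forall>x. norm x > R \<longrightarrow> ?\<xi> x = 0" by simp
    moreover have "(\<lambda>x. grad f x \<bullet> b) = (\<lambda>x. \<integral>y. ?\<xi> (a + s *\<^sub>R x - y) * u y \<partial>M)"
    proof
      fix x
      have "grad f x = s *\<^sub>R (\<integral>y. u y *\<^sub>R grad \<zeta> (a + s *\<^sub>R x - y) \<partial>M)"
        unfolding f by (rule grad_eqI[OF convolution_GDERIV[OF M u \<zeta>]])
      then have "grad f x \<bullet> b = s * (\<integral>y. (u y *\<^sub>R grad \<zeta> (a + s *\<^sub>R x - y)) \<bullet> b \<partial>M)"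
        using convolution_integrable_grad[OF M u \<zeta>] by (subst integral_inner_left) auto
      also have "\<dots> = (\<integral>y. s * ((u y *\<^sub>R grad \<zeta> (a + s *\<^sub>R x - y)) \<bullet> b) \<partial>M)" by simp
      also have "\<dots> = (\<integral>y. ?\<xi> (a + s *\<^sub>R x - y) * u y \<partial>M)"
        by (rule Bochner_Integration.integral_cong) auto
      finally show "grad f x \<bullet> b = (\<integral>y. ?\<xi> (a + s *\<^sub>R x - y) * u y \<partial>M)" .
    qed
    ultimately show "(\<lambda>x. grad f x \<bullet> b) \<in> S" unfolding S_def by blast
  qed
qed

section \<open>Density of bounded continuous functions in L2\<close>

text \<open>Truncating \<open>u\<close> at a large height costs little. The truncation is an almost
  everywhere limit of continuous functions, and after a projection that bounds these, dominated
  convergence applies on the finite measure.\<close>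

lemma L2_continuous_dense:
  fixes u :: "'a::euclidean_space \<Rightarrow> 'b::euclidean_space"
  assumes S: "S \<in> lmeasurable" and u: "L2 (lebesgue_on S) u" and e: "e > 0"
  obtains f K where "continuous_on UNIV f" "\<And>x. norm (f x) \<le> K" "l2 (lebesgue_on S) (\<lambda>x. u x - f x) < e"
proof -
  let ?M = "lebesgue_on S"
  interpret finite_measure ?M using S by (rule finite_measure_lebesgue_on)
  note [measurable] = L2_measurable[OF u]
  have SL: "S \<in> sets lebesgue" using S by auto
  define w where "w = (\<lambda>m x. indicator {x. norm (u x) \<le> real m} x *\<^sub>R u x)"
  have wm[measurable]: "w m \<in> borel_measurable ?M" for m
  proof -
    have "(\<lambda>x. (if norm (u x) \<le> real m then u x else 0)) \<in> borel_measurable ?M" by measurable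
    moreover have "w m = (\<lambda>x. (if norm (u x) \<le> real m then u x else 0))"
      by (auto simp: w_def indicator_def)
    ultimately show ?thesis by simp
  qed
  have wb: "norm (w m x) \<le> real m" for m x by (auto simp: w_def indicator_def)
  have "(\<lambda>m. \<integral>x. (norm (u x - w m x))\<^sup>2 \<partial>?M) \<longlonglongrightarrow> (\<integral>x. 0 \<partial>?M)"
  proof (rule integral_dominated_convergence[where w = "\<lambda>x. (norm (u x))\<^sup>2"])
    show "integrable ?M (\<lambda>x. (norm (u x))\<^sup>2)" using u by (simp add: L2_def)
    show "AE x in ?M. (\<lambda>m. (norm (u x - w m x))\<^sup>2) \<longlonglongrightarrow> 0"
    proof (rule AE_I2)
      fix x
      obtain m where "norm (u x) \<le> real m" using real_arch_simple by blast
      then have "\<forall>k\<ge>m. (norm (u x - w k x))\<^sup>2 = 0" by (auto simp: w_def indicator_def)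
      then show "(\<lambda>m. (norm (u x - w m x))\<^sup>2) \<longlonglongrightarrow> 0"
        by (intro tendsto_eventually) (auto simp: eventually_sequentially)
    qed
    show "AE x in ?M. norm ((norm (u x - w m x))\<^sup>2) \<le> (norm (u x))\<^sup>2" for m
      by (auto simp: w_def indicator_def)
  qed measurable
  then have "(\<lambda>m. l2 ?M (\<lambda>x. u x - w m x)) \<longlonglongrightarrow> 0" unfolding l2_tendsto_0_iff by simp
  then have "\<forall>\<^sub>F m in sequentially. l2 ?M (\<lambda>x. u x - w m x) < e / 2"
    by (rule order_tendstoD) (use e in simp)
  then obtain m where m: "l2 ?M (\<lambda>x. u x - w m x) < e / 2"
    using eventually_happens'[OF sequentially_bot] by blast
  have "w m measurable_on S"
    using wm SL by (simp add: measurable_on_iff_borel_measurable)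
  then obtain N g where N: "negligible N" and g: "\<And>n. continuous_on UNIV (g n)"
    "\<And>x. x \<notin> N \<Longrightarrow> (\<lambda>n. g n x) \<longlonglongrightarrow> (if x \<in> S then w m x else 0)"
    unfolding measurable_on_def by blast
  \<comment> \<open>The nearest-point projection onto the ball of radius \<open>m\<close> is
    continuous, fixes the values of \<open>w m\<close>, and bounds the approximants
    uniformly.\<close>
  define P where "P = closest_point (cball (0::'b) (real m))"
  have Pc: "continuous_on UNIV P" unfolding P_def by (rule continuous_on_closest_point) auto
  have Pb: "norm (P y) \<le> real m" for y
    using closest_point_in_set[of "cball (0::'b) (real m)" y] by (simp add: P_def)
  have Pw: "P y = y" if "norm y \<le> real m" for y
    unfolding P_def using that by (intro closest_point_self) simp
  have cont: "continuous_on UNIV (\<lambda>x. P (g n x))" for n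
    using continuous_on_compose2[OF Pc g(1)] by simp
  have [measurable]: "(\<lambda>x. P (g n x)) \<in> borel_measurable ?M" for n
    by (rule continuous_borel_measurable_lebesgue_on[OF cont])
  have "(\<lambda>n. \<integral>x. (norm (w m x - P (g n x)))\<^sup>2 \<partial>?M) \<longlonglongrightarrow> (\<integral>x. 0 \<partial>?M)"
  proof (rule integral_dominated_convergence[where w = "\<lambda>x. (real m + real m)\<^sup>2"])
    show "integrable ?M (\<lambda>x. (real m + real m)\<^sup>2)" by simp
    have "AE x in lebesgue. x \<notin> N" using N by (simp add: AE_not_in negligible_iff_null_sets)
    then have "AE x in ?M. x \<notin> N" using AE_restrict_space_iff SL by (auto simp: AE_restrict_space_iff elim: eventually_mono)
    then show "AE x in ?M. (\<lambda>n. (norm (w m x - P (g n x)))\<^sup>2) \<longlonglongrightarrow> 0"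
      using AE_space
    proof eventually_elim
      fix x assume "x \<notin> N" "x \<in> space ?M"
      then have "(\<lambda>n. g n x) \<longlonglongrightarrow> w m x" using g(2)[of x] by (simp add: space_restrict_space)
      moreover have "isCont P (w m x)" using Pc by (simp add: continuous_on_eq_continuous_at)
      ultimately have "(\<lambda>n. P (g n x)) \<longlonglongrightarrow> P (w m x)" by (rule isCont_tendsto_compose[rotated])
      then have "(\<lambda>n. P (g n x)) \<longlonglongrightarrow> w m x" using Pw[OF wb] by simp
      then have "(\<lambda>n. (norm (w m x - P (g n x)))\<^sup>2) \<longlonglongrightarrow> (norm (w m x - w m x))\<^sup>2"
        by (intro tendsto_intros)
      then show "(\<lambda>n. (norm (w m x - P (g n x)))\<^sup>2) \<longlonglongrightarrow> 0" by simp
    qed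
    show "AE x in ?M. norm ((norm (w m x - P (g n x)))\<^sup>2) \<le> (real m + real m)\<^sup>2" for n
    proof (rule AE_I2)
      fix x
      have "norm (w m x - P (g n x)) \<le> real m + real m"
        using norm_triangle_ineq4[of "w m x" "P (g n x)"] wb[of m x] Pb[of "g n x"] by linarith
      then have "(norm (w m x - P (g n x)))\<^sup>2 \<le> (real m + real m)\<^sup>2"
        by (rule power_mono) simp
      then show "norm ((norm (w m x - P (g n x)))\<^sup>2) \<le> (real m + real m)\<^sup>2"
        by (subst real_norm_def, subst abs_of_nonneg) auto
    qed
  qed measurable
  then have "(\<lambda>n. l2 ?M (\<lambda>x. w m x - P (g n x))) \<longlonglongrightarrow> 0" unfolding l2_tendsto_0_iff by simp
  then have "\<forall>\<^sub>F n in sequentially. l2 ?M (\<lambda>x. w m x - P (g n x)) < e / 2"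
    by (rule order_tendstoD) (use e in simp)
  then obtain n where n: "l2 ?M (\<lambda>x. w m x - P (g n x)) < e / 2"
    using eventually_happens'[OF sequentially_bot] by blast
  have "L2 ?M (w m)" "L2 ?M (\<lambda>x. P (g n x))"
    by (rule L2_bounded[where K = "real m"]; use wb Pb in auto)+
  from l2_triangle_diff[OF u this] m n have "l2 ?M (\<lambda>x. u x - P (g n x)) < e" by linarith
  with cont Pb show ?thesis by (rule that)
qed

lemma nn_integral_lebesgue_on:
  fixes f :: "'a::euclidean_space \<Rightarrow> ennreal"
  assumes "S \<in> sets lebesgue"
  shows "(\<integral>\<^sup>+x. f x \<partial>lebesgue_on S) = (\<integral>\<^sup>+x. f x * indicator S x \<partial>lborel)"
  using assms by (simp add: nn_integral_restrict_space nn_integral_completion)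

lemma id_measurable_lebesgue_on: "(\<lambda>y. y) \<in> lebesgue_on S \<rightarrow>\<^sub>M borel"
  by (rule borel_measurable_lebesgue_on) simp

section \<open>Averaging on the ball after a contraction\<close>

locale mollifier =
  fixes c :: "'a::euclidean_space" and r :: real and \<eta> :: "'a \<Rightarrow> real"
  assumes r: "0 < r" and \<eta>_smooth: "smooth \<eta>" and \<eta>_nonneg: "\<And>x. 0 \<le> \<eta> x"
    and \<eta>_support: "\<And>x. 1 \<le> norm x \<Longrightarrow> \<eta> x = 0"
    and \<eta>_integrable: "integrable lborel \<eta>" and \<eta>_integral: "(\<integral>x. \<eta> x \<partial>lborel) = 1"
begin

abbreviation "M \<equiv> lebesgue_on (ball c r)"

sublocale finite_measure M by (rule finite_measure_lebesgue_ball)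

text \<open>The contraction leaves a margin \<open>shrink n * r\<close> to the sphere, and the
  averaging radius uses half of it, so even the closed support of the kernel lies in the open ball.
  Starting from 1/2 keeps the Jacobian of the contraction above \<open>1 / 2 ^ N\<close>.\<close>

definition shrink :: "nat \<Rightarrow> real" where "shrink n = 1 / (real n + 2)"
definition width :: "nat \<Rightarrow> real" where "width n = shrink n * r / 2"
definition kernel :: "nat \<Rightarrow> 'a \<Rightarrow> real" where
  "kernel n z = 1 / width n ^ DIM('a) * \<eta> (0 + (1 / width n) *\<^sub>R z)"
definition contract :: "nat \<Rightarrow> 'a \<Rightarrow> 'a" where
  "contract n x = shrink n *\<^sub>R c + (1 - shrink n) *\<^sub>R x"

text \<open>Shrinking towards the centre before averaging keeps the support of the averaging kernel
  inside the ball, so that no extension across the boundary is needed.\<close>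

definition mollify :: "nat \<Rightarrow> ('a \<Rightarrow> 'b::euclidean_space) \<Rightarrow> 'a \<Rightarrow> 'b" where
  "mollify n u x = (\<integral>y. kernel n (contract n x - y) *\<^sub>R u y \<partial>M)"

lemma shrink: "0 < shrink n" "shrink n \<le> 1 / 2"
  by (auto simp: shrink_def field_simps)

lemma shrink_tendsto: "shrink \<longlonglongrightarrow> 0"
proof -
  have "(\<lambda>n. 1 / real (n + 2)) \<longlonglongrightarrow> 0" by (rule LIMSEQ_ignore_initial_segment[OF lim_1_over_n])
  then show ?thesis by (simp add: shrink_def[abs_def] add.commute)
qed

lemma width: "0 < width n"
  using shrink r by (simp add: width_def)

lemma kernel_nonneg: "0 \<le> kernel n z"
  using width[of n] \<eta>_nonneg by (simp add: kernel_def)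

lemma kernel_support: "width n \<le> norm z \<Longrightarrow> kernel n z = 0"
  using width[of n] \<eta>_support[of "(1 / width n) *\<^sub>R z"] by (simp add: kernel_def field_simps)

lemma kernel_smooth: "smooth (kernel n)"
  unfolding kernel_def by (rule smooth_affine[OF \<eta>_smooth])

lemma kernel_support': "norm z > width n \<Longrightarrow> kernel n z = 0"
  by (rule kernel_support) simp

lemma kernel_measurable [measurable]: "kernel n \<in> borel_measurable borel"
  by (rule borel_measurable_continuous_onI[OF smooth_continuous[OF kernel_smooth]])

lemma contract_measurable [measurable]: "contract n \<in> borel_measurable borel"
  unfolding contract_def by measurable

text \<open>The contraction moves \<open>x\<close> by at most \<open>shrink n * r\<close> and the
  kernel reaches half of that further; the distance bound is this 3/2 rounded up to 2.\<close>

lemma kernel_nonzeroD: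
  assumes x: "x \<in> cball c r" and nz: "kernel n (contract n x - y) \<noteq> 0"
  shows "y \<in> ball c r" "dist x y \<le> 2 * shrink n * r"
proof -
  have 1: "norm (contract n x - y) < width n"
    using nz kernel_support by (metis not_le)
  have "contract n x - c = (1 - shrink n) *\<^sub>R (x - c)" by (simp add: contract_def algebra_simps)
  then have "norm (contract n x - c) = (1 - shrink n) * norm (x - c)"
    using shrink[of n] by simp
  also have "\<dots> \<le> (1 - shrink n) * r"
    using x shrink[of n] by (intro mult_left_mono) (auto simp: dist_norm norm_minus_commute)
  finally have 2: "norm (contract n x - c) \<le> (1 - shrink n) * r" .
  have "norm (c - y) \<le> norm (c - contract n x) + norm (contract n x - y)"
    by (metis norm_triangle_ineq diff_add_cancel add_diff_eq)
  also have "\<dots> < (1 - shrink n) * r + shrink n * r / 2"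
    using 1 2 by (simp add: width_def norm_minus_commute)
  also have "\<dots> \<le> r" using shrink[of n] r by (simp add: algebra_simps)
  finally show "y \<in> ball c r" by (simp add: dist_norm)
  have "x - contract n x = shrink n *\<^sub>R (x - c)" by (simp add: contract_def algebra_simps)
  then have "norm (x - contract n x) = shrink n * norm (x - c)" using shrink[of n] by simp
  also have "\<dots> \<le> shrink n * r"
    using x shrink[of n] by (intro mult_left_mono) (auto simp: dist_norm norm_minus_commute)
  finally have 3: "norm (x - contract n x) \<le> shrink n * r" .
  have "norm (x - y) \<le> norm (x - contract n x) + norm (contract n x - y)"
    by (metis norm_triangle_ineq diff_add_cancel add_diff_eq)
  also have "\<dots> \<le> shrink n * r + shrink n * r / 2" using 1 3 by (simp add: width_def algebra_simps)
  also have "\<dots> \<le> 2 * shrink n * r" using shrink[of n] r by simp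
  finally show "dist x y \<le> 2 * shrink n * r" by (simp add: dist_norm)
qed

lemma nn_integral_\<eta>: "(\<integral>\<^sup>+x. ennreal (\<eta> x) \<partial>lborel) = 1"
  using nn_integral_eq_integral[OF \<eta>_integrable] \<eta>_nonneg \<eta>_integral by simp

lemma \<eta>_measurable [measurable]: "\<eta> \<in> borel_measurable borel"
  using borel_measurable_integrable[OF \<eta>_integrable] by simp

lemma nn_integral_kernel_affine:
  assumes "k \<noteq> 0"
  shows "(\<integral>\<^sup>+x. ennreal (kernel n (t + k *\<^sub>R x)) \<partial>lborel) = ennreal (1 / \<bar>k\<bar> ^ DIM('a))"
proof -
  let ?w = "width n"
  have w: "?w > 0" by (rule width)
  have "(\<integral>\<^sup>+x. ennreal (kernel n (t + k *\<^sub>R x)) \<partial>lborel)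
    = (\<integral>\<^sup>+x. ennreal (1 / ?w ^ DIM('a)) * ennreal (\<eta> ((1 / ?w) *\<^sub>R t + (k / ?w) *\<^sub>R x)) \<partial>lborel)"
    using w by (intro nn_integral_cong, subst ennreal_mult[symmetric])
      (auto simp: kernel_def scaleR_add_right \<eta>_nonneg)
  also have "\<dots> = ennreal (1 / ?w ^ DIM('a)) * (\<integral>\<^sup>+x. ennreal (\<eta> ((1 / ?w) *\<^sub>R t + (k / ?w) *\<^sub>R x)) \<partial>lborel)"
    by (rule nn_integral_cmult) measurable
  also have "(\<integral>\<^sup>+x. ennreal (\<eta> ((1 / ?w) *\<^sub>R t + (k / ?w) *\<^sub>R x)) \<partial>lborel) = ennreal (1 / \<bar>k / ?w\<bar> ^ DIM('a))"
    using assms w by (subst nn_integral_lborel_affine[of "\<lambda>x. ennreal (\<eta> x)"]) (auto simp: nn_integral_\<eta>)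
  also have "ennreal (1 / ?w ^ DIM('a)) * \<dots> = ennreal (1 / \<bar>k\<bar> ^ DIM('a))"
    using w by (subst ennreal_mult[symmetric]) (auto simp: power_divide)
  finally show ?thesis .
qed

text \<open>Restricting the integration to the ball loses nothing, because the kernel centred at the
  contracted point vanishes outside it. This holds for \<open>x\<close> on the sphere as well, which
  the traces need.\<close>

lemma nn_integral_kernel:
  assumes x: "x \<in> cball c r"
  shows "(\<integral>\<^sup>+y. ennreal (kernel n (contract n x - y)) \<partial>M) = 1"
proof -
  have "(\<integral>\<^sup>+y. ennreal (kernel n (contract n x - y)) \<partial>M)
    = (\<integral>\<^sup>+y. ennreal (kernel n (contract n x - y)) * indicator (ball c r) y \<partial>lborel)"
    by (rule nn_integral_lebesgue_on) auto
  also have "\<dots> = (\<integral>\<^sup>+y. ennreal (kernel n (contract n x + (-1) *\<^sub>R y)) \<partial>lborel)"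
  proof (rule nn_integral_cong)
    fix y
    show "ennreal (kernel n (contract n x - y)) * indicator (ball c r) y = ennreal (kernel n (contract n x + (-1) *\<^sub>R y))"
    proof (cases "y \<in> ball c r")
      case False
      then have "kernel n (contract n x - y) = 0" using kernel_nonzeroD(1)[OF x] by blast
      then show ?thesis by simp
    qed simp
  qed
  also have "\<dots> = 1" by (subst nn_integral_kernel_affine) auto
  finally show ?thesis .
qed

lemma kernel_integrable:
  assumes x: "x \<in> cball c r"
  shows "integrable M (\<lambda>y. kernel n (contract n x - y))" "(\<integral>y. kernel n (contract n x - y) \<partial>M) = 1"
proof -
  have m: "(\<lambda>y. kernel n (contract n x - y)) \<in> borel_measurable M"
    by (rule borel_measurable_lebesgue_on) measurable
  show "integrable M (\<lambda>y. kernel n (contract n x - y))"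
    by (rule integrableI_nonneg) (use m kernel_nonneg nn_integral_kernel[OF x] in auto)
  show "(\<integral>y. kernel n (contract n x - y) \<partial>M) = 1"
    by (subst integral_eq_nn_integral) (use m kernel_nonneg nn_integral_kernel[OF x] in auto)
qed

text \<open>Substituting the contraction in \<open>x\<close> costs the inverse Jacobian, at most
  \<open>2 ^ N\<close>. Together with \<open>nn_integral_kernel\<close> these are the two marginal
  bounds of a Schur test.\<close>

lemma nn_integral_kernel_left:
  "(\<integral>\<^sup>+x. ennreal (kernel n (contract n x - y)) \<partial>M) \<le> ennreal (2 ^ DIM('a))"
proof -
  let ?k = "1 - shrink n"
  have k: "1/2 \<le> ?k" using shrink[of n] by simp
  have "(\<integral>\<^sup>+x. ennreal (kernel n (contract n x - y)) \<partial>M)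
    \<le> (\<integral>\<^sup>+x. ennreal (kernel n ((shrink n *\<^sub>R c - y) + ?k *\<^sub>R x)) \<partial>lborel)"
    by (subst nn_integral_lebesgue_on) (auto intro!: nn_integral_mono simp: indicator_def contract_def algebra_simps)
  also have "\<dots> = ennreal (1 / \<bar>?k\<bar> ^ DIM('a))"
    using k by (intro nn_integral_kernel_affine) auto
  also have "\<dots> \<le> ennreal (2 ^ DIM('a))"
  proof (rule ennreal_leI)
    have "(1/2) ^ DIM('a) \<le> \<bar>?k\<bar> ^ DIM('a)" using k by (intro power_mono) auto
    then show "1 / \<bar>?k\<bar> ^ DIM('a) \<le> 2 ^ DIM('a)"
      using k by (simp add: field_simps power_one_over)
  qed
  finally show ?thesis .
qed

lemma mollify_integrable:
  fixes u :: "'a \<Rightarrow> 'b::euclidean_space"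
  assumes "integrable M u"
  shows "integrable M (\<lambda>y. kernel n (z - y) *\<^sub>R u y)"
  by (rule convolution_integrable[OF id_measurable_lebesgue_on assms smooth_continuous[OF kernel_smooth] kernel_support'])

lemma mollify_eq: "mollify n u = (\<lambda>x. \<integral>y. kernel n (shrink n *\<^sub>R c + (1 - shrink n) *\<^sub>R x - y) * u y \<partial>M)"
  by (simp add: mollify_def contract_def fun_eq_iff)

lemma mollify_smooth:
  fixes u :: "'a \<Rightarrow> real"
  assumes "integrable M u"
  shows "smooth (mollify n u)"
  unfolding mollify_eq
  by (rule convolution_smooth[OF id_measurable_lebesgue_on assms kernel_smooth kernel_support'])

text \<open>Makes the averaging kernel admissible in the definition of the weak gradient. The strict
  margin of the contraction is what turns the support into a compact subset of the open
  ball.\<close>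

lemma kernel_test_function:
  assumes x: "x \<in> ball c r"
  shows "test_function (ball c r) (\<lambda>y. kernel n (contract n x - y))"
    and "grad (\<lambda>y. kernel n (contract n x - y)) y = - grad (kernel n) (contract n x - y)"
proof -
  have eq: "(\<lambda>y. kernel n (contract n x - y)) = (\<lambda>y. 1 * kernel n (contract n x + (-1) *\<^sub>R y))" by simp
  have "closure {y. kernel n (contract n x - y) \<noteq> 0} \<subseteq> cball (contract n x) (width n)"
    using kernel_support[of n] by (intro closure_minimal) (auto simp: dist_norm not_le, metis le_less_linear less_imp_le)
  moreover have "cball (contract n x) (width n) \<subseteq> ball c r"
  proof
    fix y assume "y \<in> cball (contract n x) (width n)"
    then have 1: "norm (contract n x - y) \<le> shrink n * r / 2" by (simp add: dist_norm width_def)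
    have "contract n x - c = (1 - shrink n) *\<^sub>R (x - c)" by (simp add: contract_def algebra_simps)
    then have "norm (contract n x - c) = (1 - shrink n) * norm (x - c)"
      using shrink[of n] by simp
    also have "\<dots> \<le> (1 - shrink n) * r"
      using x shrink[of n] by (intro mult_left_mono) (auto simp: dist_norm norm_minus_commute)
    finally have 2: "norm (contract n x - c) \<le> (1 - shrink n) * r" .
    have "norm (c - y) \<le> norm (c - contract n x) + norm (contract n x - y)"
      by (metis norm_triangle_ineq diff_add_cancel add_diff_eq)
    also have "\<dots> \<le> (1 - shrink n) * r + shrink n * r / 2"
      using 1 2 by (simp add: norm_minus_commute)
    also have "\<dots> < r" using shrink[of n] r by (simp add: algebra_simps)
    finally show "y \<in> ball c r" by (simp add: dist_norm)
  qed
  ultimately have cl: "closure {y. kernel n (contract n x - y) \<noteq> 0} \<subseteq> cball (contract n x) (width n)"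
    "closure {y. kernel n (contract n x - y) \<noteq> 0} \<subseteq> ball c r" by auto
  show "test_function (ball c r) (\<lambda>y. kernel n (contract n x - y))"
    unfolding test_function_def
  proof (intro conjI)
    show "smooth (\<lambda>y. kernel n (contract n x - y))"
      unfolding eq by (rule smooth_affine[OF kernel_smooth])
    show "compact (closure {y. kernel n (contract n x - y) \<noteq> 0})"
      using cl(1) bounded_subset[OF bounded_cball] by (simp add: compact_eq_bounded_closed)
  qed fact
  show "grad (\<lambda>y. kernel n (contract n x - y)) y = - grad (kernel n) (contract n x - y)"
    unfolding eq by (subst grad_affine[OF kernel_smooth]) simp
qed

text \<open>Two minus signs cancel: the one from the reflected variable \<open>y\<close> in the
  kernel and the one from the weak gradient. The factor \<open>1 - shrink n\<close> is the chain
  rule for the contraction and tends to 1.\<close>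

lemma mollify_grad:
  assumes u: "integrable M u" and G: "is_weak_grad (ball c r) u G" and x: "x \<in> ball c r"
  shows "grad (mollify n u) x = (1 - shrink n) *\<^sub>R mollify n G x"
proof -
  let ?\<phi> = "\<lambda>y. kernel n (contract n x - y)"
  have "(\<integral>y. u y *\<^sub>R grad ?\<phi> y \<partial>M) = - (\<integral>y. ?\<phi> y *\<^sub>R G y \<partial>M)"
    using G kernel_test_function(1)[OF x] unfolding is_weak_grad_def by blast
  then have "(\<integral>y. u y *\<^sub>R grad (kernel n) (contract n x - y) \<partial>M) = mollify n G x"
    by (simp add: kernel_test_function(2)[OF x] mollify_def)
  then show ?thesis
    using grad_eqI[OF convolution_GDERIV[OF id_measurable_lebesgue_on u kernel_smooth kernel_support',
      where a = "shrink n *\<^sub>R c" and s = "1 - shrink n" and x = x]]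
    by (simp add: mollify_eq contract_def)
qed

lemma mollify_measurable:
  fixes u :: "'a \<Rightarrow> 'b::euclidean_space"
  assumes [measurable]: "u \<in> borel_measurable M"
  shows "mollify n u \<in> borel_measurable M"
proof -
  have id[measurable]: "(\<lambda>y. y) \<in> M \<rightarrow>\<^sub>M borel" by (rule id_measurable_lebesgue_on)
  have [measurable]: "fst \<in> M \<Otimes>\<^sub>M M \<rightarrow>\<^sub>M borel" "snd \<in> M \<Otimes>\<^sub>M M \<rightarrow>\<^sub>M borel"
    using measurable_compose[OF measurable_fst id] measurable_compose[OF measurable_snd id] by simp_all
  have "(\<lambda>z. kernel n (contract n (fst z) - snd z) *\<^sub>R u (snd z)) \<in> borel_measurable (M \<Otimes>\<^sub>M M)"
    by measurable
  then show ?thesis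
    unfolding mollify_def[abs_def]
    by (intro borel_measurable_lebesgue_integral) (simp add: case_prod_beta')
qed

text \<open>Schur's test. The kernel is split as a product of two square roots, Cauchy-Schwarz uses
  that its \<open>y\<close>-integral is 1, and Fubini leaves the \<open>x\<close>-integral, which is
  at most \<open>2 ^ N\<close> for every \<open>n\<close>.\<close>

lemma mollify_L2:
  fixes u :: "'a \<Rightarrow> 'b::euclidean_space"
  assumes u: "L2 M u"
  shows "L2 M (mollify n u)" "l2 M (mollify n u) \<le> sqrt (2 ^ DIM('a)) * l2 M u"
proof -
  note [measurable] = L2_measurable[OF u] id_measurable_lebesgue_on[of "ball c r"]
  have [measurable]: "fst \<in> M \<Otimes>\<^sub>M M \<rightarrow>\<^sub>M borel" "snd \<in> M \<Otimes>\<^sub>M M \<rightarrow>\<^sub>M borel"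
    using measurable_compose[OF measurable_fst id_measurable_lebesgue_on[of "ball c r"]]
      measurable_compose[OF measurable_snd id_measurable_lebesgue_on[of "ball c r"]] by simp_all
  have ui: "integrable M u" by (rule L2_integrable[OF u])
  have Tm[measurable]: "mollify n u \<in> borel_measurable M" by (rule mollify_measurable) measurable
  have pt: "ennreal ((norm (mollify n u x))\<^sup>2) \<le> (\<integral>\<^sup>+y. ennreal (kernel n (contract n x - y)) * ennreal ((norm (u y))\<^sup>2) \<partial>M)"
    if x: "x \<in> space M" for x
  proof -
    let ?k = "\<lambda>y. kernel n (contract n x - y)"
    have xc: "x \<in> cball c r" using x by (auto simp: space_restrict_space)
    have km[measurable]: "?k \<in> borel_measurable M"
      by (rule borel_measurable_lebesgue_on) measurable
    have "ennreal (norm (mollify n u x)) \<le> (\<integral>\<^sup>+y. ennreal (norm (?k y *\<^sub>R u y)) \<partial>M)"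
      unfolding mollify_def by (rule integral_norm_bound_ennreal[OF mollify_integrable[OF ui]])
    also have "\<dots> = (\<integral>\<^sup>+y. ennreal (sqrt (?k y)) * ennreal (sqrt (?k y) * norm (u y)) \<partial>M)"
      using kernel_nonneg by (intro nn_integral_cong, subst ennreal_mult[symmetric])
        (auto simp: mult.assoc[symmetric])
    finally have "(ennreal (norm (mollify n u x)))\<^sup>2 \<le> (\<integral>\<^sup>+y. ennreal (sqrt (?k y)) * ennreal (sqrt (?k y) * norm (u y)) \<partial>M)\<^sup>2"
      by (rule power_mono) simp
    also have "\<dots> \<le> (\<integral>\<^sup>+y. (ennreal (sqrt (?k y)))\<^sup>2 \<partial>M) * (\<integral>\<^sup>+y. (ennreal (sqrt (?k y) * norm (u y)))\<^sup>2 \<partial>M)"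
      by (rule Cauchy_Schwarz_nn_integral) measurable
    also have "(\<integral>\<^sup>+y. (ennreal (sqrt (?k y)))\<^sup>2 \<partial>M) = 1"
      using nn_integral_kernel[OF xc] kernel_nonneg by (simp add: ennreal_power)
    also have "(\<integral>\<^sup>+y. (ennreal (sqrt (?k y) * norm (u y)))\<^sup>2 \<partial>M) = (\<integral>\<^sup>+y. ennreal (?k y) * ennreal ((norm (u y))\<^sup>2) \<partial>M)"
      using kernel_nonneg
      by (intro nn_integral_cong, subst ennreal_mult[symmetric]) (auto simp: ennreal_power power_mult_distrib)
    finally show ?thesis by (simp add: ennreal_power)
  qed
  interpret P: pair_sigma_finite M M ..
  have "(\<integral>\<^sup>+x. ennreal ((norm (mollify n u x))\<^sup>2) \<partial>M)
    \<le> (\<integral>\<^sup>+x. (\<integral>\<^sup>+y. ennreal (kernel n (contract n x - y)) * ennreal ((norm (u y))\<^sup>2) \<partial>M) \<partial>M)"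
    by (rule nn_integral_mono) (rule pt)
  also have "\<dots> = (\<integral>\<^sup>+y. (\<integral>\<^sup>+x. ennreal (kernel n (contract n x - y)) * ennreal ((norm (u y))\<^sup>2) \<partial>M) \<partial>M)"
    by (rule P.Fubini'[symmetric]) measurable
  also have "\<dots> = (\<integral>\<^sup>+y. (\<integral>\<^sup>+x. ennreal (kernel n (contract n x - y)) \<partial>M) * ennreal ((norm (u y))\<^sup>2) \<partial>M)"
    by (intro nn_integral_cong nn_integral_multc) (rule measurable_compose[OF borel_measurable_lebesgue_on]; measurable)
  also have "\<dots> \<le> (\<integral>\<^sup>+y. ennreal (2 ^ DIM('a)) * ennreal ((norm (u y))\<^sup>2) \<partial>M)"
    by (intro nn_integral_mono mult_right_mono nn_integral_kernel_left) auto
  also have "\<dots> = ennreal (2 ^ DIM('a)) * (\<integral>\<^sup>+y. ennreal ((norm (u y))\<^sup>2) \<partial>M)"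
    by (rule nn_integral_cmult) measurable
  also have "(\<integral>\<^sup>+y. ennreal ((norm (u y))\<^sup>2) \<partial>M) = ennreal ((l2 M u)\<^sup>2)"
    unfolding l2_power2 by (rule nn_integral_eq_integral[OF L2_integrable_sq[OF u]]) simp
  finally have main: "(\<integral>\<^sup>+x. ennreal ((norm (mollify n u x))\<^sup>2) \<partial>M) \<le> ennreal (2 ^ DIM('a) * (l2 M u)\<^sup>2)"
    by (simp add: ennreal_mult)
  have int: "integrable M (\<lambda>x. (norm (mollify n u x))\<^sup>2)"
    by (rule integrableI_nonneg) (use main in \<open>auto simp: top_unique less_top intro: le_less_trans\<close>)
  then show "L2 M (mollify n u)" unfolding L2_def using Tm by auto
  have "ennreal ((l2 M (mollify n u))\<^sup>2) \<le> ennreal (2 ^ DIM('a) * (l2 M u)\<^sup>2)"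
    using main nn_integral_eq_integral[OF int] by (simp add: l2_power2)
  then have "(l2 M (mollify n u))\<^sup>2 \<le> 2 ^ DIM('a) * (l2 M u)\<^sup>2" by simp
  also have "\<dots> = (sqrt (2 ^ DIM('a)) * l2 M u)\<^sup>2" by (simp add: power_mult_distrib)
  finally show "l2 M (mollify n u) \<le> sqrt (2 ^ DIM('a)) * l2 M u"
    by (rule power2_le_imp_le) simp
qed

lemma mollify_bounded:
  fixes f :: "'a \<Rightarrow> 'b::euclidean_space"
  assumes f: "f \<in> borel_measurable M" "\<And>y. y \<in> ball c r \<Longrightarrow> norm (f y) \<le> K" and x: "x \<in> cball c r"
  shows "norm (mollify n f x) \<le> K"
proof -
  have fi: "integrable M f"
    by (rule integrable_const_bound[where B = K]) (use f in \<open>auto intro!: AE_I2 simp: space_restrict_space\<close>)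
  have "norm (mollify n f x) \<le> (\<integral>y. kernel n (contract n x - y) * K \<partial>M)"
    unfolding mollify_def
  proof (rule Bochner_Integration.integral_norm_bound_integral)
    show "integrable M (\<lambda>y. kernel n (contract n x - y) *\<^sub>R f y)" by (rule mollify_integrable[OF fi])
    show "integrable M (\<lambda>y. kernel n (contract n x - y) * K)" using kernel_integrable[OF x] by simp
    fix y assume "y \<in> space M"
    then show "norm (kernel n (contract n x - y) *\<^sub>R f y) \<le> kernel n (contract n x - y) * K"
      using f(2)[of y] kernel_nonneg by (auto simp: space_restrict_space intro!: mult_left_mono)
  qed
  then show ?thesis using kernel_integrable[OF x] by simp
qed

text \<open>The kernel is a probability density concentrating at \<open>x\<close>. Points of the
  sphere are included so that restrictions to the boundary converge too.\<close>

lemma mollify_pointwise: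
  fixes f :: "'a \<Rightarrow> 'b::euclidean_space"
  assumes f: "continuous_on UNIV f" and x: "x \<in> cball c r"
  shows "(\<lambda>n. mollify n f x) \<longlonglongrightarrow> f x"
proof (rule LIMSEQ_I)
  fix e :: real assume e: "e > 0"
  have "isCont f x" using f by (simp add: continuous_on_eq_continuous_at)
  then obtain d where d: "d > 0" "\<And>y. dist y x < d \<Longrightarrow> dist (f y) (f x) < e / 2"
    unfolding continuous_at_eps_delta using e by (metis half_gt_zero)
  have "(\<lambda>n. 2 * shrink n * r) \<longlonglongrightarrow> 2 * 0 * r" by (intro tendsto_intros shrink_tendsto)
  then have "\<forall>\<^sub>F n in sequentially. 2 * shrink n * r < d"
    by (rule order_tendstoD) (use d in simp)
  then obtain n0 where n0: "\<And>n. n \<ge> n0 \<Longrightarrow> 2 * shrink n * r < d"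
    unfolding eventually_sequentially by blast
  have fm: "f \<in> borel_measurable M" by (rule continuous_borel_measurable_lebesgue_on[OF f])
  have "bounded (f ` cball c r)"
    by (intro compact_imp_bounded compact_continuous_image continuous_on_subset[OF f]) auto
  then obtain K where "\<forall>y\<in>f ` cball c r. norm y \<le> K" unfolding bounded_iff by blast
  then have K: "norm (f y) \<le> K" if "y \<in> cball c r" for y using that by blast
  have fi: "integrable M f"
    by (rule integrable_const_bound[where B = K]) (use fm K in \<open>auto intro!: AE_I2 simp: space_restrict_space\<close>)
  show "\<exists>no. \<forall>n\<ge>no. norm (mollify n f x - f x) < e"
  proof (intro exI allI impI)
    fix n assume n: "n0 \<le> n"
    let ?k = "\<lambda>y. kernel n (contract n x - y)"
    note k = kernel_integrable[OF x, of n]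
    have "mollify n f x - f x = (\<integral>y. ?k y *\<^sub>R f y - ?k y *\<^sub>R f x \<partial>M)"
      using k mollify_integrable[OF fi] by (simp add: mollify_def)
    also have "norm \<dots> \<le> (\<integral>y. ?k y * (e / 2) \<partial>M)"
    proof (rule Bochner_Integration.integral_norm_bound_integral)
      show "integrable M (\<lambda>y. ?k y *\<^sub>R f y - ?k y *\<^sub>R f x)"
        using k mollify_integrable[OF fi] by auto
      show "integrable M (\<lambda>y. ?k y * (e / 2))" using k by simp
      fix y
      show "norm (?k y *\<^sub>R f y - ?k y *\<^sub>R f x) \<le> ?k y * (e / 2)"
      proof (cases "?k y = 0")
        case False
        from kernel_nonzeroD(2)[OF x False] n0[OF n] have "dist y x < d"
          by (simp add: dist_commute)
        from d(2)[OF this] have "norm (f y - f x) \<le> e / 2" by (simp add: dist_norm)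
        then have "?k y * norm (f y - f x) \<le> ?k y * (e / 2)"
          by (rule mult_left_mono) (rule kernel_nonneg)
        then show ?thesis using kernel_nonneg
          by (simp flip: scaleR_diff_right)
      qed simp
    qed
    also have "\<dots> = e / 2" using k by simp
    finally show "norm (mollify n f x - f x) < e" using e by linarith
  qed
qed

lemma mollify_diff:
  fixes u f :: "'a \<Rightarrow> 'b::euclidean_space"
  assumes "integrable M u" "integrable M f"
  shows "mollify n (\<lambda>y. u y - f y) x = mollify n u x - mollify n f x"
  using mollify_integrable[OF assms(1)] mollify_integrable[OF assms(2)]
  by (simp add: mollify_def scaleR_diff_right)

lemma mollify_tendsto_continuous:
  fixes f :: "'a \<Rightarrow> 'b::euclidean_space"
  assumes f: "continuous_on UNIV f" and K: "\<And>x. x \<in> ball c r \<Longrightarrow> norm (f x) \<le> K"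
  shows "(\<lambda>n. l2 M (\<lambda>x. mollify n f x - f x)) \<longlonglongrightarrow> 0"
proof -
  note [measurable] = continuous_borel_measurable_lebesgue_on[OF f, of "ball c r"] 
  have [measurable]: "mollify n f \<in> borel_measurable M" for n by (rule mollify_measurable) measurable
  have "(\<lambda>n. \<integral>x. (norm (mollify n f x - f x))\<^sup>2 \<partial>M) \<longlonglongrightarrow> (\<integral>x. 0 \<partial>M)"
  proof (rule integral_dominated_convergence[where w = "\<lambda>x. (K + K)\<^sup>2"])
    show "integrable M (\<lambda>x. (K + K)\<^sup>2)" by simp
    show "AE x in M. (\<lambda>n. (norm (mollify n f x - f x))\<^sup>2) \<longlonglongrightarrow> 0"
    proof (rule AE_I2)
      fix x assume "x \<in> space M"
      then have "x \<in> cball c r" by (auto simp: space_restrict_space)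
      from mollify_pointwise[OF f this]
      have "(\<lambda>n. (norm (mollify n f x - f x))\<^sup>2) \<longlonglongrightarrow> (norm (f x - f x))\<^sup>2" by (intro tendsto_intros)
      then show "(\<lambda>n. (norm (mollify n f x - f x))\<^sup>2) \<longlonglongrightarrow> 0" by simp
    qed
    show "AE x in M. norm ((norm (mollify n f x - f x))\<^sup>2) \<le> (K + K)\<^sup>2" for n
    proof (rule AE_I2)
      fix x assume "x \<in> space M"
      then have x: "x \<in> ball c r" "x \<in> cball c r" by (auto simp: space_restrict_space)
      have "norm (mollify n f x) \<le> K" by (rule mollify_bounded) (use K x in auto)
      then have "norm (mollify n f x - f x) \<le> K + K"
        using norm_triangle_ineq4[of "mollify n f x" "f x"] K[OF x(1)] by linarith
      then have "(norm (mollify n f x - f x))\<^sup>2 \<le> (K + K)\<^sup>2" by (rule power_mono) simp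
      then show "norm ((norm (mollify n f x - f x))\<^sup>2) \<le> (K + K)\<^sup>2"
        by (subst real_norm_def, subst abs_of_nonneg) auto
    qed
  qed measurable
  then show ?thesis unfolding l2_tendsto_0_iff by simp
qed

text \<open>The usual density argument: convergence holds for continuous functions, and the
  operators are bounded uniformly in \<open>n\<close>.\<close>

lemma mollify_tendsto:
  fixes u :: "'a \<Rightarrow> 'b::euclidean_space"
  assumes u: "L2 M u"
  shows "(\<lambda>n. l2 M (\<lambda>x. mollify n u x - u x)) \<longlonglongrightarrow> 0"
proof (rule LIMSEQ_I)
  fix e :: real assume e: "e > 0"
  \<comment> \<open>The error \<open>u - f\<close> enters twice, once averaged, at the price of the
    operator bound, and once as it stands.\<close>
  define C where "C = sqrt (2 ^ DIM('a)) + 1"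
  have C: "C > 0" unfolding C_def by (intro add_nonneg_pos) auto
  obtain f K where f: "continuous_on UNIV f" "\<And>x. norm (f x) \<le> K" "l2 M (\<lambda>x. u x - f x) < e / (2 * C)"
    by (rule L2_continuous_dense[of "ball c r" u "e / (2 * C)"]) (use u e C in auto)
  have fL: "L2 M f"
    by (rule L2_bounded[OF continuous_borel_measurable_lebesgue_on[OF f(1)] f(2)])
  have "\<forall>\<^sub>F n in sequentially. l2 M (\<lambda>x. mollify n f x - f x) < e / 2"
    by (rule order_tendstoD(2)[OF mollify_tendsto_continuous[OF f(1,2)]]) (use e in simp)
  then obtain n0 where n0: "\<And>n. n \<ge> n0 \<Longrightarrow> l2 M (\<lambda>x. mollify n f x - f x) < e / 2"
    unfolding eventually_sequentially by blast
  show "\<exists>no. \<forall>n\<ge>no. norm (l2 M (\<lambda>x. mollify n u x - u x) - 0) < e"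
  proof (intro exI allI impI)
    fix n assume n: "n0 \<le> n"
    have "l2 M (\<lambda>x. mollify n u x - mollify n f x) = l2 M (mollify n (\<lambda>y. u y - f y))"
    proof -
      have "mollify n (\<lambda>y. u y - f y) = (\<lambda>x. mollify n u x - mollify n f x)"
        by (rule ext, rule mollify_diff[OF L2_integrable[OF u] L2_integrable[OF fL]])
      then show ?thesis by simp
    qed
    also have "\<dots> \<le> sqrt (2 ^ DIM('a)) * l2 M (\<lambda>x. u x - f x)"
      by (rule mollify_L2(2)[OF L2_diff[OF u fL]])
    finally have 1: "l2 M (\<lambda>x. mollify n u x - mollify n f x) \<le> sqrt (2 ^ DIM('a)) * l2 M (\<lambda>x. u x - f x)" .
    have "l2 M (\<lambda>x. mollify n u x - u x) \<le> l2 M (\<lambda>x. mollify n u x - mollify n f x) + l2 M (\<lambda>x. mollify n f x - u x)"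
      by (intro l2_triangle_diff mollify_L2 u fL)
    moreover have "l2 M (\<lambda>x. mollify n f x - u x) \<le> l2 M (\<lambda>x. mollify n f x - f x) + l2 M (\<lambda>x. f x - u x)"
      by (intro l2_triangle_diff mollify_L2 u fL)
    moreover have "C * l2 M (\<lambda>x. u x - f x) < e / 2"
      using f(3) C by (simp add: field_simps)
    ultimately have "l2 M (\<lambda>x. mollify n u x - u x) < e"
      using 1 n0[OF n] l2_minus_commute[of M f u] by (simp add: C_def algebra_simps)
    then show "norm (l2 M (\<lambda>x. mollify n u x - u x) - 0) < e" by simp
  qed
qed

lemma mollify_grad_tendsto:
  assumes u: "L2 M u" and G: "is_weak_grad (ball c r) u G"
  shows "(\<lambda>n. l2 M (\<lambda>x. grad (mollify n u) x - G x)) \<longlonglongrightarrow> 0"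
proof (rule Lim_null_comparison)
  have GL: "L2 M G" using G unfolding is_weak_grad_def by blast
  show "\<forall>\<^sub>F n in sequentially. norm (l2 M (\<lambda>x. grad (mollify n u) x - G x)) \<le>
      (1 - shrink n) * l2 M (\<lambda>x. mollify n G x - G x) + shrink n * l2 M G"
  proof (intro always_eventually allI)
    fix n
    have "l2 M (\<lambda>x. grad (mollify n u) x - G x) =
        l2 M (\<lambda>x. (1 - shrink n) *\<^sub>R (mollify n G x - G x) + (- shrink n) *\<^sub>R G x)"
      unfolding l2_def
      by (intro arg_cong[where f = sqrt] Bochner_Integration.integral_cong refl)
         (auto simp: mollify_grad[OF L2_integrable[OF u] G] space_restrict_space algebra_simps)
    also have "\<dots> \<le> l2 M (\<lambda>x. (1 - shrink n) *\<^sub>R (mollify n G x - G x)) + l2 M (\<lambda>x. (- shrink n) *\<^sub>R G x)"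
      by (intro l2_triangle L2_cmult L2_diff mollify_L2 GL)
    also have "\<dots> = (1 - shrink n) * l2 M (\<lambda>x. mollify n G x - G x) + shrink n * l2 M G"
      unfolding l2_cmult using shrink[of n] by simp
    finally show "norm (l2 M (\<lambda>x. grad (mollify n u) x - G x)) \<le>
      (1 - shrink n) * l2 M (\<lambda>x. mollify n G x - G x) + shrink n * l2 M G" by simp
  qed
  show "(\<lambda>n. (1 - shrink n) * l2 M (\<lambda>x. mollify n G x - G x) + shrink n * l2 M G) \<longlonglongrightarrow> 0"
    using mollify_tendsto[OF GL] shrink_tendsto by (auto intro!: tendsto_eq_intros)
qed

text \<open>The kernels are test functions and cannot tell two weak gradients apart, so the averages
  of the difference vanish identically on the ball; yet they converge to the difference.\<close>

lemma weak_grad_unique: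
  assumes G: "is_weak_grad (ball c r) u G" and H: "is_weak_grad (ball c r) u H"
  shows "AE x in M. G x = H x"
proof -
  have L: "L2 M G" "L2 M H" using G H unfolding is_weak_grad_def by blast+
  have "mollify n (\<lambda>y. G y - H y) x = 0" if "x \<in> ball c r" for n x
  proof -
    have "- (\<integral>y. kernel n (contract n x - y) *\<^sub>R G y \<partial>M) = - (\<integral>y. kernel n (contract n x - y) *\<^sub>R H y \<partial>M)"
      using G H kernel_test_function(1)[OF that] unfolding is_weak_grad_def by metis
    then show ?thesis
      by (subst mollify_diff) (auto simp: mollify_def L2_integrable L)
  qed
  then have "l2 M (\<lambda>x. mollify n (\<lambda>y. G y - H y) x - (G x - H x)) = l2 M (\<lambda>x. G x - H x)" for n
    unfolding l2_def
    by (intro arg_cong[where f = sqrt] Bochner_Integration.integral_cong refl)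
       (auto simp: space_restrict_space norm_minus_commute)
  then have "l2 M (\<lambda>x. G x - H x) = 0"
    using mollify_tendsto[OF L2_diff[OF L]] by (simp add: LIMSEQ_const_iff)
  from l2_eq_0_AE[OF L2_diff[OF L] this] show ?thesis by simp
qed

end

section \<open>Surface measure and traces\<close>

lemma lborel_integral_affine:
  fixes f :: "'a::euclidean_space \<Rightarrow> real"
  assumes f[measurable]: "f \<in> borel_measurable borel" and k: "k \<noteq> 0"
  shows "(\<integral>x. f (t + k *\<^sub>R x) \<partial>lborel) = (1 / \<bar>k\<bar> ^ DIM('a)) * (\<integral>x. f x \<partial>lborel)"
    and "integrable lborel f \<Longrightarrow> integrable lborel (\<lambda>x. f (t + k *\<^sub>R x))"
proof -
  let ?T = "\<lambda>x. t + k *\<^sub>R x"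
  have eq: "lborel = density (distr lborel borel ?T) (\<lambda>_. ennreal (\<bar>k\<bar> ^ DIM('a)))"
    using lborel_affine[OF k, of t] by (simp add: ennreal_power)
  have "(\<integral>x. f x \<partial>lborel) = (\<integral>x. \<bar>k\<bar> ^ DIM('a) *\<^sub>R f x \<partial>distr lborel borel ?T)"
    by (subst eq, rule integral_density) auto
  also have "\<dots> = (\<integral>x. \<bar>k\<bar> ^ DIM('a) *\<^sub>R f (?T x) \<partial>lborel)"
    by (rule integral_distr) auto
  finally show "(\<integral>x. f (t + k *\<^sub>R x) \<partial>lborel) = (1 / \<bar>k\<bar> ^ DIM('a)) * (\<integral>x. f x \<partial>lborel)"
    using k by simp
  assume "integrable lborel f"
  then have "integrable (density (distr lborel borel ?T) (\<lambda>_. ennreal (\<bar>k\<bar> ^ DIM('a)))) f"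
    using eq by simp
  then have "integrable (distr lborel borel ?T) (\<lambda>x. \<bar>k\<bar> ^ DIM('a) *\<^sub>R f x)"
    by (subst (asm) integrable_density) auto
  then have "integrable lborel (\<lambda>x. \<bar>k\<bar> ^ DIM('a) *\<^sub>R f (?T x))"
    by (subst (asm) integrable_distr_eq) auto
  then show "integrable lborel (\<lambda>x. f (?T x))" using k by simp
qed

lemma integral_lebesgue_on:
  fixes f :: "'a::euclidean_space \<Rightarrow> real"
  assumes "S \<in> sets borel" "f \<in> borel_measurable borel"
  shows "(\<integral>x. f x \<partial>lebesgue_on S) = (\<integral>x. indicator S x * f x \<partial>lborel)"
    and "integrable (lebesgue_on S) f \<longleftrightarrow> integrable lborel (\<lambda>x. indicator S x * f x)"
proof -
  have [measurable]: "(\<lambda>x. indicator S x * f x) \<in> borel_measurable borel"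
    using assms by measurable
  show "(\<integral>x. f x \<partial>lebesgue_on S) = (\<integral>x. indicator S x * f x \<partial>lborel)"
    using assms by (simp add: integral_restrict_space integral_completion)
  show "integrable (lebesgue_on S) f \<longleftrightarrow> integrable lborel (\<lambda>x. indicator S x * f x)"
    using assms by (simp add: integrable_restrict_space integrable_completion set_integrable_def)
qed

lemma scale_measure_eq_density: "scale_measure k M = density M (\<lambda>_. k)"
  by (rule measure_eqI) (auto simp: emeasure_density_const)

section \<open>Integration against the surface measure\<close>

text \<open>At the centre the division by 0 makes the value \<open>c\<close> itself. Hence the
  projection always lies in the closed ball, and on the sphere only away from the centre.\<close>

definition sphere_proj :: "'a::euclidean_space \<Rightarrow> real \<Rightarrow> 'a \<Rightarrow> 'a" where
  "sphere_proj c r x = c + (r / dist c x) *\<^sub>R (x - c)"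

lemma sphere_proj_measurable [measurable]: "sphere_proj c r \<in> borel_measurable borel"
  unfolding sphere_proj_def by measurable

lemma sphere_proj_measurable_lebesgue: "sphere_proj c r \<in> lebesgue_on S \<rightarrow>\<^sub>M borel"
  by (rule borel_measurable_lebesgue_on) simp

lemma sphere_proj_in: "r > 0 \<Longrightarrow> x \<noteq> c \<Longrightarrow> sphere_proj c r x \<in> sphere c r"
  by (simp add: sphere_proj_def dist_norm norm_minus_commute)

lemma sphere_proj_in_cball: "r > 0 \<Longrightarrow> sphere_proj c r x \<in> cball c r"
  by (cases "x = c") (use sphere_proj_in[of r x c] in \<open>auto simp: sphere_proj_def\<close>)

lemma sphere_measure_eq:
  "sphere_measure (c :: 'a::euclidean_space) r = density (distr (lebesgue_on (ball c r)) borel (sphere_proj c r))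
     (\<lambda>_. ennreal (real DIM('a) / r))"
  unfolding sphere_measure_def scale_measure_eq_density sphere_proj_def[abs_def] ..

lemma sets_sphere_measure [simp, measurable_cong]: "sets (sphere_measure c r) = sets borel"
  by (simp add: sphere_measure_eq)

lemma space_sphere_measure [simp]: "space (sphere_measure c r) = UNIV"
  by (simp add: sphere_measure_eq)

lemma integral_sphere_measure:
  fixes c :: "'a::euclidean_space" and f :: "'a \<Rightarrow> real"
  assumes "r > 0" and [measurable]: "f \<in> borel_measurable borel"
  shows "(\<integral>x. f x \<partial>sphere_measure c r) = real DIM('a) / r * (\<integral>x. f (sphere_proj c r x) \<partial>lebesgue_on (ball c r))"
    and "integrable (sphere_measure c r) f \<longleftrightarrow> integrable (lebesgue_on (ball c r)) (\<lambda>x. f (sphere_proj c r x))"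
proof -
  let ?M = "lebesgue_on (ball c r)"
  have [measurable]: "sphere_proj c r \<in> ?M \<rightarrow>\<^sub>M borel" by (rule sphere_proj_measurable_lebesgue)
  have "(\<integral>x. f x \<partial>sphere_measure c r) = (\<integral>x. (real DIM('a) / r) *\<^sub>R f x \<partial>distr ?M borel (sphere_proj c r))"
    unfolding sphere_measure_eq using assms by (intro integral_density) auto
  also have "\<dots> = (\<integral>x. (real DIM('a) / r) *\<^sub>R f (sphere_proj c r x) \<partial>?M)"
    by (rule integral_distr) auto
  finally show "(\<integral>x. f x \<partial>sphere_measure c r) = real DIM('a) / r * (\<integral>x. f (sphere_proj c r x) \<partial>?M)"
    by simp
  have "integrable (sphere_measure c r) f \<longleftrightarrow> integrable (distr ?M borel (sphere_proj c r)) (\<lambda>x. (real DIM('a) / r) *\<^sub>R f x)"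
    unfolding sphere_measure_eq using assms by (intro integrable_density) auto
  also have "\<dots> \<longleftrightarrow> integrable ?M (\<lambda>x. (real DIM('a) / r) *\<^sub>R f (sphere_proj c r x))"
    by (rule integrable_distr_eq) auto
  also have "\<dots> \<longleftrightarrow> integrable ?M (\<lambda>x. f (sphere_proj c r x))"
    unfolding real_scaleR_def by (subst integrable_mult_left_iff) (use assms in auto)
  finally show "integrable (sphere_measure c r) f \<longleftrightarrow> integrable ?M (\<lambda>x. f (sphere_proj c r x))" .
qed

lemma AE_sphere_measure:
  fixes c :: "'a::euclidean_space"
  assumes r: "r > 0"
  shows "AE x in sphere_measure c r. x \<in> sphere c r"
proof -
  let ?M = "lebesgue_on (ball c r)"
  have "AE x in ?M. x \<noteq> c"
  proof -
    have "AE x in (lebesgue :: 'a measure). x \<noteq> c"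
      by (rule AE_completion) (auto intro: AE_lborel_singleton)
    then show ?thesis by (auto simp: AE_restrict_space_iff elim: eventually_mono)
  qed
  then have 1: "AE x in ?M. sphere_proj c r x \<in> sphere c r"
    by eventually_elim (rule sphere_proj_in[OF r])
  have "AE x in distr ?M borel (sphere_proj c r). x \<in> sphere c r"
    by (subst AE_distr_iff[OF sphere_proj_measurable_lebesgue]) (use 1 in auto)
  then show ?thesis unfolding sphere_measure_eq by (subst AE_density) (auto elim: eventually_mono)
qed

lemma finite_measure_sphere_measure:
  fixes c :: "'a::euclidean_space"
  assumes "r > 0"
  shows "finite_measure (sphere_measure c r)"
proof -
  interpret finite_measure "lebesgue_on (ball c r)" by (rule finite_measure_lebesgue_ball)
  have "integrable (sphere_measure c r) (\<lambda>_. 1 :: real)"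
    by (subst integral_sphere_measure(2)[OF assms]) auto
  then have "(\<integral>\<^sup>+x. ennreal (norm (1::real)) \<partial>sphere_measure c r) < \<infinity>"
    unfolding integrable_iff_bounded by blast
  then show ?thesis by (intro finite_measureI) (auto simp: less_top)
qed

section \<open>The divergence theorem along rays\<close>

text \<open>The exponent \<open>N + 1\<close> collects the Jacobian \<open>t ^ N\<close> of a
  dilation and the factor \<open>1 / t\<close> of the radial derivative; the value
  \<open>1 / N\<close> is where the factor \<open>DIM('a)\<close> of
  \<open>radial_divergence\<close> originates.\<close>

lemma nn_integral_power_tail:
  assumes "N > 0"
  shows "(\<integral>\<^sup>+t. ennreal (1 / t ^ (N + 1)) * indicator {1..} t \<partial>lborel) = ennreal (1 / real N)"
proof -
  let ?F = "\<lambda>t::real. - 1 / (real N * t ^ N)"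
  have "(\<integral>\<^sup>+t. ennreal (1 / t ^ (N + 1)) * indicator {1..} t \<partial>lborel) = ennreal (0 - ?F 1)"
  proof (rule nn_integral_FTC_atLeast[where F = ?F and T = 0])
    fix x :: real assume x: "1 \<le> x"
    have "x ^ (N - Suc 0) * x = x ^ N" using assms by (cases N) auto
    then show "DERIV ?F x :> 1 / x ^ (N + 1)"
      using x assms by (auto intro!: derivative_eq_intros simp: field_simps power2_eq_square)
    show "0 \<le> 1 / x ^ (N + 1)" using x by simp
  next
    have "filterlim (\<lambda>t::real. t ^ N) at_top at_top"
      using assms by (rule filterlim_pow_at_top) (rule filterlim_ident)
    then have "filterlim (\<lambda>t::real. real N * t ^ N) at_infinity at_top"
      using assms by (intro filterlim_at_top_imp_at_infinity filterlim_tendsto_pos_mult_at_top[OF tendsto_const]) auto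
    then show "(?F \<longlongrightarrow> 0) at_top" by (rule tendsto_divide_0[OF tendsto_const])
  qed measurable
  then show ?thesis by simp
qed

text \<open>Writing the boundary value of \<open>K\<close> minus its value at \<open>x\<close> as the integral of the radial derivative
  along the ray through \<open>x\<close> and scaling back every point of that ray turns the divergence theorem
  on the ball into Fubini's theorem.\<close>

lemma radial_divergence:
  fixes c :: "'a::euclidean_space" and K D :: "'a \<Rightarrow> real"
  assumes r: "r > 0" and K: "continuous_on (cball c r) K" and D: "continuous_on (cball c r) D"
    and deriv: "\<And>x t. x \<noteq> c \<Longrightarrow> 1 \<le> t \<Longrightarrow> t * dist c x \<le> r \<Longrightarrow>
       ((\<lambda>t. K (c + t *\<^sub>R (x - c))) has_real_derivative D (c + t *\<^sub>R (x - c)) / t) (at t)"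
  shows "real DIM('a) * (\<integral>x. K (sphere_proj c r x) \<partial>lebesgue_on (ball c r)) =
    (\<integral>x. real DIM('a) * K x + D x \<partial>lebesgue_on (ball c r))"
proof -
  let ?N = "DIM('a)" and ?M = "lebesgue_on (ball c r)"
  interpret M: finite_measure ?M by (rule finite_measure_lebesgue_ball)
  \<comment> \<open>Here \<open>D y\<close> plays the role of
    \<open>(y - c) \<bullet> grad K y\<close>, so that \<open>N * K + D\<close> is the divergence of
    \<open>(y - c) K\<close>. Extending \<open>D\<close> by 0 lets every ray end at the sphere by
    itself and permits substitutions in the whole space.\<close>
  define D' where "D' x = indicator (cball c r) x *\<^sub>R D x" for x
  define K' where "K' x = indicator (cball c r) x *\<^sub>R K x" for x
  have D'm[measurable]: "D' \<in> borel_measurable borel" and K'm[measurable]: "K' \<in> borel_measurable borel"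
    unfolding D'_def[abs_def] K'_def[abs_def]
    by (rule borel_measurable_continuous_on_indicator[OF _ D], simp)
       (rule borel_measurable_continuous_on_indicator[OF _ K], simp)
  have D'i: "integrable lborel D'"
    using borel_integrable_compact[OF _ D] unfolding D'_def[abs_def] by simp
  have "bounded (K ` cball c r)" by (intro compact_imp_bounded compact_continuous_image K) auto
  then obtain B where "\<forall>y\<in>K ` cball c r. norm y \<le> B" unfolding bounded_iff by blast
  then have "norm (K x) \<le> \<bar>B\<bar>" if "x \<in> cball c r" for x
    using that by (intro order_trans[OF _ abs_ge_self]) blast
  then have K'b: "norm (K' x) \<le> \<bar>B\<bar>" for x by (simp add: K'_def indicator_def)
  define h where "h t x = indicator {1..} t * (D' (c + t *\<^sub>R (x - c)) / t)" for t x
  have aff: "c + t *\<^sub>R (x - c) = (c - t *\<^sub>R c) + t *\<^sub>R x" for t x by (simp add: algebra_simps)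
  have hx: "integrable lborel (h t)" "(\<integral>x. h t x \<partial>lborel) = indicator {1..} t * (1 / t ^ (?N + 1)) * (\<integral>x. D' x \<partial>lborel)"
      "(\<integral>x. norm (h t x) \<partial>lborel) = indicator {1..} t * (1 / t ^ (?N + 1)) * (\<integral>x. norm (D' x) \<partial>lborel)" for t
  proof -
    consider "t < 1" | "1 \<le> t" by linarith
    then have "integrable lborel (h t) \<and> (\<integral>x. h t x \<partial>lborel) = indicator {1..} t * (1 / t ^ (?N + 1)) * (\<integral>x. D' x \<partial>lborel)
      \<and> (\<integral>x. norm (h t x) \<partial>lborel) = indicator {1..} t * (1 / t ^ (?N + 1)) * (\<integral>x. norm (D' x) \<partial>lborel)"
    proof cases
      case 1
      then show ?thesis by (simp add: h_def[abs_def])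
    next
      case 2
      then have t: "t \<noteq> 0" "t > 0" by auto
      have "integrable lborel (\<lambda>x. D' (c + t *\<^sub>R (x - c)))"
        unfolding aff by (rule lborel_integral_affine(2)) (use D'i t in auto)
      moreover have "(\<integral>x. D' (c + t *\<^sub>R (x - c)) \<partial>lborel) = 1 / \<bar>t\<bar> ^ ?N * (\<integral>x. D' x \<partial>lborel)"
        unfolding aff by (rule lborel_integral_affine(1)) (use t in auto)
      moreover have "(\<integral>x. norm (D' (c + t *\<^sub>R (x - c))) \<partial>lborel) = 1 / \<bar>t\<bar> ^ ?N * (\<integral>x. norm (D' x) \<partial>lborel)"
        unfolding aff by (rule lborel_integral_affine(1)[of "\<lambda>x. norm (D' x)"]) (use t in auto)
      ultimately show ?thesis using 2 t
        by (auto simp: h_def[abs_def] field_simps)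
    qed
    then show "integrable lborel (h t)" "(\<integral>x. h t x \<partial>lborel) = indicator {1..} t * (1 / t ^ (?N + 1)) * (\<integral>x. D' x \<partial>lborel)"
      "(\<integral>x. norm (h t x) \<partial>lborel) = indicator {1..} t * (1 / t ^ (?N + 1)) * (\<integral>x. norm (D' x) \<partial>lborel)" by auto
  qed
  have tail: "has_bochner_integral lborel (\<lambda>t. indicator {1..} t * (1 / t ^ (?N + 1))) (1 / real ?N)"
  proof (rule has_bochner_integral_nn_integral)
    have "(\<integral>\<^sup>+t. ennreal (indicator {1..} t * (1 / t ^ (?N + 1))) \<partial>lborel)
      = (\<integral>\<^sup>+t. ennreal (1 / t ^ (?N + 1)) * indicator {1..} t \<partial>lborel)"
      by (intro nn_integral_cong) (auto simp: indicator_def)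
    also have "\<dots> = ennreal (1 / real ?N)" by (rule nn_integral_power_tail) simp
    finally show "(\<integral>\<^sup>+t. ennreal (indicator {1..} t * (1 / t ^ (?N + 1))) \<partial>lborel) = ennreal (1 / real ?N)" .
  qed (auto simp: indicator_def)
  have hi: "integrable (lborel \<Otimes>\<^sub>M lborel) (case_prod h)"
  proof (rule lborel_pair.Fubini_integrable)
    show "case_prod h \<in> borel_measurable (lborel \<Otimes>\<^sub>M lborel)"
      unfolding h_def[abs_def] by measurable
    show "integrable lborel (\<lambda>t. \<integral>x. norm (case_prod h (t, x)) \<partial>lborel)"
      unfolding prod.case hx(3)
      by (rule integrable_mult_left) (rule integrable.intros[OF tail])
    show "AE t in lborel. integrable lborel (\<lambda>x. case_prod h (t, x))"
      using hx(1) by simp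
  qed
  have "(\<integral>x. (\<integral>t. h t x \<partial>lborel) \<partial>lborel) = (\<integral>t. (\<integral>x. h t x \<partial>lborel) \<partial>lborel)"
    by (rule lborel_pair.Fubini_integral[OF hi])
  also have "\<dots> = 1 / real ?N * (\<integral>x. D' x \<partial>lborel)"
    unfolding hx(2) integral_mult_left_zero has_bochner_integral_integral_eq[OF tail] ..
  finally have 1: "(\<integral>x. (\<integral>t. h t x \<partial>lborel) \<partial>lborel) = 1 / real ?N * (\<integral>x. D' x \<partial>lborel)" .
  have ray: "(\<integral>t. h t x \<partial>lborel) = K (sphere_proj c r x) - K x" if x: "x \<in> ball c r" "x \<noteq> c" for x
  proof -
    let ?b = "r / dist c x"
    have d: "dist c x > 0" "dist c x < r" using x by auto
    then have b: "1 \<le> ?b" by simp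
    have mem: "c + t *\<^sub>R (x - c) \<in> cball c r \<longleftrightarrow> t \<le> ?b" if "1 \<le> t" for t
    proof -
      have "dist c (c + t *\<^sub>R (x - c)) = t * dist c x"
        using that by (simp add: dist_norm norm_minus_commute)
      then show ?thesis using d by (simp add: pos_le_divide_eq)
    qed
    have "h t x = indicator {1..?b} t *\<^sub>R (D (c + t *\<^sub>R (x - c)) / t)" for t
      using mem[of t] by (auto simp: h_def D'_def indicator_def)
    then have "(\<integral>t. h t x \<partial>lborel) = (\<integral>t. indicator {1..?b} t *\<^sub>R (D (c + t *\<^sub>R (x - c)) / t) \<partial>lborel)" by simp
    also have "\<dots> = K (c + ?b *\<^sub>R (x - c)) - K (c + 1 *\<^sub>R (x - c))"
    proof (rule integral_FTC_Icc[OF b, where F = "\<lambda>t. K (c + t *\<^sub>R (x - c))"])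
      fix t assume t: "1 \<le> t" "t \<le> ?b"
      then have "t * dist c x \<le> r" using d by (simp add: field_simps)
      from deriv[OF x(2) t(1) this]
      show "((\<lambda>t. K (c + t *\<^sub>R (x - c))) has_vector_derivative D (c + t *\<^sub>R (x - c)) / t) (at t within {1..?b})"
        by (auto intro: has_vector_derivative_at_within simp: has_real_derivative_iff_has_vector_derivative)
    next
      show "continuous_on {1..?b} (\<lambda>t. D (c + t *\<^sub>R (x - c)) / t)"
        by (intro continuous_intros continuous_on_compose2[OF D]) (use mem in auto)
    qed
    finally show ?thesis by (simp add: sphere_proj_def)
  qed
  have out: "(\<integral>t. h t x \<partial>lborel) = 0" if "x \<notin> cball c r" for x
  proof -
    have "h t x = 0" for t
    proof (cases "1 \<le> t")
      case True
      have "r < dist c x" using that by simp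
      also have "\<dots> \<le> t * dist c x" using True by (simp add: mult_le_cancel_right1)
      finally have "c + t *\<^sub>R (x - c) \<notin> cball c r" using True by (simp add: dist_norm norm_minus_commute)
      then show ?thesis by (simp add: h_def D'_def)
    qed (simp add: h_def)
    then show ?thesis by simp
  qed
  have sphere0: "AE x in lborel. x \<notin> sphere c r"
    using negligible_sphere[of c r] by (intro AE_not_in) (simp add: negligible_iff_null_sets null_sets_completion_iff)
  have "AE x in lborel. (\<integral>t. h t x \<partial>lborel) = indicator (ball c r) x * (K' (sphere_proj c r x) - K' x)"
    using sphere0 AE_lborel_singleton[of c]
  proof eventually_elim
    fix x assume "x \<notin> sphere c r" "x \<noteq> c"
    then show "(\<integral>t. h t x \<partial>lborel) = indicator (ball c r) x * (K' (sphere_proj c r x) - K' x)"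
      using ray[of x] out[of x] sphere_proj_in_cball[OF r, of c x]
      by (cases "x \<in> ball c r") (auto simp: K'_def)
  qed
  then have "(\<integral>x. (\<integral>t. h t x \<partial>lborel) \<partial>lborel) = (\<integral>x. indicator (ball c r) x * (K' (sphere_proj c r x) - K' x) \<partial>lborel)"
  proof (rule integral_cong_AE[rotated 2])
    show "(\<lambda>x. \<integral>t. h t x \<partial>lborel) \<in> borel_measurable lborel"
      unfolding h_def by measurable
    show "(\<lambda>x. indicator (ball c r) x * (K' (sphere_proj c r x) - K' x)) \<in> borel_measurable lborel"
      using K'm by (intro borel_measurable_times borel_measurable_diff borel_measurable_indicator
          measurable_compose[OF sphere_proj_measurable]) auto
  qed
  also have "\<dots> = (\<integral>x. K' (sphere_proj c r x) - K' x \<partial>?M)"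
    by (rule integral_lebesgue_on(1)[symmetric]) auto
  also have "\<dots> = (\<integral>x. K (sphere_proj c r x) - K x \<partial>?M)"
    using sphere_proj_in_cball[OF r] by (intro Bochner_Integration.integral_cong) (auto simp: K'_def space_restrict_space indicator_def)
  finally have 2: "(\<integral>x. (\<integral>t. h t x \<partial>lborel) \<partial>lborel) = (\<integral>x. K (sphere_proj c r x) - K x \<partial>?M)" .
  have "AE x in lborel. D' x = indicator (ball c r) x * D' x"
    using sphere0 by eventually_elim (auto simp: D'_def indicator_def)
  then have "(\<integral>x. D' x \<partial>lborel) = (\<integral>x. indicator (ball c r) x * D' x \<partial>lborel)"
    using D'm by (intro integral_cong_AE borel_measurable_times borel_measurable_indicator) auto
  also have "\<dots> = (\<integral>x. D' x \<partial>?M)" by (rule integral_lebesgue_on(1)[symmetric]) auto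
  also have "\<dots> = (\<integral>x. D x \<partial>?M)"
    by (intro Bochner_Integration.integral_cong) (auto simp: D'_def space_restrict_space)
  finally have 3: "(\<integral>x. D' x \<partial>lborel) = (\<integral>x. D x \<partial>?M)" .
  have Ki: "integrable ?M K"
  proof -
    have "integrable ?M K'"
      by (rule M.integrable_const_bound[where B = "\<bar>B\<bar>"]) (use K'b in \<open>auto intro: borel_measurable_lebesgue_on\<close>)
    then show ?thesis by (rule Bochner_Integration.integrable_cong[THEN iffD1, rotated 2])
        (auto simp: K'_def space_restrict_space)
  qed
  have Pi: "integrable ?M (\<lambda>x. K (sphere_proj c r x))"
  proof -
    have "integrable ?M (\<lambda>x. K' (sphere_proj c r x))"
      by (rule M.integrable_const_bound[where B = "\<bar>B\<bar>"])
         (use K'b in \<open>auto intro!: borel_measurable_lebesgue_on\<close>)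
    then show ?thesis by (rule Bochner_Integration.integrable_cong[THEN iffD1, rotated 2])
        (use sphere_proj_in_cball[OF r] in \<open>auto simp: K'_def space_restrict_space indicator_def\<close>)
  qed
  have Di: "integrable ?M D"
  proof -
    have "integrable ?M D'"
      using D'i by (subst integral_lebesgue_on(2)) (auto intro: integrable_real_mult_indicator simp: mult.commute)
    then show ?thesis by (rule Bochner_Integration.integrable_cong[THEN iffD1, rotated 2])
        (auto simp: D'_def space_restrict_space)
  qed
  have "(\<integral>x. K (sphere_proj c r x) - K x \<partial>?M) = 1 / real ?N * (\<integral>x. D x \<partial>?M)"
    using 1 2 3 by simp
  then have "(\<integral>x. K (sphere_proj c r x) \<partial>?M) = (\<integral>x. K x \<partial>?M) + 1 / real ?N * (\<integral>x. D x \<partial>?M)"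
    using Ki Pi by simp
  then show ?thesis using Ki Di by (simp add: field_simps)
qed

section \<open>Existence and uniqueness of traces\<close>

text \<open>Riesz-Fischer. Along a subsequence the increments are geometrically small in L2, hence
  summable in L1 on a finite measure, so the subsequence converges almost everywhere; Fatou's lemma
  turns the Cauchy estimate into an estimate for the limit.\<close>

lemma (in finite_measure) L2_complete:
  fixes f :: "nat \<Rightarrow> 'a \<Rightarrow> real"
  assumes f: "\<And>n. L2 M (f n)"
    and Cauchy: "\<And>e. e > 0 \<Longrightarrow> \<exists>n0. \<forall>m\<ge>n0. \<forall>n\<ge>n0. l2 M (\<lambda>x. f m x - f n x) < e"
  obtains g where "L2 M g" "(\<lambda>n. l2 M (\<lambda>x. f n x - g x)) \<longlonglongrightarrow> 0"
proof -
  note [measurable] = L2_measurable[OF f]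
  have "\<forall>k. \<exists>n0. \<forall>m\<ge>n0. \<forall>n\<ge>n0. l2 M (\<lambda>x. f m x - f n x) < (1/2)^k" using Cauchy by simp
  then obtain n0 where n0: "\<And>k m n. m \<ge> n0 k \<Longrightarrow> n \<ge> n0 k \<Longrightarrow> l2 M (\<lambda>x. f m x - f n x) < (1/2)^k" by metis
  \<comment> \<open>The partial sums put both \<open>s k\<close> and \<open>s (Suc k)\<close> beyond
    \<open>n0 k\<close>; the summand \<open>k\<close> makes the subsequence tend to infinity even if
    \<open>n0\<close> vanishes.\<close>
  define s where "s k = (\<Sum>j\<le>k. n0 j) + k" for k
  have s: "s k \<ge> n0 k" "s (Suc k) \<ge> n0 k" "s k \<ge> k" for k
    using member_le_sum[of k "{..k}" n0] member_le_sum[of k "{..Suc k}" n0] by (auto simp: s_def)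
  define a where "a k x = \<bar>f (s (Suc k)) x - f (s k) x\<bar>" for k x
  have aL: "L2 M (a k)" for k
    using L2_norm[OF L2_diff[OF f[of "s (Suc k)"] f[of "s k"]]] by (simp add: a_def[abs_def])
  have [measurable]: "a k \<in> borel_measurable M" for k by (rule L2_measurable[OF aL])
  have one: "L2 M (\<lambda>_. 1::real)" by (rule L2_bounded[where K = 1]) auto
  have ai: "(\<integral>x. a k x \<partial>M) \<le> (1/2)^k * l2 M (\<lambda>_. 1::real)" for k
  proof -
    have "(\<integral>x. a k x \<partial>M) \<le> l2 M (a k) * l2 M (\<lambda>_. 1::real)"
      using l2_Cauchy_Schwarz[OF aL one, of k] by (simp add: a_def)
    also have "l2 M (a k) = l2 M (\<lambda>x. f (s (Suc k)) x - f (s k) x)" by (simp add: l2_def a_def)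
    also have "\<dots> * l2 M (\<lambda>_. 1::real) \<le> (1/2)^k * l2 M (\<lambda>_. 1::real)"
      using n0[OF s(2,1)] by (intro mult_right_mono) (auto intro: less_imp_le)
    finally show ?thesis .
  qed
  have "(\<integral>\<^sup>+x. (\<Sum>k. ennreal (a k x)) \<partial>M) = (\<Sum>k. \<integral>\<^sup>+x. ennreal (a k x) \<partial>M)"
    by (rule nn_integral_suminf) measurable
  also have "\<dots> \<le> (\<Sum>k. ennreal ((1/2)^k * l2 M (\<lambda>_. 1::real)))"
  proof (rule suminf_le)
    fix k
    have "(\<integral>\<^sup>+x. ennreal (a k x) \<partial>M) = ennreal (\<integral>x. a k x \<partial>M)"
      by (rule nn_integral_eq_integral[OF L2_integrable[OF aL]]) (simp add: a_def)
    then show "(\<integral>\<^sup>+x. ennreal (a k x) \<partial>M) \<le> ennreal ((1/2)^k * l2 M (\<lambda>_. 1::real))"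
      using ai[of k] by (simp add: ennreal_leI)
  qed auto
  also have "\<dots> = ennreal (\<Sum>k. (1/2)^k * l2 M (\<lambda>_. 1::real))"
    by (rule suminf_ennreal2) (auto intro!: summable_mult2 summable_geometric)
  also have "\<dots> < \<infinity>" by simp
  finally have "(\<integral>\<^sup>+x. (\<Sum>k. ennreal (a k x)) \<partial>M) \<noteq> \<infinity>" by simp
  then have "AE x in M. (\<Sum>k. ennreal (a k x)) \<noteq> \<infinity>"
    by (intro nn_integral_PInf_AE) auto
  then have conv: "AE x in M. convergent (\<lambda>k. f (s k) x)"
  proof eventually_elim
    fix x assume "(\<Sum>k. ennreal (a k x)) \<noteq> \<infinity>"
    then have "summable (\<lambda>k. a k x)" by (intro summable_suminf_not_top) (auto simp: a_def)
    then have "summable (\<lambda>k. f (s (Suc k)) x - f (s k) x)"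
      unfolding a_def by (rule summable_rabs_cancel)
    then have "convergent (\<lambda>n. \<Sum>k<n. f (s (Suc k)) x - f (s k) x)" by (simp add: summable_iff_convergent)
    then have "convergent (\<lambda>n. f (s n) x - f (s 0) x)" by (simp add: sum_lessThan_telescope[of "\<lambda>k. f (s k) x"])
    then have "convergent (\<lambda>n. (f (s n) x - f (s 0) x) + f (s 0) x)" by (intro convergent_add convergent_const)
    then show "convergent (\<lambda>k. f (s k) x)" by simp
  qed
  define g where "g x = lim (\<lambda>k. f (s k) x)" for x
  have [measurable]: "g \<in> borel_measurable M" unfolding g_def by measurable
  have lim: "AE x in M. (\<lambda>k. f (s k) x) \<longlonglongrightarrow> g x"
    using conv by eventually_elim (simp add: g_def convergent_LIMSEQ_iff)
  have est: "(\<integral>\<^sup>+x. ennreal ((f n x - g x)\<^sup>2) \<partial>M) \<le> ennreal (((1/2)^k)\<^sup>2)" if n: "n \<ge> n0 k" for n k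
  proof -
    have "(\<integral>\<^sup>+x. ennreal ((f n x - g x)\<^sup>2) \<partial>M) = (\<integral>\<^sup>+x. liminf (\<lambda>j. ennreal ((f n x - f (s j) x)\<^sup>2)) \<partial>M)"
    proof (rule nn_integral_cong_AE)
      show "AE x in M. ennreal ((f n x - g x)\<^sup>2) = liminf (\<lambda>j. ennreal ((f n x - f (s j) x)\<^sup>2))"
        using lim
      proof eventually_elim
        fix x assume "(\<lambda>k. f (s k) x) \<longlonglongrightarrow> g x"
        then have "(\<lambda>j. ennreal ((f n x - f (s j) x)\<^sup>2)) \<longlonglongrightarrow> ennreal ((f n x - g x)\<^sup>2)"
          by (intro tendsto_intros tendsto_ennrealI)
        then show "ennreal ((f n x - g x)\<^sup>2) = liminf (\<lambda>j. ennreal ((f n x - f (s j) x)\<^sup>2))"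
          by (rule lim_imp_Liminf[symmetric, rotated]) simp
      qed
    qed
    also have "\<dots> \<le> liminf (\<lambda>j. \<integral>\<^sup>+x. ennreal ((f n x - f (s j) x)\<^sup>2) \<partial>M)"
      by (rule nn_integral_liminf) measurable
    also have "\<dots> \<le> ennreal (((1/2)^k)\<^sup>2)"
    proof (rule Liminf_le)
      show "\<forall>\<^sub>F j in sequentially. (\<integral>\<^sup>+x. ennreal ((f n x - f (s j) x)\<^sup>2) \<partial>M) \<le> ennreal (((1/2)^k)\<^sup>2)"
        unfolding eventually_sequentially
      proof (intro exI allI impI)
        fix j assume "n0 k \<le> j"
        then have sj: "s j \<ge> n0 k" using s(3)[of j] by linarith
        have "(\<integral>\<^sup>+x. ennreal ((f n x - f (s j) x)\<^sup>2) \<partial>M) = ennreal ((l2 M (\<lambda>x. f n x - f (s j) x))\<^sup>2)"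
          unfolding l2_power2 using L2_integrable_sq[OF L2_diff[OF f f]]
          by (subst nn_integral_eq_integral) auto
        also have "\<dots> \<le> ennreal (((1/2)^k)\<^sup>2)"
          using n0[OF n sj] by (intro ennreal_leI power_mono) auto
        finally show "(\<integral>\<^sup>+x. ennreal ((f n x - f (s j) x)\<^sup>2) \<partial>M) \<le> ennreal (((1/2)^k)\<^sup>2)" .
      qed
    qed simp
    finally show ?thesis .
  qed
  have dL: "L2 M (\<lambda>x. f n x - g x)" if "n \<ge> n0 k" for n k
    unfolding L2_def
  proof
    show "integrable M (\<lambda>x. (norm (f n x - g x))\<^sup>2)"
      by (rule integrableI_nonneg) (use est[OF that] in \<open>auto intro: le_less_trans\<close>)
  qed measurable
  have "L2 M (\<lambda>x. f (n0 0) x - (f (n0 0) x - g x))" by (rule L2_diff[OF f dL[of 0]]) simp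
  then have gL: "L2 M g" by simp
  moreover have "(\<lambda>n. l2 M (\<lambda>x. f n x - g x)) \<longlonglongrightarrow> 0"
  proof (rule LIMSEQ_I)
    fix e :: real assume "e > 0"
    then obtain k where k: "(1/2)^k < e" using real_arch_pow_inv[of e "1/2"] by auto
    show "\<exists>no. \<forall>n\<ge>no. norm (l2 M (\<lambda>x. f n x - g x) - 0) < e"
    proof (intro exI allI impI)
      fix n assume n: "n0 k \<le> n"
      have "ennreal ((l2 M (\<lambda>x. f n x - g x))\<^sup>2) = (\<integral>\<^sup>+x. ennreal ((f n x - g x)\<^sup>2) \<partial>M)"
        unfolding l2_power2 using L2_integrable_sq[OF dL[OF n]]
        by (subst nn_integral_eq_integral) auto
      then have "ennreal ((l2 M (\<lambda>x. f n x - g x))\<^sup>2) \<le> ennreal (((1/2)^k)\<^sup>2)" using est[OF n] by simp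
      then have "(l2 M (\<lambda>x. f n x - g x))\<^sup>2 \<le> ((1/2)^k)\<^sup>2" by simp
      then have "l2 M (\<lambda>x. f n x - g x) \<le> (1/2)^k" by (rule power2_le_imp_le) simp
      then show "norm (l2 M (\<lambda>x. f n x - g x) - 0) < e" using k by simp
    qed
  qed
  ultimately show ?thesis by (rule that)
qed

lemma GDERIV_line:
  assumes "GDERIV f (c + t *\<^sub>R v) :> D"
  shows "((\<lambda>t. f (c + t *\<^sub>R v)) has_real_derivative (v \<bullet> D)) (at t)"
proof -
  have "((\<lambda>t. c + t *\<^sub>R v) has_derivative (\<lambda>h. h *\<^sub>R v)) (at t)"
    by (auto intro!: derivative_eq_intros)
  from has_derivative_compose[OF this assms[unfolded gderiv_def]]
  show ?thesis by (simp add: has_field_derivative_def mult.commute[of _ "v \<bullet> D"])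
qed

lemma GDERIV_isCont: "GDERIV f x :> D \<Longrightarrow> isCont f x"
  unfolding gderiv_def by (rule has_derivative_continuous)

lemma GDERIV_continuous_on: "(\<And>x. x \<in> S \<Longrightarrow> GDERIV f x :> f' x) \<Longrightarrow> continuous_on S f"
  by (meson GDERIV_isCont continuous_at_imp_continuous_on)

lemma continuous_bounded_cball:
  fixes f :: "'a::euclidean_space \<Rightarrow> 'b::euclidean_space"
  assumes "continuous_on (cball c r) f"
  obtains K where "K \<ge> 0" "\<And>x. x \<in> cball c r \<Longrightarrow> norm (f x) \<le> K"
proof -
  have "bounded (f ` cball c r)" by (intro compact_imp_bounded compact_continuous_image assms) auto
  then obtain B where B: "\<forall>y\<in>f ` cball c r. norm y \<le> B" unfolding bounded_iff by blast
  show ?thesis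
  proof (rule that[of "\<bar>B\<bar>"])
    show "norm (f x) \<le> \<bar>B\<bar>" if "x \<in> cball c r" for x
      by (rule order_trans[OF _ abs_ge_self]) (use B that in blast)
  qed simp
qed

lemma continuous_measurable_ball:
  fixes f :: "'a::euclidean_space \<Rightarrow> 'b::euclidean_space"
  assumes "continuous_on (cball c r) f"
  shows "f \<in> borel_measurable (lebesgue_on (ball c r))"
  by (rule continuous_imp_measurable_on_sets_lebesgue[OF continuous_on_subset[OF assms]]) auto

lemma L2_continuous_ball:
  fixes f :: "'a::euclidean_space \<Rightarrow> 'b::euclidean_space"
  assumes "continuous_on (cball c r) f"
  shows "L2 (lebesgue_on (ball c r)) f"
proof -
  interpret finite_measure "lebesgue_on (ball c r)" by (rule finite_measure_lebesgue_ball)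
  obtain K where "\<And>x. x \<in> cball c r \<Longrightarrow> norm (f x) \<le> K" using continuous_bounded_cball[OF assms] by metis
  then show ?thesis
    by (intro L2_bounded[where K = K] continuous_measurable_ball assms) (auto simp: space_restrict_space)
qed

lemma L2_continuous_sphere:
  fixes f :: "'a::euclidean_space \<Rightarrow> real"
  assumes r: "r > 0" and f: "continuous_on (cball c r) f" "f \<in> borel_measurable borel"
  shows "L2 (sphere_measure c r) f"
proof -
  interpret finite_measure "sphere_measure c r" by (rule finite_measure_sphere_measure[OF r])
  obtain K where K: "\<And>x. x \<in> cball c r \<Longrightarrow> norm (f x) \<le> K" using continuous_bounded_cball[OF f(1)] by metis
  have [measurable]: "f \<in> borel_measurable (sphere_measure c r)" using f(2) by simp
  have "integrable (sphere_measure c r) (\<lambda>x. (norm (f x))\<^sup>2)"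
  proof (rule integrable_const_bound[where B = "K\<^sup>2"])
    show "AE x in sphere_measure c r. norm ((norm (f x))\<^sup>2) \<le> K\<^sup>2"
      using AE_sphere_measure[OF r, of c]
    proof eventually_elim
      fix x assume "x \<in> sphere c r"
      then have "norm (f x) \<le> K" using K[of x] by simp
      then have "(norm (f x))\<^sup>2 \<le> K\<^sup>2" by (rule power_mono) simp
      then show "norm ((norm (f x))\<^sup>2) \<le> K\<^sup>2" by simp
    qed
  qed measurable
  then show ?thesis unfolding L2_def by auto
qed

text \<open>The divergence identity for the square of \<open>f\<close>. Its radial derivative
  \<open>2 f (x - c) \<bullet> f'\<close> is at most \<open>r\<close> times the sum of the two
  squares, because \<open>x - c\<close> has length at most \<open>r\<close>.\<close>

lemma C1_trace_inequality:
  fixes f :: "'a::euclidean_space \<Rightarrow> real"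
  assumes r: "r > 0" and f: "\<And>x. GDERIV f x :> f' x" and f': "continuous_on UNIV f'"
  defines "C \<equiv> (real DIM('a) + r) / r"
  shows "l2 (sphere_measure c r) f \<le> sqrt C * (l2 (lebesgue_on (ball c r)) f + l2 (lebesgue_on (ball c r)) f')"
proof -
  let ?M = "lebesgue_on (ball c r)" and ?S = "sphere_measure c r" and ?N = "real DIM('a)"
  have fc: "continuous_on S f" for S by (rule GDERIV_continuous_on) (rule f)
  have f'c: "continuous_on S f'" for S by (rule continuous_on_subset[OF f']) simp
  have fL: "L2 ?M f" "L2 ?M f'" by (intro L2_continuous_ball fc f'c)+
  have fm: "f \<in> borel_measurable borel" by (rule borel_measurable_continuous_onI[OF fc])
  define D where "D x = 2 * f x * ((x - c) \<bullet> f' x)" for x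
  have Dc: "continuous_on (cball c r) D" unfolding D_def by (intro continuous_intros fc f'c)
  have "?N * (\<integral>x. (f (sphere_proj c r x))\<^sup>2 \<partial>?M) = (\<integral>x. ?N * (f x)\<^sup>2 + D x \<partial>?M)"
  proof (rule radial_divergence[OF r _ Dc, of "\<lambda>x. (f x)\<^sup>2"])
    show "continuous_on (cball c r) (\<lambda>x. (f x)\<^sup>2)" by (intro continuous_intros fc)
    fix x :: 'a and t :: real assume "1 \<le> t"
    have "((\<lambda>t. f (c + t *\<^sub>R (x - c))) has_real_derivative ((x - c) \<bullet> f' (c + t *\<^sub>R (x - c)))) (at t)"
      by (rule GDERIV_line[OF f])
    then show "((\<lambda>t. (f (c + t *\<^sub>R (x - c)))\<^sup>2) has_real_derivative D (c + t *\<^sub>R (x - c)) / t) (at t)"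
      using \<open>1 \<le> t\<close> by (auto intro!: derivative_eq_intros simp: D_def)
  qed
  also have "\<dots> \<le> (\<integral>x. (?N + r) * ((norm (f x))\<^sup>2 + (norm (f' x))\<^sup>2) \<partial>?M)"
  proof (rule integral_mono)
    show "integrable ?M (\<lambda>x. ?N * (f x)\<^sup>2 + D x)"
    proof (intro Bochner_Integration.integrable_add integrable_mult_right)
      show "integrable ?M (\<lambda>x. (f x)\<^sup>2)" using fL(1) by (simp add: L2_def)
      interpret finite_measure ?M by (rule finite_measure_lebesgue_ball)
      show "integrable ?M D" by (rule L2_integrable[OF L2_continuous_ball[OF Dc]])
    qed
    show "integrable ?M (\<lambda>x. (?N + r) * ((norm (f x))\<^sup>2 + (norm (f' x))\<^sup>2))"
      using fL by (auto simp: L2_def)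
    fix x assume "x \<in> space ?M"
    then have x: "norm (x - c) \<le> r" by (simp add: space_restrict_space dist_norm norm_minus_commute)
    have "\<bar>(x - c) \<bullet> f' x\<bar> \<le> norm (x - c) * norm (f' x)" by (rule Cauchy_Schwarz_ineq2)
    also have "\<dots> \<le> r * norm (f' x)" by (rule mult_right_mono[OF x]) simp
    finally have "\<bar>f x\<bar> * \<bar>(x - c) \<bullet> f' x\<bar> \<le> \<bar>f x\<bar> * (r * norm (f' x))" by (rule mult_left_mono) simp
    moreover have "f x * ((x - c) \<bullet> f' x) \<le> \<bar>f x\<bar> * \<bar>(x - c) \<bullet> f' x\<bar>" by (metis abs_ge_self abs_mult)
    ultimately have "2 * (f x * ((x - c) \<bullet> f' x)) \<le> 2 * (\<bar>f x\<bar> * (r * norm (f' x)))" by linarith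
    then have "D x \<le> r * (2 * \<bar>f x\<bar> * norm (f' x))" unfolding D_def by (simp add: mult_ac)
    also have "\<dots> \<le> r * (\<bar>f x\<bar>\<^sup>2 + (norm (f' x))\<^sup>2)"
      using r by (intro mult_left_mono sum_squares_bound) auto
    finally have "?N * (f x)\<^sup>2 + D x \<le> ?N * (f x)\<^sup>2 + r * ((f x)\<^sup>2 + (norm (f' x))\<^sup>2)" by simp
    also have "\<dots> \<le> (?N + r) * ((norm (f x))\<^sup>2 + (norm (f' x))\<^sup>2)"
      by (simp add: algebra_simps)
    finally show "?N * (f x)\<^sup>2 + D x \<le> (?N + r) * ((norm (f x))\<^sup>2 + (norm (f' x))\<^sup>2)" .
  qed
  also have "\<dots> = (?N + r) * ((l2 ?M f)\<^sup>2 + (l2 ?M f')\<^sup>2)"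
    using fL by (simp add: L2_def l2_power2)
  finally have 1: "?N * (\<integral>x. (f (sphere_proj c r x))\<^sup>2 \<partial>?M) \<le> (?N + r) * ((l2 ?M f)\<^sup>2 + (l2 ?M f')\<^sup>2)" .
  have "(l2 ?S f)\<^sup>2 = ?N / r * (\<integral>x. (f (sphere_proj c r x))\<^sup>2 \<partial>?M)"
    unfolding l2_power2 using fm by (subst integral_sphere_measure(1)[OF r]) auto
  also have "\<dots> \<le> C * ((l2 ?M f)\<^sup>2 + (l2 ?M f')\<^sup>2)"
    using 1 r by (simp add: C_def field_simps)
  also have "\<dots> \<le> C * (l2 ?M f + l2 ?M f')\<^sup>2"
    using r by (intro mult_left_mono) (auto simp: C_def power2_sum)
  also have "\<dots> = (sqrt C * (l2 ?M f + l2 ?M f'))\<^sup>2"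
    using r by (simp add: C_def power_mult_distrib)
  finally show ?thesis by (rule power2_le_imp_le) (use r in \<open>simp add: C_def\<close>)
qed

lemma smooth_L2:
  fixes f :: "'a::euclidean_space \<Rightarrow> real"
  assumes "smooth f"
  shows "L2 (lebesgue_on (ball c r)) f" "L2 (lebesgue_on (ball c r)) (grad f)"
    and "r > 0 \<Longrightarrow> L2 (sphere_measure c r) f"
proof -
  note c = continuous_on_subset[OF smooth_continuous[OF assms] subset_UNIV]
  show "L2 (lebesgue_on (ball c r)) f" by (rule L2_continuous_ball[OF c])
  show "L2 (lebesgue_on (ball c r)) (grad f)"
    by (rule L2_continuous_ball[OF continuous_on_subset[OF smooth_continuous_grad[OF assms] subset_UNIV]])
  show "L2 (sphere_measure c r) f" if "r > 0"
    by (rule L2_continuous_sphere[OF that c borel_measurable_continuous_onI[OF smooth_continuous[OF assms]]])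
qed

text \<open>Convergence of smooth functions to \<open>u\<close>, of their gradients to \<open>G\<close> and of their restrictions
  to the sphere to \<open>g\<close>.\<close>

definition H1_approx :: "'a::euclidean_space \<Rightarrow> real \<Rightarrow> (nat \<Rightarrow> 'a \<Rightarrow> real) \<Rightarrow> ('a \<Rightarrow> real) \<Rightarrow> ('a \<Rightarrow> 'a) \<Rightarrow> ('a \<Rightarrow> real) \<Rightarrow> bool"
  where "H1_approx c r \<phi> u G g \<longleftrightarrow> (\<forall>n. smooth (\<phi> n)) \<and>
    (\<lambda>n. l2 (lebesgue_on (ball c r)) (\<lambda>x. \<phi> n x - u x)) \<longlonglongrightarrow> 0 \<and>
    (\<lambda>n. l2 (lebesgue_on (ball c r)) (\<lambda>x. grad (\<phi> n) x - G x)) \<longlonglongrightarrow> 0 \<and>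
    (\<lambda>n. l2 (sphere_measure c r) (\<lambda>x. \<phi> n x - g x)) \<longlonglongrightarrow> 0"

text \<open>The H1 distance in \<open>is_trace\<close> is a single integral of a sum; both summands
  are integrable and nonnegative, so it tends to 0 exactly when the two L2 distances do.\<close>

lemma is_trace_iff:
  fixes c :: "'a::euclidean_space"
  assumes r: "r > 0" and u: "L2 (lebesgue_on (ball c r)) u"
    and G: "L2 (lebesgue_on (ball c r)) (weak_grad (ball c r) u)"
  shows "is_trace c r u g \<longleftrightarrow> L2 (sphere_measure c r) g \<and>
    (\<exists>\<phi>. H1_approx c r \<phi> u (weak_grad (ball c r) u) g)"
proof -
  let ?M = "lebesgue_on (ball c r)" and ?G = "weak_grad (ball c r) u"
  have "(\<lambda>n. \<integral>x. (\<phi> n x - u x)\<^sup>2 + (norm (grad (\<phi> n) x - ?G x))\<^sup>2 \<partial>?M) \<longlonglongrightarrow> 0 \<longleftrightarrow>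
     (\<lambda>n. l2 ?M (\<lambda>x. \<phi> n x - u x)) \<longlonglongrightarrow> 0 \<and> (\<lambda>n. l2 ?M (\<lambda>x. grad (\<phi> n) x - ?G x)) \<longlonglongrightarrow> 0"
    if sm: "\<And>n. smooth (\<phi> n)" for \<phi> :: "nat \<Rightarrow> 'a \<Rightarrow> real"
  proof -
    have eq: "(\<integral>x. (\<phi> n x - u x)\<^sup>2 + (norm (grad (\<phi> n) x - ?G x))\<^sup>2 \<partial>?M) =
       (\<integral>x. (norm (\<phi> n x - u x))\<^sup>2 \<partial>?M) + (\<integral>x. (norm (grad (\<phi> n) x - ?G x))\<^sup>2 \<partial>?M)" for n
    proof -
      have "integrable ?M (\<lambda>x. (norm (\<phi> n x - u x))\<^sup>2)"
        by (intro L2_integrable_sq L2_diff smooth_L2(1) sm u)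
      moreover have "integrable ?M (\<lambda>x. (norm (grad (\<phi> n) x - ?G x))\<^sup>2)"
        by (intro L2_integrable_sq L2_diff smooth_L2(2) sm G)
      ultimately show ?thesis by (subst Bochner_Integration.integral_add[symmetric]) simp_all
    qed
    have sum0: "(\<lambda>n. a n + b n) \<longlonglongrightarrow> 0 \<longleftrightarrow> a \<longlonglongrightarrow> 0 \<and> b \<longlonglongrightarrow> 0"
      if nn: "\<And>n. 0 \<le> a n" "\<And>n. 0 \<le> b n" for a b :: "nat \<Rightarrow> real"
    proof
      assume lim: "(\<lambda>n. a n + b n) \<longlonglongrightarrow> 0"
      have "a \<longlonglongrightarrow> 0"
        by (rule Lim_null_comparison[OF _ lim]) (simp add: nn)
      moreover have "b \<longlonglongrightarrow> 0"
        by (rule Lim_null_comparison[OF _ lim]) (simp add: nn)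
      ultimately show "a \<longlonglongrightarrow> 0 \<and> b \<longlonglongrightarrow> 0" ..
    next
      assume "a \<longlonglongrightarrow> 0 \<and> b \<longlonglongrightarrow> 0"
      then show "(\<lambda>n. a n + b n) \<longlonglongrightarrow> 0"
        using tendsto_add[of a 0 sequentially b 0] by simp
    qed
    show ?thesis unfolding l2_tendsto_0_iff eq by (rule sum0) auto
  qed
  moreover have "(\<lambda>n. \<integral>x. (\<phi> n x - g x)\<^sup>2 \<partial>sphere_measure c r) \<longlonglongrightarrow> 0 \<longleftrightarrow>
    (\<lambda>n. l2 (sphere_measure c r) (\<lambda>x. \<phi> n x - g x)) \<longlonglongrightarrow> 0" for \<phi> :: "nat \<Rightarrow> 'a \<Rightarrow> real"
    unfolding l2_tendsto_0_iff by simp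
  ultimately have "((\<forall>n. smooth (\<phi> n)) \<and>
      (\<lambda>n. \<integral>x. (\<phi> n x - u x)\<^sup>2 + (norm (grad (\<phi> n) x - ?G x))\<^sup>2 \<partial>?M) \<longlonglongrightarrow> 0 \<and>
      (\<lambda>n. \<integral>x. (\<phi> n x - g x)\<^sup>2 \<partial>sphere_measure c r) \<longlonglongrightarrow> 0) \<longleftrightarrow> H1_approx c r \<phi> u ?G g" for \<phi>
    unfolding H1_approx_def by blast
  then show ?thesis unfolding is_trace_def by simp
qed

lemma smooth_diff_trace_inequality:
  fixes f g :: "'a::euclidean_space \<Rightarrow> real"
  assumes r: "r > 0" and f: "smooth f" and g: "smooth g"
  shows "l2 (sphere_measure c r) (\<lambda>x. f x - g x) \<le> sqrt ((real DIM('a) + r) / r) *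
    (l2 (lebesgue_on (ball c r)) (\<lambda>x. f x - g x) + l2 (lebesgue_on (ball c r)) (\<lambda>x. grad f x - grad g x))"
proof (rule C1_trace_inequality[OF r])
  show "GDERIV (\<lambda>x. f x - g x) x :> grad f x - grad g x" for x
    by (intro GDERIV_diff smooth_GDERIV f g)
  show "continuous_on UNIV (\<lambda>x. grad f x - grad g x)"
    by (intro continuous_on_diff smooth_continuous_grad f g)
qed

lemma mollifier_exists:
  assumes "r > 0"
  obtains \<eta> :: "'a::euclidean_space \<Rightarrow> real" where "mollifier r \<eta>"
proof -
  from bump_exists obtain \<eta> :: "'a \<Rightarrow> real" where
    "smooth \<eta>" "\<And>x. 0 \<le> \<eta> x" "\<And>x. 1 \<le> norm x \<Longrightarrow> \<eta> x = 0"
    "integrable lborel \<eta>" "(\<integral>x. \<eta> x \<partial>lborel) = 1" by metis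
  then have "mollifier r \<eta>" using assms by (intro mollifier.intro)
  then show ?thesis by (rule that)
qed

lemma H1_weak_grad:
  assumes "u \<in> H1 \<Omega>"
  shows "L2 (lebesgue_on \<Omega>) u" "is_weak_grad \<Omega> u (weak_grad \<Omega> u)" "L2 (lebesgue_on \<Omega>) (weak_grad \<Omega> u)"
proof -
  show "L2 (lebesgue_on \<Omega>) u" using assms by (simp add: H1_def)
  have "\<exists>G. is_weak_grad \<Omega> u G" using assms by (simp add: H1_def)
  then show "is_weak_grad \<Omega> u (weak_grad \<Omega> u)"
    unfolding weak_grad_def by (rule someI_ex)
  then show "L2 (lebesgue_on \<Omega>) (weak_grad \<Omega> u)" unfolding is_weak_grad_def by blast
qed

text \<open>The averages of \<open>u\<close> converge in H1, so by the trace inequality applied to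
  their differences their restrictions form a Cauchy sequence on the sphere.\<close>

lemma H1_trace_exists:
  fixes c :: "'a::euclidean_space"
  assumes r: "r > 0" and u: "u \<in> H1 (ball c r)"
  shows "\<exists>g. is_trace c r u g"
proof -
  let ?M = "lebesgue_on (ball c r)" and ?G = "weak_grad (ball c r) u" and ?S = "sphere_measure c r"
  note uD = H1_weak_grad[OF u]
  obtain \<eta> :: "'a \<Rightarrow> real" where "mollifier r \<eta>" using mollifier_exists[OF r] .
  then interpret mollifier c r \<eta> .
  interpret S: finite_measure ?S by (rule finite_measure_sphere_measure[OF r])
  define \<phi> where "\<phi> n = mollify n u" for n
  have sm: "smooth (\<phi> n)" for n unfolding \<phi>_def by (rule mollify_smooth[OF L2_integrable[OF uD(1)]])
  have l1: "(\<lambda>n. l2 ?M (\<lambda>x. \<phi> n x - u x)) \<longlonglongrightarrow> 0"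
    unfolding \<phi>_def by (rule mollify_tendsto[OF uD(1)])
  have l2: "(\<lambda>n. l2 ?M (\<lambda>x. grad (\<phi> n) x - ?G x)) \<longlonglongrightarrow> 0"
    unfolding \<phi>_def by (rule mollify_grad_tendsto[OF uD(1,2)])
  define C where "C = sqrt ((real DIM('a) + r) / r)"
  have C: "C > 0" using r by (simp add: C_def)
  define d where "d n = l2 ?M (\<lambda>x. \<phi> n x - u x) + l2 ?M (\<lambda>x. grad (\<phi> n) x - ?G x)" for n
  have d: "d \<longlonglongrightarrow> 0" unfolding d_def using tendsto_add[OF l1 l2] by simp
  have le: "l2 ?S (\<lambda>x. \<phi> m x - \<phi> n x) \<le> C * (d m + d n)" for m n
  proof -
    have "l2 ?S (\<lambda>x. \<phi> m x - \<phi> n x) \<le> C * (l2 ?M (\<lambda>x. \<phi> m x - \<phi> n x) + l2 ?M (\<lambda>x. grad (\<phi> m) x - grad (\<phi> n) x))"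
      unfolding C_def by (rule smooth_diff_trace_inequality[OF r sm sm])
    also have "\<dots> \<le> C * (d m + d n)"
    proof (rule mult_left_mono)
      have "l2 ?M (\<lambda>x. \<phi> m x - \<phi> n x) \<le> l2 ?M (\<lambda>x. \<phi> m x - u x) + l2 ?M (\<lambda>x. u x - \<phi> n x)"
        by (intro l2_triangle_diff smooth_L2 sm uD)
      moreover have "l2 ?M (\<lambda>x. grad (\<phi> m) x - grad (\<phi> n) x) \<le> l2 ?M (\<lambda>x. grad (\<phi> m) x - ?G x) + l2 ?M (\<lambda>x. ?G x - grad (\<phi> n) x)"
        by (intro l2_triangle_diff smooth_L2 sm uD)
      ultimately show "l2 ?M (\<lambda>x. \<phi> m x - \<phi> n x) + l2 ?M (\<lambda>x. grad (\<phi> m) x - grad (\<phi> n) x) \<le> d m + d n"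
        unfolding d_def l2_minus_commute[of ?M u] l2_minus_commute[of ?M ?G] by linarith
    qed (use C in simp)
    finally show ?thesis .
  qed
  obtain g where g: "L2 ?S g" "(\<lambda>n. l2 ?S (\<lambda>x. \<phi> n x - g x)) \<longlonglongrightarrow> 0"
  proof (rule S.L2_complete[of \<phi>])
    show "L2 ?S (\<phi> n)" for n by (rule smooth_L2(3)[OF sm r])
    fix e :: real assume "e > 0"
    then have "\<forall>\<^sub>F n in sequentially. d n < e / (2 * C)"
      by (intro order_tendstoD(2)[OF d]) (use C in simp)
    then obtain n0 where n0: "\<And>n. n \<ge> n0 \<Longrightarrow> d n < e / (2 * C)" unfolding eventually_sequentially by blast
    have "l2 ?S (\<lambda>x. \<phi> m x - \<phi> n x) < e" if "m \<ge> n0" "n \<ge> n0" for m n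
    proof -
      have "C * (d m + d n) < C * (e / (2 * C) + e / (2 * C))"
        using n0[OF that(1)] n0[OF that(2)] C by (intro mult_strict_left_mono) auto
      also have "\<dots> = e" using C by (simp add: field_simps)
      finally show ?thesis using le[of m n] by linarith
    qed
    then show "\<exists>n0. \<forall>m\<ge>n0. \<forall>n\<ge>n0. l2 ?S (\<lambda>x. \<phi> m x - \<phi> n x) < e" by blast
  qed
  have "H1_approx c r \<phi> u ?G g" unfolding H1_approx_def using sm l1 l2 g(2) by blast
  then show ?thesis using is_trace_iff[OF r uD(1,3)] g(1) by blast
qed

text \<open>Two smooth sequences with the same H1 limit approach each other in H1, and by the trace
  inequality also on the sphere.\<close>

lemma trace_unique:
  fixes c :: "'a::euclidean_space"
  assumes r: "r > 0" and u: "u \<in> H1 (ball c r)" and g: "is_trace c r u g" and h: "is_trace c r u h"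
  shows "AE x in sphere_measure c r. g x = h x"
proof -
  let ?M = "lebesgue_on (ball c r)" and ?G = "weak_grad (ball c r) u" and ?S = "sphere_measure c r"
  note uD = H1_weak_grad[OF u]
  obtain \<phi> \<psi> where \<phi>: "H1_approx c r \<phi> u ?G g" and \<psi>: "H1_approx c r \<psi> u ?G h"
    and L: "L2 ?S g" "L2 ?S h"
    using g h unfolding is_trace_iff[OF r uD(1,3)] by blast
  note \<phi>' = \<phi>[unfolded H1_approx_def] and \<psi>' = \<psi>[unfolded H1_approx_def]
  have sm: "smooth (\<phi> n)" "smooth (\<psi> n)" for n using \<phi>' \<psi>' by auto
  define C where "C = sqrt ((real DIM('a) + r) / r)"
  have C: "C \<ge> 0" using r by (simp add: C_def)
  have "l2 ?S (\<lambda>x. g x - h x) \<le> l2 ?S (\<lambda>x. \<phi> n x - g x) + C * ((l2 ?M (\<lambda>x. \<phi> n x - u x) + l2 ?M (\<lambda>x. \<psi> n x - u x))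
     + (l2 ?M (\<lambda>x. grad (\<phi> n) x - ?G x) + l2 ?M (\<lambda>x. grad (\<psi> n) x - ?G x))) + l2 ?S (\<lambda>x. \<psi> n x - h x)" for n
  proof -
    have "l2 ?S (\<lambda>x. \<phi> n x - \<psi> n x) \<le> C * (l2 ?M (\<lambda>x. \<phi> n x - \<psi> n x) + l2 ?M (\<lambda>x. grad (\<phi> n) x - grad (\<psi> n) x))"
      unfolding C_def by (rule smooth_diff_trace_inequality[OF r sm])
    also have "\<dots> \<le> C * ((l2 ?M (\<lambda>x. \<phi> n x - u x) + l2 ?M (\<lambda>x. \<psi> n x - u x))
     + (l2 ?M (\<lambda>x. grad (\<phi> n) x - ?G x) + l2 ?M (\<lambda>x. grad (\<psi> n) x - ?G x)))"
    proof (rule mult_left_mono[OF _ C], rule add_mono)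
      show "l2 ?M (\<lambda>x. \<phi> n x - \<psi> n x) \<le> l2 ?M (\<lambda>x. \<phi> n x - u x) + l2 ?M (\<lambda>x. \<psi> n x - u x)"
        unfolding l2_minus_commute[of ?M "\<psi> n" u] by (intro l2_triangle_diff smooth_L2 sm uD)
      show "l2 ?M (\<lambda>x. grad (\<phi> n) x - grad (\<psi> n) x) \<le> l2 ?M (\<lambda>x. grad (\<phi> n) x - ?G x) + l2 ?M (\<lambda>x. grad (\<psi> n) x - ?G x)"
        unfolding l2_minus_commute[of ?M "grad (\<psi> n)" ?G] by (intro l2_triangle_diff smooth_L2 sm uD)
    qed
    finally have 1: "l2 ?S (\<lambda>x. \<phi> n x - \<psi> n x) \<le> C * ((l2 ?M (\<lambda>x. \<phi> n x - u x) + l2 ?M (\<lambda>x. \<psi> n x - u x))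
     + (l2 ?M (\<lambda>x. grad (\<phi> n) x - ?G x) + l2 ?M (\<lambda>x. grad (\<psi> n) x - ?G x)))" .
    have "l2 ?S (\<lambda>x. g x - h x) \<le> l2 ?S (\<lambda>x. g x - \<phi> n x) + l2 ?S (\<lambda>x. \<phi> n x - h x)"
      by (intro l2_triangle_diff L smooth_L2(3) sm r)
    also have "l2 ?S (\<lambda>x. \<phi> n x - h x) \<le> l2 ?S (\<lambda>x. \<phi> n x - \<psi> n x) + l2 ?S (\<lambda>x. \<psi> n x - h x)"
      by (intro l2_triangle_diff L smooth_L2(3) sm r)
    finally show ?thesis using 1 by (simp add: l2_minus_commute[of ?S g])
  qed
  moreover have "(\<lambda>n. l2 ?S (\<lambda>x. \<phi> n x - g x) + C * ((l2 ?M (\<lambda>x. \<phi> n x - u x) + l2 ?M (\<lambda>x. \<psi> n x - u x))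
     + (l2 ?M (\<lambda>x. grad (\<phi> n) x - ?G x) + l2 ?M (\<lambda>x. grad (\<psi> n) x - ?G x))) + l2 ?S (\<lambda>x. \<psi> n x - h x)) \<longlonglongrightarrow> 0 + C * ((0 + 0) + (0 + 0)) + 0"
    using \<phi>' \<psi>' by (intro tendsto_intros) auto
  ultimately have "l2 ?S (\<lambda>x. g x - h x) \<le> 0 + C * ((0 + 0) + (0 + 0)) + 0"
    by (intro LIMSEQ_le_const) auto
  then have "l2 ?S (\<lambda>x. g x - h x) = 0" using l2_nonneg[of ?S "\<lambda>x. g x - h x"] by simp
  from l2_eq_0_AE[OF L2_diff[OF L] this] show ?thesis by simp
qed

text \<open>The only access to the function picked by \<open>boundary_trace\<close>: one sequence
  approximates the function, its weak gradient and its trace at the same time.\<close>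

lemma H1_approx_exists:
  fixes c :: "'a::euclidean_space"
  assumes r: "r > 0" and u: "u \<in> H1 (ball c r)"
  obtains \<phi> where "H1_approx c r \<phi> u (weak_grad (ball c r) u) (boundary_trace c r u)"
    "L2 (sphere_measure c r) (boundary_trace c r u)"
proof -
  have "is_trace c r u (boundary_trace c r u)"
    unfolding boundary_trace_def by (rule someI_ex[OF H1_trace_exists[OF r u]])
  then show ?thesis using that is_trace_iff[OF r H1_weak_grad(1,3)[OF u]] by blast
qed

section \<open>Continuously differentiable functions as elements of H1\<close>

text \<open>Difference quotients integrate to 0 by translation invariance. They converge to the
  partial derivative and are dominated by the Lipschitz constant on a ball enlarged by 1, since the
  steps have length at most 1.\<close>

lemma integral_gradient_eq_0:
  fixes F :: "'a::euclidean_space \<Rightarrow> real"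
  assumes F: "\<And>x. GDERIV F x :> F' x" and F': "continuous_on UNIV F'"
    and supp: "\<And>x. norm x > R \<Longrightarrow> F x = 0" "\<And>x. norm x > R \<Longrightarrow> F' x = 0"
  shows "(\<integral>x. F' x \<partial>lborel) = 0"
proof -
  have Fc: "continuous_on UNIV F" by (rule GDERIV_continuous_on) (rule F)
  obtain K where K: "K \<ge> 0" "\<And>x. norm (F' x) \<le> K" using bounded_support_bounded[OF F' supp(2)] by metis
  have Fi: "integrable lborel F" and F'i: "integrable lborel F'"
    by (rule integrable_continuous_bounded_support[OF Fc supp(1)] integrable_continuous_bounded_support[OF F' supp(2)]; simp)+
  have [measurable]: "F \<in> borel_measurable borel" "F' \<in> borel_measurable borel"
    by (intro borel_measurable_continuous_onI Fc F')+
  have "(\<integral>x. F' x \<partial>lborel) \<bullet> b = 0" if b: "b \<in> Basis" for b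
  proof -
    have nb: "norm b = 1" using b by simp
    define q where "q n x = (F (x + (1 / real (Suc n)) *\<^sub>R b) - F x) * real (Suc n)" for n x
    have q0: "(\<integral>x. q n x \<partial>lborel) = 0" for n
    proof -
      have "(\<integral>x. F ((1 / real (Suc n)) *\<^sub>R b + 1 *\<^sub>R x) \<partial>lborel) = (\<integral>x. F x \<partial>lborel)"
        by (subst lborel_integral_affine(1)) auto
      moreover have "integrable lborel (\<lambda>x. F ((1 / real (Suc n)) *\<^sub>R b + 1 *\<^sub>R x))"
        by (rule lborel_integral_affine(2)) (use Fi in auto)
      ultimately show ?thesis using Fi by (simp add: q_def add.commute)
    qed
    have "(\<lambda>n. \<integral>x. q n x \<partial>lborel) \<longlonglongrightarrow> (\<integral>x. F' x \<bullet> b \<partial>lborel)"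
    proof (rule integral_dominated_convergence[where w = "\<lambda>x. indicator (cball 0 (\<bar>R\<bar> + 1)) x * K"])
      show "integrable lborel (\<lambda>x. indicator (cball (0::'a) (\<bar>R\<bar> + 1)) x * K)"
        by (intro integrable_mult_left integrable_real_indicator) (use emeasure_lborel_cball_finite[of "0::'a" "\<bar>R\<bar> + 1"] in auto)
      show "q n \<in> borel_measurable lborel" for n unfolding q_def[abs_def] by measurable
      show "AE x in lborel. (\<lambda>n. q n x) \<longlonglongrightarrow> F' x \<bullet> b"
      proof (rule AE_I2)
        fix x
        have "((\<lambda>t. F (x + t *\<^sub>R b)) has_real_derivative (b \<bullet> F' x)) (at 0)"
          by (rule GDERIV_line) (simp add: F)
        then have "((\<lambda>h. (F (x + h *\<^sub>R b) - F x) / h) \<longlongrightarrow> b \<bullet> F' x) (at 0)"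
          by (simp add: DERIV_def)
        moreover have "filterlim (\<lambda>n. 1 / real (Suc n)) (at 0) sequentially"
          using LIMSEQ_inverse_real_of_nat by (auto simp: filterlim_at inverse_eq_divide intro!: always_eventually)
        ultimately have "(\<lambda>n. (F (x + (1 / real (Suc n)) *\<^sub>R b) - F x) / (1 / real (Suc n))) \<longlonglongrightarrow> b \<bullet> F' x"
          by (rule filterlim_compose)
        then show "(\<lambda>n. q n x) \<longlonglongrightarrow> F' x \<bullet> b" by (simp add: q_def inner_commute)
      qed
      show "AE x in lborel. norm (q n x) \<le> indicator (cball 0 (\<bar>R\<bar> + 1)) x * K" for n
      proof (rule AE_I2)
        fix x
        let ?h = "1 / real (Suc n)"
        have "\<bar>F (x + ?h *\<^sub>R b) - F x\<bar> \<le> K * norm (x + ?h *\<^sub>R b - x)"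
          by (rule GDERIV_bounded_Lipschitz[OF convex_UNIV F K(2)]) auto
        then have "\<bar>F (x + ?h *\<^sub>R b) - F x\<bar> \<le> K * ?h" using nb by simp
        then have "\<bar>F (x + ?h *\<^sub>R b) - F x\<bar> * real (Suc n) \<le> K * ?h * real (Suc n)"
          by (rule mult_right_mono) simp
        then have "\<bar>q n x\<bar> \<le> K * ?h * real (Suc n)"
          by (simp add: q_def abs_mult del: of_nat_Suc)
        then have qK: "\<bar>q n x\<bar> \<le> K" by simp
        show "norm (q n x) \<le> indicator (cball 0 (\<bar>R\<bar> + 1)) x * K"
        proof (cases "x \<in> cball 0 (\<bar>R\<bar> + 1)")
          case False
          then have "norm x > \<bar>R\<bar> + 1" by simp
          moreover have "norm x \<le> norm (x + ?h *\<^sub>R b) + norm (?h *\<^sub>R b)"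
            by (metis add_diff_cancel_right' norm_triangle_ineq4)
          moreover have "norm (?h *\<^sub>R b) \<le> 1" using nb by simp
          ultimately have "norm x > R" "norm (x + ?h *\<^sub>R b) > R" by linarith+
          then show ?thesis using supp(1) K(1) by (simp add: q_def)
        qed (use qK in simp)
      qed
    qed (use F'i in auto)
    then have "(\<integral>x. F' x \<bullet> b \<partial>lborel) = 0" unfolding q0 by (simp add: LIMSEQ_const_iff)
    then show ?thesis using F'i by simp
  qed
  then show ?thesis by (intro euclidean_eqI[of "\<integral>x. F' x \<partial>lborel" 0]) simp
qed

text \<open>Integration by parts: the product with a test function has bounded support, so its
  gradient integrates to 0.\<close>

lemma C1_weak_grad:
  fixes f :: "'a::euclidean_space \<Rightarrow> real"
  assumes f: "\<And>x. GDERIV f x :> f' x" and f': "continuous_on UNIV f'"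
  shows "is_weak_grad (ball c r) f f'"
  unfolding is_weak_grad_def
proof (intro conjI allI impI)
  let ?M = "lebesgue_on (ball c r)"
  have fc: "continuous_on S f" for S by (rule GDERIV_continuous_on) (rule f)
  show f'L: "L2 ?M f'" by (rule L2_continuous_ball) (rule continuous_on_subset[OF f'], simp)
  fix \<phi> assume "test_function (ball c r) \<phi>"
  then have sm: "smooth \<phi>" and supp: "closure {x. \<phi> x \<noteq> 0} \<subseteq> ball c r" unfolding test_function_def by auto
  have \<phi>0: "\<phi> x = 0" if "x \<notin> ball c r" for x
    using that supp closure_subset[of "{x. \<phi> x \<noteq> 0}"] by blast
  have g0: "grad \<phi> x = 0" if "x \<notin> ball c r" for x
  proof (rule grad_eqI)
    have "GDERIV (\<lambda>_. 0) x :> 0" by (rule GDERIV_const)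
    then show "GDERIV \<phi> x :> 0" unfolding gderiv_def
      by (rule has_derivative_transform_within_open[where s = "- closure {x. \<phi> x \<noteq> 0}"])
         (use that supp closure_subset[of "{x. \<phi> x \<noteq> 0}"] in \<open>auto simp: closed_def[symmetric]\<close>)
  qed
  let ?F' = "\<lambda>x. f x *\<^sub>R grad \<phi> x + \<phi> x *\<^sub>R f' x"
  have out: "x \<notin> ball c r" if "norm x > norm c + r" for x
    using that norm_triangle_ineq2[of x c] by (auto simp: dist_norm norm_minus_commute)
  have F'c: "continuous_on UNIV ?F'"
    by (intro continuous_intros fc f' smooth_continuous smooth_continuous_grad sm)
  have "(\<integral>x. ?F' x \<partial>lborel) = 0"
  proof (rule integral_gradient_eq_0[where R = "norm c + r"])
    show "GDERIV (\<lambda>x. f x * \<phi> x) x :> ?F' x" for x by (intro GDERIV_mult f smooth_GDERIV sm)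
  qed (use out F'c in \<open>auto simp: \<phi>0 g0\<close>)
  moreover have "(\<integral>x. ?F' x \<partial>?M) = (\<integral>x. ?F' x \<partial>lborel)"
  proof -
    have [measurable]: "?F' \<in> borel_measurable borel" by (rule borel_measurable_continuous_onI[OF F'c])
    have "(\<integral>x. ?F' x \<partial>?M) = (\<integral>x. indicator (ball c r) x *\<^sub>R ?F' x \<partial>lebesgue)"
      by (subst integral_restrict_space) auto
    also have "\<dots> = (\<integral>x. ?F' x \<partial>lebesgue)"
      by (intro Bochner_Integration.integral_cong) (auto simp: indicator_def \<phi>0 g0)
    also have "\<dots> = (\<integral>x. ?F' x \<partial>lborel)" by (rule integral_completion) simp
    finally show ?thesis .
  qed
  moreover have "(\<integral>x. ?F' x \<partial>?M) = (\<integral>x. f x *\<^sub>R grad \<phi> x \<partial>?M) + (\<integral>x. \<phi> x *\<^sub>R f' x \<partial>?M)"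
    by (rule Bochner_Integration.integral_add[OF
          L2_scaleR_integrable[OF L2_continuous_ball[OF fc] smooth_L2(2)[OF sm]]
          L2_scaleR_integrable[OF smooth_L2(1)[OF sm] f'L]])
  ultimately show "(\<integral>x. f x *\<^sub>R grad \<phi> x \<partial>?M) = - (\<integral>x. \<phi> x *\<^sub>R f' x \<partial>?M)"
    by (simp add: eq_neg_iff_add_eq_0)
qed

text \<open>Evaluates the two choice operators on classical functions. For the trace, the averages
  converge pointwise and boundedly on the sphere, and uniqueness of traces does the rest.\<close>

lemma C1_H1:
  fixes f :: "'a::euclidean_space \<Rightarrow> real"
  assumes r: "r > 0" and f: "\<And>x. GDERIV f x :> f' x" and f': "continuous_on UNIV f'"
  shows "f \<in> H1 (ball c r)" "AE x in lebesgue_on (ball c r). weak_grad (ball c r) f x = f' x"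
    and "AE x in sphere_measure c r. boundary_trace c r f x = f x"
proof -
  let ?M = "lebesgue_on (ball c r)" and ?S = "sphere_measure c r"
  have fc: "continuous_on S f" for S by (rule GDERIV_continuous_on) (rule f)
  have fm[measurable]: "f \<in> borel_measurable borel" by (rule borel_measurable_continuous_onI[OF fc])
  have w: "is_weak_grad (ball c r) f f'" by (rule C1_weak_grad[OF f f'])
  show H: "f \<in> H1 (ball c r)" unfolding H1_def using w L2_continuous_ball[OF fc] by blast
  note D = H1_weak_grad[OF H]
  obtain \<eta> :: "'a \<Rightarrow> real" where "mollifier r \<eta>" using mollifier_exists[OF r] .
  then interpret mollifier c r \<eta> .
  interpret S: finite_measure ?S by (rule finite_measure_sphere_measure[OF r])
  show "AE x in ?M. weak_grad (ball c r) f x = f' x" by (rule weak_grad_unique[OF D(2) w])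
  have sm: "smooth (mollify n f)" for n by (rule mollify_smooth[OF L2_integrable[OF D(1)]])
  obtain K where K: "\<And>x. x \<in> cball c r \<Longrightarrow> norm (f x) \<le> K" using continuous_bounded_cball[OF fc] by metis
  have [measurable]: "mollify n f \<in> borel_measurable borel" for n
    by (rule borel_measurable_continuous_onI[OF smooth_continuous[OF sm]])
  have "(\<lambda>n. \<integral>x. (norm (mollify n f x - f x))\<^sup>2 \<partial>?S) \<longlonglongrightarrow> (\<integral>x. 0 \<partial>?S)"
  proof (rule integral_dominated_convergence[where w = "\<lambda>x. (K + K)\<^sup>2"])
    show "AE x in ?S. (\<lambda>n. (norm (mollify n f x - f x))\<^sup>2) \<longlonglongrightarrow> 0"
      using AE_sphere_measure[OF r, of c]
    proof eventually_elim
      fix x assume "x \<in> sphere c r"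
      then have "x \<in> cball c r" by auto
      from mollify_pointwise[OF fc this]
      have "(\<lambda>n. (norm (mollify n f x - f x))\<^sup>2) \<longlonglongrightarrow> (norm (f x - f x))\<^sup>2" by (intro tendsto_intros)
      then show "(\<lambda>n. (norm (mollify n f x - f x))\<^sup>2) \<longlonglongrightarrow> 0" by simp
    qed
    show "AE x in ?S. norm ((norm (mollify n f x - f x))\<^sup>2) \<le> (K + K)\<^sup>2" for n
      using AE_sphere_measure[OF r, of c]
    proof eventually_elim
      fix x assume "x \<in> sphere c r"
      then have x: "x \<in> cball c r" by auto
      have "norm (mollify n f x) \<le> K"
        by (rule mollify_bounded[OF continuous_borel_measurable_lebesgue_on[OF fc] _ x]) (use K in auto)
      then have "norm (mollify n f x - f x) \<le> K + K"
        using norm_triangle_ineq4[of "mollify n f x" "f x"] K[OF x] by linarith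
      then have "(norm (mollify n f x - f x))\<^sup>2 \<le> (K + K)\<^sup>2" by (rule power_mono) simp
      then show "norm ((norm (mollify n f x - f x))\<^sup>2) \<le> (K + K)\<^sup>2"
        by (subst real_norm_def, subst abs_of_nonneg) auto
    qed
  qed auto
  then have "(\<lambda>n. l2 ?S (\<lambda>x. mollify n f x - f x)) \<longlonglongrightarrow> 0" unfolding l2_tendsto_0_iff by simp
  then have "H1_approx c r (\<lambda>n. mollify n f) f (weak_grad (ball c r) f) f"
    unfolding H1_approx_def using sm mollify_tendsto[OF D(1)] mollify_grad_tendsto[OF D(1,2)] by blast
  then have "is_trace c r f f"
    using is_trace_iff[OF r D(1,3)] L2_continuous_sphere[OF r fc fm] by blast
  moreover have "is_trace c r f (boundary_trace c r f)"
    unfolding boundary_trace_def by (rule someI_ex[OF H1_trace_exists[OF r H]])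
  ultimately show "AE x in ?S. boundary_trace c r f x = f x" using trace_unique[OF r H] by blast
qed

section \<open>The radial equation\<close>

text \<open>Truncation makes the nonlinearity bounded and globally Lipschitz. It is harmless: the
  profile starts at 1, decreases, and is used only where it is still positive.\<close>

definition clamp_powr :: "real \<Rightarrow> real \<Rightarrow> real" where
  "clamp_powr p x = (max 0 (min 1 x)) powr p"

text \<open>The derivative \<open>p * z powr (p - 1)\<close> is at most 2 on the unit interval. The
  endpoint 0 is handled directly, so that the mean value theorem is applied only to positive
  arguments.\<close>

lemma powr_Lipschitz_unit:
  fixes a b p :: real
  assumes p: "1 < p" "p \<le> 2" and ab: "0 \<le> a" "a \<le> b" "b \<le> 1"
  shows "b powr p - a powr p \<le> 2 * (b - a)"
proof (cases "a = 0")
  case True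
  have "b powr p = b powr 1 * b powr (p - 1)" using powr_add[of b 1 "p - 1"] by simp
  also have "\<dots> \<le> b powr 1" using p ab by (intro mult_left_le powr_le1) auto
  finally show ?thesis using True p ab by auto
next
  case False
  then have a: "a > 0" using ab by simp
  show ?thesis
  proof (cases "a = b")
    case False
    then have "a < b" using ab by simp
    obtain z where z: "a < z" "z < b" "b powr p - a powr p = (b - a) * (p * z powr (p - 1))"
    proof -
      have "\<exists>z>a. z < b \<and> b powr p - a powr p = (b - a) * (p * z powr (p - 1))"
        by (rule MVT2[OF \<open>a < b\<close>, of "\<lambda>x. x powr p"]) (use a in \<open>auto intro!: derivative_eq_intros\<close>)
      then show ?thesis using that by blast
    qed
    have "z powr (p - 1) \<le> 1" by (rule powr_le1) (use p z a ab in auto)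
    then have "p * z powr (p - 1) \<le> 2 * 1" using p by (intro mult_mono) auto
    then show ?thesis unfolding z(3) using ab by (subst mult.commute) (intro mult_right_mono, auto)
  qed simp
qed

lemma clamp_powr_Lipschitz:
  assumes p: "1 < p" "p \<le> 2"
  shows "\<bar>clamp_powr p x - clamp_powr p y\<bar> \<le> 2 * \<bar>x - y\<bar>"
proof -
  define c where "c x = max 0 (min 1 x)" for x :: real
  have c: "0 \<le> c x" "c x \<le> 1" for x by (auto simp: c_def)
  have le: "c x powr p \<le> c y powr p" if "c x \<le> c y" for x y
    by (rule powr_mono2) (use that p c in auto)
  have main: "\<bar>c x powr p - c y powr p\<bar> \<le> 2 * \<bar>c x - c y\<bar>" if "c x \<le> c y" for x y
    using powr_Lipschitz_unit[OF p c(1) that c(2)] le[OF that] that by simp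
  have "\<bar>c x powr p - c y powr p\<bar> \<le> 2 * \<bar>c x - c y\<bar>"
    using main[of x y] main[of y x] by (cases "c x \<le> c y") (auto simp: abs_minus_commute)
  also have "\<bar>c x - c y\<bar> \<le> \<bar>x - y\<bar>" by (auto simp: c_def max_def min_def)
  finally show ?thesis by (simp add: clamp_powr_def c_def)
qed

lemma clamp_powr_range: "p > 0 \<Longrightarrow> 0 \<le> clamp_powr p x \<and> clamp_powr p x \<le> 1"
  unfolding clamp_powr_def by (auto intro: powr_le1)

lemma clamp_powr_continuous: "p > 0 \<Longrightarrow> continuous_on S (clamp_powr p)"
  unfolding clamp_powr_def[abs_def] by (intro continuous_intros continuous_on_powr') auto

lemma clamp_powr_mono: "p > 0 \<Longrightarrow> x \<le> y \<Longrightarrow> clamp_powr p x \<le> clamp_powr p y"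
  unfolding clamp_powr_def by (rule powr_mono2) auto

lemma clamp_powr_eq: "0 \<le> x \<Longrightarrow> x \<le> 1 \<Longrightarrow> clamp_powr p x = x powr p"
  unfolding clamp_powr_def by simp

lemma integral_monomial:
  assumes "0 \<le> (t::real)" "N > 0"
  shows "((\<lambda>\<sigma>. \<sigma> ^ (N - 1)) has_integral t ^ N / real N) {0..t}"
proof -
  have "((\<lambda>\<sigma>. \<sigma> ^ (N - 1)) has_integral (t ^ N / real N - 0 ^ N / real N)) {0..t}"
    using assms
    by (intro fundamental_theorem_of_calculus)
       (auto intro!: derivative_eq_intros simp flip: has_real_derivative_iff_has_vector_derivative)
  then show ?thesis using assms by (simp add: zero_power)
qed

section \<open>A global radial solution by Picard iteration\<close>

context
  fixes N :: nat and p :: real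
  assumes N: "N \<ge> 2" and p: "1 < p" "p \<le> 2"
begin

text \<open>The radial equation \<open>(s^(N-1) U')' = - s^(N-1) U^p\<close> integrated once: for a
  solution with \<open>U 0 = 1\<close> this is \<open>- s^(N-1) U'\<close>, and the second
  integration, \<open>profile_drop\<close>, is \<open>1 - U\<close>.\<close>

definition flux :: "(real \<Rightarrow> real) \<Rightarrow> real \<Rightarrow> real" where
  "flux U t = integral {0..t} (\<lambda>\<sigma>. \<sigma> ^ (N - 1) * clamp_powr p (U \<sigma>))"

definition profile_drop :: "(real \<Rightarrow> real) \<Rightarrow> real \<Rightarrow> real" where
  "profile_drop U s = integral {0..s} (\<lambda>t. flux U t / t ^ (N - 1))"

lemma flux_integrand_continuous:
  "continuous_on UNIV U \<Longrightarrow> continuous_on S (\<lambda>\<sigma>. \<sigma> ^ (N - 1) * clamp_powr p (U \<sigma>))"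
  by (intro continuous_intros continuous_on_compose2[OF clamp_powr_continuous])
     (use p in \<open>auto elim: continuous_on_subset\<close>)

lemma flux_integrable:
  "continuous_on UNIV U \<Longrightarrow> (\<lambda>\<sigma>. \<sigma> ^ (N - 1) * clamp_powr p (U \<sigma>)) integrable_on {0..t}"
  by (intro integrable_continuous_real flux_integrand_continuous)

lemma flux_bounds:
  assumes U: "continuous_on UNIV U" and t: "0 \<le> t" and l: "\<And>\<sigma>. 0 \<le> \<sigma> \<Longrightarrow> \<sigma> \<le> t \<Longrightarrow> l \<le> clamp_powr p (U \<sigma>)"
  shows "l * (t ^ N / real N) \<le> flux U t" "flux U t \<le> t ^ N / real N"
proof -
  have mono: "((\<lambda>\<sigma>. \<sigma> ^ (N - 1)) has_integral t ^ N / real N) {0..t}"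
    by (rule integral_monomial) (use t N in auto)
  have "((\<lambda>\<sigma>. l * \<sigma> ^ (N - 1)) has_integral l * (t ^ N / real N)) {0..t}"
    by (rule has_integral_mult_right[OF mono])
  moreover have f: "((\<lambda>\<sigma>. \<sigma> ^ (N - 1) * clamp_powr p (U \<sigma>)) has_integral flux U t) {0..t}"
    unfolding flux_def by (rule integrable_integral[OF flux_integrable[OF U]])
  ultimately show "l * (t ^ N / real N) \<le> flux U t"
    by (rule has_integral_le) (use l in \<open>auto simp: mult.commute[of l] intro!: mult_left_mono\<close>)
  show "flux U t \<le> t ^ N / real N"
    by (rule has_integral_le[OF f mono]) (use clamp_powr_range[of p] p in \<open>auto intro!: mult_left_le\<close>)
qed

lemma flux_nonneg: "continuous_on UNIV U \<Longrightarrow> 0 \<le> t \<Longrightarrow> 0 \<le> flux U t"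
  using flux_bounds(1)[of U t 0] clamp_powr_range[of p] p by auto

lemma flux_le: "continuous_on UNIV U \<Longrightarrow> 0 \<le> t \<Longrightarrow> flux U t \<le> t ^ N / real N"
  using flux_bounds(2)[of U t 0] clamp_powr_range[of p] p by auto

lemma flux_DERIV:
  assumes U: "continuous_on UNIV U" and t: "0 < t"
  shows "(flux U has_real_derivative (t ^ (N - 1) * clamp_powr p (U t))) (at t)"
proof -
  have "(flux U has_real_derivative (t ^ (N - 1) * clamp_powr p (U t))) (at t within {0..t + 1})"
    unfolding flux_def[abs_def]
    by (rule integral_has_real_derivative[OF flux_integrand_continuous[OF U]]) (use t in auto)
  moreover have "at t within {0..t + 1} = at t" by (rule at_within_interior) (use t in auto)
  ultimately show ?thesis by simp
qed

lemma power_N: "t ^ N = t * t ^ (N - 1)" for t :: real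
  using N by (cases N) auto

lemma flux_quotient_bounds:
  assumes U: "continuous_on UNIV U" and t: "0 \<le> t"
  shows "0 \<le> flux U t / t ^ (N - 1)" "flux U t / t ^ (N - 1) \<le> t / real N"
proof -
  show "0 \<le> flux U t / t ^ (N - 1)" using flux_nonneg[OF U t] t by simp
  show "flux U t / t ^ (N - 1) \<le> t / real N"
  proof (cases "t = 0")
    case False
    then have "flux U t / t ^ (N - 1) \<le> (t ^ N / real N) / t ^ (N - 1)"
      using flux_le[OF U t] t by (intro divide_right_mono) auto
    also have "\<dots> = t / real N" using False by (simp add: power_N)
    finally show ?thesis .
  qed (use N in \<open>auto simp: power_0_left\<close>)
qed

text \<open>At 0 the quotient is \<open>0 / 0\<close>, which has the value 0; this is also the
  limit, because the flux is at most \<open>t ^ N / N\<close>.\<close>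

lemma flux_quotient_continuous:
  assumes U: "continuous_on UNIV U"
  shows "continuous_on {0..} (\<lambda>t. flux U t / t ^ (N - 1))"
  unfolding continuous_on_eq_continuous_within
proof
  fix t :: real assume "t \<in> {0..}"
  then consider "t = 0" | "t > 0" by fastforce
  then show "continuous (at t within {0..}) (\<lambda>t. flux U t / t ^ (N - 1))"
  proof cases
    case 1
    have "((\<lambda>t. flux U t / t ^ (N - 1)) \<longlongrightarrow> 0) (at 0 within {0..})"
    proof (rule Lim_null_comparison)
      show "\<forall>\<^sub>F t in at 0 within {0..}. norm (flux U t / t ^ (N - 1)) \<le> t / real N"
      proof -
        have "norm (flux U t / t ^ (N - 1)) \<le> t / real N" if "0 \<le> t" for t
          using flux_quotient_bounds[OF U that] by (simp only: real_norm_def abs_of_nonneg)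
        then show ?thesis unfolding eventually_at_topological by (intro exI[of _ UNIV]) auto
      qed
      show "((\<lambda>t. t / real N) \<longlongrightarrow> 0) (at 0 within {0..})"
        using N by (auto intro!: tendsto_eq_intros)
    qed
    then show ?thesis using 1 N by (simp add: continuous_within power_0_left)
  next
    case 2
    have "isCont (flux U) t" by (rule DERIV_isCont[OF flux_DERIV[OF U 2]])
    then have "isCont (\<lambda>t. flux U t / t ^ (N - 1)) t" using 2 by (intro continuous_intros) auto
    then show ?thesis by (rule continuous_at_imp_continuous_at_within)
  qed
qed

lemma profile_drop_has_integral:
  assumes U: "continuous_on UNIV U"
  shows "((\<lambda>t. flux U t / t ^ (N - 1)) has_integral profile_drop U s) {0..s}"
  unfolding profile_drop_def
  by (intro integrable_integral integrable_continuous_real continuous_on_subset[OF flux_quotient_continuous[OF U]]) auto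

lemma profile_drop_bounds:
  assumes U: "continuous_on UNIV U" and s: "0 \<le> s"
  shows "0 \<le> profile_drop U s" "profile_drop U s \<le> s\<^sup>2 / (2 * real N)"
proof -
  show "0 \<le> profile_drop U s"
    by (rule has_integral_nonneg[OF profile_drop_has_integral[OF U]]) (use flux_quotient_bounds[OF U] in auto)
  have "((\<lambda>t. t ^ (2 - 1) / real N) has_integral (s ^ 2 / real 2) / real N) {0..s}"
    by (intro has_integral_divide integral_monomial) (use s in auto)
  then have "((\<lambda>t. t / real N) has_integral s\<^sup>2 / (2 * real N)) {0..s}" by simp
  then show "profile_drop U s \<le> s\<^sup>2 / (2 * real N)"
    by (rule has_integral_le[OF profile_drop_has_integral[OF U]]) (use flux_quotient_bounds[OF U] in auto)
qed

lemma profile_drop_DERIV: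
  assumes U: "continuous_on UNIV U" and s: "0 < s"
  shows "(profile_drop U has_real_derivative (flux U s / s ^ (N - 1))) (at s)"
proof -
  have "(profile_drop U has_real_derivative (flux U s / s ^ (N - 1))) (at s within {0..s + 1})"
    unfolding profile_drop_def[abs_def]
    by (rule integral_has_real_derivative[OF continuous_on_subset[OF flux_quotient_continuous[OF U]]])
       (use s in auto)
  moreover have "at s within {0..s + 1} = at s" by (rule at_within_interior) (use s in auto)
  ultimately show ?thesis by simp
qed

lemma profile_drop_abs_continuous:
  assumes U: "continuous_on UNIV U"
  shows "continuous_on UNIV (\<lambda>s. profile_drop U \<bar>s\<bar>)"
proof -
  have "isCont (\<lambda>s. profile_drop U \<bar>s\<bar>) s" for s
  proof -
    let ?T = "\<bar>s\<bar> + 1"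
    have "continuous_on {0..?T} (profile_drop U)"
      unfolding profile_drop_def[abs_def]
      by (intro indefinite_integral_continuous_1 integrable_continuous_real
          continuous_on_subset[OF flux_quotient_continuous[OF U]]) auto
    then have "continuous_on {-?T<..<?T} (\<lambda>s. profile_drop U \<bar>s\<bar>)"
      by (rule continuous_on_compose2) (auto intro!: continuous_intros)
    then have "\<forall>x\<in>{-?T<..<?T}. isCont (\<lambda>s. profile_drop U \<bar>s\<bar>) x"
      by (subst (asm) continuous_on_eq_continuous_at) auto
    moreover have "s \<in> {-?T<..<?T}" by auto
    ultimately show ?thesis by blast
  qed
  then show ?thesis by (simp add: continuous_on_eq_continuous_at)
qed

text \<open>The Lipschitz constant 2 and the averaging factor \<open>1 / N\<close> leave at most
  \<open>t * exp (2 * t^2)\<close> under the integral, since \<open>N \<ge> 2\<close>. Its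
  antiderivative is a quarter of the weight, so the factor 1/2 is not even sharp.\<close>

lemma profile_drop_contraction:
  assumes U: "continuous_on UNIV U" and V: "continuous_on UNIV V"
    and d: "\<And>s. \<bar>U s - V s\<bar> \<le> d * exp (2 * s\<^sup>2)" and s: "0 \<le> s"
  shows "\<bar>profile_drop U s - profile_drop V s\<bar> \<le> d * exp (2 * s\<^sup>2) / 2"
proof -
  have d0: "0 \<le> d" using d[of 0] by simp
  have fl: "\<bar>flux U t - flux V t\<bar> \<le> 2 * d * exp (2 * t\<^sup>2) * (t ^ N / real N)" if t: "0 \<le> t" for t
  proof -
    let ?f = "\<lambda>W \<sigma>. \<sigma> ^ (N - 1) * clamp_powr p (W \<sigma>)"
    have h: "((\<lambda>\<sigma>. 2 * d * exp (2 * t\<^sup>2) * \<sigma> ^ (N - 1)) has_integral 2 * d * exp (2 * t\<^sup>2) * (t ^ N / real N)) {0..t}"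
      by (intro has_integral_mult_right integral_monomial) (use t N in auto)
    have "flux U t - flux V t = integral {0..t} (\<lambda>\<sigma>. ?f U \<sigma> - ?f V \<sigma>)"
      unfolding flux_def by (rule integral_diff[symmetric]) (intro flux_integrable U V)+
    also have "norm \<dots> \<le> integral {0..t} (\<lambda>\<sigma>. 2 * d * exp (2 * t\<^sup>2) * \<sigma> ^ (N - 1))"
    proof (rule integral_norm_bound_integral)
      show "(\<lambda>\<sigma>. ?f U \<sigma> - ?f V \<sigma>) integrable_on {0..t}"
        by (intro integrable_diff flux_integrable U V)
      show "(\<lambda>\<sigma>. 2 * d * exp (2 * t\<^sup>2) * \<sigma> ^ (N - 1)) integrable_on {0..t}" using h by blast
      fix \<sigma> assume \<sigma>: "\<sigma> \<in> {0..t}"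
      have "norm (?f U \<sigma> - ?f V \<sigma>) = \<sigma> ^ (N - 1) * \<bar>clamp_powr p (U \<sigma>) - clamp_powr p (V \<sigma>)\<bar>"
        using \<sigma> by (simp add: abs_mult flip: right_diff_distrib)
      also have "\<dots> \<le> \<sigma> ^ (N - 1) * (2 * (d * exp (2 * t\<^sup>2)))"
      proof (rule mult_left_mono)
        have "d * exp (2 * \<sigma>\<^sup>2) \<le> d * exp (2 * t\<^sup>2)"
          using \<sigma> d0 by (intro mult_left_mono) (auto intro!: power_mono)
        then show "\<bar>clamp_powr p (U \<sigma>) - clamp_powr p (V \<sigma>)\<bar> \<le> 2 * (d * exp (2 * t\<^sup>2))"
          using order_trans[OF d[of \<sigma>]] by (intro order_trans[OF clamp_powr_Lipschitz[OF p]]) simp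
      qed (use \<sigma> in auto)
      finally show "norm (?f U \<sigma> - ?f V \<sigma>) \<le> 2 * d * exp (2 * t\<^sup>2) * \<sigma> ^ (N - 1)"
        by (simp add: mult_ac)
    qed
    also have "\<dots> = 2 * d * exp (2 * t\<^sup>2) * (t ^ N / real N)" using h by (rule integral_unique)
    finally show ?thesis by simp
  qed
  have ex: "((\<lambda>t. d * (t * exp (2 * t\<^sup>2))) has_integral d * (exp (2 * s\<^sup>2) / 4 - exp (2 * 0\<^sup>2) / 4)) {0..s}"
    by (intro has_integral_mult_right fundamental_theorem_of_calculus)
       (use s in \<open>auto intro!: derivative_eq_intros simp flip: has_real_derivative_iff_has_vector_derivative\<close>)
  let ?q = "\<lambda>W t. flux W t / t ^ (N - 1)"
  have "profile_drop U s - profile_drop V s = integral {0..s} (\<lambda>t. ?q U t - ?q V t)"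
    using has_integral_diff[OF profile_drop_has_integral[OF U, of s] profile_drop_has_integral[OF V, of s]]
    by (rule integral_unique[symmetric])
  also have "norm \<dots> \<le> integral {0..s} (\<lambda>t. d * (t * exp (2 * t\<^sup>2)))"
  proof (rule integral_norm_bound_integral)
    show "(\<lambda>t. ?q U t - ?q V t) integrable_on {0..s}"
      using has_integral_diff[OF profile_drop_has_integral[OF U, of s] profile_drop_has_integral[OF V, of s]] by blast
    show "(\<lambda>t. d * (t * exp (2 * t\<^sup>2))) integrable_on {0..s}" using ex by blast
    fix t assume t: "t \<in> {0..s}"
    show "norm (?q U t - ?q V t) \<le> d * (t * exp (2 * t\<^sup>2))"
    proof (cases "t = 0")
      case False
      then have t0: "t > 0" using t by simp
      have "norm (?q U t - ?q V t) = \<bar>flux U t - flux V t\<bar> / t ^ (N - 1)"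
        using t0 by (simp flip: diff_divide_distrib)
      also have "\<dots> \<le> (2 * d * exp (2 * t\<^sup>2) * (t ^ N / real N)) / t ^ (N - 1)"
        using fl[of t] t0 by (intro divide_right_mono) auto
      also have "\<dots> = d * (t * exp (2 * t\<^sup>2)) * (2 / real N)" using t0 by (simp add: power_N)
      also have "\<dots> \<le> d * (t * exp (2 * t\<^sup>2)) * 1"
        using N d0 t0 by (intro mult_left_mono) auto
      finally show ?thesis by simp
    qed (use N in \<open>auto simp: power_0_left\<close>)
  qed
  also have "\<dots> = d * (exp (2 * s\<^sup>2) / 4 - 1 / 4)" using integral_unique[OF ex] by simp
  also have "\<dots> \<le> d * exp (2 * s\<^sup>2) / 2" using d0 by (simp add: algebra_simps)
  finally show ?thesis by simp
qed

text \<open>Picard iteration contracts in the norm weighted by \<open>exp (- 2 s\<^sup>2)\<close>, which gives the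
  solution on the whole half-line at once.\<close>

lemma profile_drop_fixed_point:
  obtains U where "continuous_on UNIV U" "\<And>s. U s = 1 - profile_drop U \<bar>s\<bar>"
proof -
  \<comment> \<open>\<open>E\<close> removes the weight, so a bounded function \<open>V\<close>
    stands for a profile that may grow. Profiles are extended evenly through
    \<open>\<bar>s\<bar>\<close>, because bounded continuous functions live on the whole
    line.\<close>
  define E where "E V = (\<lambda>s::real. exp (2 * s\<^sup>2) * apply_bcontfun V s)" for V :: "real \<Rightarrow>\<^sub>C real"
  define F where "F V = (\<lambda>s. exp (- (2 * s\<^sup>2)) * (1 - profile_drop (E V) \<bar>s\<bar>))" for V
  have Ec: "continuous_on UNIV (E V)" for V
    unfolding E_def by (intro continuous_intros continuous_on_apply_bcontfun) 
  have Fb: "F V \<in> bcontfun" for V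
  proof (rule bcontfun_normI)
    show "continuous_on UNIV (F V)"
      unfolding F_def by (intro continuous_intros profile_drop_abs_continuous Ec)
    fix s
    have "s\<^sup>2 * 1 \<le> s\<^sup>2 * (2 * real N)" using N by (intro mult_left_mono) auto
    then have "s\<^sup>2 / (2 * real N) \<le> s\<^sup>2" using N by (simp add: pos_divide_le_eq)
    then have "\<bar>1 - profile_drop (E V) \<bar>s\<bar>\<bar> \<le> 1 + s\<^sup>2"
      using profile_drop_bounds[OF Ec, of "\<bar>s\<bar>" V] by auto
    also have "\<dots> \<le> exp (2 * s\<^sup>2)" using exp_ge_add_one_self[of "2 * s\<^sup>2"] zero_le_power2[of s] by linarith
    finally have "exp (- (2 * s\<^sup>2)) * \<bar>1 - profile_drop (E V) \<bar>s\<bar>\<bar> \<le> exp (- (2 * s\<^sup>2)) * exp (2 * s\<^sup>2)"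
      by (rule mult_left_mono) simp
    then show "norm (F V s) \<le> 1" by (simp add: F_def abs_mult flip: exp_add)
  qed
  have "\<exists>!V. Bcontfun (F V) = V"
  proof (rule banach_fix_type)
    show "\<forall>V W. dist (Bcontfun (F V)) (Bcontfun (F W)) \<le> 1 / 2 * dist V W"
    proof (intro allI dist_bound)
      fix V W :: "real \<Rightarrow>\<^sub>C real" and s :: real
      have "\<bar>E V s' - E W s'\<bar> \<le> dist V W * exp (2 * s'\<^sup>2)" for s'
        using dist_bounded[of V s' W] by (simp add: E_def dist_real_def abs_mult flip: right_diff_distrib)
      from profile_drop_contraction[OF Ec Ec this, of "\<bar>s\<bar>"]
      have "\<bar>profile_drop (E V) \<bar>s\<bar> - profile_drop (E W) \<bar>s\<bar>\<bar> \<le> dist V W * exp (2 * s\<^sup>2) / 2" by simp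
      then have "exp (- (2 * s\<^sup>2)) * \<bar>profile_drop (E V) \<bar>s\<bar> - profile_drop (E W) \<bar>s\<bar>\<bar> \<le> exp (- (2 * s\<^sup>2)) * (dist V W * exp (2 * s\<^sup>2) / 2)"
        by (rule mult_left_mono) simp
      also have "\<dots> = 1 / 2 * dist V W" by (simp add: exp_minus)
      also have "exp (- (2 * s\<^sup>2)) * \<bar>profile_drop (E V) \<bar>s\<bar> - profile_drop (E W) \<bar>s\<bar>\<bar> = \<bar>F V s - F W s\<bar>"
        by (simp add: F_def abs_mult abs_minus_commute flip: right_diff_distrib)
      finally show "dist (apply_bcontfun (Bcontfun (F V)) s) (apply_bcontfun (Bcontfun (F W)) s) \<le> 1 / 2 * dist V W"
        using Fb by (simp add: Bcontfun_inverse dist_real_def)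
    qed
  qed auto
  then obtain V where "Bcontfun (F V) = V" by blast
  then have "apply_bcontfun V = F V" using Fb by (metis Bcontfun_inverse)
  then have V: "apply_bcontfun V s = exp (- (2 * s\<^sup>2)) * (1 - profile_drop (E V) \<bar>s\<bar>)" for s
    by (simp add: F_def)
  have "E V s = exp (2 * s\<^sup>2) * (exp (- (2 * s\<^sup>2)) * (1 - profile_drop (E V) \<bar>s\<bar>))" for s
    unfolding V[symmetric] by (simp add: E_def)
  then have "E V s = 1 - profile_drop (E V) \<bar>s\<bar>" for s
    by (simp flip: mult.assoc exp_add)
  with Ec show ?thesis by (rule that)
qed

text \<open>Uses \<open>A = - U' / s\<close> instead of \<open>U'\<close>: the gradient of the
  radial function is then a continuous multiple of the position vector, with no singularity at the
  centre. The last clause feeds a lower bound of \<open>U\<close> back into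
  \<open>A\<close>.\<close>

lemma radial_ode_solution:
  obtains U A :: "real \<Rightarrow> real" where
    "U 0 = 1" "\<And>s. U s \<le> 1" "\<And>s. s \<ge> 0 \<Longrightarrow> 1 - s\<^sup>2 / (2 * real N) \<le> U s"
    "continuous_on UNIV U" "continuous_on {0..} A"
    "\<And>s. s > 0 \<Longrightarrow> (U has_real_derivative (- (s * A s))) (at s)"
    "\<And>s. s > 0 \<Longrightarrow> (A has_real_derivative ((clamp_powr p (U s) - real N * A s) / s)) (at s)"
    "\<And>s. s \<ge> 0 \<Longrightarrow> 0 \<le> A s" "\<And>s. s \<ge> 0 \<Longrightarrow> A s \<le> 1 / real N"
    "\<And>s l. s \<ge> 0 \<Longrightarrow> (\<And>\<sigma>. 0 \<le> \<sigma> \<Longrightarrow> \<sigma> \<le> s \<Longrightarrow> l \<le> clamp_powr p (U \<sigma>)) \<Longrightarrow> l / real N \<le> A s"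
proof -
  obtain U where U: "continuous_on UNIV U" "\<And>s. U s = 1 - profile_drop U \<bar>s\<bar>" using profile_drop_fixed_point by blast
  \<comment> \<open>For \<open>s > 0\<close> this is \<open>1 / N\<close> times the mean of
    \<open>clamp_powr p U\<close> over a ball of radius \<open>s\<close>; since
    \<open>U 0 = 1\<close>, the value at 0 is its limit.\<close>
  define A where "A s = (if s = 0 then 1 / real N else flux U s / s ^ N)" for s
  have U0: "U 0 = 1" using U(2)[of 0] by (simp add: profile_drop_def)
  have c1: "clamp_powr p 1 = 1" by (simp add: clamp_powr_def)
  have lower: "l / real N \<le> A s" if "s \<ge> 0" and l: "\<And>\<sigma>. 0 \<le> \<sigma> \<Longrightarrow> \<sigma> \<le> s \<Longrightarrow> l \<le> clamp_powr p (U \<sigma>)" for s l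
  proof (cases "s = 0")
    case True
    then show ?thesis using l[of 0] U0 c1 N by (simp add: A_def divide_right_mono)
  next
    case False
    then show ?thesis using flux_bounds(1)[OF U(1) \<open>s \<ge> 0\<close> l] that(1)
      by (simp add: A_def pos_le_divide_eq)
  qed
  have A0: "0 \<le> A s" if "s \<ge> 0" for s
    using lower[OF that, of 0] clamp_powr_range[of p] p by simp
  have A1: "A s \<le> 1 / real N" if "s \<ge> 0" for s
    using flux_le[OF U(1) that] that by (auto simp: A_def pos_divide_le_eq)
  have A_DERIV: "(A has_real_derivative ((clamp_powr p (U s) - real N * A s) / s)) (at s)" if s: "s > 0" for s
  proof -
    have "((\<lambda>s. flux U s / s ^ N) has_real_derivative
        (s ^ (N - 1) * clamp_powr p (U s) * s ^ N - flux U s * (real N * s ^ (N - 1))) / (s ^ N * s ^ N)) (at s)"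
      using s by (auto intro!: derivative_eq_intros flux_DERIV[OF U(1)])
    also have "(s ^ (N - 1) * clamp_powr p (U s) * s ^ N - flux U s * (real N * s ^ (N - 1))) / (s ^ N * s ^ N)
      = (clamp_powr p (U s) - real N * A s) / s"
      using s by (simp add: A_def power_N field_simps)
    finally show ?thesis
      by (rule has_field_derivative_transform_within_open[where S = "{0<..}"]) (use s in \<open>auto simp: A_def\<close>)
  qed
  have U_DERIV: "(U has_real_derivative (- (s * A s))) (at s)" if s: "s > 0" for s
  proof -
    have "((\<lambda>s. 1 - profile_drop U s) has_real_derivative (- (s * A s))) (at s)"
      using s by (auto intro!: derivative_eq_intros profile_drop_DERIV[OF U(1)] simp: A_def power_N)
    then show ?thesis
      by (rule has_field_derivative_transform_within_open[where S = "{0<..}"]) (use s U(2) in auto)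
  qed
  have A_cont: "continuous_on {0..} A"
    unfolding continuous_on_eq_continuous_within
  proof
    fix s :: real assume "s \<in> {0..}"
    then consider "s = 0" | "s > 0" by fastforce
    then show "continuous (at s within {0..}) A"
    proof cases
      case 1
      have "(A \<longlongrightarrow> 1 / real N) (at 0 within {0..})"
      proof (rule tendstoI)
        fix e :: real assume e: "e > 0"
        have "isCont (\<lambda>s. clamp_powr p (U s)) 0"
          using continuous_on_compose2[OF clamp_powr_continuous U(1), of p UNIV] p
          by (simp add: continuous_on_eq_continuous_at)
        then obtain d where d: "d > 0" "\<And>s. dist s 0 < d \<Longrightarrow> dist (clamp_powr p (U s)) (clamp_powr p (U 0)) < e"
          unfolding continuous_at_eps_delta using e by blast
        have "dist (A s) (1 / real N) < e" if s: "s \<ge> 0" "s < d" for s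
        proof -
          have "(1 - e) / real N \<le> A s"
          proof (rule lower[OF s(1)])
            fix \<sigma> assume "0 \<le> \<sigma>" "\<sigma> \<le> s"
            then show "1 - e \<le> clamp_powr p (U \<sigma>)" using d(2)[of \<sigma>] s U0 c1 by (auto simp: dist_real_def)
          qed
          moreover have "e / real N < e" using N e by (simp add: field_simps)
          moreover have "(1 - e) / real N = 1 / real N - e / real N" by (simp add: diff_divide_distrib)
          ultimately show ?thesis using A1[OF s(1)] by (simp add: dist_real_def)
        qed
        then show "\<forall>\<^sub>F s in at 0 within {0..}. dist (A s) (1 / real N) < e"
          unfolding eventually_at using d(1) by (intro exI[of _ d]) (auto simp: dist_real_def)
      qed
      then show ?thesis using 1 by (simp add: continuous_within A_def)
    next
      case 2
      show ?thesis by (rule continuous_at_imp_continuous_at_within[OF DERIV_isCont[OF A_DERIV[OF 2]]])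
    qed
  qed
  show ?thesis
  proof (rule that[of U A])
    show "U s \<le> 1" for s
      unfolding U(2)[of s] using profile_drop_bounds(1)[OF U(1) abs_ge_zero[of s]] by linarith
    show "1 - s\<^sup>2 / (2 * real N) \<le> U s" if "s \<ge> 0" for s
      unfolding U(2)[of s] abs_of_nonneg[OF that] using profile_drop_bounds(2)[OF U(1) that] by linarith
  qed (fact U0 U(1) A_cont U_DERIV A_DERIV A0 A1 lower)+
qed

end

section \<open>The first radius at which the Robin condition holds\<close>

text \<open>The least root is needed, not just some root: the lower bound for the profile is
  available only before the first sign change.\<close>

lemma least_root:
  fixes Q :: "real \<Rightarrow> real"
  assumes Q: "continuous_on {0..S} Q" and Q0: "Q 0 > 0" and S: "0 \<le> S" "Q S \<le> 0"
  obtains z where "0 < z" "z \<le> S" "Q z = 0" "\<And>s. 0 \<le> s \<Longrightarrow> s < z \<Longrightarrow> Q s > 0"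
proof -
  define Z where "Z = {s \<in> {0..S}. Q s = 0}"
  have "compact Z"
  proof -
    have "closed Z" unfolding Z_def
      using continuous_closed_preimage_constant[OF Q, of 0] by (simp add: vimage_def Int_def conj_commute)
    moreover have "bounded Z" by (rule bounded_subset[of "{0..S}"]) (auto simp: Z_def)
    ultimately show ?thesis by (simp add: compact_eq_bounded_closed)
  qed
  moreover have root: "\<exists>z\<in>Z. z \<le> s" if "0 \<le> s" "s \<le> S" "Q s \<le> 0" for s
  proof -
    have "\<exists>x\<ge>0. x \<le> s \<and> Q x = 0"
      by (rule IVT2') (use that Q0 continuous_on_subset[OF Q] in auto)
    then show ?thesis using that by (auto simp: Z_def)
  qed
  have "Z \<noteq> {}" using root[OF S(1) order_refl S(2)] by auto
  ultimately obtain z where z: "z \<in> Z" "\<And>y. y \<in> Z \<Longrightarrow> z \<le> y" using compact_attains_inf[of Z] by metis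
  show ?thesis
  proof (rule that[of z])
    show "0 < z" "z \<le> S" "Q z = 0" using z(1) Q0 by (auto simp: Z_def less_le)
    show "Q s > 0" if sz: "0 \<le> s" "s < z" for s
    proof (rule ccontr)
      assume "\<not> Q s > 0"
      moreover have "s \<le> S" using z(1) sz by (simp add: Z_def)
      ultimately obtain y where "y \<in> Z" "y \<le> s" using root[of s] sz by auto
      then show False using z(2)[of y] sz by simp
    qed
  qed
qed

text \<open>Here \<open>b\<close> stands for \<open>\<beta> * r\<close>. Without a sign change up to
  \<open>S\<close> one would get \<open>S / 2 < b * N\<close>, which this length violates.
  \<open>ode_min\<close> is the lower bound \<open>s powr (- b) / 2\<close> for the profile, taken
  at that length. Neither depends on \<open>p\<close>.\<close>

definition ode_length :: "nat \<Rightarrow> real \<Rightarrow> real" where "ode_length N b = 2 * b * real N + 1"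
definition ode_min :: "nat \<Rightarrow> real \<Rightarrow> real" where "ode_min N b = 1 / 2 * ode_length N b powr (- b)"

lemma ode_constants:
  assumes "b > 0"
  shows "1 \<le> ode_length N b" "0 < ode_min N b" "ode_min N b \<le> 1 / 2"
proof -
  show 1: "1 \<le> ode_length N b" using assms by (simp add: ode_length_def)
  then show "0 < ode_min N b" by (simp add: ode_min_def)
  have "ode_length N b powr (- b) \<le> ode_length N b powr 0" using 1 assms by (intro powr_mono) auto
  then show "ode_min N b \<le> 1 / 2" using 1 by (simp add: ode_min_def)
qed

text \<open>As long as \<open>s U' + b U\<close> is positive, \<open>U s * s powr b\<close> increases; this bounds \<open>U\<close> from below and,
  fed back into the flux, forces a sign change before \<open>ode_length N b\<close>.\<close>

lemma radial_ode_root: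
  assumes N: "N \<ge> 2" and p: "1 < p" "p \<le> 2" and b: "b > 0" "b * (p - 1) \<le> 1"
  obtains U A :: "real \<Rightarrow> real" and z :: real where
    "U 0 = 1" "\<And>s. U s \<le> 1" "\<And>s. s \<ge> 0 \<Longrightarrow> 1 - s\<^sup>2 / (2 * real N) \<le> U s"
    "continuous_on UNIV U" "continuous_on {0..} A"
    "\<And>s. s > 0 \<Longrightarrow> (U has_real_derivative (- (s * A s))) (at s)"
    "\<And>s. s > 0 \<Longrightarrow> (A has_real_derivative ((clamp_powr p (U s) - real N * A s) / s)) (at s)"
    "0 < z" "z \<le> ode_length N b" "b * real N * ode_min N b \<le> z\<^sup>2" "z\<^sup>2 * A z = b * U z"
    "\<And>s. 0 \<le> s \<Longrightarrow> s \<le> z \<Longrightarrow> ode_min N b \<le> U s"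
proof -
  obtain U A :: "real \<Rightarrow> real" where UA:
    "U 0 = 1" "\<And>s. U s \<le> 1" "\<And>s. s \<ge> 0 \<Longrightarrow> 1 - s\<^sup>2 / (2 * real N) \<le> U s"
    "continuous_on UNIV U" "continuous_on {0..} A"
    "\<And>s. s > 0 \<Longrightarrow> (U has_real_derivative (- (s * A s))) (at s)"
    "\<And>s. s > 0 \<Longrightarrow> (A has_real_derivative ((clamp_powr p (U s) - real N * A s) / s)) (at s)"
    "\<And>s. s \<ge> 0 \<Longrightarrow> 0 \<le> A s" "\<And>s. s \<ge> 0 \<Longrightarrow> A s \<le> 1 / real N"
    "\<And>s l. s \<ge> 0 \<Longrightarrow> (\<And>\<sigma>. 0 \<le> \<sigma> \<Longrightarrow> \<sigma> \<le> s \<Longrightarrow> l \<le> clamp_powr p (U \<sigma>)) \<Longrightarrow> l / real N \<le> A s"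
    by (rule radial_ode_solution[OF N p]) blast
  \<comment> \<open>This is \<open>b * U + s * U'\<close>; its zero is the Robin condition on the
    sphere of radius \<open>s\<close>, before rescaling.\<close>
  define Q where "Q s = b * U s - s\<^sup>2 * A s" for s
  let ?S = "ode_length N b" and ?m = "ode_min N b"
  note S1 = ode_constants[OF b(1), of N]
  have Qc: "continuous_on {0..T} Q" for T
    unfolding Q_def by (intro continuous_intros continuous_on_subset[OF UA(4)] continuous_on_subset[OF UA(5)]) auto
  have decr: "U t \<le> U s" if "0 \<le> s" "s \<le> t" for s t
  proof (cases "s = 0")
    case False
    show ?thesis
    proof (rule DERIV_nonpos_imp_nonincreasing[OF that(2)])
      fix x assume "s \<le> x" "x \<le> t"
      then have "x > 0" using that False by linarith
      then show "\<exists>y. (U has_real_derivative y) (at x) \<and> y \<le> 0"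
        using UA(6)[of x] UA(8)[of x] by (intro exI[of _ "- (x * A x)"]) auto
    qed
  qed (use UA in auto)
  have "1 / 2 \<le> U 1"
  proof -
    have "1 / 2 \<le> 1 - 1\<^sup>2 / (2 * real N)" using N by (simp add: field_simps)
    then show ?thesis using UA(3)[of 1] by linarith
  qed
  then have U1: "1 / 2 \<le> U s" if "0 \<le> s" "s \<le> 1" for s using decr[OF that] by linarith
  have lower: "1 / 2 * s powr (- b) \<le> U s" if s: "1 \<le> s" and pos: "\<And>t. 0 \<le> t \<Longrightarrow> t < s \<Longrightarrow> Q t > 0" for s
  proof -
    have "U 1 * 1 powr b \<le> U s * s powr b"
    proof (rule DERIV_nonneg_imp_increasing_open[OF s])
      fix x assume x: "1 < x" "x < s"
      have "((\<lambda>s. U s * s powr b) has_real_derivative (- (x * A x) * x powr b + b * x powr (b - 1) * U x)) (at x)"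
        using x by (auto intro!: derivative_eq_intros UA(6))
      moreover have "- (x * A x) * x powr b + b * x powr (b - 1) * U x = x powr (b - 1) * Q x"
      proof -
        have "x powr b = x * x powr (b - 1)" using x by (simp add: powr_mult_base)
        then show ?thesis by (simp add: Q_def power2_eq_square algebra_simps)
      qed
      moreover have "0 \<le> x powr (b - 1) * Q x" using pos[of x] x by simp
      ultimately show "\<exists>y. ((\<lambda>s. U s * s powr b) has_real_derivative y) (at x) \<and> 0 \<le> y" by metis
    next
      show "continuous_on {1..s} (\<lambda>s. U s * s powr b)"
        by (intro continuous_intros continuous_on_subset[OF UA(4)]) auto
    qed
    then have "1 / 2 \<le> U s * s powr b" using \<open>1 / 2 \<le> U 1\<close> by simp
    then have "1 / 2 * s powr (- b) \<le> U s * s powr b * s powr (- b)" by (rule mult_right_mono) simp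
    also have "\<dots> = U s" using s by (simp add: mult.assoc flip: powr_add)
    finally show ?thesis .
  qed
  have m_le: "?m \<le> U s" if s: "0 \<le> s" "s \<le> ?S" and pos: "\<And>t. 0 \<le> t \<Longrightarrow> t < s \<Longrightarrow> Q t > 0" for s
  proof (cases "s \<le> 1")
    case True
    then show ?thesis using U1[of s] s S1(3) by linarith
  next
    case False
    have "?S powr (- b) \<le> s powr (- b)" using False s b by (intro powr_mono2') auto
    then have "?m \<le> 1 / 2 * s powr (- b)" by (simp add: ode_min_def)
    also have "\<dots> \<le> U s" by (rule lower) (use False pos in auto)
    finally show ?thesis .
  qed
  have ex: "\<exists>s. 0 \<le> s \<and> s \<le> ?S \<and> Q s \<le> 0"
  proof (rule ccontr)
    assume "\<nexists>s. 0 \<le> s \<and> s \<le> ?S \<and> Q s \<le> 0"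
    then have pos: "Q s > 0" if "0 \<le> s" "s \<le> ?S" for s using that by (meson not_le)
    have US: "1 / 2 * ?S powr (- b) \<le> U ?S" by (rule lower) (use S1 pos in auto)
    have US0: "0 < U ?S" by (rule less_le_trans[OF _ US]) (use S1 in simp)
    have "U ?S powr p / real N \<le> A ?S"
    proof (rule UA(10))
      fix \<sigma> assume "0 \<le> \<sigma>" "\<sigma> \<le> ?S"
      then have "clamp_powr p (U ?S) \<le> clamp_powr p (U \<sigma>)"
        using decr p by (intro clamp_powr_mono) auto
      then show "U ?S powr p \<le> clamp_powr p (U \<sigma>)"
        using US0 UA(2) by (simp add: clamp_powr_eq)
    qed (use S1 in simp)
    then have "?S\<^sup>2 * (U ?S powr p / real N) \<le> ?S\<^sup>2 * A ?S" by (rule mult_left_mono) simp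
    also have "\<dots> < b * U ?S" using pos[of ?S] S1 by (simp add: Q_def)
    finally have "?S\<^sup>2 * U ?S powr p < b * real N * U ?S" using N by (simp add: field_simps)
    also have "U ?S powr p = U ?S powr (p - 1) * U ?S"
      using US0 powr_mult_base[of "U ?S" "p - 1"] by (simp add: mult.commute)
    finally have "?S\<^sup>2 * U ?S powr (p - 1) < b * real N" using US0 by simp
    \<comment> \<open>The hypothesis \<open>b * (p - 1) \<le> 1\<close> enters: the decay of the
      profile, raised to the power \<open>p - 1\<close>, costs at most one of the two powers of
      \<open>S\<close>.\<close>
    moreover have "?S / 2 \<le> ?S\<^sup>2 * U ?S powr (p - 1)"
    proof -
      have "(1 / 2) powr 1 \<le> (1 / 2 :: real) powr (p - 1)" using p by (intro powr_mono') auto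
      moreover have "?S powr (- 1) \<le> ?S powr (- (b * (p - 1)))" using S1 b by (intro powr_mono) auto
      ultimately have "1 / 2 * ?S powr (- 1) \<le> (1 / 2) powr (p - 1) * ?S powr (- (b * (p - 1)))"
        by (intro mult_mono) auto
      also have "\<dots> = (1 / 2 * ?S powr (- b)) powr (p - 1)"
        by (subst powr_mult) (auto simp: powr_powr)
      also have "\<dots> \<le> U ?S powr (p - 1)" using US p by (intro powr_mono2) auto
      finally have "?S\<^sup>2 * (1 / 2 * ?S powr (- 1)) \<le> ?S\<^sup>2 * U ?S powr (p - 1)" by (rule mult_left_mono) simp
      moreover have "?S\<^sup>2 * (1 / 2 * ?S powr (- 1)) = ?S / 2"
        using S1 by (simp add: powr_minus power2_eq_square field_simps)
      ultimately show ?thesis by simp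
    qed
    ultimately have "?S / 2 < b * real N" by linarith
    then show False by (simp add: ode_length_def)
  qed
  then obtain s0 where s0: "0 \<le> s0" "s0 \<le> ?S" "Q s0 \<le> 0" by blast
  obtain z where z: "0 < z" "z \<le> s0" "Q z = 0" "\<And>s. 0 \<le> s \<Longrightarrow> s < z \<Longrightarrow> Q s > 0"
    by (rule least_root[OF Qc _ s0(1,3)]) (use UA(1) b in \<open>auto simp: Q_def\<close>)
  have mz: "?m \<le> U s" if "0 \<le> s" "s \<le> z" for s by (rule m_le) (use that z s0 in auto)
  show ?thesis
  proof (rule that[of U A z])
    show "z\<^sup>2 * A z = b * U z" using z(3) by (simp add: Q_def)
    have "b * ?m \<le> b * U z" using mz[of z] z b by (intro mult_left_mono) auto
    also have "\<dots> = z\<^sup>2 * A z" using z(3) by (simp add: Q_def)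
    also have "\<dots> \<le> z\<^sup>2 * (1 / real N)" using UA(9)[of z] z by (intro mult_left_mono) auto
    finally show "b * real N * ?m \<le> z\<^sup>2" using N by (simp add: field_simps)
    show "z \<le> ode_length N b" using z(2) s0(2) by linarith
  qed (fact UA z(1) mz)+
qed

section \<open>Rescaling the profile to the ball\<close>

text \<open>The dilation \<open>k = z / r\<close> moves the root to the sphere, and
  \<open>\<sigma> powr (p - 1) = k^2\<close> restores the equation. As \<open>\<sigma>\<close> is
  not controlled when \<open>p\<close> tends to 1, the bounds are stated for \<open>u\<close>
  relative to \<open>\<sigma>\<close> and for \<open>u powr (p - 1)\<close>, with constants free of
  \<open>p\<close>. The function \<open>h\<close> is defined by
  \<open>grad u = - h (x - c)\<close>.\<close>

lemma radial_solution_exists: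
  fixes c :: "'a::euclidean_space" and r \<beta> p m S :: real
  assumes N: "DIM('a) \<ge> 2" and r: "r > 0" and \<beta>: "\<beta> > 0" and p: "1 < p" "p \<le> 2" "\<beta> * r * (p - 1) \<le> 1"
  defines "m \<equiv> ode_min DIM('a) (\<beta> * r)" and "S \<equiv> ode_length DIM('a) (\<beta> * r)"
  obtains u h :: "'a \<Rightarrow> real" and \<sigma> :: real where
    "\<sigma> > 0" "\<And>x. GDERIV u x :> - (h x *\<^sub>R (x - c))" "continuous_on UNIV h"
    "\<And>x. x \<in> cball c r \<Longrightarrow> m * \<sigma> \<le> u x" "\<And>x. x \<in> cball c r \<Longrightarrow> u x \<le> \<sigma>"
    "\<And>x. x \<in> cball c r \<Longrightarrow> \<beta> * DIM('a) * m\<^sup>2 / r \<le> u x powr (p - 1)"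
    "\<And>x. x \<in> cball c r \<Longrightarrow> u x powr (p - 1) \<le> (S / r)\<^sup>2"
    "\<And>x t. x \<noteq> c \<Longrightarrow> 1 \<le> t \<Longrightarrow> t * dist c x \<le> r \<Longrightarrow>
       ((\<lambda>t. h (c + t *\<^sub>R (x - c))) has_real_derivative
         (u (c + t *\<^sub>R (x - c)) powr p - DIM('a) * h (c + t *\<^sub>R (x - c))) / t) (at t)"
    "\<And>x. x \<in> sphere c r \<Longrightarrow> r * h x = \<beta> * u x"
    "\<exists>f. \<forall>x. u x = f (dist c x)"
proof -
  let ?N = "DIM('a)" and ?b = "\<beta> * r"
  have b: "?b > 0" using r \<beta> by simp
  obtain U A :: "real \<Rightarrow> real" and z :: real where UA:
    "U 0 = 1" "\<And>s. U s \<le> 1" "\<And>s. s \<ge> 0 \<Longrightarrow> 1 - s\<^sup>2 / (2 * real ?N) \<le> U s"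
    "continuous_on UNIV U" "continuous_on {0..} A"
    "\<And>s. s > 0 \<Longrightarrow> (U has_real_derivative (- (s * A s))) (at s)"
    "\<And>s. s > 0 \<Longrightarrow> (A has_real_derivative ((clamp_powr p (U s) - real ?N * A s) / s)) (at s)"
    "0 < z" "z \<le> S" "?b * real ?N * m \<le> z\<^sup>2" "z\<^sup>2 * A z = ?b * U z"
    "\<And>s. 0 \<le> s \<Longrightarrow> s \<le> z \<Longrightarrow> m \<le> U s"
    unfolding m_def S_def by (rule radial_ode_root[OF N p(1,2) b p(3)]) blast
  have m: "0 < m" "m \<le> 1 / 2" unfolding m_def by (rule ode_constants[OF b])+
  define k where "k = z / r"
  have k: "k > 0" using UA(8) r by (simp add: k_def)
  define \<sigma> where "\<sigma> = (k\<^sup>2) powr (1 / (p - 1))"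
  have \<sigma>: "\<sigma> > 0" using k by (simp add: \<sigma>_def)
  have \<sigma>k: "\<sigma> powr (p - 1) = k\<^sup>2" using k p by (simp add: \<sigma>_def powr_powr)
  have \<sigma>p: "\<sigma> powr p = \<sigma> * k\<^sup>2"
    using powr_mult_base[of \<sigma> "p - 1"] \<sigma> \<sigma>k by simp
  define u where "u x = \<sigma> * U (k * norm (x - c))" for x
  define h where "h x = \<sigma> * k\<^sup>2 * A (k * norm (x - c))" for x
  have rng: "0 \<le> k * norm (x - c)" "k * norm (x - c) \<le> z" if "x \<in> cball c r" for x
  proof -
    show "0 \<le> k * norm (x - c)" using k by simp
    have "k * norm (x - c) \<le> k * r" using k that by (intro mult_left_mono) (auto simp: dist_norm norm_minus_commute)
    then show "k * norm (x - c) \<le> z" using r by (simp add: k_def)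
  qed
  have mU: "m \<le> U (k * norm (x - c))" if "x \<in> cball c r" for x using UA(12) rng[OF that] by blast
  have upow: "u x powr q = \<sigma> powr q * U (k * norm (x - c)) powr q" if "x \<in> cball c r" for x q
    using mU[OF that] m \<sigma> by (simp add: u_def powr_mult)
  show ?thesis
  proof (rule that[of \<sigma> u h])
    show "\<sigma> > 0" by fact
    show "GDERIV u x :> - (h x *\<^sub>R (x - c))" for x
    proof (cases "x = c")
      case True
      \<comment> \<open>The norm is not differentiable at the centre; the bounds
        \<open>1 - s^2 / (2 N) \<le> U s \<le> 1\<close> give the gradient 0 there.\<close>
      have "\<bar>u (x + d) - u x - d \<bullet> 0\<bar> \<le> (\<sigma> * k\<^sup>2 / (2 * real ?N)) * (norm d)\<^sup>2" for d
      proof -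
        let ?s = "k * norm d"
        have "1 - ?s\<^sup>2 / (2 * real ?N) \<le> U ?s" using UA(3)[of ?s] k by simp
        then have "\<bar>U ?s - 1\<bar> \<le> ?s\<^sup>2 / (2 * real ?N)" using UA(2)[of ?s] by simp
        then have "\<sigma> * \<bar>U ?s - 1\<bar> \<le> \<sigma> * (?s\<^sup>2 / (2 * real ?N))" using \<sigma> by (intro mult_left_mono) auto
        moreover have "\<bar>u (x + d) - u x - d \<bullet> 0\<bar> = \<sigma> * \<bar>U ?s - 1\<bar>"
          using \<sigma> by (simp add: u_def True UA(1) abs_mult flip: right_diff_distrib[of \<sigma> _ 1, simplified])
        ultimately show ?thesis by (simp add: power_mult_distrib mult_ac)
      qed
      from quadratic_GDERIV[OF this] show ?thesis using True by simp
    next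
      case False
      then have s: "k * norm (x - c) > 0" using k by simp
      have g: "GDERIV (\<lambda>x. norm (x - c)) x :> sgn (x - c)"
      proof -
        have "((\<lambda>x. x - c) has_derivative (\<lambda>h. h)) (at x)" by (auto intro!: derivative_eq_intros)
        from has_derivative_compose[OF this, of norm "\<lambda>h. h \<bullet> sgn (x - c)"]
        show ?thesis using GDERIV_norm[of "x - c"] False unfolding gderiv_def by simp
      qed
      have "DERIV (\<lambda>s. \<sigma> * U (k * s)) (norm (x - c)) :> \<sigma> * (- (k * norm (x - c) * A (k * norm (x - c))) * k)"
        using UA(6)[OF s] by (auto intro!: derivative_eq_intros DERIV_chain2[where f = U])
      from GDERIV_DERIV_compose[OF g this]
      have "GDERIV u x :> (\<sigma> * (- (k * norm (x - c) * A (k * norm (x - c))) * k)) *\<^sub>R sgn (x - c)"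
        unfolding u_def .
      moreover have "(\<sigma> * (- (k * norm (x - c) * A (k * norm (x - c))) * k)) *\<^sub>R sgn (x - c) = - (h x *\<^sub>R (x - c))"
        using False by (simp add: h_def sgn_div_norm power2_eq_square mult_ac)
      ultimately show ?thesis by simp
    qed
    show "continuous_on UNIV h"
      unfolding h_def by (intro continuous_intros continuous_on_compose2[OF UA(5)]) (use k in auto)
    show "m * \<sigma> \<le> u x" "u x \<le> \<sigma>" if "x \<in> cball c r" for x
      using mU[OF that] UA(2)[of "k * norm (x - c)"] \<sigma> by (auto simp: u_def mult.commute)
    \<comment> \<open>One factor \<open>m\<close> comes from the lower bound for the root
      \<open>z\<close>, the other from \<open>U powr (p - 1) \<ge> m powr (p - 1) \<ge> m\<close>,
      where \<open>p \<le> 2\<close> and \<open>m < 1\<close> are used.\<close>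
    show "\<beta> * ?N * m\<^sup>2 / r \<le> u x powr (p - 1)" if "x \<in> cball c r" for x
    proof -
      have "\<beta> * ?N * m / r \<le> k\<^sup>2"
        using UA(10) r by (simp add: k_def power_divide field_simps power2_eq_square)
      moreover have "m \<le> U (k * norm (x - c)) powr (p - 1)"
      proof -
        have "m = m powr 1" using m by simp
        also have "\<dots> \<le> m powr (p - 1)" using m p by (intro powr_mono') auto
        also have "\<dots> \<le> U (k * norm (x - c)) powr (p - 1)" using mU[OF that] m p by (intro powr_mono2) auto
        finally show ?thesis .
      qed
      ultimately have "\<beta> * ?N * m / r * m \<le> k\<^sup>2 * U (k * norm (x - c)) powr (p - 1)"
        using m by (intro mult_mono) auto
      then show ?thesis by (simp add: upow[OF that] \<sigma>k power2_eq_square)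
    qed
    show "u x powr (p - 1) \<le> (S / r)\<^sup>2" if "x \<in> cball c r" for x
    proof -
      have "k\<^sup>2 \<le> (S / r)\<^sup>2" unfolding k_def using UA(8,9) r by (intro power_mono divide_right_mono) auto
      moreover have "U (k * norm (x - c)) powr (p - 1) \<le> 1"
        using mU[OF that] m UA(2)[of "k * norm (x - c)"] p by (intro powr_le1) auto
      ultimately have "k\<^sup>2 * U (k * norm (x - c)) powr (p - 1) \<le> (S / r)\<^sup>2 * 1"
        by (intro mult_mono) auto
      then show ?thesis by (simp add: upow[OF that] \<sigma>k)
    qed
    show "((\<lambda>t. h (c + t *\<^sub>R (x - c))) has_real_derivative
         (u (c + t *\<^sub>R (x - c)) powr p - ?N * h (c + t *\<^sub>R (x - c))) / t) (at t)"
      if x: "x \<noteq> c" and t: "1 \<le> t" "t * dist c x \<le> r" for x t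
    proof -
      define d where "d = k * norm (x - c)"
      have d: "d > 0" using x k by (simp add: d_def)
      let ?y = "c + t *\<^sub>R (x - c)"
      have y: "?y \<in> cball c r" using t by (simp add: dist_norm norm_minus_commute)
      have kt: "k * norm (?y - c) = t * d" using t by (simp add: d_def)
      have "((\<lambda>t. \<sigma> * k\<^sup>2 * A (t * d)) has_real_derivative \<sigma> * k\<^sup>2 * ((clamp_powr p (U (t * d)) - ?N * A (t * d)) / (t * d) * d)) (at t)"
        using UA(7)[of "t * d"] t d by (auto intro!: derivative_eq_intros DERIV_chain2[where f = A])
      also have "\<sigma> * k\<^sup>2 * ((clamp_powr p (U (t * d)) - ?N * A (t * d)) / (t * d) * d) = (u ?y powr p - ?N * h ?y) / t"
      proof -
        have "m \<le> U (t * d)" using mU[OF y] kt by simp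
        then have "clamp_powr p (U (t * d)) = U (t * d) powr p"
          using m UA(2) by (intro clamp_powr_eq) auto
        then have "u ?y powr p = \<sigma> * k\<^sup>2 * clamp_powr p (U (t * d))"
          using upow[OF y, of p] \<sigma>p unfolding kt by simp
        moreover have "h ?y = \<sigma> * k\<^sup>2 * A (t * d)" unfolding h_def kt ..
        ultimately show ?thesis using d t by (simp add: field_simps)
      qed
      finally show ?thesis
        by (rule has_field_derivative_transform_within_open[where S = "{0<..}"])
           (use t in \<open>auto simp: h_def d_def mult_ac\<close>)
    qed
    show "r * h x = \<beta> * u x" if "x \<in> sphere c r" for x
    proof -
      have kx: "k * norm (x - c) = z" using that r by (simp add: k_def dist_norm norm_minus_commute)
      have "r * h x = \<sigma> * (z\<^sup>2 * A z) / r"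
        unfolding h_def kx using r by (simp add: k_def power2_eq_square)
      also have "\<dots> = \<beta> * u x" unfolding UA(11) u_def kx using r by simp
      finally show ?thesis .
    qed
    show "\<exists>f. \<forall>x. u x = f (dist c x)"
      by (rule exI[of _ "\<lambda>d. \<sigma> * U (k * d)"]) (simp add: u_def dist_norm norm_minus_commute)
  qed
qed

section \<open>A Poincare--Sobolev inequality\<close>

text \<open>Jensen's inequality for the power \<open>q\<close> of a number below the mean: Young's
  inequality pairs \<open>X\<close> with the constant \<open>Y powr (q - 1)\<close>, whose own
  contribution is absorbed on the left.\<close>

lemma powr_le_integral_powr:
  fixes X :: "'a \<Rightarrow> real"
  assumes M: "finite_measure M" "measure M (space M) = 1" and q: "q \<ge> 1" and Y: "0 \<le> Y"
    and X: "integrable M X" "\<And>x. x \<in> space M \<Longrightarrow> 0 \<le> X x" "integrable M (\<lambda>x. X x powr q)"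
    and le: "Y \<le> (\<integral>x. X x \<partial>M)"
  shows "Y powr q \<le> (\<integral>x. X x powr q \<partial>M)"
proof (cases "q = 1 \<or> Y = 0")
  case True
  then show ?thesis
  proof
    assume "q = 1"
    moreover have "(\<integral>x. X x powr 1 \<partial>M) = (\<integral>x. X x \<partial>M)"
      by (intro Bochner_Integration.integral_cong) (use X(2) in auto)
    ultimately show ?thesis using le Y by simp
  qed (simp add: X)
next
  case False
  then have q1: "q > 1" and Y0: "Y > 0" using q Y by auto
  interpret finite_measure M by fact
  define q' where "q' = q / (q - 1)"
  have q': "q' > 1" "1 / q + 1 / q' = 1" using q1 by (auto simp: q'_def field_simps)
  have "Y powr q = Y * Y powr (q - 1)" using Y0 powr_mult_base[of Y "q - 1"] by simp
  also have "\<dots> \<le> (\<integral>x. X x \<partial>M) * Y powr (q - 1)" by (rule mult_right_mono[OF le]) simp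
  also have "\<dots> = (\<integral>x. X x * Y powr (q - 1) \<partial>M)" by simp
  also have "\<dots> \<le> (\<integral>x. X x powr q / q + Y powr q / q' \<partial>M)"
  proof (rule integral_mono)
    fix x assume x: "x \<in> space M"
    have "X x * Y powr (q - 1) \<le> X x powr q / q + (Y powr (q - 1)) powr q' / q'"
      by (rule Youngs_inequality) (use q1 q' X(2)[OF x] in auto)
    also have "(Y powr (q - 1)) powr q' = Y powr q" using q1 by (simp add: powr_powr q'_def)
    finally show "X x * Y powr (q - 1) \<le> X x powr q / q + Y powr q / q'" .
  qed (use X in auto)
  also have "\<dots> = (\<integral>x. X x powr q \<partial>M) / q + Y powr q / q'"
    using X M(2) by simp
  finally have "Y powr q * (1 - 1 / q') \<le> (\<integral>x. X x powr q \<partial>M) / q" by (simp add: algebra_simps)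
  moreover have "1 - 1 / q' = 1 / q" using q' by linarith
  ultimately show ?thesis using q1 by (simp add: field_simps)
qed

text \<open>The fundamental theorem of calculus on the segment with parameter \<open>s^2\<close>; in
  the factor \<open>4 * r * s\<close> the derivative of the parameter gives \<open>2 * s\<close> and
  the diameter gives \<open>2 * r\<close>.\<close>

lemma integral_segment:
  fixes f :: "'a::euclidean_space \<Rightarrow> real"
  assumes f: "\<And>x. x \<in> cball c r \<Longrightarrow> GDERIV f x :> f' x" and f': "continuous_on (cball c r) f'"
    and x: "x \<in> cball c r" and y: "y \<in> cball c r"
  shows "\<bar>f y - f x\<bar> \<le> integral {0..1} (\<lambda>s. 4 * r * s * norm (f' (x + s\<^sup>2 *\<^sub>R (y - x))))"
proof -
  have seg: "x + s\<^sup>2 *\<^sub>R (y - x) \<in> cball c r" if "s \<in> {0..1}" for s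
  proof -
    have "(1 - s\<^sup>2) *\<^sub>R x + s\<^sup>2 *\<^sub>R y \<in> cball c r"
      by (rule convexD[OF convex_cball x y]) (use that in \<open>auto simp: power_le_one\<close>)
    then show ?thesis by (simp add: algebra_simps)
  qed
  have c: "continuous_on {0..1} (\<lambda>s. f' (x + s\<^sup>2 *\<^sub>R (y - x)))"
    by (intro continuous_on_compose2[OF f'] continuous_intros) (use seg in auto)
  have ftc: "((\<lambda>s. 2 * s * ((y - x) \<bullet> f' (x + s\<^sup>2 *\<^sub>R (y - x)))) has_integral
      (f (x + 1\<^sup>2 *\<^sub>R (y - x)) - f (x + 0\<^sup>2 *\<^sub>R (y - x)))) {0..1}"
  proof (rule fundamental_theorem_of_calculus)
    fix s :: real assume s: "s \<in> {0..1}"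
    have "((\<lambda>t. f (x + t *\<^sub>R (y - x))) has_real_derivative ((y - x) \<bullet> f' (x + s\<^sup>2 *\<^sub>R (y - x)))) (at (s\<^sup>2))"
      by (rule GDERIV_line[OF f[OF seg[OF s]]])
    moreover have "((\<lambda>s. s\<^sup>2) has_real_derivative 2 * s) (at s within {0..1})"
      by (auto intro!: derivative_eq_intros)
    ultimately have "((\<lambda>s. f (x + s\<^sup>2 *\<^sub>R (y - x))) has_real_derivative ((y - x) \<bullet> f' (x + s\<^sup>2 *\<^sub>R (y - x))) * (2 * s)) (at s within {0..1})"
      by (rule DERIV_chain2)
    then show "((\<lambda>s. f (x + s\<^sup>2 *\<^sub>R (y - x))) has_vector_derivative 2 * s * ((y - x) \<bullet> f' (x + s\<^sup>2 *\<^sub>R (y - x)))) (at s within {0..1})"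
      by (simp add: has_real_derivative_iff_has_vector_derivative mult_ac)
  qed simp
  have "f y - f x = integral {0..1} (\<lambda>s. 2 * s * ((y - x) \<bullet> f' (x + s\<^sup>2 *\<^sub>R (y - x))))"
    using integral_unique[OF ftc] by simp
  also have "norm \<dots> \<le> integral {0..1} (\<lambda>s. 4 * r * s * norm (f' (x + s\<^sup>2 *\<^sub>R (y - x))))"
  proof (rule integral_norm_bound_integral)
    show "(\<lambda>s. 2 * s * ((y - x) \<bullet> f' (x + s\<^sup>2 *\<^sub>R (y - x)))) integrable_on {0..1}" using ftc by blast
    show "(\<lambda>s. 4 * r * s * norm (f' (x + s\<^sup>2 *\<^sub>R (y - x)))) integrable_on {0..1}"
      by (intro integrable_continuous_real continuous_intros c)
    fix s :: real assume s: "s \<in> {0..1}"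
    have "norm (y - x) \<le> norm (y - c) + norm (c - x)"
      by (metis norm_triangle_ineq diff_add_cancel add_diff_eq)
    also have "\<dots> \<le> r + r" using x y by (intro add_mono) (auto simp: dist_norm norm_minus_commute)
    finally have "\<bar>(y - x) \<bullet> f' (x + s\<^sup>2 *\<^sub>R (y - x))\<bar> \<le> (2 * r) * norm (f' (x + s\<^sup>2 *\<^sub>R (y - x)))"
      by (intro order_trans[OF Cauchy_Schwarz_ineq2] mult_right_mono) auto
    then have "2 * s * \<bar>(y - x) \<bullet> f' (x + s\<^sup>2 *\<^sub>R (y - x))\<bar> \<le> 2 * s * ((2 * r) * norm (f' (x + s\<^sup>2 *\<^sub>R (y - x))))"
      using s by (intro mult_left_mono) auto
    then show "norm (2 * s * ((y - x) \<bullet> f' (x + s\<^sup>2 *\<^sub>R (y - x)))) \<le> 4 * r * s * norm (f' (x + s\<^sup>2 *\<^sub>R (y - x)))"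
      using s by (simp add: abs_mult mult_ac)
  qed
  finally show ?thesis by simp
qed

text \<open>Depends on the weight only through its upper bound \<open>L\<close>, so one constant
  serves all exponents \<open>p\<close>. The factors come from the length of the segments, from the
  pointwise bound of the averages, and from integrating the averages over the ball of volume
  \<open>V\<close>.\<close>

definition poincare_const :: "'a::euclidean_space itself \<Rightarrow> real \<Rightarrow> real \<Rightarrow> real \<Rightarrow> real \<Rightarrow> real" where
  "poincare_const TYPE('a) r L V q = (4 * r) powr q * L powr ((q - 2) / 2) * (2 ^ DIM('a) * (1 + L * V))"

text \<open>The substitution \<open>t = s\<^sup>2\<close> along the segments spreads the singularity at \<open>t = 0\<close>, so that the factor
  \<open>s powr q\<close> absorbs the loss \<open>s powr (- N * (q - 2))\<close> in the pointwise bound of the averages; this is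
  what allows an exponent \<open>q > 2\<close>.\<close>

lemma poincare_sobolev_C1:
  fixes f :: "'a::euclidean_space \<Rightarrow> real" and c :: 'a and \<rho> :: "'a \<Rightarrow> real"
  assumes r: "r > 0" and f: "\<And>x. x \<in> cball c r \<Longrightarrow> GDERIV f x :> f' x" and f': "continuous_on (cball c r) f'"
    and \<rho>m: "\<rho> \<in> borel_measurable (lebesgue_on (ball c r))"
    and \<rho>b: "\<And>x. x \<in> ball c r \<Longrightarrow> 0 \<le> \<rho> x" "\<And>x. x \<in> ball c r \<Longrightarrow> \<rho> x \<le> L"
    and \<rho>1: "(\<integral>x. \<rho> x \<partial>lebesgue_on (ball c r)) = 1"
    and q: "2 \<le> q" "real DIM('a) * (q - 2) \<le> q"
  shows "(\<integral>\<^sup>+x. ennreal (\<bar>f x - (\<integral>y. \<rho> y * f y \<partial>lebesgue_on (ball c r))\<bar> powr q) \<partial>lebesgue_on (ball c r))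
    \<le> ennreal (poincare_const TYPE('a) r L (measure lborel (ball c r)) q *
        (\<integral>x. (norm (f' x))\<^sup>2 \<partial>lebesgue_on (ball c r)) powr (q / 2))"
proof -
  let ?M = "lebesgue_on (ball c r)" and ?I = "lebesgue_on {0..1::real}" and ?N = "DIM('a)"
  interpret M: finite_measure ?M by (rule finite_measure_lebesgue_ball)
  interpret I: finite_measure ?I by (rule finite_measure_lebesgue_on) auto
  have I1: "measure ?I (space ?I) = 1" by (simp add: measure_restrict_space space_restrict_space)
  have spM: "space ?M = ball c r" and spI: "space ?I = {0..1}" by (simp_all add: space_restrict_space)
  have fc: "continuous_on (cball c r) f" by (rule GDERIV_continuous_on) (rule f)
  \<comment> \<open>The norm of the gradient, cut off outside the ball, is Borel on the whole space,
    so that affine substitutions over \<open>lborel\<close> apply to it.\<close>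
  define g where "g x = indicator (ball c r) x * (indicator (cball c r) x *\<^sub>R norm (f' x))" for x
  have gm0: "(\<lambda>x. indicator (cball c r) x *\<^sub>R norm (f' x)) \<in> borel_measurable borel"
    by (rule borel_measurable_continuous_on_indicator) (auto intro!: continuous_intros f')
  have gm[measurable]: "g \<in> borel_measurable borel" unfolding g_def[abs_def]
    by (intro borel_measurable_times borel_measurable_indicator gm0) simp
  have geq: "g x = norm (f' x)" if "x \<in> ball c r" for x using that by (simp add: g_def)
  obtain K where K: "K \<ge> 0" "\<And>x. x \<in> cball c r \<Longrightarrow> norm (f' x) \<le> K" using continuous_bounded_cball[OF f'] by metis
  have g: "0 \<le> g x" "g x \<le> K" for x using K by (auto simp: g_def indicator_def)
  define E where "E = (\<integral>x. (norm (f' x))\<^sup>2 \<partial>?M)"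
  have E0: "E \<ge> 0" by (simp add: E_def)
  have gE: "(\<integral>\<^sup>+x. ennreal ((g x)\<^sup>2) \<partial>lborel) = ennreal E"
  proof -
    have "(\<integral>\<^sup>+x. ennreal ((g x)\<^sup>2) \<partial>lborel) = (\<integral>\<^sup>+x. ennreal ((norm (f' x))\<^sup>2) * indicator (ball c r) x \<partial>lborel)"
      by (intro nn_integral_cong) (auto simp: g_def indicator_def)
    also have "\<dots> = (\<integral>\<^sup>+x. ennreal ((norm (f' x))\<^sup>2) \<partial>?M)"
      by (rule nn_integral_lebesgue_on[symmetric]) auto
    also have "\<dots> = ennreal E" unfolding E_def
      by (rule nn_integral_eq_integral[OF L2_integrable_sq[OF L2_continuous_ball[OF f']]]) simp
    finally show ?thesis .
  qed
  have L0: "0 \<le> L" using \<rho>b[of c] r by force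
  note [measurable] = \<rho>m id_measurable_lebesgue_on[of "ball c r"]
  have idI[measurable]: "(\<lambda>s. s) \<in> ?I \<rightarrow>\<^sub>M borel" by (rule id_measurable_lebesgue_on)
  have \<rho>i: "integrable ?M \<rho>"
    by (rule M.integrable_const_bound[where B = L]) (use \<rho>b in \<open>auto intro!: AE_I2 simp: spM\<close>)
  have \<rho>nn: "(\<integral>\<^sup>+y. ennreal (\<rho> y) \<partial>?M) = 1"
    using nn_integral_eq_integral[OF \<rho>i] \<rho>b \<rho>1 by (simp add: spM AE_restrict_space_iff)
  define seg where "seg s x y = x + s\<^sup>2 *\<^sub>R (y - x)" for s :: real and x y :: 'a
  have seg_eq: "seg s x y = (1 - s\<^sup>2) *\<^sub>R x + s\<^sup>2 *\<^sub>R y" for s x y by (simp add: seg_def algebra_simps)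
  have seg_in: "seg s x y \<in> ball c r" if "s \<in> {0..1}" "x \<in> ball c r" "y \<in> ball c r" for s x y
    unfolding seg_eq by (rule convexD[OF convex_ball that(2,3)]) (use that(1) in \<open>auto simp: power_le_one\<close>)
  have [measurable]: "(\<lambda>s. seg (a s) (b s) (d s)) \<in> borel_measurable R"
    if [measurable]: "a \<in> borel_measurable R" "b \<in> borel_measurable R" "d \<in> borel_measurable R"
    for a b d and R :: "'z measure"
    unfolding seg_def by measurable
  define G where "G s x y = \<rho> y * g (seg s x y)" for s x y
  define A where "A s x = (\<integral>y. \<rho> y * (g (seg s x y))\<^sup>2 \<partial>?M)" for s x
  define a where "a s x = (\<integral>y. G s x y \<partial>?M)" for s x
  have gi: "integrable ?M (\<lambda>y. \<rho> y * (g (seg s x y)) ^ k)" for s x k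
  proof (rule M.integrable_const_bound[where B = "L * K ^ k"])
    show "AE y in ?M. norm (\<rho> y * g (seg s x y) ^ k) \<le> L * K ^ k"
      using \<rho>b g L0 by (auto intro!: AE_I2 mult_mono power_mono simp: spM abs_mult)
  qed measurable
  have A0: "0 \<le> A s x" and a0: "0 \<le> a s x" for s x
    unfolding A_def a_def G_def using \<rho>b g
    by (auto intro!: integral_nonneg_AE AE_I2 mult_nonneg_nonneg simp: spM)
  \<comment> \<open>The variance of \<open>g\<close> along the segments is nonnegative with respect
    to the probability density \<open>\<rho>\<close>.\<close>
  have aA: "(a s x)\<^sup>2 \<le> A s x" for s x
  proof -
    have i1: "integrable ?M (\<lambda>y. \<rho> y * g (seg s x y))" using gi[of s x 1] by simp
    have "0 \<le> (\<integral>y. \<rho> y * (g (seg s x y) - a s x)\<^sup>2 \<partial>?M)"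
      using \<rho>b by (auto intro!: integral_nonneg_AE AE_I2 mult_nonneg_nonneg simp: spM)
    also have "(\<integral>y. \<rho> y * (g (seg s x y) - a s x)\<^sup>2 \<partial>?M)
      = (\<integral>y. \<rho> y * (g (seg s x y))\<^sup>2 - 2 * a s x * (\<rho> y * g (seg s x y)) + (a s x)\<^sup>2 * \<rho> y \<partial>?M)"
      by (intro Bochner_Integration.integral_cong) (auto simp: power2_eq_square algebra_simps)
    also have "\<dots> = A s x - 2 * a s x * a s x + (a s x)\<^sup>2"
      using gi[of s x 2] i1 \<rho>i \<rho>1 by (simp add: A_def a_def G_def)
    finally show ?thesis by (simp add: power2_eq_square)
  qed
  have Ann: "ennreal (A s x) = (\<integral>\<^sup>+y. ennreal (\<rho> y) * ennreal ((g (seg s x y))\<^sup>2) \<partial>?M)" for s x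
  proof -
    have "ennreal (A s x) = (\<integral>\<^sup>+y. ennreal (\<rho> y * (g (seg s x y))\<^sup>2) \<partial>?M)"
      unfolding A_def
      by (rule nn_integral_eq_integral[symmetric, OF gi]) (use \<rho>b in \<open>auto intro!: AE_I2 simp: spM\<close>)
    also have "\<dots> = (\<integral>\<^sup>+y. ennreal (\<rho> y) * ennreal ((g (seg s x y))\<^sup>2) \<partial>?M)"
      by (rule nn_integral_cong) (use \<rho>b in \<open>auto simp: spM ennreal_mult'\<close>)
    finally show ?thesis .
  qed
  \<comment> \<open>The density is replaced by its bound \<open>L\<close>, and the variable
    \<open>y\<close>, which enters with coefficient \<open>s^2\<close>, is substituted; this
    produces the singular power of \<open>s\<close>.\<close>
  have Ab: "A s x \<le> L * E * s powr (- (2 * real ?N))" if s: "0 < s" for s x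
  proof -
    have "ennreal (A s x) \<le> (\<integral>\<^sup>+y. ennreal L * ennreal ((g (seg s x y))\<^sup>2) \<partial>?M)"
      unfolding Ann using \<rho>b by (intro nn_integral_mono mult_right_mono ennreal_leI) (auto simp: spM)
    also have "\<dots> \<le> (\<integral>\<^sup>+y. ennreal L * ennreal ((g (seg s x y))\<^sup>2) \<partial>lborel)"
      by (subst nn_integral_lebesgue_on) (auto intro!: nn_integral_mono simp: indicator_def)
    also have "\<dots> = ennreal L * (\<integral>\<^sup>+y. ennreal ((g ((1 - s\<^sup>2) *\<^sub>R x + s\<^sup>2 *\<^sub>R y))\<^sup>2) \<partial>lborel)"
    proof -
      have "(\<lambda>y. (1 - s\<^sup>2) *\<^sub>R x + s\<^sup>2 *\<^sub>R y) \<in> borel_measurable borel"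
        by (intro borel_measurable_continuous_onI continuous_intros)
      from measurable_compose[OF this gm]
      show ?thesis unfolding seg_eq by (intro nn_integral_cmult) auto
    qed
    also have "(\<integral>\<^sup>+y. ennreal ((g ((1 - s\<^sup>2) *\<^sub>R x + s\<^sup>2 *\<^sub>R y))\<^sup>2) \<partial>lborel) = ennreal (1 / \<bar>s\<^sup>2\<bar> ^ ?N) * ennreal E"
      using s by (subst nn_integral_lborel_affine[of "\<lambda>x. ennreal ((g x)\<^sup>2)"]) (auto simp: gE)
    also have "ennreal L * (ennreal (1 / \<bar>s\<^sup>2\<bar> ^ ?N) * ennreal E) = ennreal (L * E * (1 / \<bar>s\<^sup>2\<bar> ^ ?N))"
      using L0 E0 by (simp add: ennreal_mult'[symmetric] mult_ac)
    also have "1 / \<bar>s\<^sup>2\<bar> ^ ?N = s powr (- (2 * real ?N))"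
    proof -
      have "s powr (2 * real ?N) = s ^ (2 * ?N)" using s powr_realpow[of s "2 * ?N"] by simp
      then show ?thesis using s by (simp add: powr_minus_divide power_mult)
    qed
    finally show ?thesis using L0 E0 by (simp add: ennreal_le_iff)
  qed
  \<comment> \<open>On each segment one of the coefficients \<open>1 - s^2\<close> and
    \<open>s^2\<close> is at least 1/2, and that endpoint is substituted: \<open>x\<close> after
    Fubini, with \<open>\<rho>\<close> integrating to 1, or else \<open>y\<close> through
    \<open>Ab\<close>. Hence the bound has no singularity in \<open>s\<close>.\<close>
  have Aint: "(\<integral>\<^sup>+x. ennreal (A s x) \<partial>?M) \<le> ennreal (2 ^ ?N * (1 + L * measure lborel (ball c r)) * E)"
    if s: "s \<in> {0..1}" for s
  proof (cases "s\<^sup>2 \<le> 1 / 2")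
    case True
    interpret P: pair_sigma_finite ?M ?M ..
    have "(\<integral>\<^sup>+x. ennreal (A s x) \<partial>?M) = (\<integral>\<^sup>+x. (\<integral>\<^sup>+y. ennreal (\<rho> y) * ennreal ((g (seg s x y))\<^sup>2) \<partial>?M) \<partial>?M)"
      by (simp add: Ann)
    also have "\<dots> = (\<integral>\<^sup>+y. (\<integral>\<^sup>+x. ennreal (\<rho> y) * ennreal ((g (seg s x y))\<^sup>2) \<partial>?M) \<partial>?M)"
      by (rule P.Fubini'[symmetric]) measurable
    also have "\<dots> \<le> (\<integral>\<^sup>+y. ennreal (\<rho> y) * ennreal (2 ^ ?N * E) \<partial>?M)"
    proof (rule nn_integral_mono)
      fix y
      have "(\<integral>\<^sup>+x. ennreal ((g (seg s x y))\<^sup>2) \<partial>?M) \<le> (\<integral>\<^sup>+x. ennreal ((g (s\<^sup>2 *\<^sub>R y + (1 - s\<^sup>2) *\<^sub>R x))\<^sup>2) \<partial>lborel)"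
        unfolding seg_eq by (subst nn_integral_lebesgue_on) (auto intro!: nn_integral_mono simp: indicator_def add.commute)
      also have "\<dots> = ennreal (1 / \<bar>1 - s\<^sup>2\<bar> ^ ?N) * ennreal E"
        using True by (subst nn_integral_lborel_affine[of "\<lambda>x. ennreal ((g x)\<^sup>2)"]) (auto simp: gE)
      also have "\<dots> \<le> ennreal (2 ^ ?N) * ennreal E"
      proof (intro mult_right_mono ennreal_leI)
        have "(1/2) ^ ?N \<le> \<bar>1 - s\<^sup>2\<bar> ^ ?N" using True by (intro power_mono) auto
        moreover have "0 < \<bar>1 - s\<^sup>2\<bar> ^ ?N" using True by auto
        ultimately show "1 / \<bar>1 - s\<^sup>2\<bar> ^ ?N \<le> 2 ^ ?N" by (simp add: field_simps power_one_over)
      qed simp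
      finally have le: "(\<integral>\<^sup>+x. ennreal ((g (seg s x y))\<^sup>2) \<partial>?M) \<le> ennreal (2 ^ ?N * E)"
        using E0 by (simp add: ennreal_mult')
      have "(\<integral>\<^sup>+x. ennreal (\<rho> y) * ennreal ((g (seg s x y))\<^sup>2) \<partial>?M) = ennreal (\<rho> y) * (\<integral>\<^sup>+x. ennreal ((g (seg s x y))\<^sup>2) \<partial>?M)"
        by (rule nn_integral_cmult) measurable
      also have "\<dots> \<le> ennreal (\<rho> y) * ennreal (2 ^ ?N * E)" using le by (rule mult_left_mono) simp
      finally show "(\<integral>\<^sup>+x. ennreal (\<rho> y) * ennreal ((g (seg s x y))\<^sup>2) \<partial>?M) \<le> ennreal (\<rho> y) * ennreal (2 ^ ?N * E)" .
    qed
    also have "\<dots> = ennreal (2 ^ ?N * E)" by (subst nn_integral_multc) (auto simp: \<rho>nn)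
    also have "\<dots> \<le> ennreal (2 ^ ?N * (1 + L * measure lborel (ball c r)) * E)"
      using L0 E0 by (intro ennreal_leI mult_right_mono) (auto simp: mult_le_cancel_left1)
    finally show ?thesis .
  next
    case False
    then have s0: "s > 0" using s by (cases "s = 0") auto
    have "A s x \<le> L * E * 2 ^ ?N" for x
    proof -
      have "s powr (- (2 * real ?N)) \<le> 2 ^ ?N"
      proof -
        have "s powr (2 * real ?N) = (s\<^sup>2) ^ ?N"
          using s0 powr_realpow[of s "2 * ?N"] by (simp add: power_mult)
        moreover have "(1/2) ^ ?N \<le> (s\<^sup>2) ^ ?N" using False by (intro power_mono) auto
        ultimately show ?thesis using s0 by (simp add: powr_minus_divide field_simps power_one_over)
      qed
      then have "L * E * s powr (- (2 * real ?N)) \<le> L * E * 2 ^ ?N" using L0 E0 by (intro mult_left_mono) auto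
      then show ?thesis using Ab[OF s0, of x] by linarith
    qed
    then have "(\<integral>\<^sup>+x. ennreal (A s x) \<partial>?M) \<le> (\<integral>\<^sup>+x. ennreal (L * E * 2 ^ ?N) \<partial>?M)"
      by (intro nn_integral_mono ennreal_leI)
    also have "\<dots> = ennreal (L * E * 2 ^ ?N) * emeasure lborel (ball c r)"
      by (simp add: emeasure_restrict_space space_restrict_space)
    also have "emeasure lborel (ball c r) = ennreal (measure lborel (ball c r))"
      using emeasure_lborel_ball_finite[of c r] by (intro emeasure_eq_ennreal_measure) auto
    also have "ennreal (L * E * 2 ^ ?N) * \<dots> = ennreal (L * E * 2 ^ ?N * measure lborel (ball c r))"
      using L0 E0 by (simp add: ennreal_mult')
    also have "\<dots> \<le> ennreal (2 ^ ?N * (1 + L * measure lborel (ball c r)) * E)"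
      using L0 E0 by (intro ennreal_leI) (simp add: algebra_simps)
    finally show ?thesis .
  qed
  have am[measurable]: "(\<lambda>s. a s x) \<in> borel_measurable ?I" "(\<lambda>s. A s x) \<in> borel_measurable ?I" for x
    unfolding a_def A_def G_def by measurable
  have ab: "a s x \<le> K" for s x
  proof -
    have "a s x \<le> (\<integral>y. \<rho> y * K \<partial>?M)" unfolding a_def G_def
      using gi[of s x 1] \<rho>i \<rho>b g by (intro integral_mono) (auto intro!: mult_left_mono simp: spM)
    then show ?thesis using \<rho>i \<rho>1 by simp
  qed
  have Ab': "A s x \<le> K\<^sup>2" for s x
  proof -
    have "A s x \<le> (\<integral>y. \<rho> y * K\<^sup>2 \<partial>?M)" unfolding A_def
      using gi[of s x 2] \<rho>i \<rho>b g by (intro integral_mono) (auto intro!: mult_left_mono power_mono simp: spM)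
    then show ?thesis using \<rho>i \<rho>1 by simp
  qed
  let ?fm = "\<integral>y. \<rho> y * f y \<partial>?M"
  define B where "B = (4 * r) powr q * (L * E) powr ((q - 2) / 2)"
  have B0: "B \<ge> 0" by (simp add: B_def)
  have pt: "\<bar>f x - ?fm\<bar> powr q \<le> (\<integral>s. B * A s x \<partial>?I)" if x: "x \<in> ball c r" for x
  proof -
    interpret P: pair_sigma_finite ?I ?M ..
    obtain F where F: "\<And>y. y \<in> cball c r \<Longrightarrow> norm (f y) \<le> F" using continuous_bounded_cball[OF fc] by metis
    have fmeas[measurable]: "f \<in> borel_measurable ?M" by (rule continuous_measurable_ball[OF fc])
    have fi: "integrable ?M (\<lambda>y. \<rho> y * f y)"
    proof (rule M.integrable_const_bound[where B = "L * F"])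
      show "AE y in ?M. norm (\<rho> y * f y) \<le> L * F"
        using \<rho>b F L0 by (intro AE_I2) (auto intro!: mult_mono simp: spM abs_mult)
    qed measurable
    have hi: "integrable (?I \<Otimes>\<^sub>M ?M) (\<lambda>(s, y). 4 * r * s * G s x y)"
    proof -
      interpret PM: finite_measure "?I \<Otimes>\<^sub>M ?M"
        by (rule finite_measureI) (simp add: M.emeasure_pair_measure_Times space_pair_measure I.emeasure_finite M.emeasure_finite ennreal_mult_eq_top_iff)
      show ?thesis
      proof (rule PM.integrable_const_bound[where B = "4 * r * 1 * (L * K)"])
        show "AE z in ?I \<Otimes>\<^sub>M ?M. norm (case z of (s, y) \<Rightarrow> 4 * r * s * G s x y) \<le> 4 * r * 1 * (L * K)"
        proof (rule AE_I2)
          fix z assume "z \<in> space (?I \<Otimes>\<^sub>M ?M)"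
          then obtain s y where z: "z = (s, y)" "s \<in> {0..1}" "y \<in> ball c r" by (auto simp: space_pair_measure spM spI)
          then show "norm (case z of (s, y) \<Rightarrow> 4 * r * s * G s x y) \<le> 4 * r * 1 * (L * K)"
          proof -
            have "s * (\<rho> y * g (seg s x y)) \<le> 1 * (L * K)"
              using z \<rho>b[OF z(3)] g L0 K by (intro mult_mono) auto
            then have "4 * r * (s * (\<rho> y * g (seg s x y))) \<le> 4 * r * (1 * (L * K))"
              using r by (intro mult_left_mono) auto
            then show ?thesis
              using z r \<rho>b[OF z(3)] g by (simp add: G_def abs_mult mult.assoc)
          qed
        qed
        show "(\<lambda>(s, y). 4 * r * s * G s x y) \<in> borel_measurable (?I \<Otimes>\<^sub>M ?M)"
          unfolding G_def by measurable
      qed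
    qed
    have "f x - ?fm = (\<integral>y. \<rho> y * (f x - f y) \<partial>?M)"
      using fi \<rho>i \<rho>1 by (simp add: right_diff_distrib)
    also have "\<bar>\<dots>\<bar> \<le> (\<integral>y. (\<integral>s. 4 * r * s * G s x y \<partial>?I) \<partial>?M)"
    proof -
      have "norm (\<integral>y. \<rho> y * (f x - f y) \<partial>?M) \<le> (\<integral>y. (\<integral>s. 4 * r * s * G s x y \<partial>?I) \<partial>?M)"
      proof (rule Bochner_Integration.integral_norm_bound_integral)
        show "integrable ?M (\<lambda>y. \<rho> y * (f x - f y))" using fi \<rho>i by (simp add: right_diff_distrib)
        show "integrable ?M (\<lambda>y. \<integral>s. 4 * r * s * G s x y \<partial>?I)" by (rule P.integrable_snd[OF hi])
        fix y assume "y \<in> space ?M"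
        then have y: "y \<in> ball c r" by (simp add: spM)
        have xy: "x \<in> cball c r" "y \<in> cball c r" using x y by auto
        have segc: "x + s\<^sup>2 *\<^sub>R (y - x) \<in> cball c r" if "s \<in> {0..1}" for s
          using seg_in[OF that x y] by (simp add: seg_def)
        have cs: "continuous_on {0..1} (\<lambda>s. f' (x + s\<^sup>2 *\<^sub>R (y - x)))"
          by (intro continuous_on_compose2[OF f'] continuous_intros)
             (use segc in auto)
        have ii: "integrable ?I (\<lambda>s. 4 * r * s * norm (f' (x + s\<^sup>2 *\<^sub>R (y - x))))"
          by (intro continuous_imp_integrable_real continuous_intros cs)
        have "norm (\<rho> y * (f x - f y)) = \<rho> y * \<bar>f y - f x\<bar>" using \<rho>b(1)[OF y] by (simp add: abs_mult abs_minus_commute)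
        also have "\<dots> \<le> \<rho> y * integral {0..1} (\<lambda>s. 4 * r * s * norm (f' (x + s\<^sup>2 *\<^sub>R (y - x))))"
          by (rule mult_left_mono[OF integral_segment[OF f f' xy]]) (use \<rho>b y in auto)
        also have "integral {0..1} (\<lambda>s. 4 * r * s * norm (f' (x + s\<^sup>2 *\<^sub>R (y - x)))) = (\<integral>s. 4 * r * s * norm (f' (x + s\<^sup>2 *\<^sub>R (y - x))) \<partial>?I)"
          by (rule lebesgue_integral_eq_integral[symmetric]) (use ii in auto)
        also have "\<rho> y * \<dots> = (\<integral>s. \<rho> y * (4 * r * s * norm (f' (x + s\<^sup>2 *\<^sub>R (y - x)))) \<partial>?I)" by simp
        also have "\<dots> = (\<integral>s. 4 * r * s * G s x y \<partial>?I)"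
          using geq[OF seg_in[OF _ x y]]
          by (intro Bochner_Integration.integral_cong) (auto simp: spI G_def seg_def)
        finally show "norm (\<rho> y * (f x - f y)) \<le> (\<integral>s. 4 * r * s * G s x y \<partial>?I)" .
      qed
      then show ?thesis by simp
    qed
    also have "\<dots> = (\<integral>s. (\<integral>y. 4 * r * s * G s x y \<partial>?M) \<partial>?I)" by (rule P.Fubini_integral[OF hi])
    also have "\<dots> = (\<integral>s. 4 * r * s * a s x \<partial>?I)" by (simp add: a_def)
    finally have le: "\<bar>f x - ?fm\<bar> \<le> (\<integral>s. 4 * r * s * a s x \<partial>?I)" .
    have Xb: "0 \<le> 4 * r * s * a s x" "4 * r * s * a s x \<le> 4 * r * 1 * K" if "s \<in> {0..1}" for s
    proof -
      show "0 \<le> 4 * r * s * a s x" using that r a0 by auto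
      have "s * a s x \<le> 1 * K" using that a0 ab K by (intro mult_mono) auto
      then have "4 * r * (s * a s x) \<le> 4 * r * (1 * K)" using r by (intro mult_left_mono) auto
      then show "4 * r * s * a s x \<le> 4 * r * 1 * K" by (simp add: mult.assoc)
    qed
    \<comment> \<open>The power \<open>a powr q\<close> is split as \<open>a powr (q - 2)\<close>
      times a square. The former is bounded pointwise by \<open>Ab\<close>, the latter is kept as
      \<open>A s x\<close>, whose integral over \<open>x\<close> is harmless. The remaining exponent
      \<open>q - N * (q - 2)\<close> of \<open>s\<close> is nonnegative by hypothesis.\<close>
    have Xq: "(4 * r * s * a s x) powr q \<le> B * A s x" if s: "s \<in> {0..1}" for s
    proof (cases "s = 0 \<or> a s x = 0")
      case True
      then show ?thesis using B0 A0[of s x] q by auto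
    next
      case False
      then have s0: "s > 0" and a1: "a s x > 0" using s a0[of s x] by auto
      have sq: "a s x powr 2 = (a s x)\<^sup>2" using a1 by simp
      have "a s x powr (q - 2) = (a s x powr 2) powr ((q - 2) / 2)" unfolding powr_powr by (rule arg_cong[where f = "(powr) (a s x)"]) (simp add: field_simps)
      also have "\<dots> = ((a s x)\<^sup>2) powr ((q - 2) / 2)" unfolding sq ..
      also have "\<dots> \<le> (L * E * s powr (- (2 * real ?N))) powr ((q - 2) / 2)"
        using q order_trans[OF aA Ab[OF s0]] by (intro powr_mono2) auto
      also have "\<dots> = (L * E) powr ((q - 2) / 2) * s powr (- (real ?N * (q - 2)))"
        using L0 E0 s0 by (simp add: powr_mult powr_powr)
      finally have 1: "a s x powr (q - 2) \<le> (L * E) powr ((q - 2) / 2) * s powr (- (real ?N * (q - 2)))" .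
      have "a s x powr q = a s x powr (q - 2) * (a s x)\<^sup>2"
        using powr_add[of "a s x" "q - 2" 2] unfolding sq by simp
      also have "\<dots> \<le> ((L * E) powr ((q - 2) / 2) * s powr (- (real ?N * (q - 2)))) * A s x"
        by (intro mult_mono 1 aA) auto
      finally have "s powr q * a s x powr q \<le> s powr q * (((L * E) powr ((q - 2) / 2) * s powr (- (real ?N * (q - 2)))) * A s x)"
        by (rule mult_left_mono) simp
      also have "\<dots> = (s powr (q - real ?N * (q - 2))) * ((L * E) powr ((q - 2) / 2) * A s x)"
      proof -
        have "s powr (q - real ?N * (q - 2)) = s powr q * s powr (- (real ?N * (q - 2)))"
          using powr_add[of s q "- (real ?N * (q - 2))"] by simp
        then show ?thesis by (simp only: mult_ac)
      qed
      also have "\<dots> \<le> 1 * ((L * E) powr ((q - 2) / 2) * A s x)"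
        using s s0 q A0 by (intro mult_right_mono powr_le1) auto
      finally have "(4 * r) powr q * (s powr q * a s x powr q) \<le> (4 * r) powr q * ((L * E) powr ((q - 2) / 2) * A s x)"
        by (intro mult_left_mono) auto
      then show ?thesis using r s0 a1 by (simp add: B_def powr_mult mult_ac)
    qed
    have "\<bar>f x - ?fm\<bar> powr q \<le> (\<integral>s. (4 * r * s * a s x) powr q \<partial>?I)"
    proof (rule powr_le_integral_powr[OF _ I1 _ _ _ _ _ le])
      show "finite_measure ?I" by (rule I.finite_measure_axioms)
      show "integrable ?I (\<lambda>s. 4 * r * s * a s x)"
        by (rule I.integrable_const_bound[where B = "4 * r * 1 * K"]) (use Xb in \<open>auto intro!: AE_I2 simp: spI abs_of_nonneg\<close>)
      show "integrable ?I (\<lambda>s. (4 * r * s * a s x) powr q)"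
      proof (rule I.integrable_const_bound[where B = "(4 * r * 1 * K) powr q"])
        show "AE s in ?I. norm ((4 * r * s * a s x) powr q) \<le> (4 * r * 1 * K) powr q"
          using Xb q by (intro AE_I2) (auto simp: spI intro!: powr_mono2)
      qed measurable
    qed (use Xb q in \<open>auto simp: spI\<close>)
    also have "\<dots> \<le> (\<integral>s. B * A s x \<partial>?I)"
    proof (rule integral_mono)
      show "integrable ?I (\<lambda>s. (4 * r * s * a s x) powr q)"
      proof (rule I.integrable_const_bound[where B = "(4 * r * 1 * K) powr q"])
        show "AE s in ?I. norm ((4 * r * s * a s x) powr q) \<le> (4 * r * 1 * K) powr q"
          using Xb q by (intro AE_I2) (auto simp: spI intro!: powr_mono2)
      qed measurable
      show "integrable ?I (\<lambda>s. B * A s x)"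
        by (intro integrable_mult_right I.integrable_const_bound[where B = "K\<^sup>2"]) (use A0 Ab' in \<open>auto simp: abs_of_nonneg\<close>)
    qed (use Xq in \<open>auto simp: spI\<close>)
    finally show ?thesis .
  qed
  interpret P2: pair_sigma_finite ?I ?M ..
  have Ap[measurable]: "(\<lambda>z. A (fst z) (snd z)) \<in> borel_measurable (?I \<Otimes>\<^sub>M ?M)"
    unfolding A_def by measurable
  have "(\<integral>\<^sup>+x. ennreal (\<bar>f x - ?fm\<bar> powr q) \<partial>?M) \<le> (\<integral>\<^sup>+x. (\<integral>\<^sup>+s. ennreal (B * A s x) \<partial>?I) \<partial>?M)"
  proof (rule nn_integral_mono)
    fix x assume "x \<in> space ?M"
    then have x: "x \<in> ball c r" by (simp add: spM)
    have i: "integrable ?I (\<lambda>s. B * A s x)"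
      by (intro integrable_mult_right I.integrable_const_bound[where B = "K\<^sup>2"]) (use A0 Ab' in \<open>auto simp: abs_of_nonneg\<close>)
    have "(\<integral>\<^sup>+s. ennreal (B * A s x) \<partial>?I) = ennreal (\<integral>s. B * A s x \<partial>?I)"
      by (rule nn_integral_eq_integral[OF i]) (use A0 B0 in auto)
    then show "ennreal (\<bar>f x - ?fm\<bar> powr q) \<le> (\<integral>\<^sup>+s. ennreal (B * A s x) \<partial>?I)"
      using pt[OF x] by (simp add: ennreal_leI)
  qed
  also have "\<dots> = (\<integral>\<^sup>+s. (\<integral>\<^sup>+x. ennreal (B * A s x) \<partial>?M) \<partial>?I)"
    by (rule P2.Fubini') measurable
  also have "\<dots> \<le> (\<integral>\<^sup>+s. ennreal (B * (2 ^ ?N * (1 + L * measure lborel (ball c r)) * E)) \<partial>?I)"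
  proof (rule nn_integral_mono)
    fix s assume "s \<in> space ?I"
    then have s: "s \<in> {0..1}" by (simp add: spI)
    have [measurable]: "(\<lambda>x. A s x) \<in> borel_measurable ?M" unfolding A_def by measurable
    have "(\<integral>\<^sup>+x. ennreal (B * A s x) \<partial>?M) = ennreal B * (\<integral>\<^sup>+x. ennreal (A s x) \<partial>?M)"
      using B0 by (subst nn_integral_cmult[symmetric]) (auto simp: ennreal_mult')
    also have "\<dots> \<le> ennreal B * ennreal (2 ^ ?N * (1 + L * measure lborel (ball c r)) * E)"
      by (intro mult_left_mono Aint s) auto
    also have "\<dots> = ennreal (B * (2 ^ ?N * (1 + L * measure lborel (ball c r)) * E))"
      using B0 by (simp add: ennreal_mult')
    finally show "(\<integral>\<^sup>+x. ennreal (B * A s x) \<partial>?M) \<le> ennreal (B * (2 ^ ?N * (1 + L * measure lborel (ball c r)) * E))" .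
  qed
  also have "\<dots> = ennreal (B * (2 ^ ?N * (1 + L * measure lborel (ball c r)) * E))"
    by (simp add: emeasure_restrict_space space_restrict_space)
  also have "B * (2 ^ ?N * (1 + L * measure lborel (ball c r)) * E) =
     poincare_const TYPE('a) r L (measure lborel (ball c r)) q * E powr (q / 2)"
  proof -
    have "E powr (q / 2) = E powr ((q - 2) / 2) * E"
    proof (cases "E = 0")
      case False
      then have "E > 0" using E0 by simp
      then have "E powr ((q - 2) / 2) * E = E powr ((q - 2) / 2 + 1)" by (simp add: powr_add)
      then show ?thesis by (simp add: diff_divide_distrib)
    qed simp
    then show ?thesis using L0 E0 by (simp add: B_def poincare_const_def powr_mult mult_ac)
  qed
  finally show ?thesis unfolding E_def .
qed

section \<open>Vanishing of the energy for exponents close to 1\<close>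

lemma powr_le_linear:
  fixes x a :: real
  assumes "0 \<le> x" "0 \<le> a" "a \<le> 1"
  shows "x powr a \<le> 1 + a * (x - 1)"
proof (cases "x = 0")
  case False
  then show ?thesis using Youngs_inequality_0[of a "1 - a" x 1] assms by (simp add: algebra_simps)
qed (use assms in simp)

lemma powr_ge_linear:
  fixes x p :: real
  assumes "0 \<le> x" "1 < p"
  shows "1 + p * (x - 1) \<le> x powr p"
proof -
  define p' where "p' = p / (p - 1)"
  have p': "p' > 1" "1 / p + 1 / p' = 1" using assms by (auto simp: p'_def field_simps)
  have "x * 1 \<le> x powr p / p + 1 powr p' / p'"
    by (rule Youngs_inequality) (use assms p' in auto)
  moreover have "1 / p' = (p - 1) / p" by (simp add: p'_def)
  ultimately have "x \<le> (x powr p + (p - 1)) / p" by (simp add: add_divide_distrib)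
  then have "x * p \<le> x powr p + (p - 1)" using assms by (simp add: pos_le_divide_eq)
  then show ?thesis by (simp add: algebra_simps)
qed

lemma powr_one_plus_le:
  fixes y s :: real
  assumes "0 \<le> y" "0 < s" "s \<le> 1"
  shows "(1 + y) powr s \<le> 1 + y powr s"
proof (cases "y = 0")
  case False
  then have y: "y > 0" using assms by simp
  have "(1 + y) powr s = (1 + y) * (1 + y) powr (s - 1)" using y powr_mult_base[of "1 + y" "s - 1"] by simp
  also have "\<dots> = (1 + y) powr (s - 1) + y * (1 + y) powr (s - 1)" by (simp add: algebra_simps)
  also have "\<dots> \<le> 1 powr (s - 1) + y * y powr (s - 1)"
    using y assms by (intro add_mono mult_left_mono powr_mono2') auto
  also have "\<dots> = 1 + y powr s" using y powr_mult_base[of y "s - 1"] by simp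
  finally show ?thesis .
qed simp

text \<open>Extracts the factor \<open>\<epsilon>\<close>. For \<open>x \<le> 1\<close> the tangent
  line of \<open>x powr (1 + \<epsilon>)\<close> suffices. For \<open>x = 1 + y > 1\<close>,
  concavity gives \<open>x powr \<epsilon> - 1 \<le> (\<epsilon> / s) (x powr s - 1)\<close>, and
  the last bracket is estimated by \<open>s * y\<close> where it is multiplied by \<open>y\<close>
  and by \<open>y powr s\<close> where it is multiplied by \<open>y^2\<close>.\<close>

lemma powr_excess_bound:
  fixes x \<epsilon> s :: real
  assumes x: "0 \<le> x" and \<epsilon>: "0 < \<epsilon>" "\<epsilon> \<le> s" and s: "s \<le> 1"
  shows "x * (x powr \<epsilon> - 1) * (x - 1) \<le> \<epsilon> * ((x - 1)\<^sup>2 + \<bar>x - 1\<bar> powr (2 + s) / s)"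
proof (cases "x \<le> 1")
  case True
  have "1 + (1 + \<epsilon>) * (x - 1) \<le> x powr (1 + \<epsilon>)" by (rule powr_ge_linear) (use x \<epsilon> in auto)
  also have "x powr (1 + \<epsilon>) = x * x powr \<epsilon>" using x by (simp add: powr_mult_base)
  finally have "x * (1 - x powr \<epsilon>) \<le> \<epsilon> * (1 - x)" by (simp add: algebra_simps)
  then have "x * (1 - x powr \<epsilon>) * (1 - x) \<le> \<epsilon> * (1 - x) * (1 - x)" using True by (intro mult_right_mono) auto
  moreover have "x * (1 - x powr \<epsilon>) * (1 - x) = x * (x powr \<epsilon> - 1) * (x - 1)" by (simp add: algebra_simps)
  moreover have "\<epsilon> * (1 - x) * (1 - x) = \<epsilon> * (x - 1)\<^sup>2" by (simp add: power2_eq_square algebra_simps)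
  moreover have "0 \<le> \<epsilon> * (\<bar>x - 1\<bar> powr (2 + s) / s)" using \<epsilon> by auto
  ultimately show ?thesis by (simp add: distrib_left)
next
  case False
  define y where "y = x - 1"
  have y: "y > 0" "x = 1 + y" using False by (auto simp: y_def)
  have s0: "s > 0" using \<epsilon> by simp
  have e1: "x powr s - 1 \<le> s * y" using powr_le_linear[OF x, of s] s s0 by (simp add: y_def)
  have e2: "x powr s - 1 \<le> y powr s" using powr_one_plus_le[of y s] y s s0 by simp
  have "(x powr s) powr (\<epsilon> / s) \<le> 1 + (\<epsilon> / s) * (x powr s - 1)"
    by (rule powr_le_linear) (use \<epsilon> s0 in auto)
  moreover have "(x powr s) powr (\<epsilon> / s) = x powr \<epsilon>" unfolding powr_powr using s0 by simp
  ultimately have "x powr \<epsilon> - 1 \<le> (\<epsilon> / s) * (x powr s - 1)" by linarith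
  then have "x * y * (x powr \<epsilon> - 1) \<le> x * y * ((\<epsilon> / s) * (x powr s - 1))"
    using x y by (intro mult_left_mono) auto
  also have "\<dots> = (\<epsilon> / s) * (y * (x powr s - 1) + y * y * (x powr s - 1))"
    unfolding y(2) by (simp add: algebra_simps add_divide_distrib)
  also have "\<dots> \<le> (\<epsilon> / s) * (y * (s * y) + y * y * y powr s)"
    using e1 e2 y \<epsilon> s0 by (intro mult_left_mono add_mono) auto
  also have "y * y * y powr s = y powr (2 + s)"
    using y powr_add[of y 2 s] by (simp add: power2_eq_square)
  also have "(\<epsilon> / s) * (y * (s * y) + y powr (2 + s)) = \<epsilon> * (y\<^sup>2 + \<bar>y\<bar> powr (2 + s) / s)"
    using s0 y by (simp add: field_simps power2_eq_square)
  finally show ?thesis by (simp add: y_def mult_ac)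
qed

lemma powr_second_order_le:
  fixes x \<epsilon> :: real
  assumes "0 \<le> x" "0 < \<epsilon>" "\<epsilon> \<le> 1"
  shows "x powr (1 + \<epsilon>) \<le> 1 + (1 + \<epsilon>) * (x - 1) + \<epsilon> * (x - 1)\<^sup>2"
proof -
  have "x powr (1 + \<epsilon>) = x * x powr \<epsilon>" using assms by (simp add: powr_mult_base)
  also have "\<dots> \<le> x * (1 + \<epsilon> * (x - 1))"
    using assms by (intro mult_left_mono powr_le_linear) auto
  finally show ?thesis by (simp add: algebra_simps power2_eq_square)
qed

text \<open>Below the height \<open>T\<close> the exponent is lowered to 1, above it is raised to
  \<open>q\<close>. The free parameter \<open>T\<close> is later tied to the energy.\<close>

lemma powr_interpolate:
  fixes x T a q :: real
  assumes x: "0 \<le> x" and T: "0 < T" and a: "1 < a" "a < q"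
  shows "x powr a \<le> T powr (a - 1) * x + T powr (a - q) * x powr q"
proof (cases "x = 0")
  case False
  then have x0: "x > 0" using x by simp
  show ?thesis
  proof (cases "x \<le> T")
    case True
    have "x powr a = x powr (a - 1) * x" using x0 powr_mult_base[of x "a - 1"] by (simp add: mult.commute)
    also have "\<dots> \<le> T powr (a - 1) * x" using True x0 a by (intro mult_right_mono powr_mono2) auto
    finally show ?thesis by (simp add: add_increasing2)
  next
    case False
    have "x powr a = x powr (a - q) * x powr q" by (simp flip: powr_add)
    also have "\<dots> \<le> T powr (a - q) * x powr q" using False T a by (intro mult_right_mono powr_mono2') auto
    finally show ?thesis using x0 by (simp add: add_increasing)
  qed
qed simp

lemma self_improving_bound:
  fixes z K t :: real
  assumes z: "z \<ge> 1" and t: "t > 0" and le: "z \<le> K * z powr (1 - t)"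
  shows "z \<le> K powr (1 / t)"
proof -
  have "z powr t * z powr (1 - t) = z" using z by (simp flip: powr_add)
  then have "z powr t * z powr (1 - t) \<le> K * z powr (1 - t)" using le by simp
  then have "z powr t \<le> K" using z by simp
  then have "(z powr t) powr (1 / t) \<le> K powr (1 / t)" using t by (intro powr_mono2) auto
  then show ?thesis using t z by (simp add: powr_powr)
qed

section \<open>The energy of the ratio of two solutions\<close>

text \<open>Solves \<open>z \<le> K * z powr (1 - s / 16)\<close>, where \<open>z\<close> is 1 plus
  the energy and \<open>K\<close> is the base of this power.\<close>

definition energy_bound :: "real \<Rightarrow> real \<Rightarrow> real \<Rightarrow> real" where
  "energy_bound B C s = (1 + 9 * B + 8 * B * C) powr (16 / s)"

text \<open>The entry \<open>s / 4\<close> leaves room for interpolating between the exponents 1 and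
  \<open>2 + s\<close>. The other entry makes \<open>\<epsilon>\<close> times the constant of the
  final estimate, for energies below \<open>energy_bound\<close>, smaller than 1.\<close>

definition exponent_threshold :: "real \<Rightarrow> real \<Rightarrow> real \<Rightarrow> real" where
  "exponent_threshold B C s = min (s / 4) (1 / (1 + (2 * B * C / s) * (1 + energy_bound B C s powr (s / 2))))"

lemma exponent_threshold_pos: "0 \<le> B \<Longrightarrow> 0 \<le> C \<Longrightarrow> 0 < s \<Longrightarrow> 0 < exponent_threshold B C s"
  unfolding exponent_threshold_def by (auto intro!: divide_pos_pos add_pos_nonneg mult_nonneg_nonneg add_nonneg_nonneg)

text \<open>\<open>X\<close> is the ratio of two solutions, normalised to mean \<open>1\<close>, and \<open>d\<close> its Dirichlet energy.\<close>

lemma ratio_energy_eq_0: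
  fixes M :: "'a measure" and X :: "'a \<Rightarrow> real" and A B C s \<epsilon> d :: real
  assumes M: "finite_measure M" "measure M (space M) = 1"
    and const: "0 \<le> B" "0 \<le> C" "0 < s" "s \<le> 1" and \<epsilon>: "0 < \<epsilon>" "\<epsilon> < exponent_threshold B C s"
    and X0: "AE x in M. 0 \<le> X x"
    and Xi: "integrable M X" "(\<integral>x. X x \<partial>M) = 1"
    and Xp: "integrable M (\<lambda>x. X x powr (1 + \<epsilon>))" "A * (\<integral>x. X x powr (1 + \<epsilon>) \<partial>M) = 1"
    and Xp1: "integrable M (\<lambda>x. X x powr (2 + \<epsilon>))"
    and X2: "integrable M (\<lambda>x. (X x)\<^sup>2)"
    and Yq: "integrable M (\<lambda>x. \<bar>X x - 1\<bar> powr (2 + s))"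
    and d: "0 \<le> d" "d \<le> B * (A * (\<integral>x. X x powr (2 + \<epsilon>) \<partial>M) - (\<integral>x. (X x)\<^sup>2 \<partial>M))"
    and Y2b: "(\<integral>x. (X x - 1)\<^sup>2 \<partial>M) \<le> C * d"
    and Yqb: "(\<integral>x. \<bar>X x - 1\<bar> powr (2 + s) \<partial>M) \<le> C * d powr (1 + s / 2)"
  shows "d = 0"
proof -
  interpret finite_measure M by fact
  have \<epsilon>s: "\<epsilon> < s / 4" "\<epsilon> < 1 / (1 + (2 * B * C / s) * (1 + energy_bound B C s powr (s / 2)))"
    using \<epsilon>(2) by (auto simp: exponent_threshold_def)
  then have \<epsilon>1: "\<epsilon> \<le> s" "\<epsilon> \<le> 1" using const by auto
  have Y2i: "integrable M (\<lambda>x. (X x - 1)\<^sup>2)"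
  proof -
    have "(\<lambda>x. (X x - 1)\<^sup>2) = (\<lambda>x. (X x)\<^sup>2 - 2 * X x + 1)" by (auto simp: power2_eq_square algebra_simps)
    then show ?thesis using X2 Xi by auto
  qed
  let ?P = "\<integral>x. X x powr (1 + \<epsilon>) \<partial>M"
  let ?Y2 = "\<integral>x. (X x - 1)\<^sup>2 \<partial>M" and ?Yq = "\<integral>x. \<bar>X x - 1\<bar> powr (2 + s) \<partial>M"
  have nn: "0 \<le> ?Y2" "0 \<le> ?Yq" by simp_all
  \<comment> \<open>Bernoulli's inequality integrated: the linear term drops out because
    \<open>X\<close> has mean 1. It follows that \<open>A \<le> 1\<close>.\<close>
  have P1: "1 \<le> ?P"
  proof -
    have "(\<integral>x. 1 + (1 + \<epsilon>) * (X x - 1) \<partial>M) \<le> ?P"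
      by (rule integral_mono_AE) (use Xi Xp X0 powr_ge_linear \<epsilon> in \<open>auto elim!: eventually_mono\<close>)
    then show ?thesis using Xi M(2) by simp
  qed
  have A0: "0 < A"
  proof (rule ccontr)
    assume "\<not> 0 < A"
    then have "A * ?P \<le> 0" using P1 by (intro mult_nonpos_nonneg) auto
    then show False using Xp(2) by simp
  qed
  moreover have "A * 1 \<le> A * ?P" using P1 A0 by (intro mult_left_mono) auto
  ultimately have A: "0 < A" "A \<le> 1" using Xp(2) by auto
  \<comment> \<open>\<open>1 - A\<close> is of second order in \<open>X - 1\<close>, again because
    the linear term integrates to 0.\<close>
  have A1: "1 - A \<le> \<epsilon> * ?Y2"
  proof -
    have "1 - A = A * (?P - 1)" using Xp(2) by (simp add: algebra_simps)
    also have "\<dots> \<le> 1 * (?P - 1)" using A P1 by (intro mult_right_mono) auto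
    also have "?P \<le> (\<integral>x. 1 + (1 + \<epsilon>) * (X x - 1) + \<epsilon> * (X x - 1)\<^sup>2 \<partial>M)"
      by (rule integral_mono_AE) (use Xi Xp X0 powr_second_order_le \<epsilon> \<epsilon>1 Y2i in \<open>auto elim!: eventually_mono\<close>)
    also have "\<dots> = 1 + \<epsilon> * ?Y2" using Xi Y2i M(2) by simp
    finally show ?thesis by simp
  qed
  \<comment> \<open>\<open>A * X powr (1 + \<epsilon>) - X\<close> has integral
    \<open>1 - 1 = 0\<close> and may be subtracted. This replaces one factor \<open>X\<close> by
    \<open>X - 1\<close>, and the integrand becomes quadratic near 1 with a factor
    \<open>\<epsilon>\<close>, up to a multiple of \<open>1 - A\<close>.\<close>
  have quad: "d \<le> B * (2 * \<epsilon> / s * (?Y2 + ?Yq))"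
  proof -
    have pw: "A * x powr (2 + \<epsilon>) - x\<^sup>2 - (A * x powr (1 + \<epsilon>) - x) \<le> \<epsilon> * ((x - 1)\<^sup>2 + \<bar>x - 1\<bar> powr (2 + s) / s) + (1 - A)"
      if x: "0 \<le> x" for x
    proof -
      have p1: "x powr (1 + \<epsilon>) = x * x powr \<epsilon>" "x powr (2 + \<epsilon>) = x * (x * x powr \<epsilon>)"
        using x powr_mult_base[of x \<epsilon>] powr_mult_base[of x "1 + \<epsilon>"] by (simp_all add: add.assoc[symmetric])
      have e1: "A * x powr (2 + \<epsilon>) - x\<^sup>2 - (A * x powr (1 + \<epsilon>) - x) = x * (x powr \<epsilon> - 1) * (x - 1) + (1 - A) * (x powr (1 + \<epsilon>) * (1 - x))"
        unfolding p1 by (simp add: algebra_simps power2_eq_square)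
      have "x powr (1 + \<epsilon>) * (1 - x) \<le> 1"
      proof (cases "x \<le> 1")
        case True
        have "x powr (1 + \<epsilon>) * (1 - x) \<le> 1 * 1"
          using True x \<epsilon> by (intro mult_mono powr_le1) auto
        then show ?thesis by simp
      next
        case False
        then have "x powr (1 + \<epsilon>) * (1 - x) \<le> 0" by (intro mult_nonneg_nonpos) auto
        then show ?thesis by simp
      qed
      then have e2: "(1 - A) * (x powr (1 + \<epsilon>) * (1 - x)) \<le> (1 - A) * 1" using A by (intro mult_left_mono) auto
      have e3: "x * (x powr \<epsilon> - 1) * (x - 1) \<le> \<epsilon> * ((x - 1)\<^sup>2 + \<bar>x - 1\<bar> powr (2 + s) / s)"
        by (rule powr_excess_bound[OF x \<epsilon>(1) \<epsilon>1(1) const(4)])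
      show ?thesis using add_mono[OF e3 e2] unfolding e1 by simp
    qed
    have "A * (\<integral>x. X x powr (2 + \<epsilon>) \<partial>M) - (\<integral>x. (X x)\<^sup>2 \<partial>M)
      = (\<integral>x. A * X x powr (2 + \<epsilon>) - (X x)\<^sup>2 - (A * X x powr (1 + \<epsilon>) - X x) \<partial>M)"
      using Xi Xp Xp1 X2 by simp
    also have "\<dots> \<le> (\<integral>x. \<epsilon> * ((X x - 1)\<^sup>2 + \<bar>X x - 1\<bar> powr (2 + s) / s) + (1 - A) \<partial>M)"
      by (rule integral_mono_AE) (use Xi Xp Xp1 X2 Y2i Yq X0 pw in \<open>auto elim!: eventually_mono\<close>)
    also have "\<dots> = \<epsilon> * (?Y2 + ?Yq / s) + (1 - A)"
      using Y2i Yq M(2) by simp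
    also have "\<dots> \<le> \<epsilon> * (?Y2 + ?Yq / s) + \<epsilon> * ?Y2" using A1 by simp
    also have "\<dots> \<le> 2 * \<epsilon> / s * (?Y2 + ?Yq)"
    proof -
      have "?Y2 \<le> ?Y2 / s" using const nn by (simp add: pos_le_divide_eq mult_left_le)
      moreover have "0 \<le> ?Yq / s" using nn const by simp
      ultimately have "2 * ?Y2 + ?Yq / s \<le> 2 * (?Y2 / s) + 2 * (?Yq / s)" by linarith
      then have "\<epsilon> * (2 * ?Y2 + ?Yq / s) \<le> \<epsilon> * (2 * (?Y2 / s) + 2 * (?Yq / s))"
        using \<epsilon> by (intro mult_left_mono) auto
      then show ?thesis by (simp add: algebra_simps add_divide_distrib)
    qed
    finally show ?thesis using d(2) const(1) by (meson mult_left_mono order_trans)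
  qed
  define z where "z = 1 + d"
  have z: "z \<ge> 1" using d by (simp add: z_def)
  \<comment> \<open>No a priori bound on the energy is available; the mean 1 of \<open>X\<close>
    controls one end of the interpolation and the Poincare-Sobolev estimate the other.\<close>
  have zK: "z \<le> energy_bound B C s"
  proof -
    \<comment> \<open>With the power 3/4 and \<open>\<epsilon> < s / 4\<close> both terms are
      sublinear: \<open>3/4 * (1 + s / 4)\<close> and \<open>1 + s / 2 - 9/16 * s\<close> are at
      most \<open>1 - s / 16\<close> for \<open>s \<le> 1\<close>.\<close>
    define T where "T = z powr (3/4)"
    have T: "T > 0" using z by (simp add: T_def)
    have "A * (\<integral>x. X x powr (2 + \<epsilon>) \<partial>M) \<le> 1 * (\<integral>x. X x powr (2 + \<epsilon>) \<partial>M)"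
      using A by (intro mult_right_mono) auto
    moreover have "0 \<le> (\<integral>x. (X x)\<^sup>2 \<partial>M)" by simp
    ultimately have "A * (\<integral>x. X x powr (2 + \<epsilon>) \<partial>M) - (\<integral>x. (X x)\<^sup>2 \<partial>M) \<le> (\<integral>x. X x powr (2 + \<epsilon>) \<partial>M)" by linarith
    then have d1: "d \<le> B * (\<integral>x. X x powr (2 + \<epsilon>) \<partial>M)" using d(2) const(1) by (meson mult_left_mono order_trans)
    have pw: "x powr (2 + \<epsilon>) \<le> T powr (1 + \<epsilon>) * x + T powr (\<epsilon> - s) * (8 * (1 + \<bar>x - 1\<bar> powr (2 + s)))" if x: "0 \<le> x" for x
    proof -
      have "x powr (2 + \<epsilon>) \<le> T powr (1 + \<epsilon>) * x + T powr (\<epsilon> - s) * x powr (2 + s)"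
        using powr_interpolate[OF x T, of "2 + \<epsilon>" "2 + s"] \<epsilon>s \<epsilon> const by (simp add: algebra_simps)
      also have "x powr (2 + s) \<le> 8 * (1 + \<bar>x - 1\<bar> powr (2 + s))"
      proof -
        have "x \<le> 2 * max 1 \<bar>x - 1\<bar>" by (cases "x \<le> 2") (auto simp: max_def)
        then have "x powr (2 + s) \<le> (2 * max 1 \<bar>x - 1\<bar>) powr (2 + s)"
          using x const by (intro powr_mono2) auto
        also have "\<dots> = 2 powr (2 + s) * (max 1 \<bar>x - 1\<bar>) powr (2 + s)" by (simp add: powr_mult)
        also have "\<dots> \<le> 2 powr 3 * (1 + \<bar>x - 1\<bar> powr (2 + s))"
          using const by (intro mult_mono powr_mono) (auto simp: max_def)
        finally show ?thesis by simp
      qed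
      finally show ?thesis by (simp add: mult_left_mono)
    qed
    have "(\<integral>x. X x powr (2 + \<epsilon>) \<partial>M) \<le> (\<integral>x. T powr (1 + \<epsilon>) * X x + T powr (\<epsilon> - s) * (8 * (1 + \<bar>X x - 1\<bar> powr (2 + s))) \<partial>M)"
      by (rule integral_mono_AE) (use Xi Xp1 Yq X0 pw in \<open>auto elim!: eventually_mono\<close>)
    also have "\<dots> = T powr (1 + \<epsilon>) + T powr (\<epsilon> - s) * (8 * (1 + ?Yq))"
      using Xi Yq M(2) by simp
    also have "\<dots> \<le> T powr (1 + \<epsilon>) + T powr (\<epsilon> - s) * (8 * (1 + C * z powr (1 + s / 2)))"
    proof -
      have "C * d powr (1 + s / 2) \<le> C * z powr (1 + s / 2)"
        using d const by (intro mult_left_mono powr_mono2) (auto simp: z_def)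
      then show ?thesis using Yqb by (intro add_left_mono mult_left_mono) auto
    qed
    also have "\<dots> \<le> z powr (1 - s / 16) + 8 * z powr (1 - s / 16) + 8 * C * z powr (1 - s / 16)"
    proof -
      have "T powr (1 + \<epsilon>) = z powr (3/4 * (1 + \<epsilon>))" by (simp add: T_def powr_powr)
      also have "\<dots> \<le> z powr (1 - s / 16)" using z \<epsilon>s const by (intro powr_mono) auto
      finally have 1: "T powr (1 + \<epsilon>) \<le> z powr (1 - s / 16)" .
      have "T powr (\<epsilon> - s) = z powr (3/4 * (\<epsilon> - s))" by (simp add: T_def powr_powr)
      also have "\<dots> \<le> z powr (- (9/16 * s))" using z \<epsilon>s by (intro powr_mono) auto
      finally have 2: "T powr (\<epsilon> - s) \<le> z powr (- (9/16 * s))" .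
      have 3: "T powr (\<epsilon> - s) \<le> z powr (1 - s / 16)"
        by (rule order_trans[OF 2]) (use z const in \<open>intro powr_mono, auto\<close>)
      have "T powr (\<epsilon> - s) * z powr (1 + s / 2) \<le> z powr (- (9/16 * s)) * z powr (1 + s / 2)"
        using 2 by (rule mult_right_mono) simp
      also have "\<dots> = z powr (- (9/16 * s) + (1 + s / 2))" by (rule powr_add[symmetric])
      also have "- (9/16 * s) + (1 + s / 2) = 1 - s / 16" by simp
      finally have 4: "T powr (\<epsilon> - s) * z powr (1 + s / 2) \<le> z powr (1 - s / 16)" .
      have "T powr (\<epsilon> - s) * (8 * (1 + C * z powr (1 + s / 2))) = 8 * T powr (\<epsilon> - s) + 8 * C * (T powr (\<epsilon> - s) * z powr (1 + s / 2))"
        by (simp add: algebra_simps)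
      also have "\<dots> \<le> 8 * z powr (1 - s / 16) + 8 * C * z powr (1 - s / 16)"
        using 3 4 const by (intro add_mono mult_left_mono) auto
      finally show ?thesis using 1 by linarith
    qed
    finally have "(\<integral>x. X x powr (2 + \<epsilon>) \<partial>M) \<le> (9 + 8 * C) * z powr (1 - s / 16)" by (simp add: algebra_simps)
    then have "d \<le> B * ((9 + 8 * C) * z powr (1 - s / 16))" using d1 const(1) by (meson mult_left_mono order_trans)
    moreover have "1 \<le> z powr (1 - s / 16)" using z const by (intro ge_one_powr_ge_zero) auto
    ultimately have "z \<le> (1 + 9 * B + 8 * B * C) * z powr (1 - s / 16)" by (simp add: z_def algebra_simps)
    from self_improving_bound[OF z _ this] show ?thesis using const by (simp add: energy_bound_def)
  qed
  show "d = 0"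
  proof (rule ccontr)
    assume "d \<noteq> 0"
    then have d0: "d > 0" using d by simp
    \<comment> \<open>Since \<open>d\<close> is bounded, its power \<open>d powr (s / 2)\<close> is
      a constant, and \<open>quad\<close> becomes \<open>d \<le> \<epsilon> * ?k * d\<close> with
      \<open>\<epsilon> * ?k < 1\<close>.\<close>
    let ?k = "(2 * B * C / s) * (1 + energy_bound B C s powr (s / 2))"
    have "?Y2 + ?Yq \<le> C * d + C * d powr (1 + s / 2)" using Y2b Yqb by linarith
    also have "d powr (1 + s / 2) = d * d powr (s / 2)" using d0 powr_mult_base[of d "s / 2"] by simp
    also have "C * d + C * (d * d powr (s / 2)) = (C * d) * (1 + d powr (s / 2))" by (simp add: algebra_simps)
    also have "\<dots> \<le> (C * d) * (1 + energy_bound B C s powr (s / 2))"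
      using zK d0 const by (intro mult_left_mono add_left_mono powr_mono2) (auto simp: z_def)
    finally have "B * (2 * \<epsilon> / s * (?Y2 + ?Yq)) \<le> B * (2 * \<epsilon> / s * ((C * d) * (1 + energy_bound B C s powr (s / 2))))"
      using const \<epsilon> by (intro mult_left_mono) auto
    also have "\<dots> = \<epsilon> * ?k * d" by simp
    finally have "d \<le> \<epsilon> * ?k * d" using quad by linarith
    then have "1 * d \<le> (\<epsilon> * ?k) * d" by simp
    then have "1 \<le> \<epsilon> * ?k" using d0 by (rule mult_right_le_imp_le)
    moreover have k0: "0 \<le> ?k" using const by (intro mult_nonneg_nonneg) auto
    have "\<epsilon> * (1 + ?k) < 1" using \<epsilon>s(2) k0 by (simp add: pos_less_divide_eq)
    then have "\<epsilon> * ?k < 1" using \<epsilon> by (simp add: distrib_left)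
    ultimately show False by linarith
  qed
qed

section \<open>Comparison of positive solutions\<close>

text \<open>What the comparison uses of the radial solution. As \<open>grad u = - h (x - c)\<close>,
  the equation says that the divergence of \<open>h (x - c)\<close> is \<open>u powr p\<close>;
  written along rays it involves only the radial derivative of \<open>h\<close>, so no second
  derivatives of \<open>u\<close> appear. On the sphere the normal derivative is
  \<open>- r * h\<close>, and \<open>h_boundary\<close> is the Robin condition.\<close>

locale robin_profile =
  fixes c :: "'a::euclidean_space" and r \<beta> p \<sigma> m :: real and u h :: "'a \<Rightarrow> real"
  assumes r: "r > 0" and \<beta>: "\<beta> > 0" and p: "p > 1" and \<sigma>: "\<sigma> > 0" and m: "m > 0"
    and u_GDERIV: "\<And>x. GDERIV u x :> - (h x *\<^sub>R (x - c))" and h_cont: "continuous_on UNIV h"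
    and u_lower: "\<And>x. x \<in> cball c r \<Longrightarrow> m * \<sigma> \<le> u x"
    and h_DERIV: "\<And>x t. x \<noteq> c \<Longrightarrow> 1 \<le> t \<Longrightarrow> t * dist c x \<le> r \<Longrightarrow>
       ((\<lambda>t. h (c + t *\<^sub>R (x - c))) has_real_derivative
         (u (c + t *\<^sub>R (x - c)) powr p - DIM('a) * h (c + t *\<^sub>R (x - c))) / t) (at t)"
    and h_boundary: "\<And>x. x \<in> sphere c r \<Longrightarrow> r * h x = \<beta> * u x"
begin

abbreviation "M \<equiv> lebesgue_on (ball c r)"
abbreviation "S \<equiv> sphere_measure c r"

sublocale finite_measure M by (rule finite_measure_lebesgue_ball)

definition u' :: "'a \<Rightarrow> 'a" where "u' x = - (h x *\<^sub>R (x - c))"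

lemma u_GDERIV': "GDERIV u x :> u' x"
  using u_GDERIV by (simp add: u'_def)

lemma u'_cont: "continuous_on A u'"
  unfolding u'_def by (intro continuous_intros continuous_on_subset[OF h_cont]) auto

lemma u_cont: "continuous_on A u"
  by (rule GDERIV_continuous_on) (rule u_GDERIV)

lemma u_pos: "x \<in> cball c r \<Longrightarrow> u x > 0"
  using u_lower[of x] m \<sigma> by (meson less_le_trans mult_pos_pos)

lemma u_measurable [measurable]: "u \<in> borel_measurable borel" "h \<in> borel_measurable borel"
  by (intro borel_measurable_continuous_onI u_cont h_cont)+

lemma u_powr_cont: "continuous_on (cball c r) (\<lambda>x. u x powr a)"
  by (intro continuous_on_powr u_cont continuous_intros) (use u_pos in force)

text \<open>The radial divergence formula for \<open>K = h * f\<close>: the field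
  \<open>(x - c) h f\<close> is \<open>- f grad u\<close>, and \<open>h_DERIV\<close> replaces the
  radial derivative of \<open>h\<close>. Differentiability of \<open>f\<close> on the closed ball is
  enough, so \<open>f\<close> may be a quotient by \<open>u\<close>.\<close>

lemma green_identity:
  assumes f: "\<And>x. x \<in> cball c r \<Longrightarrow> GDERIV f x :> f' x" and f': "continuous_on (cball c r) f'"
  shows "(\<integral>x. u' x \<bullet> f' x \<partial>M) + DIM('a) * (\<integral>x. h (sphere_proj c r x) * f (sphere_proj c r x) \<partial>M)
    = (\<integral>x. u x powr p * f x \<partial>M)"
proof -
  have fc: "continuous_on (cball c r) f" by (rule GDERIV_continuous_on) (rule f)
  define D where "D x = h x * ((x - c) \<bullet> f' x) + f x * (u x powr p - DIM('a) * h x)" for x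
  note hc = continuous_on_subset[OF h_cont subset_UNIV]
  have Dc: "continuous_on (cball c r) D"
    unfolding D_def by (intro continuous_intros hc fc f' u_powr_cont)
  have "DIM('a) * (\<integral>x. h (sphere_proj c r x) * f (sphere_proj c r x) \<partial>M) =
    (\<integral>x. DIM('a) * (h x * f x) + D x \<partial>M)"
  proof (rule radial_divergence[OF r _ Dc, of "\<lambda>x. h x * f x"])
    show "continuous_on (cball c r) (\<lambda>x. h x * f x)" by (intro continuous_intros hc fc)
    fix x :: 'a and t :: real assume x: "x \<noteq> c" and t: "1 \<le> t" "t * dist c x \<le> r"
    let ?y = "c + t *\<^sub>R (x - c)"
    have y: "?y \<in> cball c r" using t by (simp add: dist_norm norm_minus_commute)
    have "((\<lambda>t. f (c + t *\<^sub>R (x - c))) has_real_derivative ((x - c) \<bullet> f' ?y)) (at t)"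
      by (rule GDERIV_line[OF f[OF y]])
    from DERIV_mult[OF h_DERIV[OF x t] this]
    show "((\<lambda>t. h (c + t *\<^sub>R (x - c)) * f (c + t *\<^sub>R (x - c))) has_real_derivative D ?y / t) (at t)"
    proof (rule DERIV_cong)
      have alg: "(a / t) * b + e * g = (g * (t * e) + b * a) / t" for a b e g :: real
        using t by (simp add: field_simps)
      have "?y - c = t *\<^sub>R (x - c)" by simp
      then have Dy: "D ?y = h ?y * (t * ((x - c) \<bullet> f' ?y)) + f ?y * (u ?y powr p - DIM('a) * h ?y)"
        unfolding D_def by (simp only: inner_scaleR_left)
      show "(u ?y powr p - DIM('a) * h ?y) / t * f ?y + ((x - c) \<bullet> f' ?y) * h ?y = D ?y / t"
        unfolding Dy by (rule alg)
    qed
  qed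
  also have "\<dots> = (\<integral>x. u x powr p * f x - u' x \<bullet> f' x \<partial>M)"
    by (intro Bochner_Integration.integral_cong) (auto simp: D_def u'_def algebra_simps)
  also have "\<dots> = (\<integral>x. u x powr p * f x \<partial>M) - (\<integral>x. u' x \<bullet> f' x \<partial>M)"
    by (intro Bochner_Integration.integral_diff L2_mult_integrable L2_inner_integrable L2_continuous_ball u_powr_cont fc u'_cont f')
  finally show ?thesis by linarith
qed

text \<open>Trades \<open>h\<close> for the Robin coefficient on the sphere. \<open>F\<close> is
  kept apart from \<open>f\<close> because it serves two cases: \<open>F = u * f\<close>, and
  \<open>f\<close> the square of a function divided by \<open>u\<close>, where \<open>F\<close> is
  that square.\<close>

lemma boundary_integral:
  assumes [measurable]: "F \<in> borel_measurable borel" and eq: "\<And>x. x \<in> sphere c r \<Longrightarrow> r * (h x * f x) = \<beta> * F x"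
  shows "DIM('a) * (\<integral>x. h (sphere_proj c r x) * f (sphere_proj c r x) \<partial>M) = \<beta> * (\<integral>x. F x \<partial>S)"
proof -
  have "(\<integral>x. F x \<partial>S) = DIM('a) / r * (\<integral>x. F (sphere_proj c r x) \<partial>M)"
    by (rule integral_sphere_measure(1)[OF r]) simp
  also have "(\<integral>x. F (sphere_proj c r x) \<partial>M) = (\<integral>x. r / \<beta> * (h (sphere_proj c r x) * f (sphere_proj c r x)) \<partial>M)"
  proof (rule Bochner_Integration.integral_discrete_difference[where X = "{c}"])
    fix x assume "x \<in> space M" "x \<notin> {c}"
    then have "sphere_proj c r x \<in> sphere c r" using sphere_proj_in[OF r] by simp
    from eq[OF this] show "F (sphere_proj c r x) = r / \<beta> * (h (sphere_proj c r x) * f (sphere_proj c r x))"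
      using \<beta> by (simp add: field_simps)
  qed (use r in \<open>auto simp: emeasure_restrict_space sets_restrict_space\<close>)
  finally show ?thesis using r \<beta> by simp
qed

lemma u_L2: "L2 M u" "L2 M u'" "L2 M (\<lambda>x. u x powr a)" "L2 S u"
  by (intro L2_continuous_ball L2_continuous_sphere u_cont u'_cont u_powr_cont r u_measurable)+

text \<open>The weak form of the equation for \<open>u\<close> against functions whose gradient and trace are only known
  as limits.\<close>

lemma weak_form_u:
  assumes \<phi>: "H1_approx c r \<phi> v G g" and L: "L2 M v" "L2 M G" "L2 S g"
  shows "(\<integral>x. u' x \<bullet> G x \<partial>M) + \<beta> * (\<integral>x. u x * g x \<partial>S) = (\<integral>x. u x powr p * v x \<partial>M)"
proof -
  have sm: "smooth (\<phi> n)" for n using \<phi> by (simp add: H1_approx_def)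
  have const: "(\<lambda>n. l2 R (\<lambda>x. f x - f x)) \<longlonglongrightarrow> 0" for R :: "'a measure" and f :: "'a \<Rightarrow> 'b::euclidean_space"
    by (simp add: l2_def)
  have id: "(\<integral>x. u' x \<bullet> grad (\<phi> n) x \<partial>M) + \<beta> * (\<integral>x. u x * \<phi> n x \<partial>S) = (\<integral>x. u x powr p * \<phi> n x \<partial>M)" for n
  proof -
    have "DIM('a) * (\<integral>x. h (sphere_proj c r x) * \<phi> n (sphere_proj c r x) \<partial>M) = \<beta> * (\<integral>x. u x * \<phi> n x \<partial>S)"
    proof (rule boundary_integral)
      have "\<phi> n \<in> borel_measurable borel" by (rule borel_measurable_continuous_onI[OF smooth_continuous[OF sm]])
      then show "(\<lambda>x. u x * \<phi> n x) \<in> borel_measurable borel" by measurable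
      show "r * (h x * \<phi> n x) = \<beta> * (u x * \<phi> n x)" if "x \<in> sphere c r" for x
        using h_boundary[OF that] by (metis mult.assoc)
    qed
    then show ?thesis
      using green_identity[of "\<phi> n" "grad (\<phi> n)"] smooth_GDERIV[OF sm]
        continuous_on_subset[OF smooth_continuous_grad[OF sm] subset_UNIV] by simp
  qed
  have 1: "(\<lambda>n. \<integral>x. u' x \<bullet> grad (\<phi> n) x \<partial>M) \<longlonglongrightarrow> (\<integral>x. u' x \<bullet> G x \<partial>M)"
    by (rule l2_tendsto_inner[OF u_L2(2) u_L2(2) smooth_L2(2)[OF sm] L(2) const])
       (use \<phi> in \<open>simp add: H1_approx_def\<close>)
  have 2: "(\<lambda>n. \<integral>x. u x \<bullet> \<phi> n x \<partial>S) \<longlonglongrightarrow> (\<integral>x. u x \<bullet> g x \<partial>S)"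
    by (rule l2_tendsto_inner[OF u_L2(4) u_L2(4) smooth_L2(3)[OF sm r] L(3) const])
       (use \<phi> in \<open>simp add: H1_approx_def\<close>)
  have 3: "(\<lambda>n. \<integral>x. u x powr p \<bullet> \<phi> n x \<partial>M) \<longlonglongrightarrow> (\<integral>x. u x powr p \<bullet> v x \<partial>M)"
    by (rule l2_tendsto_inner[OF u_L2(3) u_L2(3) smooth_L2(1)[OF sm] L(1) const])
       (use \<phi> in \<open>simp add: H1_approx_def\<close>)
  have "(\<lambda>n. (\<integral>x. u' x \<bullet> grad (\<phi> n) x \<partial>M) + \<beta> * (\<integral>x. u x * \<phi> n x \<partial>S)) \<longlonglongrightarrow>
     (\<integral>x. u' x \<bullet> G x \<partial>M) + \<beta> * (\<integral>x. u x * g x \<partial>S)"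
    using 1 2 by (intro tendsto_intros) simp_all
  then show ?thesis using 3 unfolding id by (auto intro: LIMSEQ_unique)
qed

lemma u_H1: "u \<in> H1 (ball c r)"
  and u_weak_grad: "AE x in M. weak_grad (ball c r) u x = u' x"
  and u_trace: "AE x in S. boundary_trace c r u x = u x"
  by (rule C1_H1[OF r u_GDERIV' u'_cont])+

lemma energy_u_left:
  assumes v: "v \<in> H1 (ball c r)"
  shows "(\<integral>x. weak_grad (ball c r) u x \<bullet> weak_grad (ball c r) v x \<partial>M)
      + \<beta> * (\<integral>x. boundary_trace c r u x * boundary_trace c r v x \<partial>S) = (\<integral>x. u x powr p * v x \<partial>M)"
proof -
  note D = H1_weak_grad[OF v]
  obtain \<phi> where \<phi>: "H1_approx c r \<phi> v (weak_grad (ball c r) v) (boundary_trace c r v)"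
    and tr: "L2 S (boundary_trace c r v)" using H1_approx_exists[OF r v] by blast
  obtain \<psi> where tru: "L2 S (boundary_trace c r u)" using H1_approx_exists[OF r u_H1] by blast
  have m1: "weak_grad (ball c r) u \<in> borel_measurable M" "weak_grad (ball c r) v \<in> borel_measurable M"
    "u' \<in> borel_measurable M"
    by (intro L2_measurable H1_weak_grad(3)[OF u_H1] D(3) u_L2(2))+
  have m2: "boundary_trace c r u \<in> borel_measurable S" "boundary_trace c r v \<in> borel_measurable S" "u \<in> borel_measurable S"
    by (intro L2_measurable tr tru u_L2(4))+
  have "(\<integral>x. weak_grad (ball c r) u x \<bullet> weak_grad (ball c r) v x \<partial>M) = (\<integral>x. u' x \<bullet> weak_grad (ball c r) v x \<partial>M)"
    using u_weak_grad m1 by (intro integral_cong_AE borel_measurable_inner) (auto elim!: eventually_mono)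
  moreover have "(\<integral>x. boundary_trace c r u x * boundary_trace c r v x \<partial>S) = (\<integral>x. u x * boundary_trace c r v x \<partial>S)"
    using u_trace m2 by (intro integral_cong_AE borel_measurable_times) (auto elim!: eventually_mono)
  ultimately show ?thesis using weak_form_u[OF \<phi> D(1,3) tr] by simp
qed

lemma u_positive_solution: "positive_solution c r \<beta> p u"
  unfolding positive_solution_def
proof (intro conjI ballI)
  show "u \<in> H1 (ball c r)" by (rule u_H1)
  show "AE x in M. u x > 0" by (rule AE_I2) (use u_pos in \<open>auto simp: space_restrict_space\<close>)
  fix v assume v: "v \<in> H1 (ball c r)"
  show "integrable M (\<lambda>x. u x powr p * v x)" by (rule L2_mult_integrable[OF u_L2(3) H1_weak_grad(1)[OF v]])
qed (rule energy_u_left)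

text \<open>Since \<open>u\<close> is a positive solution of the linear equation with potential \<open>u powr (p - 1)\<close>, the
  quadratic form of that equation is the weighted Dirichlet energy of the quotient by \<open>u\<close>.\<close>

lemma ground_state_identity:
  assumes sm: "smooth \<phi>"
  defines "W \<equiv> \<lambda>x. (1 / u x) *\<^sub>R grad \<phi> x - (\<phi> x / (u x)\<^sup>2) *\<^sub>R u' x"
  shows "(\<integral>x. (norm (grad \<phi> x))\<^sup>2 \<partial>M) + \<beta> * (\<integral>x. (\<phi> x)\<^sup>2 \<partial>S) - (\<integral>x. u x powr (p - 1) * (\<phi> x)\<^sup>2 \<partial>M)
      = (\<integral>x. (u x)\<^sup>2 * (norm (W x))\<^sup>2 \<partial>M)"
    and "\<And>x. x \<in> cball c r \<Longrightarrow> GDERIV (\<lambda>x. \<phi> x / u x) x :> W x" and "continuous_on (cball c r) W"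
proof -
  note gc = continuous_on_subset[OF smooth_continuous_grad[OF sm] subset_UNIV]
  note fc = continuous_on_subset[OF smooth_continuous[OF sm] subset_UNIV]
  have u0: "u x \<noteq> 0" if "x \<in> cball c r" for x using u_pos[OF that] by simp
  have inv: "GDERIV (\<lambda>x. inverse (u x)) x :> - (inverse (u x))\<^sup>2 *\<^sub>R u' x" if "x \<in> cball c r" for x
    by (rule GDERIV_inverse[OF u_GDERIV' u0[OF that]])
  show W: "GDERIV (\<lambda>x. \<phi> x / u x) x :> W x" if "x \<in> cball c r" for x
    using GDERIV_mult[OF smooth_GDERIV[OF sm] inv[OF that]]
    by (simp add: W_def divide_inverse power_inverse algebra_simps)
  show Wc: "continuous_on (cball c r) W"
    unfolding W_def by (intro continuous_intros gc fc u_cont u'_cont) (use u0 in auto)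
  \<comment> \<open>The test function of Picone's identity: it turns the boundary term into the one
    of the quadratic form and the right-hand side into the potential term.\<close>
  let ?f = "\<lambda>x. \<phi> x * (\<phi> x / u x)" and ?f' = "\<lambda>x. \<phi> x *\<^sub>R W x + (\<phi> x / u x) *\<^sub>R grad \<phi> x"
  have f: "GDERIV ?f x :> ?f' x" if "x \<in> cball c r" for x
    by (rule GDERIV_mult[OF smooth_GDERIV[OF sm] W[OF that]])
  have f'c: "continuous_on (cball c r) ?f'"
    by (intro continuous_intros gc fc u_cont Wc) (use u0 in auto)
  have green: "(\<integral>x. u' x \<bullet> ?f' x \<partial>M) + DIM('a) * (\<integral>x. h (sphere_proj c r x) * ?f (sphere_proj c r x) \<partial>M)
    = (\<integral>x. u x powr p * ?f x \<partial>M)" by (rule green_identity[OF f f'c])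
  have bd: "DIM('a) * (\<integral>x. h (sphere_proj c r x) * ?f (sphere_proj c r x) \<partial>M) = \<beta> * (\<integral>x. (\<phi> x)\<^sup>2 \<partial>S)"
  proof (rule boundary_integral)
    have "\<phi> \<in> borel_measurable borel" by (rule borel_measurable_continuous_onI[OF smooth_continuous[OF sm]])
    then show "(\<lambda>x. (\<phi> x)\<^sup>2) \<in> borel_measurable borel" by measurable
    show "r * (h x * ?f x) = \<beta> * (\<phi> x)\<^sup>2" if "x \<in> sphere c r" for x
    proof -
      have "r * (h x * ?f x) = (r * h x) * (\<phi> x)\<^sup>2 / u x" by (simp add: power2_eq_square)
      also have "\<dots> = \<beta> * (\<phi> x)\<^sup>2" unfolding h_boundary[OF that] using u0[of x] that by simp
      finally show ?thesis .
    qed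
  qed
  have pw: "(\<integral>x. u x powr p * ?f x \<partial>M) = (\<integral>x. u x powr (p - 1) * (\<phi> x)\<^sup>2 \<partial>M)"
  proof (intro Bochner_Integration.integral_cong refl)
    fix x assume "x \<in> space M"
    then have x: "x \<in> cball c r" by (auto simp: space_restrict_space)
    have "u x powr p = u x * u x powr (p - 1)" using u_pos[OF x] powr_mult_base[of "u x" "p - 1"] by simp
    then show "u x powr p * ?f x = u x powr (p - 1) * (\<phi> x)\<^sup>2"
      using u0[OF x] by (simp add: power2_eq_square)
  qed
  have sq: "(\<integral>x. (u x)\<^sup>2 * (norm (W x))\<^sup>2 \<partial>M) = (\<integral>x. (norm (grad \<phi> x))\<^sup>2 - u' x \<bullet> ?f' x \<partial>M)"
  proof (intro Bochner_Integration.integral_cong refl)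
    fix x assume "x \<in> space M"
    then have x: "x \<in> cball c r" by (auto simp: space_restrict_space)
    have uW: "u x *\<^sub>R W x = grad \<phi> x - (\<phi> x / u x) *\<^sub>R u' x"
      using u0[OF x] by (simp add: W_def scaleR_diff_right power2_eq_square)
    have "(u x)\<^sup>2 * (norm (W x))\<^sup>2 = (norm (u x *\<^sub>R W x))\<^sup>2" by (simp add: power_mult_distrib)
    also have "\<dots> = (norm (grad \<phi> x))\<^sup>2 - 2 * (\<phi> x / u x) * (u' x \<bullet> grad \<phi> x) + (\<phi> x / u x)\<^sup>2 * (norm (u' x))\<^sup>2"
      unfolding uW power2_norm_eq_inner
      by (simp add: inner_diff_left inner_diff_right inner_commute power2_eq_square algebra_simps)
    also have "\<dots> = (norm (grad \<phi> x))\<^sup>2 - u' x \<bullet> ?f' x"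
    proof -
      have "\<phi> x *\<^sub>R W x = (\<phi> x / u x) *\<^sub>R (u x *\<^sub>R W x)" using u0[OF x] by simp
      also have "\<dots> = (\<phi> x / u x) *\<^sub>R grad \<phi> x - (\<phi> x / u x)\<^sup>2 *\<^sub>R u' x"
        unfolding uW by (simp add: scaleR_diff_right power2_eq_square)
      finally have "u' x \<bullet> ?f' x = u' x \<bullet> (((\<phi> x / u x) *\<^sub>R grad \<phi> x - (\<phi> x / u x)\<^sup>2 *\<^sub>R u' x) + (\<phi> x / u x) *\<^sub>R grad \<phi> x)"
        by simp
      also have "\<dots> = 2 * (\<phi> x / u x) * (u' x \<bullet> grad \<phi> x) - (\<phi> x / u x)\<^sup>2 * (norm (u' x))\<^sup>2"
        unfolding inner_add_right inner_diff_right inner_scaleR_right power2_norm_eq_inner by simp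
      finally show ?thesis by simp
    qed
    finally show "(u x)\<^sup>2 * (norm (W x))\<^sup>2 = (norm (grad \<phi> x))\<^sup>2 - u' x \<bullet> ?f' x" .
  qed
  also have "\<dots> = (\<integral>x. (norm (grad \<phi> x))\<^sup>2 \<partial>M) - (\<integral>x. u' x \<bullet> ?f' x \<partial>M)"
    by (intro Bochner_Integration.integral_diff L2_integrable_sq L2_inner_integrable L2_continuous_ball gc f'c u'_cont)
  finally show "(\<integral>x. (norm (grad \<phi> x))\<^sup>2 \<partial>M) + \<beta> * (\<integral>x. (\<phi> x)\<^sup>2 \<partial>S) - (\<integral>x. u x powr (p - 1) * (\<phi> x)\<^sup>2 \<partial>M)
      = (\<integral>x. (u x)\<^sup>2 * (norm (W x))\<^sup>2 \<partial>M)"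
    using green bd pw by simp
qed

text \<open>For smooth functions the ground-state identity bounds the energy of the quotient, the
  weight being at least the square of \<open>m * \<sigma>\<close>. In the limit the quadratic form
  converges by H1 and trace convergence, and the left side is handled by Fatou's lemma along an
  almost everywhere convergent subsequence. Higher integrability of \<open>v / u\<close> is thus a
  conclusion.\<close>

lemma quotient_poincare:
  fixes \<rho> :: "'a \<Rightarrow> real"
  assumes v: "v \<in> H1 (ball c r)"
    and \<rho>m: "\<rho> \<in> borel_measurable M" and \<rho>b: "\<And>x. x \<in> ball c r \<Longrightarrow> 0 \<le> \<rho> x" "\<And>x. x \<in> ball c r \<Longrightarrow> \<rho> x \<le> L"
    and \<rho>1: "(\<integral>x. \<rho> x \<partial>M) = 1"
  defines "D \<equiv> (\<integral>x. (norm (weak_grad (ball c r) v x))\<^sup>2 \<partial>M) + \<beta> * (\<integral>x. (boundary_trace c r v x)\<^sup>2 \<partial>S)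
     - (\<integral>x. u x powr (p - 1) * (v x)\<^sup>2 \<partial>M)"
  shows "0 \<le> D"
    and "2 \<le> q \<Longrightarrow> real DIM('a) * (q - 2) \<le> q \<Longrightarrow>
      (\<integral>\<^sup>+x. ennreal (\<bar>v x / u x - (\<integral>y. \<rho> y * (v y / u y) \<partial>M)\<bar> powr q) \<partial>M)
      \<le> ennreal (poincare_const TYPE('a) r L (measure lborel (ball c r)) q * (D / (m * \<sigma>)\<^sup>2) powr (q / 2))"
proof -
  note vD = H1_weak_grad[OF v]
  obtain \<phi> where \<phi>: "H1_approx c r \<phi> v (weak_grad (ball c r) v) (boundary_trace c r v)"
    and tr: "L2 S (boundary_trace c r v)" using H1_approx_exists[OF r v] by blast
  have sm: "smooth (\<phi> n)" for n using \<phi> by (simp add: H1_approx_def)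
  define W where "W n x = (1 / u x) *\<^sub>R grad (\<phi> n) x - (\<phi> n x / (u x)\<^sup>2) *\<^sub>R u' x" for n x
  define E where "E n = (\<integral>x. (u x)\<^sup>2 * (norm (W n x))\<^sup>2 \<partial>M)" for n
  note gs = ground_state_identity[OF sm, folded W_def E_def]
  have Elim: "E \<longlonglongrightarrow> D"
  proof -
    have 1: "(\<lambda>n. \<integral>x. (norm (grad (\<phi> n) x))\<^sup>2 \<partial>M) \<longlonglongrightarrow> (\<integral>x. (norm (weak_grad (ball c r) v x))\<^sup>2 \<partial>M)"
      by (rule l2_tendsto_power2[OF smooth_L2(2)[OF sm] vD(3)]) (use \<phi> in \<open>simp add: H1_approx_def\<close>)
    have "(\<lambda>n. \<integral>x. (norm (\<phi> n x))\<^sup>2 \<partial>S) \<longlonglongrightarrow> (\<integral>x. (norm (boundary_trace c r v x))\<^sup>2 \<partial>S)"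
      by (rule l2_tendsto_power2[OF smooth_L2(3)[OF sm r] tr]) (use \<phi> in \<open>simp add: H1_approx_def\<close>)
    then have 2: "(\<lambda>n. \<integral>x. (\<phi> n x)\<^sup>2 \<partial>S) \<longlonglongrightarrow> (\<integral>x. (boundary_trace c r v x)\<^sup>2 \<partial>S)" by simp
    obtain K where K: "\<And>x. x \<in> cball c r \<Longrightarrow> norm (u x powr (p - 1)) \<le> K"
      using continuous_bounded_cball[OF u_powr_cont] by metis
    have Kb: "\<bar>u x powr (p - 1)\<bar> \<le> K" if "x \<in> space M" for x
      using K[of x] that by (simp add: space_restrict_space)
    have pm: "(\<lambda>x. u x powr (p - 1)) \<in> borel_measurable M" by (rule continuous_measurable_ball[OF u_powr_cont])
    have l1: "(\<lambda>n. l2 M (\<lambda>x. \<phi> n x - v x)) \<longlonglongrightarrow> 0" using \<phi> by (simp add: H1_approx_def)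
    have "(\<lambda>n. l2 M (\<lambda>x. u x powr (p - 1) *\<^sub>R (\<phi> n x - v x))) \<longlonglongrightarrow> 0"
      by (rule l2_bounded_mult_tendsto[OF L2_diff[OF smooth_L2(1)[OF sm] vD(1)] l1 pm Kb])
    then have "(\<lambda>n. l2 M (\<lambda>x. u x powr (p - 1) *\<^sub>R \<phi> n x - u x powr (p - 1) *\<^sub>R v x)) \<longlonglongrightarrow> 0"
      by (simp add: right_diff_distrib)
    then have "(\<lambda>n. \<integral>x. (u x powr (p - 1) *\<^sub>R \<phi> n x) \<bullet> \<phi> n x \<partial>M) \<longlonglongrightarrow> (\<integral>x. (u x powr (p - 1) *\<^sub>R v x) \<bullet> v x \<partial>M)"
      by (intro l2_tendsto_inner L2_bounded_mult[OF _ pm Kb] smooth_L2(1) sm vD(1) l1)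
    then have 3: "(\<lambda>n. \<integral>x. u x powr (p - 1) * (\<phi> n x)\<^sup>2 \<partial>M) \<longlonglongrightarrow> (\<integral>x. u x powr (p - 1) * (v x)\<^sup>2 \<partial>M)"
      by (simp add: power2_eq_square mult.assoc)
    have "(\<lambda>n. (\<integral>x. (norm (grad (\<phi> n) x))\<^sup>2 \<partial>M) + \<beta> * (\<integral>x. (\<phi> n x)\<^sup>2 \<partial>S) - (\<integral>x. u x powr (p - 1) * (\<phi> n x)\<^sup>2 \<partial>M)) \<longlonglongrightarrow> D"
      unfolding D_def by (intro tendsto_intros 1 2 3)
    then show ?thesis by (simp add: gs(1) E_def[abs_def])
  qed
  have E0: "0 \<le> E n" for n by (simp add: E_def)
  show D0: "0 \<le> D" by (rule LIMSEQ_le_const[OF Elim]) (use E0 in blast)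
  assume q: "2 \<le> q" "real DIM('a) * (q - 2) \<le> q"
  let ?C = "poincare_const TYPE('a) r L (measure lborel (ball c r)) q"
  let ?mean = "\<lambda>f. \<integral>y. \<rho> y * (f y / u y) \<partial>M"
  have L0: "0 \<le> L" using \<rho>b[of c] r by force
  have C0: "?C \<ge> 0" using L0 by (simp add: poincare_const_def)
  have ms: "m * \<sigma> > 0" using m \<sigma> by simp
  have Wb: "(\<integral>x. (norm (W n x))\<^sup>2 \<partial>M) \<le> E n / (m * \<sigma>)\<^sup>2" for n
  proof -
    have Wi: "integrable M (\<lambda>x. (norm (W n x))\<^sup>2)" by (rule L2_integrable_sq[OF L2_continuous_ball[OF gs(3)]])
    have "(m * \<sigma>)\<^sup>2 * (\<integral>x. (norm (W n x))\<^sup>2 \<partial>M) = (\<integral>x. (m * \<sigma>)\<^sup>2 * (norm (W n x))\<^sup>2 \<partial>M)" by simp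
    also have "\<dots> \<le> E n" unfolding E_def
    proof (rule integral_mono)
      show "integrable M (\<lambda>x. (m * \<sigma>)\<^sup>2 * (norm (W n x))\<^sup>2)" using Wi by simp
      have "integrable M (\<lambda>x. (norm (u x *\<^sub>R W n x))\<^sup>2)"
        by (intro L2_integrable_sq L2_continuous_ball continuous_intros u_cont gs(3))
      then show "integrable M (\<lambda>x. (u x)\<^sup>2 * (norm (W n x))\<^sup>2)" by (simp add: power_mult_distrib)
      fix x assume "x \<in> space M"
      then have "m * \<sigma> \<le> u x" using u_lower[of x] by (simp add: space_restrict_space)
      then show "(m * \<sigma>)\<^sup>2 * (norm (W n x))\<^sup>2 \<le> (u x)\<^sup>2 * (norm (W n x))\<^sup>2"
        using ms by (intro mult_right_mono power_mono) auto
    qed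
    finally show ?thesis using ms by (subst pos_le_divide_eq) (auto simp: mult.commute)
  qed
  have PS: "(\<integral>\<^sup>+x. ennreal (\<bar>\<phi> n x / u x - ?mean (\<phi> n)\<bar> powr q) \<partial>M) \<le> ennreal (?C * (E n / (m * \<sigma>)\<^sup>2) powr (q / 2))" for n
  proof -
    have "(\<integral>\<^sup>+x. ennreal (\<bar>\<phi> n x / u x - ?mean (\<phi> n)\<bar> powr q) \<partial>M) \<le> ennreal (?C * (\<integral>x. (norm (W n x))\<^sup>2 \<partial>M) powr (q / 2))"
      by (rule poincare_sobolev_C1[OF r gs(2) gs(3) \<rho>m \<rho>b \<rho>1 q])
    also have "\<dots> \<le> ennreal (?C * (E n / (m * \<sigma>)\<^sup>2) powr (q / 2))"
      using C0 q by (intro ennreal_leI mult_left_mono powr_mono2 Wb) auto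
    finally show ?thesis .
  qed
  have \<rho>L2: "L2 M (\<lambda>x. \<rho> x / u x)"
  proof (rule L2_bounded[where K = "L / (m * \<sigma>)"])
    show "(\<lambda>x. \<rho> x / u x) \<in> borel_measurable M"
      using \<rho>m L2_measurable[OF u_L2(1)] by (rule borel_measurable_divide)
    fix x assume "x \<in> space M"
    then have x: "x \<in> ball c r" by (simp add: space_restrict_space)
    then have "m * \<sigma> \<le> u x" using u_lower[of x] by simp
    then show "norm (\<rho> x / u x) \<le> L / (m * \<sigma>)"
      using \<rho>b[OF x] ms L0 by (auto simp: abs_of_nonneg intro!: frac_le)
  qed
  have mlim: "(\<lambda>n. ?mean (\<phi> n)) \<longlonglongrightarrow> ?mean v"
  proof -
    have "(\<lambda>n. \<integral>x. (\<rho> x / u x) \<bullet> \<phi> n x \<partial>M) \<longlonglongrightarrow> (\<integral>x. (\<rho> x / u x) \<bullet> v x \<partial>M)"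
      by (rule l2_tendsto_inner[OF \<rho>L2 \<rho>L2 smooth_L2(1)[OF sm] vD(1)])
         (use \<phi> in \<open>simp_all add: H1_approx_def l2_def\<close>)
    then show ?thesis by simp
  qed
  obtain s where s: "strict_mono s" "AE x in M. (\<lambda>n. \<phi> (s n) x - v x) \<longlonglongrightarrow> 0"
  proof (rule l2_AE_subseq[OF L2_diff[OF smooth_L2(1)[OF sm] vD(1)]])
    show "(\<lambda>n. l2 M (\<lambda>x. \<phi> n x - v x)) \<longlonglongrightarrow> 0" using \<phi> by (simp add: H1_approx_def)
  qed
  have lim: "AE x in M. ennreal (\<bar>v x / u x - ?mean v\<bar> powr q) = liminf (\<lambda>n. ennreal (\<bar>\<phi> (s n) x / u x - ?mean (\<phi> (s n))\<bar> powr q))"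
    using s(2) AE_space
  proof eventually_elim
    fix x assume lx: "(\<lambda>n. \<phi> (s n) x - v x) \<longlonglongrightarrow> 0" and "x \<in> space M"
    then have x: "u x \<noteq> 0" using u_pos[of x] by (auto simp: space_restrict_space)
    have "(\<lambda>n. \<phi> (s n) x) \<longlonglongrightarrow> v x" using lx by (simp add: LIM_zero_iff)
    moreover have "(\<lambda>n. ?mean (\<phi> (s n))) \<longlonglongrightarrow> ?mean v"
      using LIMSEQ_subseq_LIMSEQ[OF mlim s(1)] by (simp add: o_def)
    ultimately have "(\<lambda>n. \<bar>\<phi> (s n) x / u x - ?mean (\<phi> (s n))\<bar> powr q) \<longlonglongrightarrow> \<bar>v x / u x - ?mean v\<bar> powr q"
      using x q by (intro tendsto_powr2 tendsto_intros) auto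
    then have "(\<lambda>n. ennreal (\<bar>\<phi> (s n) x / u x - ?mean (\<phi> (s n))\<bar> powr q)) \<longlonglongrightarrow> ennreal (\<bar>v x / u x - ?mean v\<bar> powr q)"
      by (rule tendsto_ennrealI)
    then show "ennreal (\<bar>v x / u x - ?mean v\<bar> powr q) = liminf (\<lambda>n. ennreal (\<bar>\<phi> (s n) x / u x - ?mean (\<phi> (s n))\<bar> powr q))"
      by (rule lim_imp_Liminf[symmetric, rotated]) simp
  qed
  have meas: "(\<lambda>x. ennreal (\<bar>\<phi> n x / u x - ?mean (\<phi> n)\<bar> powr q)) \<in> borel_measurable M" for n
    using L2_measurable[OF smooth_L2(1)[OF sm, of c r n]] L2_measurable[OF u_L2(1)] by measurable
  have "(\<integral>\<^sup>+x. ennreal (\<bar>v x / u x - ?mean v\<bar> powr q) \<partial>M)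
    = (\<integral>\<^sup>+x. liminf (\<lambda>n. ennreal (\<bar>\<phi> (s n) x / u x - ?mean (\<phi> (s n))\<bar> powr q)) \<partial>M)"
    by (rule nn_integral_cong_AE[OF lim])
  also have "\<dots> \<le> liminf (\<lambda>n. \<integral>\<^sup>+x. ennreal (\<bar>\<phi> (s n) x / u x - ?mean (\<phi> (s n))\<bar> powr q) \<partial>M)"
    by (rule nn_integral_liminf) (rule meas)
  also have "\<dots> \<le> liminf (\<lambda>n. ennreal (?C * (E (s n) / (m * \<sigma>)\<^sup>2) powr (q / 2)))"
    by (intro Liminf_mono always_eventually allI PS)
  also have "\<dots> = ennreal (?C * (D / (m * \<sigma>)\<^sup>2) powr (q / 2))"
  proof (rule lim_imp_Liminf)
    have "(\<lambda>n. E (s n)) \<longlonglongrightarrow> D" using LIMSEQ_subseq_LIMSEQ[OF Elim s(1)] by (simp add: o_def)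
    then show "(\<lambda>n. ennreal (?C * (E (s n) / (m * \<sigma>)\<^sup>2) powr (q / 2))) \<longlonglongrightarrow> ennreal (?C * (D / (m * \<sigma>)\<^sup>2) powr (q / 2))"
      using q E0 ms by (intro tendsto_ennrealI tendsto_intros tendsto_powr2) auto
  qed simp
  finally show "(\<integral>\<^sup>+x. ennreal (\<bar>v x / u x - ?mean v\<bar> powr q) \<partial>M) \<le> ennreal (?C * (D / (m * \<sigma>)\<^sup>2) powr (q / 2))" .
qed

end

section \<open>Uniqueness of the positive solution\<close>

text \<open>One constant for both exponents 2 and \<open>2 + s\<close>. \<open>L\<close> passes from
  the weighted measure to Lebesgue measure; \<open>m ^ 3\<close> replaces \<open>m powr q\<close>,
  which is legitimate for \<open>m \<le> 1\<close> and \<open>q \<le> 3\<close>.\<close>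

definition ratio_const :: "'a::euclidean_space itself \<Rightarrow> real \<Rightarrow> real \<Rightarrow> real \<Rightarrow> real \<Rightarrow> real \<Rightarrow> real" where
  "ratio_const TYPE('a) r m L V s = L * (poincare_const TYPE('a) r L V 2 + poincare_const TYPE('a) r L V (2 + s)) / m ^ 3"

lemma poincare_const_nonneg: "0 \<le> L \<Longrightarrow> 0 \<le> V \<Longrightarrow> 0 \<le> poincare_const TYPE('a::euclidean_space) r L V q"
  by (simp add: poincare_const_def)

context robin_profile
begin

text \<open>In the probability density \<open>\<rho>\<close> proportional to
  \<open>u powr (p + 1)\<close> the equations become relations between moments of
  \<open>w = v / u\<close>. After division by its mean, \<open>w\<close> satisfies the hypotheses of
  \<open>ratio_energy_eq_0\<close>, with constants given by \<open>m\<close>, \<open>v0\<close>,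
  \<open>v1\<close> and the ball alone.\<close>

lemma positive_solution_unique:
  fixes v0 v1 :: real
  defines "V \<equiv> measure lborel (ball c r)" and "s \<equiv> 1 / real DIM('a)"
  defines "L \<equiv> v1 / (m\<^sup>2 * v0 * V)"
  assumes v0: "v0 > 0" and m1: "m \<le> 1"
    and u_upper: "\<And>x. x \<in> cball c r \<Longrightarrow> u x \<le> \<sigma>"
    and pot: "\<And>x. x \<in> cball c r \<Longrightarrow> v0 \<le> u x powr (p - 1)" "\<And>x. x \<in> cball c r \<Longrightarrow> u x powr (p - 1) \<le> v1"
    and small: "p - 1 < exponent_threshold (v1 * V) (ratio_const TYPE('a) r m L V s) s"
    and v: "positive_solution c r \<beta> p v"
  shows "AE x in M. v x = u x"
proof -
  let ?PC = "poincare_const TYPE('a) r L V"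
  define C where "C = ratio_const TYPE('a) r m L V s"
  have vH: "v \<in> H1 (ball c r)" and vpos: "AE x in M. v x > 0"
    and vint: "\<And>z. z \<in> H1 (ball c r) \<Longrightarrow> integrable M (\<lambda>x. v x powr p * z x)"
    and veq: "\<And>z. z \<in> H1 (ball c r) \<Longrightarrow>
        (\<integral>x. weak_grad (ball c r) v x \<bullet> weak_grad (ball c r) z x \<partial>M)
          + \<beta> * (\<integral>x. boundary_trace c r v x * boundary_trace c r z x \<partial>S) = (\<integral>x. v x powr p * z x \<partial>M)"
    using v unfolding positive_solution_def by blast+
  note vD = H1_weak_grad[OF vH]
  have spM: "space M = ball c r" by (simp add: space_restrict_space)
  have V: "V > 0" unfolding V_def using content_ball_pos[OF r, of c] by simp
  have VM: "measure M (space M) = V" unfolding V_def by (simp add: measure_restrict_space spM)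
  have v1: "v1 > 0" using v0 pot[of c] r by force
  have mv0: "m\<^sup>2 * v0 > 0" using m v0 by simp
  have L0: "L > 0" using v1 mv0 V by (simp add: L_def)
  have s: "0 < s" "s \<le> 1" by (auto simp: s_def)
  have C0: "0 \<le> C" unfolding C_def ratio_const_def
    using L0 m V by (intro divide_nonneg_nonneg mult_nonneg_nonneg add_nonneg_nonneg poincare_const_nonneg) auto
  have um: "u \<in> borel_measurable M" and vm: "v \<in> borel_measurable M"
    by (rule L2_measurable[OF u_L2(1)], rule L2_measurable[OF vD(1)])
  note [measurable] = um vm
  have upos: "u x > 0" if "x \<in> ball c r" for x using u_pos[of x] that by simp
  \<comment> \<open>On the ball this is \<open>u powr (p + 1)\<close> divided by the square of
    \<open>\<sigma>\<close>; in this form it is bounded on both sides independently of the size of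
    \<open>u\<close>.\<close>
  define b where "b x = (u x)\<^sup>2 * u x powr (p - 1) / \<sigma>\<^sup>2" for x
  have b_bounds: "m\<^sup>2 * v0 \<le> b x" "b x \<le> v1" if x: "x \<in> ball c r" for x
  proof -
    have xc: "x \<in> cball c r" using x by simp
    have "m \<le> u x / \<sigma>" using u_lower[OF xc] \<sigma> by (simp add: pos_le_divide_eq)
    then have "m\<^sup>2 \<le> (u x / \<sigma>)\<^sup>2" using m by (intro power_mono) auto
    then have "m\<^sup>2 * v0 \<le> (u x / \<sigma>)\<^sup>2 * u x powr (p - 1)" using pot(1)[OF xc] v0 by (intro mult_mono) auto
    then show "m\<^sup>2 * v0 \<le> b x" by (simp add: b_def power_divide)
    have "(u x / \<sigma>)\<^sup>2 \<le> 1\<^sup>2" using u_upper[OF xc] upos[OF x] \<sigma> by (intro power_mono) auto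
    then have "(u x / \<sigma>)\<^sup>2 * u x powr (p - 1) \<le> 1 * v1" using pot(2)[OF xc] by (intro mult_mono) auto
    then show "b x \<le> v1" by (simp add: b_def power_divide)
  qed
  have bm[measurable]: "b \<in> borel_measurable M" unfolding b_def[abs_def] by measurable
  have bpos: "b x > 0" if "x \<in> ball c r" for x using b_bounds(1)[OF that] mv0 by linarith
  have bi: "integrable M b"
    by (rule integrable_const_bound[where B = v1]) (use b_bounds bpos in \<open>auto intro!: AE_I2 simp: spM abs_of_pos\<close>)
  define B where "B = (\<integral>x. b x \<partial>M)"
  have B_le: "B \<le> v1 * V"
  proof -
    have "B \<le> (\<integral>x. v1 \<partial>M)" unfolding B_def by (rule integral_mono[OF bi]) (use b_bounds in \<open>auto simp: spM\<close>)
    then show ?thesis using VM by (simp add: mult.commute)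
  qed
  have B_ge: "m\<^sup>2 * v0 * V \<le> B"
  proof -
    have "(\<integral>x. m\<^sup>2 * v0 \<partial>M) \<le> B" unfolding B_def by (rule integral_mono[OF _ bi]) (use b_bounds in \<open>auto simp: spM\<close>)
    then show ?thesis using VM by (simp add: mult.commute)
  qed
  have B: "B > 0" using B_ge mv0 V by (meson less_le_trans mult_pos_pos)
  define \<rho> where "\<rho> x = b x / B" for x
  have \<rho>m[measurable]: "\<rho> \<in> borel_measurable M" unfolding \<rho>_def[abs_def] by measurable
  have \<rho>pos: "0 < \<rho> x" if "x \<in> ball c r" for x using bpos[OF that] B by (simp add: \<rho>_def)
  have \<rho>b: "0 \<le> \<rho> x" "\<rho> x \<le> L" if "x \<in> ball c r" for x
  proof -
    show "0 \<le> \<rho> x" using \<rho>pos[OF that] by simp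
    show "\<rho> x \<le> L" unfolding \<rho>_def L_def
      using b_bounds(2)[OF that] B_ge mv0 V v1 by (intro frac_le) auto
  qed
  have \<rho>i: "integrable M \<rho>" unfolding \<rho>_def[abs_def] using bi by simp
  have \<rho>1: "(\<integral>x. \<rho> x \<partial>M) = 1" unfolding \<rho>_def using B by (simp add: B_def[symmetric])
  define w where "w x = v x / u x" for x
  have wm[measurable]: "w \<in> borel_measurable M" unfolding w_def[abs_def] by measurable
  have wpos: "AE x in M. 0 < w x \<and> 0 < v x \<and> 0 < u x \<and> x \<in> ball c r"
    using vpos AE_space by eventually_elim (use upos in \<open>auto simp: w_def spM\<close>)
  let ?k = "\<sigma>\<^sup>2 * B"
  have k: "?k > 0" using \<sigma> B by simp
  have powr_eqs: "AE x in M. ?k * (\<rho> x * w x) = u x powr p * v x \<and> ?k * (\<rho> x * w x powr p) = v x powr p * u x \<and>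
     ?k * (\<rho> x * w x powr (p + 1)) = v x powr p * v x \<and> ?k * (\<rho> x * (w x)\<^sup>2) = u x powr (p - 1) * (v x)\<^sup>2"
    using wpos
  proof eventually_elim
    fix x assume x: "0 < w x \<and> 0 < v x \<and> 0 < u x \<and> x \<in> ball c r"
    define a where "a = u x powr (p - 1)"
    have a: "a > 0" using x by (simp add: a_def)
    have up: "u x powr p = u x * a" unfolding a_def using x powr_mult_base[of "u x" "p - 1"] by simp
    have kr: "?k * \<rho> x = (u x)\<^sup>2 * a" using \<sigma> B by (simp add: \<rho>_def b_def a_def)
    have wp: "w x powr p = v x powr p / (u x * a)" unfolding w_def up[symmetric] by (rule powr_divide)
    have wp1: "w x powr (p + 1) = w x * w x powr p"
      using x powr_mult_base[of "w x" p] by (simp add: add.commute)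
    have e: "?k * (\<rho> x * z) = (u x)\<^sup>2 * a * z" for z using kr by (simp add: mult.assoc[symmetric])
    show "?k * (\<rho> x * w x) = u x powr p * v x \<and> ?k * (\<rho> x * w x powr p) = v x powr p * u x \<and>
     ?k * (\<rho> x * w x powr (p + 1)) = v x powr p * v x \<and> ?k * (\<rho> x * (w x)\<^sup>2) = u x powr (p - 1) * (v x)\<^sup>2"
      unfolding e wp1 wp up a_def[symmetric] using x a
      by (simp add: w_def power2_eq_square field_simps)
  qed
  have transfer: "integrable M (\<lambda>x. \<rho> x * f x)" "?k * (\<integral>x. \<rho> x * f x \<partial>M) = (\<integral>x. g x \<partial>M)"
    if g: "integrable M g" and f: "f \<in> borel_measurable M" and eq: "AE x in M. ?k * (\<rho> x * f x) = g x" for f g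
  proof -
    have fm: "(\<lambda>x. ?k * (\<rho> x * f x)) \<in> borel_measurable M" using f by measurable
    have "integrable M (\<lambda>x. ?k * (\<rho> x * f x))"
      by (rule integrable_cong_AE_imp[OF g fm]) (use eq in \<open>auto elim: eventually_mono\<close>)
    then show "integrable M (\<lambda>x. \<rho> x * f x)" using \<sigma> B by (simp add: integrable_mult_left_iff)
    have "?k * (\<integral>x. \<rho> x * f x \<partial>M) = (\<integral>x. ?k * (\<rho> x * f x) \<partial>M)" by simp
    also have "\<dots> = (\<integral>x. g x \<partial>M)"
      by (rule integral_cong_AE[OF fm _ eq]) (use g in auto)
    finally show "?k * (\<integral>x. \<rho> x * f x \<partial>M) = (\<integral>x. g x \<partial>M)" .
  qed
  have i1: "integrable M (\<lambda>x. u x powr p * v x)" by (rule L2_mult_integrable[OF u_L2(3) vD(1)])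
  have i2: "integrable M (\<lambda>x. v x powr p * u x)" by (rule vint[OF u_H1])
  have i3: "integrable M (\<lambda>x. v x powr p * v x)" by (rule vint[OF vH])
  have i4: "integrable M (\<lambda>x. u x powr (p - 1) * (v x)\<^sup>2)"
  proof -
    obtain K where K: "\<And>x. x \<in> cball c r \<Longrightarrow> norm (u x powr (p - 1)) \<le> K"
      using continuous_bounded_cball[OF u_powr_cont] by metis
    have "L2 M (\<lambda>x. u x powr (p - 1) *\<^sub>R v x)"
      by (rule L2_bounded_mult[OF vD(1) continuous_measurable_ball[OF u_powr_cont], where K = K])
         (use K in \<open>auto simp: spM\<close>)
    from L2_mult_integrable[OF this vD(1)] show ?thesis by (simp add: power2_eq_square mult.assoc)
  qed
  \<comment> \<open>Each equation is tested with the other solution, and the bilinear form is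
    symmetric. In terms of \<open>\<rho>\<close> this says that \<open>w\<close> and
    \<open>w powr p\<close> have the same mean.\<close>
  have sym: "(\<integral>x. v x powr p * u x \<partial>M) = (\<integral>x. u x powr p * v x \<partial>M)"
    using veq[OF u_H1] energy_u_left[OF vH] by (simp add: inner_commute mult.commute)
  have wpm: "(\<lambda>x. w x powr a) \<in> borel_measurable M" for a by measurable
  have w2m: "(\<lambda>x. (w x)\<^sup>2) \<in> borel_measurable M" by measurable
  have t1: "integrable M (\<lambda>x. \<rho> x * w x)" "?k * (\<integral>x. \<rho> x * w x \<partial>M) = (\<integral>x. u x powr p * v x \<partial>M)"
    by (rule transfer[OF i1 wm]; use powr_eqs in \<open>auto elim: eventually_mono\<close>)+
  have t2: "integrable M (\<lambda>x. \<rho> x * w x powr p)" "?k * (\<integral>x. \<rho> x * w x powr p \<partial>M) = (\<integral>x. v x powr p * u x \<partial>M)"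
    by (rule transfer[OF i2 wpm]; use powr_eqs in \<open>auto elim: eventually_mono\<close>)+
  have t3: "integrable M (\<lambda>x. \<rho> x * w x powr (p + 1))" "?k * (\<integral>x. \<rho> x * w x powr (p + 1) \<partial>M) = (\<integral>x. v x powr p * v x \<partial>M)"
    by (rule transfer[OF i3 wpm]; use powr_eqs in \<open>auto elim: eventually_mono\<close>)+
  have t4: "integrable M (\<lambda>x. \<rho> x * (w x)\<^sup>2)" "?k * (\<integral>x. \<rho> x * (w x)\<^sup>2 \<partial>M) = (\<integral>x. u x powr (p - 1) * (v x)\<^sup>2 \<partial>M)"
    by (rule transfer[OF i4 w2m]; use powr_eqs in \<open>auto elim: eventually_mono\<close>)+
  define \<mu> where "\<mu> = (\<integral>x. \<rho> x * w x \<partial>M)"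
  have \<mu>p: "(\<integral>x. \<rho> x * w x powr p \<partial>M) = \<mu>"
  proof -
    have "?k * (\<integral>x. \<rho> x * w x powr p \<partial>M) = ?k * \<mu>" using t1(2) t2(2) sym by (simp add: \<mu>_def)
    then show ?thesis using \<sigma> B by simp
  qed
  have \<mu>: "\<mu> > 0"
  proof -
    have nn: "AE x in M. 0 \<le> \<rho> x * w x" using wpos by eventually_elim (use \<rho>b in auto)
    have "\<mu> \<noteq> 0"
    proof
      assume "\<mu> = 0"
      then have "AE x in M. \<rho> x * w x = 0" using integral_nonneg_eq_0_iff_AE[OF t1(1) nn] by (simp add: \<mu>_def)
      then have "AE x in M. False" using wpos
      proof eventually_elim
        fix x assume "\<rho> x * w x = 0" "0 < w x \<and> 0 < v x \<and> 0 < u x \<and> x \<in> ball c r"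
        then show False using \<rho>pos[of x] by simp
      qed
      then have "emeasure M (space M) = 0" using ae_filter_eq_bot_iff trivial_limit_def[of "ae_filter M"] by blast
      then have "measure M (space M) = 0" by (simp add: measure_def)
      then show False using VM V by simp
    qed
    moreover have "0 \<le> \<mu>" unfolding \<mu>_def by (rule integral_nonneg_AE[OF nn])
    ultimately show ?thesis by simp
  qed
  define D where "D = (\<integral>x. (norm (weak_grad (ball c r) v x))\<^sup>2 \<partial>M) + \<beta> * (\<integral>x. (boundary_trace c r v x)\<^sup>2 \<partial>S)
     - (\<integral>x. u x powr (p - 1) * (v x)\<^sup>2 \<partial>M)"
  have D0: "0 \<le> D" unfolding D_def by (rule quotient_poincare(1)[OF vH \<rho>m \<rho>b \<rho>1])
  \<comment> \<open>The equation of \<open>v\<close> tested with \<open>v\<close> itself evaluates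
    the quadratic form.\<close>
  have D_eq: "D = ?k * ((\<integral>x. \<rho> x * w x powr (p + 1) \<partial>M) - (\<integral>x. \<rho> x * (w x)\<^sup>2 \<partial>M))"
  proof -
    have "(norm (weak_grad (ball c r) v x))\<^sup>2 = weak_grad (ball c r) v x \<bullet> weak_grad (ball c r) v x"
      "(boundary_trace c r v x)\<^sup>2 = boundary_trace c r v x * boundary_trace c r v x" for x
      by (rule power2_norm_eq_inner, rule power2_eq_square)
    then have "D = (\<integral>x. v x powr p * v x \<partial>M) - (\<integral>x. u x powr (p - 1) * (v x)\<^sup>2 \<partial>M)"
      using veq[OF vH] by (simp only: D_def)
    then show ?thesis by (simp only: right_diff_distrib t3(2) t4(2))
  qed
  have ms: "m * \<sigma> > 0" using m \<sigma> by simp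
  have PS: "(\<integral>\<^sup>+x. ennreal (\<bar>w x - \<mu>\<bar> powr q) \<partial>M) \<le> ennreal (?PC q * (D / (m * \<sigma>)\<^sup>2) powr (q / 2))"
    if "2 \<le> q" "real DIM('a) * (q - 2) \<le> q" for q
    using quotient_poincare(2)[OF vH \<rho>m \<rho>b \<rho>1 that] unfolding D_def[symmetric] V_def[symmetric] w_def[symmetric] \<mu>_def .
  have wq: "integrable M (\<lambda>x. \<bar>w x - \<mu>\<bar> powr q)" "(\<integral>x. \<bar>w x - \<mu>\<bar> powr q \<partial>M) \<le> ?PC q * (D / (m * \<sigma>)\<^sup>2) powr (q / 2)"
    if q: "2 \<le> q" "real DIM('a) * (q - 2) \<le> q" for q
  proof -
    show i: "integrable M (\<lambda>x. \<bar>w x - \<mu>\<bar> powr q)"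
      by (rule integrableI_nonneg) (use PS[OF q] in \<open>auto intro: le_less_trans\<close>)
    have "ennreal (\<integral>x. \<bar>w x - \<mu>\<bar> powr q \<partial>M) \<le> ennreal (?PC q * (D / (m * \<sigma>)\<^sup>2) powr (q / 2))"
      using PS[OF q] nn_integral_eq_integral[OF i] by simp
    then show "(\<integral>x. \<bar>w x - \<mu>\<bar> powr q \<partial>M) \<le> ?PC q * (D / (m * \<sigma>)\<^sup>2) powr (q / 2)"
      using L0 V by (subst (asm) ennreal_le_iff) (auto intro!: mult_nonneg_nonneg poincare_const_nonneg)
  qed
  define P where "P = density M (\<lambda>x. ennreal (\<rho> x))"
  have \<rho>AE: "AE x in M. 0 \<le> \<rho> x" by (rule AE_I2) (use \<rho>b in \<open>auto simp: spM\<close>)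
  have Pint: "integrable P f \<longleftrightarrow> integrable M (\<lambda>x. \<rho> x * f x)" "(\<integral>x. f x \<partial>P) = (\<integral>x. \<rho> x * f x \<partial>M)"
    if "f \<in> borel_measurable M" for f :: "'a \<Rightarrow> real"
    unfolding P_def using integrable_density[OF that \<rho>m \<rho>AE] integral_density[OF that \<rho>m \<rho>AE] by simp_all
  have Pspace: "emeasure P (space P) = 1"
  proof -
    have "emeasure P (space P) = (\<integral>\<^sup>+x. ennreal (\<rho> x) \<partial>M)"
      by (simp add: P_def emeasure_density cong: nn_integral_cong_simp)
    also have "\<dots> = ennreal (\<integral>x. \<rho> x \<partial>M)" by (rule nn_integral_eq_integral[OF \<rho>i \<rho>AE])
    finally show ?thesis by (simp add: \<rho>1)
  qed
  define X where "X x = w x / \<mu>" for x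
  have Xm[measurable]: "X \<in> borel_measurable M" unfolding X_def[abs_def] by measurable
  \<comment> \<open>Both amplitudes, that of \<open>u\<close> and that of the ratio, are divided
    out, so the constants that link \<open>d\<close> to \<open>X\<close> contain neither.\<close>
  define d where "d = D / (\<sigma>\<^sup>2 * \<mu>\<^sup>2)"
  have d0: "0 \<le> d" using D0 by (simp add: d_def)
  have Xpow: "AE x in M. \<rho> x * X x powr a = \<rho> x * w x powr a * (1 / \<mu> powr a)" for a
    using wpos by eventually_elim (use \<mu> in \<open>simp add: X_def powr_divide\<close>)
  have Xpow_int: "integrable M (\<lambda>x. \<rho> x * X x powr a)" "(\<integral>x. \<rho> x * X x powr a \<partial>M) = (\<integral>x. \<rho> x * w x powr a \<partial>M) / \<mu> powr a"
    if "integrable M (\<lambda>x. \<rho> x * w x powr a)" for a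
  proof -
    have e: "AE x in M. \<rho> x * w x powr a * (1 / \<mu> powr a) = \<rho> x * X x powr a" using Xpow[of a] by eventually_elim simp
    have i: "integrable M (\<lambda>x. \<rho> x * w x powr a * (1 / \<mu> powr a))" using that by (rule integrable_mult_left)
    have mm: "(\<lambda>x. \<rho> x * X x powr a) \<in> borel_measurable M" by measurable
    show "integrable M (\<lambda>x. \<rho> x * X x powr a)" by (rule integrable_cong_AE_imp[OF i mm e])
    have "(\<integral>x. \<rho> x * X x powr a \<partial>M) = (\<integral>x. \<rho> x * w x powr a * (1 / \<mu> powr a) \<partial>M)"
      by (rule integral_cong_AE[OF mm _ Xpow]) measurable
    then show "(\<integral>x. \<rho> x * X x powr a \<partial>M) = (\<integral>x. \<rho> x * w x powr a \<partial>M) / \<mu> powr a"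
      unfolding integral_mult_left_zero by simp
  qed
  have X1_eq: "\<bar>X x - 1\<bar> powr q = \<bar>w x - \<mu>\<bar> powr q / \<mu> powr q" for x q
  proof -
    have "X x - 1 = (w x - \<mu>) / \<mu>" using \<mu> by (simp add: X_def diff_divide_distrib)
    then have "\<bar>X x - 1\<bar> = \<bar>w x - \<mu>\<bar> / \<mu>" using \<mu> by simp
    then show ?thesis using \<mu> by (simp add: powr_divide)
  qed
  have Y: "integrable M (\<lambda>x. \<rho> x * \<bar>X x - 1\<bar> powr q)" "(\<integral>x. \<rho> x * \<bar>X x - 1\<bar> powr q \<partial>M) \<le> C * d powr (q / 2)"
    if q: "q = 2 \<or> q = 2 + s" for q
  proof -
    have q': "2 \<le> q" "real DIM('a) * (q - 2) \<le> q" "q \<le> 3" using q s by (auto simp: s_def)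
    note W = wq[OF q'(1,2)]
    have Li: "integrable M (\<lambda>x. L / \<mu> powr q * \<bar>w x - \<mu>\<bar> powr q)" using W(1) by simp
    have le: "\<rho> x * \<bar>X x - 1\<bar> powr q \<le> L / \<mu> powr q * \<bar>w x - \<mu>\<bar> powr q" if "x \<in> ball c r" for x
    proof -
      have "\<rho> x * \<bar>X x - 1\<bar> powr q \<le> L * \<bar>X x - 1\<bar> powr q" using \<rho>b[OF that] by (intro mult_right_mono) auto
      then show ?thesis by (simp add: X1_eq)
    qed
    show i: "integrable M (\<lambda>x. \<rho> x * \<bar>X x - 1\<bar> powr q)"
    proof (rule Bochner_Integration.integrable_bound[OF Li])
      show "(\<lambda>x. \<rho> x * \<bar>X x - 1\<bar> powr q) \<in> borel_measurable M" by measurable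
      show "AE x in M. norm (\<rho> x * \<bar>X x - 1\<bar> powr q) \<le> norm (L / \<mu> powr q * \<bar>w x - \<mu>\<bar> powr q)"
      proof (rule AE_I2)
        fix x assume "x \<in> space M"
        then have x: "x \<in> ball c r" by (simp add: spM)
        have "0 \<le> \<rho> x * \<bar>X x - 1\<bar> powr q" using \<rho>b[OF x] by simp
        then show "norm (\<rho> x * \<bar>X x - 1\<bar> powr q) \<le> norm (L / \<mu> powr q * \<bar>w x - \<mu>\<bar> powr q)"
          using le[OF x] by (metis real_norm_def abs_of_nonneg abs_ge_self order_trans)
      qed
    qed
    have "(\<integral>x. \<rho> x * \<bar>X x - 1\<bar> powr q \<partial>M) \<le> (\<integral>x. L / \<mu> powr q * \<bar>w x - \<mu>\<bar> powr q \<partial>M)"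
      by (rule integral_mono[OF i Li]) (use le in \<open>auto simp: spM\<close>)
    also have "\<dots> = L / \<mu> powr q * (\<integral>x. \<bar>w x - \<mu>\<bar> powr q \<partial>M)" by simp
    also have "\<dots> \<le> L / \<mu> powr q * (?PC q * (D / (m * \<sigma>)\<^sup>2) powr (q / 2))"
      using L0 by (intro mult_left_mono W(2)) auto
    also have "(D / (m * \<sigma>)\<^sup>2) powr (q / 2) = d powr (q / 2) * (\<mu> powr q / m powr q)"
    proof -
      have "D / (m * \<sigma>)\<^sup>2 = d * (\<mu>\<^sup>2 / m\<^sup>2)" using m \<sigma> \<mu> by (simp add: d_def field_simps)
      then have "(D / (m * \<sigma>)\<^sup>2) powr (q / 2) = (d * (\<mu>\<^sup>2 / m\<^sup>2)) powr (q / 2)" by (simp only:)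
      also have "\<dots> = d powr (q / 2) * (\<mu>\<^sup>2 / m\<^sup>2) powr (q / 2)"
        by (rule powr_mult)
      finally have "(D / (m * \<sigma>)\<^sup>2) powr (q / 2) = d powr (q / 2) * (\<mu>\<^sup>2 / m\<^sup>2) powr (q / 2)" .
      moreover have "(a\<^sup>2) powr (q / 2) = a powr q" if "a > 0" for a :: real
      proof -
        have "a\<^sup>2 = a powr 2" using that by simp
        then have "(a\<^sup>2) powr (q / 2) = (a powr 2) powr (q / 2)" by simp
        also have "\<dots> = a powr q" unfolding powr_powr by simp
        finally show ?thesis .
      qed
      ultimately show ?thesis using m \<mu> by (simp add: powr_divide)
    qed
    also have "L / \<mu> powr q * (?PC q * (d powr (q / 2) * (\<mu> powr q / m powr q))) = L * ?PC q / m powr q * d powr (q / 2)"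
      using \<mu> by simp
    also have "\<dots> \<le> C * d powr (q / 2)"
    proof (rule mult_right_mono)
      have PCn: "0 \<le> ?PC a" for a using L0 V by (intro poincare_const_nonneg) auto
      have "m ^ 3 = m powr 3" using m by simp
      also have "\<dots> \<le> m powr q" using q' m m1 by (intro powr_mono') auto
      finally have mq: "m ^ 3 \<le> m powr q" .
      have "L * ?PC q / m powr q \<le> L * (?PC 2 + ?PC (2 + s)) / m ^ 3"
      proof (rule frac_le)
        show "L * ?PC q \<le> L * (?PC 2 + ?PC (2 + s))" using q PCn L0 by (intro mult_left_mono) auto
        show "0 \<le> L * (?PC 2 + ?PC (2 + s))" using PCn L0 by auto
      qed (use mq m in auto)
      then show "L * ?PC q / m powr q \<le> C" by (simp add: C_def ratio_const_def)
    qed simp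
    finally show "(\<integral>x. \<rho> x * \<bar>X x - 1\<bar> powr q \<partial>M) \<le> C * d powr (q / 2)" .
  qed
  have X2_eq: "AE x in M. \<rho> x * (X x)\<^sup>2 = \<rho> x * (w x)\<^sup>2 * (1 / \<mu>\<^sup>2)" by (simp add: X_def power_divide)
  \<comment> \<open>Normalising the mean to 1 breaks the equality of the means of \<open>w\<close>
    and \<open>w powr p\<close>; the factor \<open>A = \<mu> powr (p - 1)\<close> compensates for
    this.\<close>
  have "d = 0"
  proof (rule ratio_energy_eq_0[where M = P and X = X and A = "\<mu> powr (p - 1)" and B = "v1 * V" and C = C and s = s and \<epsilon> = "p - 1"])
    show "finite_measure P" by (rule finite_measureI) (simp add: Pspace)
    show "measure P (space P) = 1" using Pspace by (simp add: measure_def)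
    show "0 \<le> v1 * V" "0 \<le> C" "0 < s" "s \<le> 1" using v1 V C0 s by auto
    show "0 < p - 1" using p by simp
    show "p - 1 < exponent_threshold (v1 * V) C s" using small by (simp add: C_def)
    show "AE x in P. 0 \<le> X x"
      unfolding P_def by (subst AE_density) (use wpos \<mu> in \<open>auto simp: X_def elim!: eventually_mono\<close>)
    have wi1: "integrable M (\<lambda>x. \<rho> x * w x / \<mu>)" using t1(1) by simp
    show "integrable P X" using wi1 by (simp add: Pint X_def)
    show "(\<integral>x. X x \<partial>P) = 1" using \<mu> by (simp add: Pint X_def flip: \<mu>_def)
    show "integrable P (\<lambda>x. X x powr (1 + (p - 1)))" using Xpow_int(1)[OF t2(1)] by (simp add: Pint)
    have "\<mu> powr p = \<mu> powr (p - 1) * \<mu>" using \<mu> powr_mult_base[of \<mu> "p - 1"] by (simp add: mult.commute)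
    then show "\<mu> powr (p - 1) * (\<integral>x. X x powr (1 + (p - 1)) \<partial>P) = 1"
      using Xpow_int(2)[OF t2(1)] \<mu> by (simp add: Pint \<mu>p)
    show "integrable P (\<lambda>x. X x powr (2 + (p - 1)))" using Xpow_int(1)[OF t3(1)] by (simp add: Pint add.commute)
    show "integrable P (\<lambda>x. (X x)\<^sup>2)" using t4(1) by (simp add: Pint X_def power_divide)
    show "integrable P (\<lambda>x. \<bar>X x - 1\<bar> powr (2 + s))" using Y(1)[of "2 + s"] by (simp add: Pint)
    show "0 \<le> d" by (rule d0)
    let ?R = "\<mu> powr (p - 1) * (\<integral>x. X x powr (2 + (p - 1)) \<partial>P) - (\<integral>x. (X x)\<^sup>2 \<partial>P)"
    have "\<mu> powr (p + 1) = \<mu> powr (p - 1) * \<mu>\<^sup>2"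
      using \<mu> powr_add[of \<mu> "p - 1" 2] by (simp add: add.commute)
    then have "?R = ((\<integral>x. \<rho> x * w x powr (p + 1) \<partial>M) - (\<integral>x. \<rho> x * (w x)\<^sup>2 \<partial>M)) / \<mu>\<^sup>2"
      using Xpow_int(2)[OF t3(1)] \<mu> by (simp add: Pint X_def power_divide add.commute diff_divide_distrib)
    \<comment> \<open>The true mass \<open>B\<close> is at most \<open>v1 * V\<close>, a bound free
      of \<open>p\<close>; it may take the place of \<open>B\<close> because the bracket is
      nonnegative, \<open>d\<close> being so.\<close>
    then have dR: "d = B * ?R" using \<sigma> by (simp add: d_def D_eq)
    then have "0 \<le> ?R" using d0 B by (simp add: zero_le_mult_iff)
    then show "d \<le> v1 * V * ?R" unfolding dR using B_le by (rule mult_right_mono[rotated])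
    have sq: "\<bar>X x - 1\<bar> powr 2 = (X x - 1)\<^sup>2" for x by (simp add: powr_numeral)
    have "(\<integral>x. \<rho> x * (X x - 1)\<^sup>2 \<partial>M) \<le> C * d"
      using Y(2)[of 2] d0 by (simp add: sq)
    then show "(\<integral>x. (X x - 1)\<^sup>2 \<partial>P) \<le> C * d" by (simp add: Pint)
    show "(\<integral>x. \<bar>X x - 1\<bar> powr (2 + s) \<partial>P) \<le> C * d powr (1 + s / 2)"
      using Y(2)[of "2 + s"] by (simp add: Pint add_divide_distrib)
  qed
  then have "D = 0" using \<sigma> \<mu> by (simp add: d_def)
  then have "(\<integral>\<^sup>+x. ennreal (\<bar>w x - \<mu>\<bar> powr 2) \<partial>M) = 0" using PS[of 2] by simp
  then have "AE x in M. ennreal (\<bar>w x - \<mu>\<bar> powr 2) = 0" by (subst (asm) nn_integral_0_iff_AE) auto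
  then have w\<mu>: "AE x in M. w x = \<mu>"
    by eventually_elim (simp add: ennreal_eq_0_iff)
  \<comment> \<open>A constant multiple of \<open>u\<close> is left. For constant \<open>w\<close>
    the equality of the two means reads \<open>\<mu> powr p = \<mu>\<close>, and
    \<open>p > 1\<close> leaves only \<open>\<mu> = 1\<close>.\<close>
  have "(\<integral>x. \<rho> x * w x powr p \<partial>M) = (\<integral>x. \<rho> x * \<mu> powr p \<partial>M)"
    by (rule integral_cong_AE) (use w\<mu> in \<open>auto elim: eventually_mono\<close>)
  then have "\<mu> powr p = \<mu> powr 1" using \<mu>p \<rho>1 \<mu> by simp
  then have \<mu>1: "\<mu> = 1" using powr_inj[OF \<mu>, of p 1] p by auto
  show "AE x in M. v x = u x"
    using w\<mu> wpos by eventually_elim (simp add: w_def \<mu>1)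
qed

end

section \<open>Choice of the threshold exponent\<close>

theorem corollary1p2:
  fixes c :: "'a::euclidean_space" and r \<beta> :: real
  assumes "DIM('a) \<ge> 2" and "r > 0" and "\<beta> > 0"
  shows "\<exists>p\<^sub>0>1. \<forall>p. subcritical DIM('a) p \<and> p < p\<^sub>0 \<longrightarrow>
    (\<exists>u. positive_solution c r \<beta> p u \<and>
         (\<forall>v. positive_solution c r \<beta> p v \<longrightarrow> (AE x in lebesgue_on (ball c r). v x = u x)) \<and>
         radial_in_ball c r u)"
proof -
  let ?N = "DIM('a)"
  \<comment> \<open>All constants are fixed here, before \<open>p\<close>: they depend on the
    dimension, \<open>r\<close> and \<open>\<beta>\<close> only.\<close>
  define m where "m = ode_min ?N (\<beta> * r)"
  define V where "V = measure lborel (ball c r)"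
  define v0 v1 where "v0 = \<beta> * ?N * m\<^sup>2 / r" and "v1 = (ode_length ?N (\<beta> * r) / r)\<^sup>2"
  define L where "L = v1 / (m\<^sup>2 * v0 * V)"
  define s where "s = 1 / real ?N"
  define th where "th = exponent_threshold (v1 * V) (ratio_const TYPE('a) r m L V s) s"
  have b: "\<beta> * r > 0" using assms by simp
  have m0: "0 < m" "m \<le> 1 / 2" unfolding m_def by (rule ode_constants[OF b])+
  have V: "V > 0" unfolding V_def using content_ball_pos[OF assms(2), of c] by simp
  have v0: "v0 > 0" using m0 assms by (simp add: v0_def)
  have v1: "v1 \<ge> 0" by (simp add: v1_def)
  have "0 \<le> L" using v1 v0 m0 V by (simp add: L_def)
  then have "0 \<le> ratio_const TYPE('a) r m L V s" unfolding ratio_const_def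
    using m0 V by (intro divide_nonneg_nonneg mult_nonneg_nonneg add_nonneg_nonneg poincare_const_nonneg) auto
  then have th: "th > 0" unfolding th_def using v1 V by (intro exponent_threshold_pos) (auto simp: s_def)
  \<comment> \<open>The three entries give \<open>p \<le> 2\<close> for the Lipschitz bound on the
    nonlinearity, \<open>\<beta> * r * (p - 1) \<le> 1\<close> for the position of the first root,
    and the smallness that makes the energy vanish.\<close>
  define p0 where "p0 = 1 + min 1 (min (1 / (\<beta> * r)) th)"
  show ?thesis
  proof (intro exI[of _ p0] conjI allI impI)
    show "1 < p0" using th b by (simp add: p0_def)
    fix p assume "subcritical ?N p \<and> p < p0"
    then have pp: "1 < p" "p \<le> 2" "p - 1 \<le> 1 / (\<beta> * r)" "p - 1 < th" by (auto simp: subcritical_def p0_def)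
    have bp: "\<beta> * r * (p - 1) \<le> 1" using pp(3) b by (simp add: pos_le_divide_eq mult.commute)
    obtain u h :: "'a \<Rightarrow> real" and \<sigma> :: real where u:
      "\<sigma> > 0" "\<And>x. GDERIV u x :> - (h x *\<^sub>R (x - c))" "continuous_on UNIV h"
      "\<And>x. x \<in> cball c r \<Longrightarrow> m * \<sigma> \<le> u x" "\<And>x. x \<in> cball c r \<Longrightarrow> u x \<le> \<sigma>"
      "\<And>x. x \<in> cball c r \<Longrightarrow> v0 \<le> u x powr (p - 1)"
      "\<And>x. x \<in> cball c r \<Longrightarrow> u x powr (p - 1) \<le> v1"
      "\<And>x t. x \<noteq> c \<Longrightarrow> 1 \<le> t \<Longrightarrow> t * dist c x \<le> r \<Longrightarrow>
         ((\<lambda>t. h (c + t *\<^sub>R (x - c))) has_real_derivative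
           (u (c + t *\<^sub>R (x - c)) powr p - ?N * h (c + t *\<^sub>R (x - c))) / t) (at t)"
      "\<And>x. x \<in> sphere c r \<Longrightarrow> r * h x = \<beta> * u x"
      "\<exists>f. \<forall>x. u x = f (dist c x)"
      unfolding m_def v0_def v1_def
      by (rule radial_solution_exists[OF assms pp(1,2) bp, of c]) blast
    interpret robin_profile c r \<beta> p \<sigma> m u h
      by unfold_locales (fact assms pp(1) u m0(1))+
    show "\<exists>u. positive_solution c r \<beta> p u \<and>
         (\<forall>v. positive_solution c r \<beta> p v \<longrightarrow> (AE x in lebesgue_on (ball c r). v x = u x)) \<and>
         radial_in_ball c r u"
    proof (intro exI[of _ u] conjI allI impI)
      show "positive_solution c r \<beta> p u" by (rule u_positive_solution)
      show "radial_in_ball c r u" unfolding radial_in_ball_def using u(10)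
        by (elim exE) (rule exI, rule AE_I2, erule spec)
      fix v assume v: "positive_solution c r \<beta> p v"
      have "m \<le> 1" using m0(2) by simp
      show "AE x in lebesgue_on (ball c r). v x = u x"
        by (rule positive_solution_unique[OF v0 \<open>m \<le> 1\<close> u(5,6,7) _ v])
           (use pp(4) in \<open>simp_all only: th_def L_def V_def s_def\<close>)
    qed
  qed
qed

end
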